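(* Let $p$ be a prime, $k$ an algebraically closed field of characteristic $p$, and let $\mu=(\mu_1,\ldots,\mu_s)$ be a partition of $np$ with $1\le s\le p$ parts and empty $p$-core. Let $1\le a<b\le s$ be the unique numbers such that (i) $\mu_i\equiv 0\pmod p$ for all $b+1\le i\le s$ and $\mu_b\not\equiv0\pmod p$, (ii) $\mu_a-a\equiv\mu_b-1-b\pmod p$. Then $\phi(\mu)$ has empty $p$-core, and $S^\mu{\downarrow_{E_n}}$, $S^{\phi(\mu)}{\downarrow_{E_n}}$ is a pair of modules of complementary stable Jordan type. In particular, $V^\sharp_{E_n}(S^\mu)=V^\sharp_{E_n}(k)$ if and only if $V^\sharp_{E_n}(S^{\Phi(\mu)})=V^\sharp_{E_n}(k)$.
   Context: $S^\mu$ is the Specht module over $k$ (the span of polytabloids in the permutation module on $\mu$-tabloids). $E_n\le\mathfrak{S}_{np}$ is generated by the $p$-cycles $g_i=((i-1)p+1,\ldots,ip)$, $1\le i\le n$. For a finitely generated $kE_n$-module $M$ and $\alpha\in k^n$ put $u_\alpha=1+\sum_{i=1}^n\alpha_i(g_i-1)$. The rank variety is $V_{E_n}^\sharp(M)=\{0\}\cup\{0\ne\alpha\in k^n: M{\downarrow_{k\langle u_\alpha\rangle}}\text{ is not free over }k\langle u_\alpha\rangle\}$, so $V_{E_n}^\sharp(k)=k^n$. The generic Jordan type of $M$ is the Jordan type of $M{\downarrow_{k\langle u_\alpha\rangle}}$ for a generic point $\alpha\in k^n$ (i.e. for $\alpha$ in a suitable nonempty Zariski-open set; block sizes are between $1$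 and $p$). For $1\le i\le p$, $n_M(i)$ is the number of Jordan blocks of size $i$ in the generic Jordan type of $M$. Modules $M,N$ form a pair of modules of complementary stable Jordan type if $n_M(i)=n_N(p-i)$ for all $1\le i\le p-1$. Definition of $\phi$ and $\Phi$. Let $\Lambda$ be the set of partitions $\mu=(\mu_1,\ldots,\mu_s)$ of $np$ with $s\le p$ parts and empty $p$-core. If $\mu\in\Lambda$ has a part not divisible by $p$, numbers $1\le a<b\le s$ satisfying (i) and (ii) of the claim exist and are unique, and $\phi(\mu)$ is the partition obtained from $\mu$ by replacing $\mu_b$ by $\mu_b-1$ and $\mu_a$ by $\mu_a+1$ (discarding a zero part if it occurs). If all parts of $\mu$ are divisible by $p$, $\phi(\mu)=\mu$. For $\mu\in\Lambda$ the sequence $\phi^t(\mu)$ is eventually constant, and $\Phi(\mu)$ denotes its eventual value. *)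

theory Defs
  imports
    "HOL-Algebra.Sym_Groups"
    "HOL-Combinatorics.Cycles"
    "HOL-Number_Theory.Cong"
    "HOL-Library.Poly_Mapping"
    "HOL-Computational_Algebra.Polynomial"
    "Jordan_Normal_Form.Jordan_Normal_Form"
begin

section \<open>Partitions and \<open>p\<close>-cores\<close>

definition is_partition :: "nat list \<Rightarrow> bool" where
  "is_partition \<mu> \<longleftrightarrow> sorted_wrt (\<ge>) \<mu> \<and> (\<forall>x\<in>set \<mu>. 0 < x)"

definition is_partition_of :: "nat list \<Rightarrow> nat \<Rightarrow> bool" where
  "is_partition_of \<mu> m \<longleftrightarrow> is_partition \<mu> \<and> sum_list \<mu> = m"

text \<open>Parts are numbered from 1, as in \<open>\<mu> = (\<mu>\<^sub>1, \<dots>, \<mu>\<^sub>s)\<close>; the cells of the Young diagram are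
  numbered from \<open>(0, 0)\<close>.\<close>

definition part :: "nat list \<Rightarrow> nat \<Rightarrow> nat" where
  "part \<mu> i = \<mu> ! (i - 1)"

definition diagram :: "nat list \<Rightarrow> (nat \<times> nat) set" where
  "diagram \<mu> = {(i, j). i < length \<mu> \<and> j < \<mu> ! i}"

definition adjacent :: "nat \<times> nat \<Rightarrow> nat \<times> nat \<Rightarrow> bool" where
  "adjacent c d \<longleftrightarrow>
     fst c = fst d \<and> (snd c = Suc (snd d) \<or> snd d = Suc (snd c)) \<or>
     snd c = snd d \<and> (fst c = Suc (fst d) \<or> fst d = Suc (fst c))"

definition connected_cells :: "(nat \<times> nat) set \<Rightarrow> bool" where
  "connected_cells D \<longleftrightarrow>
     (\<forall>c\<in>D. \<forall>d\<in>D. (c, d) \<in> {(x, y). x \<in> D \<and> y \<in> D \<and> adjacent x y}\<^sup>*)"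

text \<open>A rim \<open>p\<close>-hook is a connected skew diagram with \<open>p\<close> cells that contains no
  \<open>2 \<times> 2\<close> square.\<close>

definition removes_rim_hook :: "nat \<Rightarrow> nat list \<Rightarrow> nat list \<Rightarrow> bool" where
  "removes_rim_hook p \<mu> \<nu> \<longleftrightarrow>
     is_partition \<mu> \<and> is_partition \<nu> \<and> diagram \<nu> \<subseteq> diagram \<mu> \<and>
     (let D = diagram \<mu> - diagram \<nu> in
        card D = p \<and> connected_cells D \<and>
        (\<nexists>i j. {(i, j), (Suc i, j), (i, Suc j), (Suc i, Suc j)} \<subseteq> D))"

definition is_p_core_of :: "nat \<Rightarrow> nat list \<Rightarrow> nat list \<Rightarrow> bool" where
  "is_p_core_of p \<kappa> \<mu> \<longleftrightarrow>
     (removes_rim_hook p)\<^sup>*\<^sup>* \<mu> \<kappa> \<and> (\<nexists>\<nu>. removes_rim_hook p \<kappa> \<nu>)"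

definition has_empty_core :: "nat \<Rightarrow> nat list \<Rightarrow> bool" where
  "has_empty_core p \<mu> \<longleftrightarrow> is_p_core_of p [] \<mu>"

section \<open>The maps \<open>\<phi>\<close> and \<open>\<Phi>\<close>\<close>

definition phi_indices :: "nat \<Rightarrow> nat list \<Rightarrow> nat \<Rightarrow> nat \<Rightarrow> bool" where
  "phi_indices p \<mu> a b \<longleftrightarrow>
     1 \<le> a \<and> a < b \<and> b \<le> length \<mu> \<and>
     (\<forall>i\<in>{b + 1..length \<mu>}. [part \<mu> i = 0] (mod p)) \<and> \<not> [part \<mu> b = 0] (mod p) \<and>
     [int (part \<mu> a) - int a = int (part \<mu> b) - 1 - int b] (mod int p)"

definition phi :: "nat \<Rightarrow> nat list \<Rightarrow> nat list" where
  "phi p \<mu> =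
     (if \<forall>x\<in>set \<mu>. p dvd x then \<mu>
      else let (a, b) = (THE ab. phi_indices p \<mu> (fst ab) (snd ab)) in
        filter (\<lambda>x. 0 < x) (\<mu>[b - 1 := part \<mu> b - 1, a - 1 := part \<mu> a + 1]))"

definition Phi :: "nat \<Rightarrow> nat list \<Rightarrow> nat list" where
  "Phi p \<mu> = (THE \<nu>. \<forall>\<^sub>F t in sequentially. (phi p ^^ t) \<mu> = \<nu>)"

section \<open>Group algebras and their modules\<close>

text \<open>\<open>'a \<Rightarrow>\<^sub>0 'k\<close> serves as the \<open>k\<close>-vector space with basis \<open>'a\<close>: formal linear
  combinations of tabloids as well as of group elements.\<close>

definition fscale :: "'k::field \<Rightarrow> ('a \<Rightarrow>\<^sub>0 'k) \<Rightarrow> ('a \<Rightarrow>\<^sub>0 'k)" where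
  "fscale c v = Poly_Mapping.map ((*) c) v"

lemma lookup_fscale [simp]: "Poly_Mapping.lookup (fscale c v) x = c * Poly_Mapping.lookup v x"
  by (simp add: fscale_def map.rep_eq when_def)

global_interpretation fspace: vector_space fscale
  by unfold_locales (auto intro!: poly_mapping_eqI simp: lookup_add algebra_simps)

text \<open>A representation \<open>M\<close> of a group on a subspace \<open>vecs M\<close> of the type \<open>'v\<close>; the addition is
  that of \<open>'v\<close>.\<close>

record ('g, 'k, 'v) kG_rep =
  grp :: "'g monoid"
  vecs :: "'v set"
  rscale :: "'k \<Rightarrow> 'v \<Rightarrow> 'v"
  act :: "'g \<Rightarrow> 'v \<Rightarrow> 'v"

locale fg_kG_module =
  fixes M :: "('g, 'k::field, 'v::ab_group_add) kG_rep"
  assumes group: "group (grp M)"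
    and vector_space: "vector_space (rscale M)"
    and subspace: "Modules.module.subspace (rscale M) (vecs M)"
    and act_closed: "g \<in> carrier (grp M) \<Longrightarrow> x \<in> vecs M \<Longrightarrow> act M g x \<in> vecs M"
    and act_add: "g \<in> carrier (grp M) \<Longrightarrow> x \<in> vecs M \<Longrightarrow> y \<in> vecs M \<Longrightarrow>
      act M g (x + y) = act M g x + act M g y"
    and act_scale: "g \<in> carrier (grp M) \<Longrightarrow> x \<in> vecs M \<Longrightarrow>
      act M g (rscale M c x) = rscale M c (act M g x)"
    and act_one: "x \<in> vecs M \<Longrightarrow> act M \<one>\<^bsub>grp M\<^esub> x = x"
    and act_mult: "g \<in> carrier (grp M) \<Longrightarrow> h \<in> carrier (grp M) \<Longrightarrow> x \<in> vecs M \<Longrightarrow>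
      act M (g \<otimes>\<^bsub>grp M\<^esub> h) x = act M g (act M h x)"
    and fin_gen: "\<exists>B. finite B \<and> B \<subseteq> vecs M \<and>
      vecs M = Modules.module.span (rscale M) {act M g b |g b. g \<in> carrier (grp M) \<and> b \<in> B}"

definition restrict_rep :: "('g, 'k, 'v) kG_rep \<Rightarrow> 'g set \<Rightarrow> ('g, 'k, 'v) kG_rep"
    (infixl \<open>\<down>\<close> 90) where
  "M \<down> H = M\<lparr>grp := (grp M)\<lparr>carrier := H\<rparr>\<rparr>"

definition trivial_rep :: "'g monoid \<Rightarrow> ('g, 'k::field, 'k) kG_rep" where
  "trivial_rep G = \<lparr>grp = G, vecs = UNIV, rscale = (*), act = (\<lambda>_ x. x)\<rparr>"

definition ga_mult :: "'g monoid \<Rightarrow> ('g \<Rightarrow>\<^sub>0 'k::field) \<Rightarrow> ('g \<Rightarrow>\<^sub>0 'k) \<Rightarrow> ('g \<Rightarrow>\<^sub>0 'k)" where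
  "ga_mult G f h = (\<Sum>x\<in>Poly_Mapping.keys f. \<Sum>y\<in>Poly_Mapping.keys h.
     Poly_Mapping.single (x \<otimes>\<^bsub>G\<^esub> y) (Poly_Mapping.lookup f x * Poly_Mapping.lookup h y))"

primrec ga_pow :: "'g monoid \<Rightarrow> ('g \<Rightarrow>\<^sub>0 'k::field) \<Rightarrow> nat \<Rightarrow> ('g \<Rightarrow>\<^sub>0 'k)" where
  "ga_pow G f 0 = Poly_Mapping.single \<one>\<^bsub>G\<^esub> 1"
| "ga_pow G f (Suc j) = ga_mult G f (ga_pow G f j)"

definition ga_act :: "('g, 'k::field, 'v::ab_group_add) kG_rep \<Rightarrow> ('g \<Rightarrow>\<^sub>0 'k) \<Rightarrow> 'v \<Rightarrow> 'v" where
  "ga_act M f x = (\<Sum>g\<in>Poly_Mapping.keys f. rscale M (Poly_Mapping.lookup f g) (act M g x))"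

text \<open>The subalgebra \<open>k\<langle>u\<rangle>\<close> of \<open>kG\<close>: for a unit \<open>u\<close> of finite order it is spanned by the
  nonnegative powers of \<open>u\<close>.\<close>

definition ga_cyclic :: "'g monoid \<Rightarrow> ('g \<Rightarrow>\<^sub>0 'k::field) \<Rightarrow> ('g \<Rightarrow>\<^sub>0 'k) set" where
  "ga_cyclic G u = fspace.span (range (ga_pow G u))"

definition free_over_cyclic ::
    "('g, 'k::field, 'v::ab_group_add) kG_rep \<Rightarrow> ('g \<Rightarrow>\<^sub>0 'k) \<Rightarrow> bool" where
  "free_over_cyclic M u \<longleftrightarrow>
     (\<exists>B. finite B \<and> B \<subseteq> vecs M \<and>
        (\<forall>x\<in>vecs M. \<exists>!r. (\<forall>b\<in>B. r b \<in> ga_cyclic (grp M) u) \<and> (\<forall>b. b \<notin> B \<longrightarrow> r b = 0) \<and>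
           x = (\<Sum>b\<in>B. ga_act M (r b) b)))"

text \<open>\<open>J\<close> is the multiset of sizes of the Jordan blocks of the matrix by which \<open>u\<close> acts with
  respect to some basis of \<open>M\<close>.\<close>

definition has_jordan_type ::
    "('g, 'k::field, 'v::ab_group_add) kG_rep \<Rightarrow> ('g \<Rightarrow>\<^sub>0 'k) \<Rightarrow> nat multiset \<Rightarrow> bool" where
  "has_jordan_type M u J \<longleftrightarrow>
     (\<exists>bs A n_as.
        distinct bs \<and> \<not> Modules.module.dependent (rscale M) (set bs) \<and>
        Modules.module.span (rscale M) (set bs) = vecs M \<and>
        A \<in> carrier_mat (length bs) (length bs) \<and>
        (\<forall>j<length bs. ga_act M u (bs ! j) = (\<Sum>i<length bs. rscale M (A $$ (i, j)) (bs ! i))) \<and>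
        jordan_nf A n_as \<and> J = mset (map fst n_as))"

section \<open>Rank variety and generic Jordan type\<close>

definition g_cycle :: "nat \<Rightarrow> nat \<Rightarrow> nat \<Rightarrow> nat" where
  "g_cycle p i = cycle_of_list [(i - 1) * p + 1..<i * p + 1]"

definition E_subgroup :: "nat \<Rightarrow> nat \<Rightarrow> (nat \<Rightarrow> nat) set" where
  "E_subgroup p n = generate (sym_group (n * p)) (g_cycle p ` {1..n})"

text \<open>Points of \<open>k\<^sup>n\<close> are functions on \<open>nat\<close> that vanish outside the index set \<open>{1..n}\<close>.\<close>

definition affine_space :: "nat \<Rightarrow> (nat \<Rightarrow> 'k::field) set" where
  "affine_space n = {\<alpha>. \<forall>i. i \<notin> {1..n} \<longrightarrow> \<alpha> i = 0}"

definition u_elem :: "nat \<Rightarrow> nat \<Rightarrow> (nat \<Rightarrow> 'k::field) \<Rightarrow> ((nat \<Rightarrow> nat) \<Rightarrow>\<^sub>0 'k)" where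
  "u_elem p n \<alpha> = Poly_Mapping.single id 1 +
     (\<Sum>i = 1..n. fscale (\<alpha> i) (Poly_Mapping.single (g_cycle p i) 1 - Poly_Mapping.single id 1))"

definition rank_variety ::
    "nat \<Rightarrow> nat \<Rightarrow> (nat \<Rightarrow> nat, 'k::field, 'v::ab_group_add) kG_rep \<Rightarrow> (nat \<Rightarrow> 'k) set" where
  "rank_variety p n M = {\<lambda>_. 0} \<union>
     {\<alpha> \<in> affine_space n. \<alpha> \<noteq> (\<lambda>_. 0) \<and> \<not> free_over_cyclic M (u_elem p n \<alpha>)}"

text \<open>A polynomial in variables indexed by \<open>nat\<close> is a finitely supported function from exponent
  vectors to coefficients.\<close>

definition poly_eval :: "((nat \<Rightarrow>\<^sub>0 nat) \<Rightarrow>\<^sub>0 'k::field) \<Rightarrow> (nat \<Rightarrow> 'k) \<Rightarrow> 'k" where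
  "poly_eval f \<alpha> = (\<Sum>m\<in>Poly_Mapping.keys f.
     Poly_Mapping.lookup f m * (\<Prod>i\<in>Poly_Mapping.keys m. \<alpha> i ^ Poly_Mapping.lookup m i))"

definition zariski_open :: "nat \<Rightarrow> (nat \<Rightarrow> 'k::field) set \<Rightarrow> bool" where
  "zariski_open n U \<longleftrightarrow>
     (\<exists>F. (\<forall>f\<in>F. \<forall>m\<in>Poly_Mapping.keys f. Poly_Mapping.keys m \<subseteq> {1..n}) \<and>
        U = affine_space n - {\<alpha>. \<forall>f\<in>F. poly_eval f \<alpha> = 0})"

definition generic_jordan_type ::
    "nat \<Rightarrow> nat \<Rightarrow> (nat \<Rightarrow> nat, 'k::field, 'v::ab_group_add) kG_rep \<Rightarrow> nat multiset" where
  "generic_jordan_type p n M =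
     (THE J. \<exists>U. zariski_open n U \<and> U \<noteq> {} \<and> (\<forall>\<alpha>\<in>U. has_jordan_type M (u_elem p n \<alpha>) J))"

definition complementary_stable_jordan_type ::
    "nat \<Rightarrow> nat \<Rightarrow> (nat \<Rightarrow> nat, 'k::field, 'v::ab_group_add) kG_rep \<Rightarrow>
     (nat \<Rightarrow> nat, 'k, 'w::ab_group_add) kG_rep \<Rightarrow> bool" where
  "complementary_stable_jordan_type p n M N \<longleftrightarrow>
     (\<forall>i\<in>{1..p - 1}. count (generic_jordan_type p n M) i = count (generic_jordan_type p n N) (p - i))"

section \<open>Specht modules\<close>

definition is_tableau :: "nat list \<Rightarrow> (nat \<times> nat \<Rightarrow> nat) \<Rightarrow> bool" where
  "is_tableau \<mu> t \<longleftrightarrow> bij_betw t (diagram \<mu>) {1..sum_list \<mu>}"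

text \<open>The row equivalence class of a tableau is represented by the list of its rows, each row
  being the set of its entries.\<close>

definition tabloid :: "nat list \<Rightarrow> (nat \<times> nat \<Rightarrow> nat) \<Rightarrow> nat set list" where
  "tabloid \<mu> t = map (\<lambda>i. {t (i, j) |j. (i, j) \<in> diagram \<mu>}) [0..<length \<mu>]"

definition column_stabilizer :: "nat list \<Rightarrow> (nat \<times> nat \<Rightarrow> nat) \<Rightarrow> (nat \<Rightarrow> nat) set" where
  "column_stabilizer \<mu> t =
     {\<pi>. \<pi> permutes {1..sum_list \<mu>} \<and>
        (\<forall>j. \<pi> ` {t (i, j) |i. (i, j) \<in> diagram \<mu>} = {t (i, j) |i. (i, j) \<in> diagram \<mu>})}"

definition polytabloid :: "nat list \<Rightarrow> (nat \<times> nat \<Rightarrow> nat) \<Rightarrow> (nat set list \<Rightarrow>\<^sub>0 'k::field)" where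
  "polytabloid \<mu> t = (\<Sum>\<pi>\<in>column_stabilizer \<mu> t.
     Poly_Mapping.single (tabloid \<mu> (\<pi> \<circ> t)) (of_int (sign \<pi>)))"

definition tabloid_act ::
    "(nat \<Rightarrow> nat) \<Rightarrow> (nat set list \<Rightarrow>\<^sub>0 'k::field) \<Rightarrow> (nat set list \<Rightarrow>\<^sub>0 'k)" where
  "tabloid_act \<sigma> v = (\<Sum>T\<in>Poly_Mapping.keys v.
     Poly_Mapping.single (map (image \<sigma>) T) (Poly_Mapping.lookup v T))"

definition specht :: "nat list \<Rightarrow> (nat \<Rightarrow> nat, 'k::field, nat set list \<Rightarrow>\<^sub>0 'k) kG_rep" where
  "specht \<mu> = \<lparr>grp = sym_group (sum_list \<mu>),
     vecs = fspace.span {polytabloid \<mu> t |t. is_tableau \<mu> t},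
     rscale = fscale, act = tabloid_act\<rparr>"

subsection \<open>The restricted Specht modules and the trivial module are \<open>kE\<^sub>n\<close>-modules\<close>

lemma tabloid_act_superset:
  assumes "finite K" "Poly_Mapping.keys v \<subseteq> K"
  shows "tabloid_act \<sigma> v =
    (\<Sum>T\<in>K. Poly_Mapping.single (map (image \<sigma>) T) (Poly_Mapping.lookup v T))"
  unfolding tabloid_act_def using assms
  by (intro sum.mono_neutral_left) (auto simp: in_keys_iff)

lemma tabloid_act_add: "tabloid_act \<sigma> (v + w) = tabloid_act \<sigma> v + tabloid_act \<sigma> w"
proof -
  let ?K = "Poly_Mapping.keys v \<union> Poly_Mapping.keys w"
  have "finite ?K" "Poly_Mapping.keys (v + w) \<subseteq> ?K"
    using keys_add[of v w] by auto
  then show ?thesis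
    by (simp add: tabloid_act_superset[of ?K] lookup_add single_add sum.distrib)
qed

lemma tabloid_act_scale: "tabloid_act \<sigma> (fscale c v) = fscale c (tabloid_act \<sigma> v)"
proof -
  have *: "fscale c (Poly_Mapping.single x y) = Poly_Mapping.single x (c * y)" for x and y :: 'a
    by (intro poly_mapping_eqI) (auto simp: lookup_single when_def)
  have "Poly_Mapping.keys (fscale c v) \<subseteq> Poly_Mapping.keys v"
    by (auto simp: in_keys_iff)
  then show ?thesis
    by (simp add: tabloid_act_superset[of "Poly_Mapping.keys v"] fspace.scale_sum_right *)
qed

lemma tabloid_act_zero: "tabloid_act \<sigma> 0 = 0"
  by (simp add: tabloid_act_def)

lemma tabloid_act_sum: "tabloid_act \<sigma> (sum f A) = (\<Sum>x\<in>A. tabloid_act \<sigma> (f x))"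
  by (induction A rule: infinite_finite_induct) (simp_all add: tabloid_act_zero tabloid_act_add)

lemma tabloid_act_single:
  "tabloid_act \<sigma> (Poly_Mapping.single T c) = Poly_Mapping.single (map (image \<sigma>) T) c"
  by (subst tabloid_act_superset[of "{T}"]) auto

lemma tabloid_act_id: "tabloid_act id v = v"
  by (intro poly_mapping_eqI) (simp add: tabloid_act_def lookup_sum lookup_single when_def
      in_keys_iff)

lemma tabloid_act_comp: "tabloid_act (\<sigma> \<circ> \<tau>) v = tabloid_act \<sigma> (tabloid_act \<tau> v)"
proof -
  have *: "map ((`) (\<sigma> \<circ> \<tau>)) T = map ((`) \<sigma>) (map ((`) \<tau>) T)" for T
    by (simp add: image_comp)
  have "tabloid_act \<sigma> (tabloid_act \<tau> v) = (\<Sum>T\<in>Poly_Mapping.keys v.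
      Poly_Mapping.single (map ((`) \<sigma>) (map ((`) \<tau>) T)) (Poly_Mapping.lookup v T))"
    by (simp only: tabloid_act_def[of \<tau>] tabloid_act_sum tabloid_act_single)
  then show ?thesis
    by (simp only: tabloid_act_def[of "\<sigma> \<circ> \<tau>"] *)
qed

lemma tabloid_comp: "map (image \<sigma>) (tabloid \<mu> t) = tabloid \<mu> (\<sigma> \<circ> t)"
  by (auto simp: tabloid_def)

lemma tabloid_act_polytabloid:
  assumes "\<sigma> permutes {1..sum_list \<mu>}"
  shows "tabloid_act \<sigma> (polytabloid \<mu> t :: _ \<Rightarrow>\<^sub>0 'k::field) = polytabloid \<mu> (\<sigma> \<circ> t)"
proof -
  let ?m = "sum_list \<mu>"
  have inv: "inv_into UNIV \<sigma> permutes {1..?m}" and bij: "bij \<sigma>"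
    using assms permutes_inv permutes_bij by blast+
  have inv_o: "inv_into UNIV \<sigma> (\<sigma> x) = x" "\<sigma> (inv_into UNIV \<sigma> x) = x" for x
    using assms permutes_inverses by metis+
  have conj: "\<tau> \<circ> \<pi> \<circ> inv_into UNIV \<tau> \<in> column_stabilizer \<mu> (\<tau> \<circ> s)"
    if "\<tau> permutes {1..?m}" "\<pi> \<in> column_stabilizer \<mu> s" for \<tau> \<pi> and s :: "nat \<times> nat \<Rightarrow> nat"
  proof -
    have col: "{(\<tau> \<circ> s) (i, j) |i. (i, j) \<in> diagram \<mu>} = \<tau> ` {s (i, j) |i. (i, j) \<in> diagram \<mu>}" for j
      by auto
    have "inv_into UNIV \<tau> ` \<tau> ` X = X" for X
      using that(1) by (simp add: image_comp permutes_inv_o)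
    then have "(\<tau> \<circ> \<pi> \<circ> inv_into UNIV \<tau>) ` \<tau> ` X = \<tau> ` \<pi> ` X" for X
      by (metis image_comp)
    then show ?thesis
      using that unfolding column_stabilizer_def mem_Collect_eq col
      by (metis permutes_compose permutes_inv)
  qed
  have sgn: "sign (\<sigma> \<circ> \<pi> \<circ> inv_into UNIV \<sigma>) = sign \<pi>" if "\<pi> permutes {1..?m}" for \<pi>
  proof -
    have "permutation \<sigma>" "permutation \<pi>" "permutation (inv_into UNIV \<sigma>)"
      using assms that inv permutation_permutes by blast+
    then have "sign (\<sigma> \<circ> \<pi> \<circ> inv_into UNIV \<sigma>) = sign \<sigma> * sign \<pi> * sign \<sigma>"
      by (simp add: sign_compose permutation_compose sign_inverse)
    then show ?thesis
      by (cases "evenperm \<sigma>") (simp_all add: sign_def)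
  qed
  have "(polytabloid \<mu> (\<sigma> \<circ> t) :: _ \<Rightarrow>\<^sub>0 'k) = (\<Sum>\<pi>\<in>column_stabilizer \<mu> t.
      Poly_Mapping.single (tabloid \<mu> (\<sigma> \<circ> \<pi> \<circ> t)) (of_int (sign \<pi>)))"
    unfolding polytabloid_def
  proof (rule sum.reindex_bij_witness[where i = "\<lambda>\<pi>. \<sigma> \<circ> \<pi> \<circ> inv_into UNIV \<sigma>" and j = "\<lambda>\<pi>. inv_into UNIV \<sigma> \<circ> \<pi> \<circ> \<sigma>"])
    fix \<pi> assume \<pi>: "\<pi> \<in> column_stabilizer \<mu> (\<sigma> \<circ> t)"
    show eq: "\<sigma> \<circ> (inv_into UNIV \<sigma> \<circ> \<pi> \<circ> \<sigma>) \<circ> inv_into UNIV \<sigma> = \<pi>"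
      by (auto simp: fun_eq_iff inv_o)
    have "inv_into UNIV \<sigma> \<circ> (\<sigma> \<circ> t) = t"
      by (auto simp: fun_eq_iff inv_o)
    then show mem: "inv_into UNIV \<sigma> \<circ> \<pi> \<circ> \<sigma> \<in> column_stabilizer \<mu> t"
      using conj[OF inv \<pi>] bij by (simp add: inv_inv_eq)
    have "sign (inv_into UNIV \<sigma> \<circ> \<pi> \<circ> \<sigma>) = sign \<pi>"
      using sgn[of "inv_into UNIV \<sigma> \<circ> \<pi> \<circ> \<sigma>"] mem eq by (auto simp: column_stabilizer_def)
    moreover have "\<sigma> \<circ> (inv_into UNIV \<sigma> \<circ> \<pi> \<circ> \<sigma>) \<circ> t = \<pi> \<circ> (\<sigma> \<circ> t)"
      by (auto simp: fun_eq_iff inv_o)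
    ultimately show "Poly_Mapping.single (tabloid \<mu> (\<sigma> \<circ> (inv_into UNIV \<sigma> \<circ> \<pi> \<circ> \<sigma>) \<circ> t))
          (of_int (sign (inv_into UNIV \<sigma> \<circ> \<pi> \<circ> \<sigma>))) =
        Poly_Mapping.single (tabloid \<mu> (\<pi> \<circ> (\<sigma> \<circ> t))) (of_int (sign \<pi>))"
      by metis
  next
    fix \<pi> assume "\<pi> \<in> column_stabilizer \<mu> t"
    then show "\<sigma> \<circ> \<pi> \<circ> inv_into UNIV \<sigma> \<in> column_stabilizer \<mu> (\<sigma> \<circ> t)"
      using conj[OF assms] by blast
    show "inv_into UNIV \<sigma> \<circ> (\<sigma> \<circ> \<pi> \<circ> inv_into UNIV \<sigma>) \<circ> \<sigma> = \<pi>"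
      by (auto simp: fun_eq_iff inv_o)
  qed
  then show ?thesis
    by (simp only: polytabloid_def[of \<mu> t] tabloid_act_sum tabloid_act_single tabloid_comp comp_assoc)
qed

lemma finite_diagram: "finite (diagram \<mu>)"
proof (rule finite_subset)
  show "diagram \<mu> \<subseteq> (SIGMA i:{..<length \<mu>}. {..<\<mu> ! i})"
    by (auto simp: diagram_def)
qed auto

lemma finite_polytabloids: "finite {polytabloid \<mu> t |t. is_tableau \<mu> t}"
proof (rule finite_subset)
  show "{polytabloid \<mu> t |t. is_tableau \<mu> t} \<subseteq> polytabloid \<mu> ` (diagram \<mu> \<rightarrow>\<^sub>E {1..sum_list \<mu>})"
  proof safe
    fix t assume t: "is_tableau \<mu> t"
    let ?s = "restrict t (diagram \<mu>)"
    have "{?s (i, j) |i. (i, j) \<in> diagram \<mu>} = {t (i, j) |i. (i, j) \<in> diagram \<mu>}" for j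
      by force
    then have "column_stabilizer \<mu> ?s = column_stabilizer \<mu> t"
      by (simp only: column_stabilizer_def)
    moreover have "{(\<pi> \<circ> ?s) (i, j) |j. (i, j) \<in> diagram \<mu>} =
        {(\<pi> \<circ> t) (i, j) |j. (i, j) \<in> diagram \<mu>}" for \<pi> :: "nat \<Rightarrow> nat" and i
      by force
    then have "tabloid \<mu> (\<pi> \<circ> ?s) = tabloid \<mu> (\<pi> \<circ> t)" for \<pi>
      unfolding tabloid_def by presburger
    ultimately have "polytabloid \<mu> t = polytabloid \<mu> ?s"
      by (simp add: polytabloid_def)
    moreover have "?s \<in> diagram \<mu> \<rightarrow>\<^sub>E {1..sum_list \<mu>}"
      using t by (auto simp: is_tableau_def bij_betw_def)
    ultimately show "polytabloid \<mu> t \<in> polytabloid \<mu> ` (diagram \<mu> \<rightarrow>\<^sub>E {1..sum_list \<mu>})"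
      by blast
  qed
qed (simp add: finite_PiE finite_diagram)

lemma g_cycle_permutes:
  assumes "i \<in> {1..n}"
  shows "g_cycle p i permutes {1..n * p}"
proof -
  have "i * p \<le> n * p"
    using assms by simp
  then have "set [(i - 1) * p + 1..<i * p + 1] \<subseteq> {1..n * p}"
    by (intro subsetI) (simp only: set_upt atLeastLessThan_iff atLeastAtMost_iff, linarith)
  then show ?thesis
    unfolding g_cycle_def by (intro permutes_subset[OF cycle_permutes])
qed

lemma subgroup_E_subgroup: "subgroup (E_subgroup p n) (sym_group (n * p))"
  unfolding E_subgroup_def
  using g_cycle_permutes
  by (intro group.generate_is_subgroup sym_group_is_group) (simp add: sym_group_def image_subset_iff)

lemma specht_restrict_fg_kG_module:
  assumes "sum_list \<mu> = n * p"
  shows "fg_kG_module (specht \<mu> \<down> E_subgroup p n :: (_, 'k::field, _) kG_rep)"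
proof -
  let ?P = "{polytabloid \<mu> t |t. is_tableau \<mu> t} :: (nat set list \<Rightarrow>\<^sub>0 'k) set"
  let ?V = "fspace.span ?P"
  have perm: "g permutes {1..sum_list \<mu>}" if "g \<in> E_subgroup p n" for g
    using that subgroup.subset[OF subgroup_E_subgroup] assms by (auto simp: sym_group_def)
  have one: "id \<in> E_subgroup p n"
    using subgroup.one_closed[OF subgroup_E_subgroup] by (simp add: sym_group_def)
  have act_P: "tabloid_act g x \<in> ?P" if g: "g \<in> E_subgroup p n" and x: "x \<in> ?P" for g x
  proof -
    obtain t where t: "x = polytabloid \<mu> t" "is_tableau \<mu> t"
      using x by blast
    have "bij_betw g {1..sum_list \<mu>} {1..sum_list \<mu>}"
      using perm[OF g] permutes_imp_bij by blast
    then have "is_tableau \<mu> (g \<circ> t)"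
      using t(2) unfolding is_tableau_def by (rule bij_betw_trans[rotated])
    then show ?thesis
      using t(1) tabloid_act_polytabloid[OF perm[OF g], of t] by blast
  qed
  have act_V: "tabloid_act g x \<in> ?V" if g: "g \<in> E_subgroup p n" and x: "x \<in> ?V" for g x
    using x
  proof (induction rule: fspace.span_induct_alt)
    case base
    show ?case by (simp add: tabloid_act_zero fspace.span_zero)
  next
    case (step c y z)
    then have "tabloid_act g y \<in> ?V"
      using act_P[OF g] fspace.span_base by blast
    then show ?case
      using step by (simp add: tabloid_act_add tabloid_act_scale fspace.span_add fspace.span_scale)
  qed
  show ?thesis
  proof (intro fg_kG_module.intro, goal_cases)
    case 1
    show ?case
      using subgroup.subgroup_is_group[OF subgroup_E_subgroup sym_group_is_group, of p n] assms
      by (simp add: restrict_rep_def specht_def)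
  next
    case 2
    show ?case
      using fspace.vector_space_axioms by (simp add: restrict_rep_def specht_def)
  next
    case 9
    have "{tabloid_act g b |g b. g \<in> E_subgroup p n \<and> b \<in> ?P} = ?P"
    proof safe
      fix g and t assume "g \<in> E_subgroup p n" "is_tableau \<mu> t"
      then show "\<exists>s. tabloid_act g (polytabloid \<mu> t :: _ \<Rightarrow>\<^sub>0 'k) = polytabloid \<mu> s \<and> is_tableau \<mu> s"
        using act_P[of g "polytabloid \<mu> t"] by blast
    next
      fix t assume "is_tableau \<mu> t"
      then show "\<exists>g b. (polytabloid \<mu> t :: _ \<Rightarrow>\<^sub>0 'k) = tabloid_act g b \<and> g \<in> E_subgroup p n \<and> b \<in> ?P"
        using one tabloid_act_id[of "polytabloid \<mu> t"] by (metis (mono_tags, lifting) mem_Collect_eq)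
    qed
    then show ?case
      using finite_polytabloids[of \<mu>] fspace.span_superset[of ?P]
      by (intro exI[of _ ?P]) (simp add: restrict_rep_def specht_def)
  qed (auto simp: restrict_rep_def specht_def sym_group_def act_V tabloid_act_add
      tabloid_act_scale tabloid_act_id tabloid_act_comp)
qed

lemma trivial_restrict_fg_kG_module:
  "fg_kG_module (trivial_rep (sym_group (n * p)) \<down> E_subgroup p n :: (_, 'k::field, 'k) kG_rep)"
proof -
  interpret k: vector_space "(*) :: 'k \<Rightarrow> 'k \<Rightarrow> 'k"
    by unfold_locales (auto simp: algebra_simps)
  have "k.span {1} = UNIV"
    by (auto simp: k.span_singleton)
  moreover have "\<exists>g. g \<in> E_subgroup p n"
    using subgroup.one_closed[OF subgroup_E_subgroup] by blast
  ultimately have "\<exists>B. finite B \<and> k.span {b |g b. g \<in> E_subgroup p n \<and> b \<in> B} = UNIV"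
    by (intro exI[of _ "{1}"]) (simp add: conj_commute)
  then show ?thesis
    using subgroup.subgroup_is_group[OF subgroup_E_subgroup sym_group_is_group, of p n]
      k.vector_space_axioms k.subspace_UNIV
    by (intro fg_kG_module.intro) (auto simp: restrict_rep_def trivial_rep_def)
qed

end

theory Submission
  imports Defs "Jordan_Normal_Form.Jordan_Normal_Form_Existence" "Jordan_Normal_Form.Jordan_Normal_Form_Uniqueness"
begin

text \<open>Let \<open>\<nu>\<close> be \<open>\<mu>\<close> without the last node of row \<open>b\<close>. Then \<open>\<mu>\<close> and \<open>\<phi>(\<mu>)\<close> arise from \<open>\<nu>\<close> by adding nodes of
  the same content modulo \<open>p\<close>, and, as the \<open>p\<close>-core is empty, no third addable node of \<open>\<nu>\<close> has this
  content. The module induced from \<open>S\<^sup>\<nu>\<close> is filtered by the Specht modules of the partitions that arise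
  from \<open>\<nu>\<close> by adding a node, and on each of them the sum of all transpositions acts by the sum of the
  contents. A generalized eigenspace \<open>P\<close> of this sum is therefore a direct summand of the induced module
  with submodule \<open>S\<^sup>\<mu>\<close> and quotient the Specht module of \<open>\<phi>(\<mu>)\<close>. The induced module is graded by the
  entry of the added node, and \<open>g\<^sub>i\<close> permutes the \<open>p\<close> entries that it moves cyclically; so the induced
  module, and with it \<open>P\<close>, is free over \<open>k\<langle>u\<^sub>\<alpha>\<rangle>\<close> if all \<open>\<alpha>\<^sub>i\<close> are nonzero. Comparing the kernels of the powers of
  \<open>u\<^sub>\<alpha> - 1\<close> along the exact sequence with free middle term \<open>P\<close> gives the complementary Jordan types.

  Freeness at one nonzero point implies freeness at a generic point, because the rank of \<open>u\<^sub>\<alpha> - 1\<close> is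
  lower semicontinuous, and generic freeness passes from one module of a complementary pair to the other.
  Finally, \<open>\<phi>\<close> increases the sum of the squares of the parts, so that \<open>\<Phi>(\<mu>)\<close> is an iterate of \<open>\<phi>\<close>.\<close>

section \<open>Dimensions of subspaces of free vector spaces\<close>

text \<open>The obstacle is exactness of the filtration of the induced module in every
  characteristic, which usually rests on the standard basis theorem. Here only inequalities are
  proved: deleting an entry bounds the dimension of a Specht module from below, the grading bounds
  the induced module from above, and the maps that move the added node into a row of the diagram
  bound it from below. A counting identity in Young's lattice makes these bounds meet, so the common
  kernel of the maps is zero and their successive images are exactly the Specht modules. Modules
  over the cyclic algebra hardly appear. With \<open>N\<close> the action of \<open>u - 1\<close>,
  which satisfies \<open>N^p = 0\<close>, and \<open>d_j = dim ker N^j\<close>, freeness means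
  \<open>p * d_1 <= dim V\<close> (the reverse inequality always holds), and the number of blocks of
  size \<open>i\<close> is \<open>2 * d_i - d_(i-1) - d_(i+1)\<close>. The exact sequence relates
  \<open>d_j\<close> of one end to \<open>d_(p-j)\<close> of the other up to a term linear in
  \<open>j\<close>, and second differences do not see that term.\<close>

global_interpretation fpair: vector_space_pair fscale fscale
  by unfold_locales

abbreviation flinear :: "(('a \<Rightarrow>\<^sub>0 'k::field) \<Rightarrow> ('b \<Rightarrow>\<^sub>0 'k)) \<Rightarrow> bool" where
  "flinear \<equiv> Vector_Spaces.linear fscale fscale"

lemma flinearI:
  "(\<And>x y. f (x + y) = f x + f y) \<Longrightarrow> (\<And>c x. f (fscale c x) = fscale c (f x)) \<Longrightarrow> flinear f"
  unfolding Vector_Spaces.linear_iff by (auto intro: fspace.vector_space_axioms)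

lemmas flinear_simps = fpair.linear_add fpair.linear_diff fpair.linear_sum fpair.linear_0
  fpair.linear_scale fpair.linear_neg

lemma flinear_comp: "flinear f \<Longrightarrow> flinear g \<Longrightarrow> flinear (\<lambda>x. f (g x))"
  by (rule flinearI) (simp_all add: flinear_simps)

lemma flinear_ident: "flinear (\<lambda>x. x)" by (rule flinearI) auto

lemma flinear_add: "flinear f \<Longrightarrow> flinear g \<Longrightarrow> flinear (\<lambda>x. f x + g x)"
  by (rule flinearI) (simp_all add: flinear_simps fspace.scale_right_distrib)

lemma flinear_diff: "flinear f \<Longrightarrow> flinear g \<Longrightarrow> flinear (\<lambda>x. f x - g x)"
  by (rule flinearI) (simp_all add: flinear_simps fspace.scale_right_diff_distrib)

lemma flinear_scale: "flinear f \<Longrightarrow> flinear (\<lambda>x. fscale c (f x))"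
  by (rule flinearI) (simp_all add: flinear_simps fspace.scale_right_distrib mult.commute)

lemma flinear_zero: "flinear (\<lambda>x. 0)"
  by (rule flinearI) auto

lemma flinear_sum: "(\<And>i. i \<in> I \<Longrightarrow> flinear (f i)) \<Longrightarrow> flinear (\<lambda>x. \<Sum>i\<in>I. f i x)"
  by (induction I rule: infinite_finite_induct) (auto intro: flinear_add flinear_zero)

lemma flinear_funpow: "flinear (f :: ('a \<Rightarrow>\<^sub>0 'k::field) \<Rightarrow> ('a \<Rightarrow>\<^sub>0 'k)) \<Longrightarrow> flinear (f ^^ j)"
proof (induction j)
  case 0 show ?case by (simp add: id_def flinear_ident)
next
  case (Suc j)
  then show ?case using flinear_comp[of f "f ^^ j"] by (simp add: comp_def)
qed

text \<open>Guards every use of \<open>fspace.dim\<close>, which is the \<open>card\<close> of a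
  basis and hence 0 for an infinite one. Asking only for containment in a finitely spanned space
  makes the property pass to all subsets.\<close>

definition fin_dim :: "('a \<Rightarrow>\<^sub>0 'k::field) set \<Rightarrow> bool" where
  "fin_dim V \<longleftrightarrow> (\<exists>B. finite B \<and> V \<subseteq> fspace.span B)"

lemma fin_dim_subset: "fin_dim V \<Longrightarrow> U \<subseteq> V \<Longrightarrow> fin_dim U"
  unfolding fin_dim_def by blast

lemma fin_dim_Collect: "fin_dim V \<Longrightarrow> fin_dim {x \<in> V. P x}"
  by (rule fin_dim_subset) auto

lemma fin_dim_span: "finite B \<Longrightarrow> fin_dim (fspace.span B)"
  unfolding fin_dim_def by blast

lemma fin_dim_image: "fin_dim V \<Longrightarrow> flinear f \<Longrightarrow> fin_dim (f ` V)"
  unfolding fin_dim_def by (metis finite_imageI fpair.linear_span_image image_mono)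

lemma independent_card_le:
  assumes "fin_dim V" "C \<subseteq> V" "fspace.independent C"
  shows "finite C" "card C \<le> fspace.dim V"
proof -
  obtain B where B: "finite B" "V \<subseteq> fspace.span B" using assms(1) unfolding fin_dim_def by blast
  obtain D where D: "D \<subseteq> V" "fspace.independent D" "V \<subseteq> fspace.span D" "card D = fspace.dim V"
    using fspace.basis_exists by blast
  have "finite D" using fspace.independent_span_bound[OF B(1) D(2)] B D by blast
  then show "finite C" "card C \<le> fspace.dim V"
    using fspace.independent_span_bound[of D C] assms D by auto
qed

lemma fin_dim_basis:
  assumes "fin_dim V" "fspace.subspace V"
  obtains B where "finite B" "fspace.independent B" "V = fspace.span B" "card B = fspace.dim V"
proof -
  obtain D where D: "D \<subseteq> V" "fspace.independent D" "V \<subseteq> fspace.span D" "card D = fspace.dim V"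
    using fspace.basis_exists by blast
  moreover have "fspace.span D \<subseteq> V" using D assms(2) fspace.span_minimal by blast
  ultimately show thesis using that independent_card_le(1)[OF assms(1)] by blast
qed

lemma dim_mono: "fin_dim V \<Longrightarrow> U \<subseteq> V \<Longrightarrow> fspace.dim U \<le> fspace.dim V"
  by (metis fspace.basis_exists independent_card_le(2) subset_trans)

lemma dim_eq_subspace:
  assumes "fin_dim V" "fspace.subspace U" "U \<subseteq> V" "fspace.dim V \<le> fspace.dim U"
  shows "U = V"
proof (rule ccontr)
  assume "U \<noteq> V"
  then obtain v where v: "v \<in> V" "v \<notin> U" using assms(3) by blast
  obtain C where C: "finite C" "fspace.independent C" "U = fspace.span C" "card C = fspace.dim U"
    using fin_dim_basis fin_dim_subset assms by metis
  have "fspace.independent (insert v C)" using C v fspace.independent_insertI by blast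
  moreover have "insert v C \<subseteq> V" using C v assms(3) fspace.span_superset by blast
  ultimately have "card (insert v C) \<le> fspace.dim V" using independent_card_le(2)[OF assms(1)] by blast
  moreover have "v \<notin> C" using C v fspace.span_base by blast
  ultimately show False using C assms(4) by simp
qed

lemma dim_zero_space: "fspace.dim {0 :: 'a \<Rightarrow>\<^sub>0 'k::field} = 0"
  by (metis card.empty fspace.dim_span_eq_card_independent fspace.independent_empty fspace.span_empty)

lemma dim_eq_0D: "fin_dim V \<Longrightarrow> fspace.dim V = 0 \<Longrightarrow> V \<subseteq> {0}"
  by (metis card_0_eq fspace.basis_exists fspace.span_empty independent_card_le(1))

lemma subspace_ker: "flinear f \<Longrightarrow> fspace.subspace V \<Longrightarrow> fspace.subspace {x \<in> V. f x = 0}"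
  unfolding fspace.subspace_def by (auto simp: flinear_simps)

lemma subspace_image: "flinear f \<Longrightarrow> fspace.subspace V \<Longrightarrow> fspace.subspace (f ` V)"
  by (rule fpair.linear_subspace_image)

text \<open>A basis \<open>C\<close> of the kernel and chosen preimages of a basis \<open>D\<close>
  of the image together form a basis of \<open>V\<close>.\<close>

theorem rank_nullity:
  assumes f: "flinear f" and V: "fspace.subspace V" "fin_dim V"
  shows "fspace.dim V = fspace.dim {x \<in> V. f x = 0} + fspace.dim (f ` V)"
proof -
  let ?K = "{x \<in> V. f x = 0}"
  obtain C where C: "finite C" "fspace.independent C" "?K = fspace.span C" "card C = fspace.dim ?K"
    by (rule fin_dim_basis[OF fin_dim_Collect[OF V(2)] subspace_ker[OF f V(1)]])
  obtain D where D: "finite D" "fspace.independent D" "f ` V = fspace.span D" "card D = fspace.dim (f ` V)"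
    by (rule fin_dim_basis[OF fin_dim_image[OF V(2) f] subspace_image[OF f V(1)]])
  have "D \<subseteq> f ` V" unfolding D(3) by (rule fspace.span_superset)
  then have "\<forall>d\<in>D. \<exists>x\<in>V. f x = d" by (metis imageE subsetD)
  then obtain g where g: "\<And>d. d \<in> D \<Longrightarrow> g d \<in> V" "\<And>d. d \<in> D \<Longrightarrow> f (g d) = d" by metis
  have inj: "inj_on g D" by (metis g(2) inj_onI)
  have "C \<subseteq> ?K" unfolding C(3) by (rule fspace.span_superset)
  then have fC: "\<And>x. x \<in> C \<Longrightarrow> f x = 0" and CV: "C \<subseteq> V" by auto
  have disj: "C \<inter> g ` D = {}"
  proof -
    have "0 \<notin> D" using D(2) fspace.dependent_zero by blast
    then show ?thesis using fC g(2) by fastforce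
  qed
  have ind: "fspace.independent (C \<union> g ` D)"
  proof (rule fspace.independent_if_scalars_zero)
    show "finite (C \<union> g ` D)" using C D by simp
    fix u x assume s: "(\<Sum>x\<in>C \<union> g ` D. fscale (u x) x) = 0" and x: "x \<in> C \<union> g ` D"
    have split: "(\<Sum>x\<in>C \<union> g ` D. fscale (u x) x) = (\<Sum>x\<in>C. fscale (u x) x) + (\<Sum>d\<in>D. fscale (u (g d)) (g d))"
      using C D disj inj by (simp add: sum.union_disjoint sum.reindex)
    have "(\<Sum>d\<in>D. fscale (u (g d)) d) = f (\<Sum>x\<in>C \<union> g ` D. fscale (u x) x)"
      unfolding split using f fC g by (simp add: flinear_simps)
    then have "(\<Sum>d\<in>D. fscale (u (g d)) d) = 0" using s f by (simp add: flinear_simps)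
    then have uD: "u (g d) = 0" if "d \<in> D" for d
      using fspace.independentD[OF D(2) D(1) subset_refl, of "\<lambda>d. u (g d)"] that by blast
    then have "(\<Sum>x\<in>C. fscale (u x) x) = 0" using s split by simp
    then have "u c = 0" if "c \<in> C" for c
      using fspace.independentD[OF C(2) C(1) subset_refl, of u] that by blast
    then show "u x = 0" using uD x by blast
  qed
  have sp: "V \<subseteq> fspace.span (C \<union> g ` D)"
  proof
    fix v assume v: "v \<in> V"
    then have "f v \<in> fspace.span D" unfolding D(3)[symmetric] by simp
    then obtain a where a: "f v = (\<Sum>d\<in>D. fscale (a d) d)" using fspace.span_finite[OF D(1)] by auto
    let ?y = "\<Sum>d\<in>D. fscale (a d) (g d)"
    have y: "?y \<in> fspace.span (C \<union> g ` D)"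
      by (intro fspace.span_sum fspace.span_scale fspace.span_base) auto
    have "?y \<in> V" using V(1) g by (intro fspace.subspace_sum fspace.subspace_scale) auto
    moreover have "f ?y = f v" using f g a by (simp add: flinear_simps)
    ultimately have "v - ?y \<in> ?K" using v V(1) f by (simp add: fspace.subspace_diff flinear_simps)
    then have "v - ?y \<in> fspace.span C" unfolding C(3)[symmetric] .
    then have "v - ?y \<in> fspace.span (C \<union> g ` D)"
      using fspace.span_mono[of C "C \<union> g ` D"] by auto
    then show "v \<in> fspace.span (C \<union> g ` D)" using y fspace.span_add[of "v - ?y" _ ?y] by simp
  qed
  have "card (C \<union> g ` D) = fspace.dim V"
    using sp ind CV g(1) by (intro fspace.basis_card_eq_dim) auto
  then show ?thesis using C D disj inj by (simp add: card_Un_disjoint card_image)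
qed

lemma dim_image_le: "flinear f \<Longrightarrow> fspace.subspace V \<Longrightarrow> fin_dim V \<Longrightarrow> fspace.dim (f ` V) \<le> fspace.dim V"
  using rank_nullity[of f V] by simp

lemma dim_image_inj:
  assumes f: "flinear f" and V: "fspace.subspace V" "fin_dim V" and inj: "\<And>x. x \<in> V \<Longrightarrow> f x = 0 \<Longrightarrow> x = 0"
  shows "fspace.dim (f ` V) = fspace.dim V"
proof -
  have "{x \<in> V. f x = 0} = {0}" using inj f fspace.subspace_0[OF V(1)] by (auto simp: flinear_simps)
  then show ?thesis using rank_nullity[OF f V] dim_zero_space by simp
qed

text \<open>Rank-nullity iterated in the order given by \<open>h\<close>: each map is restricted to
  the common kernel of its predecessors. Injectivity of \<open>h\<close> lets the maps enter one at
  a time. This replaces filtrations with quotient spaces throughout.\<close>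

lemma dim_filtration:
  fixes \<theta> :: "'i \<Rightarrow> ('a \<Rightarrow>\<^sub>0 'k::field) \<Rightarrow> ('b \<Rightarrow>\<^sub>0 'k)" and h :: "'i \<Rightarrow> nat"
  assumes V: "fspace.subspace V" "fin_dim V" and lin: "\<And>i. i \<in> I \<Longrightarrow> flinear (\<theta> i)"
    and I: "finite I" "inj_on h I"
  shows "fspace.dim V = (\<Sum>i\<in>I. fspace.dim (\<theta> i ` {v \<in> V. \<forall>j\<in>I. h j < h i \<longrightarrow> \<theta> j v = 0}))
    + fspace.dim {v \<in> V. \<forall>i\<in>I. \<theta> i v = 0}"
proof -
  let ?K = "\<lambda>r. {v \<in> V. \<forall>j\<in>I. h j < r \<longrightarrow> \<theta> j v = 0}"
  have K: "fspace.subspace (?K r)" for r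
    using V lin unfolding fspace.subspace_def by (auto simp: flinear_simps)
  have *: "fspace.dim V = (\<Sum>i\<in>{i\<in>I. h i < r}. fspace.dim (\<theta> i ` ?K (h i))) + fspace.dim (?K r)" for r
  proof (induction r)
    case 0 show ?case by simp
  next
    case (Suc r)
    show ?case
    proof (cases "\<exists>i\<in>I. h i = r")
      case False
      then have "(h i < Suc r) = (h i < r)" if "i \<in> I" for i using that less_Suc_eq by auto
      then have "{i\<in>I. h i < Suc r} = {i\<in>I. h i < r}" "?K (Suc r) = ?K r" by blast+
      then show ?thesis using Suc by simp
    next
      case True
      then obtain i where i: "i \<in> I" "h i = r" by blast
      then have eq: "(h j < Suc r) = (h j < r \<or> j = i)" if "j \<in> I" for j
        using that I(2) less_Suc_eq by (auto dest: inj_onD)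
      have "{i\<in>I. h i < Suc r} = insert i {i\<in>I. h i < r}" using eq i by auto
      moreover have "?K (Suc r) = {v \<in> ?K r. \<theta> i v = 0}" using eq i by auto
      moreover have "fspace.dim (?K r) = fspace.dim {v \<in> ?K r. \<theta> i v = 0} + fspace.dim (\<theta> i ` ?K r)"
        by (rule rank_nullity[OF lin[OF i(1)] K fin_dim_Collect[OF V(2)]])
      ultimately show ?thesis using Suc I(1) i by simp
    qed
  qed
  obtain r where r: "\<And>i. i \<in> I \<Longrightarrow> h i < r"
    using I(1) finite_nat_set_iff_bounded[of "h ` I"] by auto
  then have "{i\<in>I. h i < r} = I" and "?K r = {v \<in> V. \<forall>i\<in>I. \<theta> i v = 0}" by blast+
  then show ?thesis using *[of r] by simp
qed

section \<open>Nilpotent operators\<close>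

text \<open>The sequence of these numbers determines the Jordan type of a nilpotent operator and
  decides freeness, so it is the only invariant that has to be transported.\<close>

definition kdim :: "(('a \<Rightarrow>\<^sub>0 'k::field) \<Rightarrow> ('a \<Rightarrow>\<^sub>0 'k)) \<Rightarrow> ('a \<Rightarrow>\<^sub>0 'k) set \<Rightarrow> nat \<Rightarrow> nat" where
  "kdim N V j = fspace.dim {x \<in> V. (N ^^ j) x = 0}"

lemma funpow_closed: "(\<And>x. x \<in> V \<Longrightarrow> N x \<in> V) \<Longrightarrow> x \<in> V \<Longrightarrow> (N ^^ j) x \<in> V"
  by (induction j) auto

lemma funpow_commute:
  assumes "\<And>x. x \<in> V \<Longrightarrow> f (N x) = N' (f x)" "\<And>x. x \<in> V \<Longrightarrow> N x \<in> V" "x \<in> V"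
  shows "f ((N ^^ j) x) = (N' ^^ j) (f x)"
proof (induction j)
  case (Suc j)
  have "f ((N ^^ Suc j) x) = N' (f ((N ^^ j) x))"
    using assms(1)[OF funpow_closed[OF assms(2,3)]] by simp
  then show ?case using Suc by simp
qed simp

lemma kdim_image:
  assumes f: "flinear f" and V: "fspace.subspace V" "fin_dim V"
    and inj: "\<And>x. x \<in> V \<Longrightarrow> f x = 0 \<Longrightarrow> x = 0"
    and N: "flinear N" "\<And>x. x \<in> V \<Longrightarrow> N x \<in> V" and c: "\<And>x. x \<in> V \<Longrightarrow> f (N x) = N' (f x)"
  shows "kdim N' (f ` V) j = kdim N V j"
proof -
  let ?K = "{x \<in> V. (N ^^ j) x = 0}"
  have c': "f ((N ^^ j) x) = (N' ^^ j) (f x)" if "x \<in> V" for x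
    by (rule funpow_commute[of V]) (use c N that in auto)
  have "{x \<in> f ` V. (N' ^^ j) x = 0} = f ` ?K"
  proof (intro subset_antisym subsetI)
    fix y assume "y \<in> {x \<in> f ` V. (N' ^^ j) x = 0}"
    then obtain x where x: "y = f x" "x \<in> V" "(N' ^^ j) (f x) = 0" by blast
    then have "f ((N ^^ j) x) = 0" using c' by simp
    then have "(N ^^ j) x = 0" using inj[of "(N ^^ j) x"] funpow_closed[of V N] N(2) x(2) by blast
    then show "y \<in> f ` ?K" using x by blast
  next
    fix y assume "y \<in> f ` ?K"
    then obtain x where x: "y = f x" "x \<in> V" "(N ^^ j) x = 0" by blast
    then have "(N' ^^ j) y = 0" using c'[of x] fpair.linear_0[OF f] by simp
    then show "y \<in> {x \<in> f ` V. (N' ^^ j) x = 0}" using x by blast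
  qed
  moreover have "fspace.dim (f ` ?K) = fspace.dim ?K"
    by (rule dim_image_inj[OF f subspace_ker[OF flinear_funpow[OF N(1)] V(1)] fin_dim_Collect[OF V(2)]]) (use inj in auto)
  ultimately show ?thesis unfolding kdim_def by simp
qed

text \<open>\<open>N^j\<close> maps the kernel of \<open>N^(i+j)\<close> into the kernel of
  \<open>N^i\<close>, and the part that it kills is contained in the kernel of
  \<open>N^j\<close>.\<close>

lemma kdim_add_le:
  assumes V: "fspace.subspace V" "fin_dim V" and N: "flinear N" "\<And>x. x \<in> V \<Longrightarrow> N x \<in> V"
  shows "kdim N V (i + j) \<le> kdim N V i + kdim N V j"
proof -
  let ?K = "{x \<in> V. (N ^^ (i + j)) x = 0}"
  have "fspace.dim ?K = fspace.dim {x \<in> ?K. (N ^^ j) x = 0} + fspace.dim ((N ^^ j) ` ?K)"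
    by (rule rank_nullity) (intro N(1) V subspace_ker flinear_funpow fin_dim_Collect)+
  moreover have "fspace.dim {x \<in> ?K. (N ^^ j) x = 0} \<le> kdim N V j" unfolding kdim_def
    by (rule dim_mono[OF fin_dim_Collect[OF V(2)]]) auto
  moreover have "fspace.dim ((N ^^ j) ` ?K) \<le> kdim N V i" unfolding kdim_def
    by (rule dim_mono[OF fin_dim_Collect[OF V(2)]]) (use funpow_closed[of V N] N(2) in \<open>auto simp: funpow_add\<close>)
  ultimately show ?thesis unfolding kdim_def by linarith
qed

locale nilpotent =
  fixes p :: nat and N :: "('a \<Rightarrow>\<^sub>0 'k::field) \<Rightarrow> ('a \<Rightarrow>\<^sub>0 'k)"
  assumes lin: "flinear N" and nil: "(N ^^ p) x = 0"

locale nilpotent_on = nilpotent +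
  fixes V :: "('a \<Rightarrow>\<^sub>0 'k::field) set"
  assumes subV: "fspace.subspace V" and finV: "fin_dim V" and closed: "x \<in> V \<Longrightarrow> N x \<in> V"
begin

lemma kdim_p: "kdim N V p = fspace.dim V"
  unfolding kdim_def using nil by simp

lemma kdim_le_mult: "kdim N V j \<le> j * kdim N V 1"
proof (induction j)
  case 0
  have "{x \<in> V. (N ^^ 0) x = 0} = {0}" using fspace.subspace_0[OF subV] by auto
  then show ?case unfolding kdim_def using dim_zero_space by simp
next
  case (Suc j)
  then show ?case using kdim_add_le[OF subV finV lin closed, of 1 j] by simp
qed

lemma dim_le_mult: "fspace.dim V \<le> p * kdim N V 1"
  using kdim_le_mult[of p] kdim_p by simp

text \<open>The first hypothesis says that all Jordan blocks have the maximal size \<open>p\<close>.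
  Subadditivity at \<open>j\<close> and \<open>p - j\<close> then leaves no room below the upper
  bound \<open>j * kdim N V 1\<close>.\<close>

lemma kdim_free:
  assumes "p * kdim N V 1 \<le> fspace.dim V" "j \<le> p"
  shows "kdim N V j = j * kdim N V 1"
proof (rule antisym[OF kdim_le_mult])
  have "p * kdim N V 1 \<le> kdim N V j + kdim N V (p - j)"
    using kdim_add_le[OF subV finV lin closed, of j "p - j"] assms kdim_p by simp
  also have "\<dots> \<le> kdim N V j + (p - j) * kdim N V 1" using kdim_le_mult by simp
  finally show "j * kdim N V 1 \<le> kdim N V j"
    using mult_le_mono1[OF assms(2), of "kdim N V 1"] diff_mult_distrib[of p j "kdim N V 1"] by linarith
qed

end

lemma nilpotent_onI:
  "nilpotent p N \<Longrightarrow> fspace.subspace V \<Longrightarrow> fin_dim V \<Longrightarrow> (\<And>x. x \<in> V \<Longrightarrow> N x \<in> V) \<Longrightarrow> nilpotent_on p N V"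
  by (simp add: nilpotent_on_def nilpotent_on_axioms_def)

text \<open>\<open>?W\<close> is the preimage in \<open>P\<close> of the kernel of the
  \<open>j\<close>-th power on the quotient by \<open>?A\<close>. Its dimension is computed twice,
  with \<open>f\<close> and with \<open>N^j\<close>; freeness of \<open>P\<close> identifies the
  image of \<open>?W\<close> under \<open>N^j\<close> as the kernel of \<open>N^(p-j)\<close> on
  \<open>?A\<close>.\<close>

lemma kdim_exact:
  assumes P: "nilpotent_on p N P" and free: "p * kdim N P 1 \<le> fspace.dim P"
    and f: "flinear f" "\<And>x. x \<in> P \<Longrightarrow> f (N x) = N' (f x)" and j: "j \<le> p"
  shows "kdim N' (f ` P) j + fspace.dim {x \<in> P. f x = 0} = j * kdim N P 1 + kdim N {x \<in> P. f x = 0} (p - j)"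
proof -
  interpret nilpotent_on p N P by fact
  let ?A = "{x \<in> P. f x = 0}"
  let ?W = "{x \<in> P. (N ^^ j) x \<in> ?A}"
  have clp: "(N ^^ i) x \<in> P" if "x \<in> P" for i x using funpow_closed[of P N] closed that by blast
  have c': "f ((N ^^ i) x) = (N' ^^ i) (f x)" if "x \<in> P" for x i
    by (rule funpow_commute[of P]) (use f closed that in auto)
  have Nj: "flinear (N ^^ i)" for i by (rule flinear_funpow[OF lin])
  have subA: "fspace.subspace ?A" by (rule subspace_ker[OF f(1) subV])
  have subW: "fspace.subspace ?W" using subA subV Nj[of j]
    unfolding fspace.subspace_def by (auto simp: flinear_simps f(1))
  have finW: "fin_dim ?W" by (rule fin_dim_Collect[OF finV])
  have "N' 0 = 0"
    using f(2)[OF fspace.subspace_0[OF subV]] f(1) lin by (simp add: flinear_simps)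
  then have N'0: "(N' ^^ i) 0 = 0" for i by (induction i) auto
  have W1: "fspace.dim ?W = fspace.dim {x \<in> ?W. f x = 0} + fspace.dim (f ` ?W)"
    by (rule rank_nullity[OF f(1) subW finW])
  have "{x \<in> ?W. f x = 0} = ?A" using c' clp N'0 by auto
  moreover have "f ` ?W = {y \<in> f ` P. (N' ^^ j) y = 0}" using c' clp by auto
  ultimately have 1: "fspace.dim ?W = fspace.dim ?A + kdim N' (f ` P) j" using W1 unfolding kdim_def by simp
  have W2: "fspace.dim ?W = fspace.dim {x \<in> ?W. (N ^^ j) x = 0} + fspace.dim ((N ^^ j) ` ?W)"
    by (rule rank_nullity[OF Nj subW finW])
  have "{x \<in> ?W. (N ^^ j) x = 0} = {x \<in> P. (N ^^ j) x = 0}"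
    using f(1) fspace.subspace_0[OF subV] by (auto simp: flinear_simps)
  then have k1: "fspace.dim {x \<in> ?W. (N ^^ j) x = 0} = j * kdim N P 1"
    using kdim_free[OF free j] unfolding kdim_def by simp
  \<comment> \<open>The inclusion is \<open>N^p = 0\<close>; equality is a dimension count, since by
    freeness the kernels of \<open>N^j\<close> and \<open>N^(p-j)\<close> have complementary
    dimensions in \<open>P\<close>.\<close>
  have im: "(N ^^ j) ` P = {x \<in> P. (N ^^ (p - j)) x = 0}"
  proof (rule dim_eq_subspace)
    show "fin_dim {x \<in> P. (N ^^ (p - j)) x = 0}" by (rule fin_dim_Collect[OF finV])
    show "fspace.subspace ((N ^^ j) ` P)" using subspace_image Nj subV by blast
    have "(N ^^ (p - j)) ((N ^^ j) x) = 0" for x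
      using nil[of x] j funpow_add[of "p - j" j N] by simp
    then show "(N ^^ j) ` P \<subseteq> {x \<in> P. (N ^^ (p - j)) x = 0}" using clp by auto
    have "fspace.dim P = kdim N P j + fspace.dim ((N ^^ j) ` P)"
      unfolding kdim_def by (rule rank_nullity[OF Nj subV finV])
    moreover have "kdim N P j + kdim N P (p - j) = fspace.dim P"
      using kdim_free[OF free, of j] kdim_free[OF free, of "p - j"] kdim_free[OF free, of p] j kdim_p
      by (simp flip: add_mult_distrib)
    ultimately show "fspace.dim {x \<in> P. (N ^^ (p - j)) x = 0} \<le> fspace.dim ((N ^^ j) ` P)"
      unfolding kdim_def by linarith
  qed
  have "(N ^^ j) ` ?W = {x \<in> ?A. (N ^^ (p - j)) x = 0}"
  proof -
    have "(N ^^ j) ` ?W = (N ^^ j) ` P \<inter> ?A" by auto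
    then show ?thesis unfolding im by auto
  qed
  then show ?thesis using 1 W2 k1 unfolding kdim_def by simp
qed

text \<open>By \<open>st\<close> the operator \<open>T\<close> is injective on its own image, hence
  maps the image onto itself. So \<open>T x = T (T z)\<close> for some \<open>z\<close>, and
  \<open>x - T z\<close> lies in the kernel.\<close>

lemma fitting:
  assumes U: "fspace.subspace U" "fin_dim U" and T: "flinear T" "\<And>x. x \<in> U \<Longrightarrow> T x \<in> U"
    and st: "\<And>x. x \<in> U \<Longrightarrow> T (T x) = 0 \<Longrightarrow> T x = 0" and x: "x \<in> U"
  obtains y z where "x = y + T z" "y \<in> U" "T y = 0" "z \<in> U"
proof -
  let ?W = "T ` U"
  have W: "fspace.subspace ?W" "fin_dim ?W" by (rule subspace_image[OF T(1) U(1)], rule fin_dim_image[OF U(2) T(1)])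
  have "fspace.dim (T ` ?W) = fspace.dim ?W"
    by (rule dim_image_inj[OF T(1) W]) (use st in auto)
  then have "T ` ?W = ?W"
    by (intro dim_eq_subspace) (use W T subspace_image in auto)
  then obtain z where z: "z \<in> U" "T x = T (T z)" using x by blast
  show thesis
  proof (rule that[of "x - T z" z])
    show "x - T z \<in> U" using x z U T fspace.subspace_diff by blast
    show "T (x - T z) = 0" using fpair.linear_diff[OF T(1), of x "T z"] z(2) by simp
  qed (use z in auto)
qed

text \<open>By stability \<open>M\<close> splits into the kernel \<open>?P\<close> and the image
  \<open>?W\<close> of \<open>T\<close>, both invariant under \<open>N\<close>. The dimensions add,
  the kernels of \<open>N\<close> add at most to that of \<open>M\<close>, and since the block bound
  \<open>dim <= p * kdim\<close> holds for \<open>?W\<close>, the reverse inequality for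
  \<open>M\<close> is inherited by \<open>?P\<close>.\<close>

lemma kdim_summand:
  assumes M: "nilpotent_on p N M" and free: "p * kdim N M 1 \<le> fspace.dim M"
    and T: "flinear T" "\<And>x. x \<in> M \<Longrightarrow> T x \<in> M" "\<And>x. x \<in> M \<Longrightarrow> T (N x) = N (T x)"
    and st: "\<And>x. x \<in> M \<Longrightarrow> T (T x) = 0 \<Longrightarrow> T x = 0"
  shows "p * kdim N {x \<in> M. T x = 0} 1 \<le> fspace.dim {x \<in> M. T x = 0}"
proof -
  interpret nilpotent_on p N M by fact
  let ?P = "{x \<in> M. T x = 0}" and ?W = "T ` M" and ?L = "{x \<in> M. N x = 0}"
  have W: "fspace.subspace ?W" "fin_dim ?W" by (rule subspace_image[OF T(1) subV], rule fin_dim_image[OF finV T(1)])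
  have L: "fspace.subspace ?L" "fin_dim ?L" by (rule subspace_ker[OF lin subV], rule fin_dim_Collect[OF finV])
  interpret W: nilpotent_on p N ?W
  proof (rule nilpotent_onI[OF nilpotent_axioms W])
    fix x assume "x \<in> ?W"
    then obtain y where y: "x = T y" "y \<in> M" by blast
    then have "N x = T (N y)" using T(3)[of y] by simp
    then show "N x \<in> ?W" using closed[OF y(2)] by simp
  qed
  have 1: "fspace.dim M = fspace.dim ?P + fspace.dim ?W" by (rule rank_nullity[OF T(1) subV finV])
  have 2: "fspace.dim ?L = fspace.dim {x \<in> ?L. T x = 0} + fspace.dim (T ` ?L)" by (rule rank_nullity[OF T(1) L])
  have eq: "{x \<in> ?L. T x = 0} = {x \<in> ?P. N x = 0}" by auto
  let ?WL = "{x \<in> ?W. N x = 0}"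
  have WL: "fspace.subspace ?WL" "fin_dim ?WL" by (rule subspace_ker[OF lin W(1)], rule fin_dim_Collect[OF W(2)])
  \<comment> \<open>\<open>T\<close> is injective on \<open>?W\<close>, so the kernel of
    \<open>N\<close> on the image embeds into the image under \<open>T\<close> of the kernel of
    \<open>N\<close> on \<open>M\<close>.\<close>
  have "fspace.dim ?WL = fspace.dim (T ` ?WL)"
    by (rule dim_image_inj[symmetric, OF T(1) WL]) (use st in auto)
  also have "\<dots> \<le> fspace.dim (T ` ?L)"
    by (rule dim_mono[OF fin_dim_image[OF L(2) T(1)]]) (use T(2) in \<open>auto intro!: imageI\<close>)
  finally have "kdim N ?P 1 + kdim N ?W 1 \<le> kdim N M 1"
    using 2 unfolding kdim_def eq by simp
  then have "p * kdim N ?P 1 + p * kdim N ?W 1 \<le> p * kdim N M 1" by (metis add_mult_distrib2 mult_le_mono2)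
  then show ?thesis using W.dim_le_mult free 1 by linarith
qed

section \<open>Jordan types and kernel dimensions\<close>

text \<open>A basis of the kernel of \<open>N^i\<close> is extended to one of the kernel of
  \<open>N^(i+1)\<close>; \<open>N\<close> sends every new vector into the span of the old
  ones.\<close>

lemma (in nilpotent_on) triangular_basis:
  "\<exists>bs. distinct bs \<and> fspace.independent (set bs) \<and> fspace.span (set bs) = V \<and>
     (\<forall>j<length bs. N (bs ! j) \<in> fspace.span (set (take j bs)))"
proof -
  have "\<exists>bs. distinct bs \<and> fspace.independent (set bs) \<and> fspace.span (set bs) = {x \<in> V. (N ^^ i) x = 0} \<and>
     (\<forall>j<length bs. N (bs ! j) \<in> fspace.span (set (take j bs)))" for i
  proof (induction i)
    case 0
    show ?case using fspace.subspace_0[OF subV] by (intro exI[of _ "[]"]) (auto simp: fspace.independent_empty)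
  next
    case (Suc i)
    then obtain bs where bs: "distinct bs" "fspace.independent (set bs)"
      "fspace.span (set bs) = {x \<in> V. (N ^^ i) x = 0}"
      "\<And>j. j<length bs \<Longrightarrow> N (bs ! j) \<in> fspace.span (set (take j bs))" by auto
    let ?K = "{x \<in> V. (N ^^ Suc i) x = 0}"
    have subK: "fspace.subspace ?K" and finK: "fin_dim ?K"
      by (rule subspace_ker[OF flinear_funpow[OF lin] subV], rule fin_dim_Collect[OF finV])
    have "set bs \<subseteq> {x \<in> V. (N ^^ i) x = 0}" unfolding bs(3)[symmetric] by (rule fspace.span_superset)
    then have sub: "set bs \<subseteq> ?K" using fpair.linear_0[OF lin] by auto
    obtain B where B: "set bs \<subseteq> B" "B \<subseteq> ?K" "fspace.independent B" "?K \<subseteq> fspace.span B"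
      by (rule fspace.maximal_independent_subset_extend[OF sub bs(2)])
    have "finite B" by (rule independent_card_le(1)[OF finK B(2,3)])
    then obtain cs where cs: "set cs = B - set bs" "distinct cs"
      using finite_distinct_list[of "B - set bs"] by auto
    have set: "set (bs @ cs) = B" using cs B by auto
    have "fspace.span B = ?K" using B(4) fspace.span_minimal[OF B(2) subK] by auto
    moreover have "N ((bs @ cs) ! j) \<in> fspace.span (set (take j (bs @ cs)))" if j: "j < length (bs @ cs)" for j
    proof (cases "j < length bs")
      case True
      then show ?thesis using bs(4)[of j] by (simp add: nth_append)
    next
      case False
      have "(bs @ cs) ! j \<in> B" using set j nth_mem by blast
      then have "(bs @ cs) ! j \<in> ?K" using B(2) by blast
      then have "N ((bs @ cs) ! j) \<in> {x \<in> V. (N ^^ i) x = 0}" using closed by (simp add: funpow_swap1)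
      then have "N ((bs @ cs) ! j) \<in> fspace.span (set bs)" unfolding bs(3) .
      then show ?thesis using False fspace.span_mono[of "set bs" "set (take j (bs @ cs))"] by auto
    qed
    ultimately show ?case using set bs(1) cs B(3) by (intro exI[of _ "bs @ cs"]) auto
  qed
  from this[of p] show ?thesis using nil by simp
qed

definition matrix_of :: "('a \<Rightarrow>\<^sub>0 'k::field) list \<Rightarrow> (('a \<Rightarrow>\<^sub>0 'k) \<Rightarrow> ('a \<Rightarrow>\<^sub>0 'k)) \<Rightarrow> 'k mat" where
  "matrix_of bs f = mat (length bs) (length bs)
     (\<lambda>(i, j). fspace.representation (set bs) (f (bs ! j)) (bs ! i))"

lemma sum_list_nth: "distinct bs \<Longrightarrow> (\<Sum>x\<in>set bs. h x) = (\<Sum>i<length bs. h (bs ! i))"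
  using sum.reindex_bij_betw[of "(!) bs" "{..<length bs}" "set bs" h] bij_betw_nth[of bs "{..<length bs}" "set bs"]
  by simp

lemma (in nilpotent_on) upper_triangular_matrix:
  assumes "distinct bs" "fspace.independent (set bs)" "fspace.span (set bs) = V"
    "\<And>j. j<length bs \<Longrightarrow> N (bs ! j) \<in> fspace.span (set (take j bs))"
  shows "upper_triangular (matrix_of bs (\<lambda>x. x + N x))"
proof (rule upper_triangularI)
  fix i j assume ij: "j < i" "i < dim_row (matrix_of bs (\<lambda>x. x + N x))"
  then have l: "i < length bs" "j < length bs" by (auto simp: matrix_of_def)
  let ?S = "set (take (Suc j) bs)"
  have S: "?S \<subseteq> set bs" by (rule set_take_subset)
  have "N (bs ! j) \<in> fspace.span ?S"
    using assms(4)[OF l(2)] fspace.span_mono[of "set (take j bs)" ?S] by (auto simp: set_take_subset_set_take)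
  moreover have "bs ! j \<in> fspace.span ?S" by (rule fspace.span_base) (use l in \<open>auto simp: take_Suc_conv_app_nth\<close>)
  ultimately have x: "bs ! j + N (bs ! j) \<in> fspace.span ?S" by (rule fspace.span_add[rotated])
  have "fspace.representation (set bs) (bs ! j + N (bs ! j)) = fspace.representation ?S (bs ! j + N (bs ! j))"
    by (rule fspace.representation_extend[OF assms(2) x S])
  moreover have "bs ! i \<notin> ?S"
    using assms(1) ij l by (auto simp: in_set_conv_nth nth_eq_iff_index_eq)
  ultimately show "matrix_of bs (\<lambda>x. x + N x) $$ (i, j) = 0"
    using l fspace.representation_ne_zero by (fastforce simp: matrix_of_def)
qed

text \<open>The map \<open>T\<close> from coordinate vectors to \<open>V\<close> is bijective and
  intertwines \<open>C\<close> with \<open>N\<close>. A basis \<open>D\<close> of the kernel of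
  \<open>N^k\<close> is pulled back along \<open>T\<close>, which moves the dimension from
  \<open>fspace\<close> to the kernel locale for matrices.\<close>

lemma (in nilpotent_on) kernel_dim_matrix:
  fixes C :: "'k mat"
  assumes bs: "distinct bs" "fspace.independent (set bs)" "fspace.span (set bs) = V"
    and C: "C \<in> carrier_mat (length bs) (length bs)"
    and CN: "\<And>j. j<length bs \<Longrightarrow> N (bs ! j) = (\<Sum>i<length bs. fscale (C $$ (i, j)) (bs ! i))"
  shows "kernel_dim (C ^\<^sub>m k) = kdim N V k"
proof -
  define n where "n = length bs"
  define T where "T x = (\<Sum>i<n. fscale (x $ i) (bs ! i))" for x :: "'k vec"
  have Ck: "C ^\<^sub>m k \<in> carrier_mat n n" for k using C by (simp add: n_def)
  have TV: "T x \<in> V" for x unfolding T_def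
    by (intro fspace.subspace_sum[OF subV] fspace.subspace_scale[OF subV])
       (metis bs(3) fspace.span_base lessThan_iff n_def nth_mem)
  have T0: "x = 0\<^sub>v n" if "x \<in> carrier_vec n" "T x = 0" for x
  proof -
    define h where "h = the_inv_into {..<n} ((!) bs)"
    have h: "h (bs ! i) = i" if "i < n" for i
      unfolding h_def by (rule the_inv_into_f_f) (use bs(1) that n_def in \<open>auto intro: inj_on_nth\<close>)
    have "(\<Sum>b\<in>set bs. fscale (x $ h b) b) = 0"
      using that(2) h unfolding T_def by (simp add: sum_list_nth[OF bs(1)] n_def)
    then have "x $ h b = 0" if "b \<in> set bs" for b
      using fspace.independentD[OF bs(2) finite_set subset_refl, of "\<lambda>b. x $ h b"] that by blast
    then have "x $ i = 0" if "i < n" for i using h that unfolding n_def by (metis nth_mem)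
    then show ?thesis using that(1) by (intro eq_vecI) auto
  qed
  have Tsurj: "\<exists>x\<in>carrier_vec n. T x = v" if v: "v \<in> V" for v
  proof -
    have "v \<in> range (\<lambda>u. \<Sum>b\<in>set bs. fscale (u b) b)"
      using v bs(3) fspace.span_finite[of "set bs"] by auto
    then obtain u where u: "v = (\<Sum>b\<in>set bs. fscale (u b) b)" by blast
    show ?thesis by (rule bexI[of _ "vec n (\<lambda>i. u (bs ! i))"])
      (auto simp: T_def u sum_list_nth[OF bs(1)] n_def)
  qed
  have TC: "T (C *\<^sub>v x) = N (T x)" if x: "x \<in> carrier_vec n" for x
  proof -
    have "T (C *\<^sub>v x) = (\<Sum>i<n. fscale (\<Sum>j<n. C $$ (i, j) * x $ j) (bs ! i))"
      unfolding T_def using C x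
      by (intro sum.cong refl) (simp add: n_def scalar_prod_def atLeast0LessThan)
    also have "\<dots> = (\<Sum>i<n. \<Sum>j<n. fscale (x $ j) (fscale (C $$ (i, j)) (bs ! i)))"
      by (simp add: fspace.scale_sum_left mult.commute)
    also have "\<dots> = (\<Sum>j<n. fscale (x $ j) (\<Sum>i<n. fscale (C $$ (i, j)) (bs ! i)))"
      by (subst sum.swap) (simp add: fspace.scale_sum_right)
    also have "\<dots> = N (T x)"
      unfolding T_def by (simp add: flinear_simps[OF lin] CN n_def)
    finally show ?thesis .
  qed
  have TCk: "T (C ^\<^sub>m k *\<^sub>v x) = (N ^^ k) (T x)" if x: "x \<in> carrier_vec n" for x
    using x
  proof (induction k arbitrary: x)
    case 0
    then show ?case using C by (simp add: n_def)
  next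
    case (Suc k)
    have "C ^\<^sub>m Suc k *\<^sub>v x = C ^\<^sub>m k *\<^sub>v (C *\<^sub>v x)"
      using assoc_mult_mat_vec[OF Ck[of k], of C n x] C Suc.prems by (simp add: n_def)
    also have "T \<dots> = (N ^^ k) (N (T x))" using Suc C TC by (simp add: n_def)
    finally show ?case by (simp add: funpow_swap1)
  qed
  let ?A = "C ^\<^sub>m k"
  interpret K: kernel n n ?A by unfold_locales (rule Ck)
  let ?K = "{x \<in> V. (N ^^ k) x = 0}"
  obtain D where D: "finite D" "fspace.independent D" "?K = fspace.span D" "card D = fspace.dim ?K"
    by (rule fin_dim_basis[OF fin_dim_Collect[OF finV] subspace_ker[OF flinear_funpow[OF lin] subV]])
  have DK: "D \<subseteq> ?K" unfolding D(3) by (rule fspace.span_superset)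
  then have "\<forall>d\<in>D. \<exists>x\<in>carrier_vec n. T x = d" using Tsurj by blast
  then obtain g where g: "\<And>d. d \<in> D \<Longrightarrow> g d \<in> carrier_vec n" "\<And>d. d \<in> D \<Longrightarrow> T (g d) = d" by metis
  have g_inj: "inj_on g D" by (rule inj_on_inverseI[of _ T]) (rule g(2))
  let ?B = "g ` D"
  have ker: "x \<in> mat_kernel ?A \<longleftrightarrow> T x \<in> ?K" if "x \<in> carrier_vec n" for x
  proof -
    have "?A *\<^sub>v x \<in> carrier_vec n" using Ck[of k] that by simp
    then have "?A *\<^sub>v x = 0\<^sub>v n \<longleftrightarrow> T (?A *\<^sub>v x) = 0" using T0 by (auto simp: T_def)
    then show ?thesis using that TV TCk[OF that] mat_kernel[OF Ck[of k]] by auto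
  qed
  have BK: "?B \<subseteq> mat_kernel ?A"
  proof
    fix x assume "x \<in> ?B"
    then obtain d where d: "x = g d" "d \<in> D" by blast
    then have "T x \<in> ?K" using g(2)[of d] DK by auto
    then show "x \<in> mat_kernel ?A" using ker[of x] g(1) d by simp
  qed
  have lc: "T (K.lincomb a X) = (\<Sum>b\<in>X. fscale (a b) (T b))" if X: "X \<subseteq> ?B" for a X
  proof -
    have "T (K.lincomb a X) = (\<Sum>i<n. fscale (\<Sum>x\<in>X. a x * x $ i) (bs ! i))"
      unfolding T_def by (intro sum.cong refl) (simp add: K.lincomb_index[OF _ subset_trans[OF X BK]])
    also have "\<dots> = (\<Sum>x\<in>X. fscale (a x) (T x))"
      unfolding T_def by (simp add: fspace.scale_sum_left fspace.scale_sum_right) (rule sum.swap)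
    finally show ?thesis .
  qed
  have T_inj: "x = y" if xy: "x \<in> carrier_vec n" "y \<in> carrier_vec n" "T x = T y" for x y
  proof -
    have "T (x - y) = T x - T y" unfolding T_def using xy
      by (simp add: fspace.scale_left_diff_distrib sum_subtractf)
    then have "x - y = 0\<^sub>v n" using xy by (intro T0) auto
    then have "(x - y) $ i = 0" if "i < n" for i using that by simp
    then show "x = y" using xy(1,2) by (intro eq_vecI) auto
  qed
  have "K.lin_indpt ?B"
  proof
    assume "K.lin_dep ?B"
    then obtain X a v where X: "finite X" "X \<subseteq> ?B" "K.lincomb a X = 0\<^sub>v n" "v \<in> X" "a v \<noteq> 0"
      unfolding K.Ker.lin_dep_def by auto
    have TX: "inj_on T X" using X(2) g by (intro inj_on_inverseI[of _ g]) auto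
    have sub: "T ` X \<subseteq> D" using X(2) g by auto
    have "(\<Sum>y\<in>T ` X. fscale (a (g y)) y) = (\<Sum>b\<in>X. fscale (a b) (T b))"
      using X(2) g by (subst sum.reindex[OF TX]) (auto intro!: sum.cong)
    also have "\<dots> = 0" using lc[OF X(2), of a] X(3) by (simp add: T_def)
    finally have "a (g (T v)) = 0"
      using fspace.independentD[OF D(2) _ sub, of "\<lambda>y. a (g y)" "T v"] X(1,4) by auto
    then show False using X g by auto
  qed
  moreover have "K.span ?B = mat_kernel ?A"
  proof
    show "K.span ?B \<subseteq> mat_kernel ?A" using K.Ker.span_is_subset2[OF BK] by simp
    show "mat_kernel ?A \<subseteq> K.span ?B"
    proof
      fix x assume x: "x \<in> mat_kernel ?A"
      then have xc: "x \<in> carrier_vec n" using mat_kernel_carrier[OF Ck] by blast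
      then have "T x \<in> ?K" using x ker by blast
      then have "T x \<in> fspace.span D" unfolding D(3) .
      then obtain u where u: "T x = (\<Sum>d\<in>D. fscale (u d) d)" using fspace.span_finite[OF D(1)] by auto
      let ?y = "K.lincomb (\<lambda>b. u (T b)) ?B"
      have "T ?y = T x"
        unfolding lc[OF subset_refl] u using g by (subst sum.reindex[OF g_inj]) (auto intro!: sum.cong)
      moreover have "?y \<in> carrier_vec n"
        using K.Ker.lincomb_closed[OF BK, of "\<lambda>b. u (T b)"] mat_kernel_carrier[OF Ck] by auto
      ultimately have "x = ?y" using T_inj xc by metis
      then show "x \<in> K.span ?B" unfolding K.Ker.span_def using D(1) by blast
    qed
  qed
  ultimately have "K.basis ?B" unfolding K.Ker.basis_def using BK by simp
  then have "K.dim = card ?B" using D(1) by (intro K.Ker.dim_basis) auto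
  then show ?thesis using D(4) card_image[OF g_inj] unfolding kdim_def by simp
qed

lemma (in nilpotent_on) kernel_dim_unipotent:
  fixes A :: "'k mat"
  assumes bs: "distinct bs" "fspace.independent (set bs)" "fspace.span (set bs) = V"
    and A: "A \<in> carrier_mat (length bs) (length bs)"
    and AN: "\<And>j. j<length bs \<Longrightarrow> bs ! j + N (bs ! j) = (\<Sum>i<length bs. fscale (A $$ (i, j)) (bs ! i))"
  shows "dim_gen_eigenspace A 1 k = kdim N V k"
  unfolding dim_gen_eigenspace_def
proof (rule kernel_dim_matrix[OF bs])
  show "char_matrix A 1 \<in> carrier_mat (length bs) (length bs)" using A by simp
  fix j assume j: "j < length bs"
  have "(\<Sum>i<length bs. fscale (char_matrix A 1 $$ (i, j)) (bs ! i)) =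
    (\<Sum>i<length bs. fscale (A $$ (i, j)) (bs ! i)) + (\<Sum>i<length bs. fscale (if i = j then -1 else 0) (bs ! i))"
    unfolding sum.distrib[symmetric] fspace.scale_left_distrib[symmetric]
    using A j by (intro sum.cong refl) (auto simp: char_matrix_def)
  also have "(\<Sum>i<length bs. fscale (if i = j then -1 else 0) (bs ! i)) = - (bs ! j)"
    using j by (subst sum.remove[of _ j]) auto
  finally have "(\<Sum>i<length bs. fscale (char_matrix A 1 $$ (i, j)) (bs ! i)) =
    (\<Sum>i<length bs. fscale (A $$ (i, j)) (bs ! i)) + - (bs ! j)" .
  then show "N (bs ! j) = (\<Sum>i<length bs. fscale (char_matrix A 1 $$ (i, j)) (bs ! i))"
    by (simp only: AN[OF j, symmetric]) simp
qed

text \<open>Generalized eigenspaces count only the blocks with eigenvalue 1. That there are no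
  others follows from the value at \<open>p\<close>: the eigenvalue-1 blocks, even with sizes
  truncated at \<open>p\<close>, already add up to \<open>dim V\<close>, the total size of all
  blocks, and every block has positive size.\<close>

lemma (in nilpotent_on) jordan_nf_unipotent:
  fixes A :: "'k mat"
  assumes bs: "distinct bs" "fspace.independent (set bs)" "fspace.span (set bs) = V"
    and A: "A \<in> carrier_mat (length bs) (length bs)"
    and AN: "\<And>j. j<length bs \<Longrightarrow> bs ! j + N (bs ! j) = (\<Sum>i<length bs. fscale (A $$ (i, j)) (bs ! i))"
    and J: "jordan_nf A n_as"
  shows "(\<Sum>n\<leftarrow>map fst n_as. min k n) = kdim N V k"
proof -
  let ?f = "filter (\<lambda>(n, e). e = 1) n_as"
  have 1: "(\<Sum>n\<leftarrow>map fst ?f. min k n) = kdim N V k" for k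
    using dim_gen_eigenspace[OF J, of 1 k] kernel_dim_unipotent[OF bs A AN] by simp
  have "similar_mat A (jordan_matrix n_as)" using J by (simp add: jordan_nf_def)
  then have "sum_list (map fst n_as) = length bs"
    using A by (auto simp: similar_mat_def similar_mat_wit_def Let_def)
  also have "\<dots> = fspace.dim V"
    using bs fspace.dim_span_eq_card_independent[OF bs(2)] by (simp add: distinct_card)
  also have "\<dots> = (\<Sum>n\<leftarrow>map fst ?f. min p n)" using 1[of p] kdim_p by simp
  finally have s: "sum_list (map fst n_as) = (\<Sum>n\<leftarrow>map fst ?f. min p n)" .
  have pos: "0 \<notin> fst ` set n_as" using J by (simp add: jordan_nf_def)
  have le: "(\<Sum>n\<leftarrow>map fst (filter (\<lambda>(n, e). e = 1) xs). min p n) \<le> sum_list (map fst xs)" for xs :: "(nat \<times> 'k) list"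
    by (induction xs) auto
  have "(\<Sum>n\<leftarrow>map fst (filter (\<lambda>(n, e). e = 1) xs). min p n) < sum_list (map fst xs)"
    if "x \<in> set xs" "snd x \<noteq> 1" "0 \<notin> fst ` set xs" for xs :: "(nat \<times> 'k) list" and x
    using that
  proof (induction xs)
    case (Cons y ys)
    show ?case
    proof (cases "snd y = 1")
      case True
      then have "x \<in> set ys" using Cons.prems by auto
      then show ?thesis using Cons True by (cases y) auto
    next
      case False
      then show ?thesis using Cons.prems le[of ys] by (cases y) auto
    qed
  qed simp
  then have "snd x = 1" if "x \<in> set n_as" for x using s pos that by (metis less_irrefl)
  then have "?f = n_as" by (intro filter_True) auto
  then show ?thesis using 1 by simp
qed

lemma has_jordan_type_sum:
  assumes N: "nilpotent_on p N V" and M: "vecs M = V" "rscale M = fscale"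
    and u: "\<And>x. x \<in> V \<Longrightarrow> ga_act M u x = x + N x" and J: "has_jordan_type M u J"
  shows "(\<Sum>s\<in>#J. min k s) = kdim N V k" and "0 \<notin># J"
proof -
  obtain bs A n_as where *: "distinct bs" "fspace.independent (set bs)" "fspace.span (set bs) = V"
    "A \<in> carrier_mat (length bs) (length bs)"
    "\<And>j. j<length bs \<Longrightarrow> ga_act M u (bs ! j) = (\<Sum>i<length bs. fscale (A $$ (i, j)) (bs ! i))"
    "jordan_nf A n_as" "J = mset (map fst n_as)"
    using J unfolding has_jordan_type_def M by blast
  have "bs ! j \<in> V" if "j < length bs" for j using *(3) fspace.span_base nth_mem[OF that] by metis
  then have "(\<Sum>n\<leftarrow>map fst n_as. min k n) = kdim N V k"
    using nilpotent_on.jordan_nf_unipotent[OF N *(1-4) _ *(6)] *(5) u by metis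
  then show "(\<Sum>s\<in>#J. min k s) = kdim N V k" unfolding *(7) by (simp flip: sum_mset_sum_list add: image_mset.compositionality comp_def)
  show "0 \<notin># J" using *(6,7) by (auto simp: jordan_nf_def)
qed

text \<open>A nilpotent operator is triangularizable over every field, so the Jordan form is
  obtained from a triangular matrix without finding roots of a characteristic polynomial.\<close>

lemma has_jordan_type_ex:
  assumes N: "nilpotent_on p N V" and M: "vecs M = V" "rscale M = fscale"
    and u: "\<And>x. x \<in> V \<Longrightarrow> ga_act M u x = x + N x"
  shows "\<exists>J. has_jordan_type M u J"
proof -
  interpret nilpotent_on p N V by fact
  obtain bs where bs: "distinct bs" "fspace.independent (set bs)" "fspace.span (set bs) = V"
     "\<And>j. j<length bs \<Longrightarrow> N (bs ! j) \<in> fspace.span (set (take j bs))"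
    using triangular_basis by blast
  let ?A = "matrix_of bs (\<lambda>x. x + N x)"
  have A: "?A \<in> carrier_mat (length bs) (length bs)" by (simp add: matrix_of_def)
  have "jordan_nf ?A (triangular_to_jnf_vector ?A)"
    by (rule triangular_to_jnf_vector[OF A upper_triangular_matrix[OF bs]])
  moreover have "ga_act M u (bs ! j) = (\<Sum>i<length bs. fscale (?A $$ (i, j)) (bs ! i))" if j: "j < length bs" for j
  proof -
    have bV: "bs ! j \<in> V" using bs(3) fspace.span_base nth_mem[OF j] by metis
    then have "bs ! j + N (bs ! j) \<in> fspace.span (set bs)"
      using closed fspace.subspace_add[OF subV] bs(3) by blast
    then have "ga_act M u (bs ! j) =
        (\<Sum>b\<in>set bs. fscale (fspace.representation (set bs) (bs ! j + N (bs ! j)) b) b)"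
      unfolding u[OF bV] by (intro fspace.sum_representation_eq[symmetric] bs(2)) auto
    also have "\<dots> = (\<Sum>i<length bs. fscale (fspace.representation (set bs) (bs ! j + N (bs ! j)) (bs ! i)) (bs ! i))"
      by (rule sum_list_nth[OF bs(1)])
    finally show ?thesis using j by (simp add: matrix_of_def)
  qed
  ultimately show ?thesis unfolding has_jordan_type_def M using bs A by blast
qed

text \<open>The second difference of \<open>k \<mapsto> min k s\<close> is -1 at
  \<open>k = s\<close> and 0 at every other positive \<open>k\<close>.\<close>

lemma count_blocks:
  fixes J :: "nat multiset"
  assumes "1 \<le> k"
  shows "(\<Sum>s\<in>#J. min (k + 1) s) + (\<Sum>s\<in>#J. min (k - 1) s) + count J k = 2 * (\<Sum>s\<in>#J. min k s)"
  using assms by (induction J) (auto simp: min_def)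

lemma jordan_type_unique:
  fixes J J' :: "nat multiset"
  assumes "\<And>k. (\<Sum>s\<in>#J. min k s) = (\<Sum>s\<in>#J'. min k s)" "0 \<notin># J" "0 \<notin># J'"
  shows "J = J'"
proof (rule multiset_eqI)
  fix k show "count J k = count J' k"
  proof (cases "k = 0")
    case True then show ?thesis using assms(2,3) by (simp add: not_in_iff)
  next
    case False
    then show ?thesis using count_blocks[of k J] count_blocks[of k J'] assms(1) by simp
  qed
qed

section \<open>Polynomial functions and generic points\<close>

definition polyfun :: "nat \<Rightarrow> ((nat \<Rightarrow> 'k::field) \<Rightarrow> 'k) \<Rightarrow> bool" where
  "polyfun n g \<longleftrightarrow> (\<exists>f. (\<forall>m\<in>Poly_Mapping.keys f. Poly_Mapping.keys m \<subseteq> {1..n}) \<and> (\<forall>\<alpha>. poly_eval f \<alpha> = g \<alpha>))"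

definition monom_eval :: "(nat \<Rightarrow>\<^sub>0 nat) \<Rightarrow> (nat \<Rightarrow> 'k::field) \<Rightarrow> 'k" where
  "monom_eval m \<alpha> = (\<Prod>i\<in>Poly_Mapping.keys m. \<alpha> i ^ Poly_Mapping.lookup m i)"

lemma monom_eval_superset:
  "finite I \<Longrightarrow> Poly_Mapping.keys m \<subseteq> I \<Longrightarrow> monom_eval m \<alpha> = (\<Prod>i\<in>I. \<alpha> i ^ Poly_Mapping.lookup m i)"
  unfolding monom_eval_def by (intro prod.mono_neutral_left) (auto simp: in_keys_iff)

lemma monom_eval_add: "monom_eval (m + m') \<alpha> = monom_eval m \<alpha> * monom_eval m' \<alpha>"
proof -
  let ?I = "Poly_Mapping.keys m \<union> Poly_Mapping.keys m'"
  have "finite ?I" "Poly_Mapping.keys (m + m') \<subseteq> ?I" using keys_add[of m m'] by auto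
  then show ?thesis by (simp add: monom_eval_superset[of ?I] lookup_add power_add prod.distrib)
qed

lemma poly_eval_superset:
  "finite K \<Longrightarrow> Poly_Mapping.keys f \<subseteq> K \<Longrightarrow>
    poly_eval f \<alpha> = (\<Sum>m\<in>K. Poly_Mapping.lookup f m * monom_eval m \<alpha>)"
  unfolding poly_eval_def monom_eval_def[symmetric]
  by (intro sum.mono_neutral_left) (auto simp: in_keys_iff)

lemma poly_eval_add: "poly_eval (f + g) \<alpha> = poly_eval f \<alpha> + poly_eval g \<alpha>"
proof -
  let ?K = "Poly_Mapping.keys f \<union> Poly_Mapping.keys g"
  have "finite ?K" "Poly_Mapping.keys (f + g) \<subseteq> ?K" using keys_add[of f g] by auto
  then show ?thesis by (simp add: poly_eval_superset[of ?K] lookup_add algebra_simps sum.distrib)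
qed

lemma poly_eval_single: "poly_eval (Poly_Mapping.single m c) \<alpha> = c * monom_eval m \<alpha>"
  by (subst poly_eval_superset[of "{m}"]) auto

lemma polyfun_add: "polyfun n g \<Longrightarrow> polyfun n h \<Longrightarrow> polyfun n (\<lambda>\<alpha>. g \<alpha> + h \<alpha>)"
proof -
  assume "polyfun n g" "polyfun n h"
  then obtain f f' where f: "\<forall>m\<in>Poly_Mapping.keys f. Poly_Mapping.keys m \<subseteq> {1..n}" "\<forall>\<alpha>. poly_eval f \<alpha> = g \<alpha>"
    "\<forall>m\<in>Poly_Mapping.keys f'. Poly_Mapping.keys m \<subseteq> {1..n}" "\<forall>\<alpha>. poly_eval f' \<alpha> = h \<alpha>"
    unfolding polyfun_def by blast
  moreover have "Poly_Mapping.keys m \<subseteq> {1..n}" if "m \<in> Poly_Mapping.keys (f + f')" for m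
    using f(1,3) that keys_add[of f f'] by blast
  ultimately show ?thesis unfolding polyfun_def using poly_eval_add[of f f']
    by (intro exI[of _ "f + f'"]) simp
qed

lemma polyfun_single: "Poly_Mapping.keys m \<subseteq> {1..n} \<Longrightarrow> polyfun n (\<lambda>\<alpha>. c * monom_eval m \<alpha>)"
  unfolding polyfun_def by (intro exI[of _ "Poly_Mapping.single m c"]) (auto simp: poly_eval_single)

lemma polyfun_const: "polyfun n (\<lambda>\<alpha>. c)"
  using polyfun_single[of 0 n c] by (simp add: monom_eval_def)

lemma polyfun_var: "i \<in> {1..n} \<Longrightarrow> polyfun n (\<lambda>\<alpha>. \<alpha> i)"
  using polyfun_single[of "Poly_Mapping.single i 1" n 1] by (simp add: monom_eval_def)

lemma polyfun_sum: "(\<And>i. i \<in> I \<Longrightarrow> polyfun n (g i)) \<Longrightarrow> polyfun n (\<lambda>\<alpha>. \<Sum>i\<in>I. g i \<alpha>)"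
  by (induction I rule: infinite_finite_induct) (auto intro: polyfun_add polyfun_const)

lemma polyfun_mult: "polyfun n g \<Longrightarrow> polyfun n h \<Longrightarrow> polyfun n (\<lambda>\<alpha>. g \<alpha> * h \<alpha>)"
proof -
  assume "polyfun n g" "polyfun n h"
  then obtain f f' where f: "\<forall>m\<in>Poly_Mapping.keys f. Poly_Mapping.keys m \<subseteq> {1..n}" "\<forall>\<alpha>. poly_eval f \<alpha> = g \<alpha>"
    "\<forall>m\<in>Poly_Mapping.keys f'. Poly_Mapping.keys m \<subseteq> {1..n}" "\<forall>\<alpha>. poly_eval f' \<alpha> = h \<alpha>"
    unfolding polyfun_def by blast
  have eq: "g \<alpha> * h \<alpha> = (\<Sum>m\<in>Poly_Mapping.keys f. \<Sum>m'\<in>Poly_Mapping.keys f'.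
      (Poly_Mapping.lookup f m * Poly_Mapping.lookup f' m') * monom_eval (m + m') \<alpha>)" for \<alpha>
    unfolding f(2)[rule_format, symmetric] f(4)[rule_format, symmetric]
    by (simp add: poly_eval_superset[OF finite_keys subset_refl] sum_product monom_eval_add)
      (intro sum.cong refl, simp add: mult_ac)
  show ?thesis unfolding eq
  proof (intro polyfun_sum polyfun_single)
    fix m m' assume "m \<in> Poly_Mapping.keys f" "m' \<in> Poly_Mapping.keys f'"
    then show "Poly_Mapping.keys (m + m') \<subseteq> {1..n}" using f(1,3) keys_add[of m m'] by blast
  qed
qed

lemma polyfun_prod: "(\<And>i. i \<in> I \<Longrightarrow> polyfun n (g i)) \<Longrightarrow> polyfun n (\<lambda>\<alpha>. \<Prod>i\<in>I. g i \<alpha>)"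
  by (induction I rule: infinite_finite_induct) (auto intro: polyfun_mult polyfun_const)

lemma polyfun_line:
  assumes "polyfun n g"
  shows "\<exists>q. \<forall>t. poly q t = g (\<lambda>i. \<alpha> i + t * \<delta> i)"
proof -
  obtain f where f: "\<forall>\<alpha>. poly_eval f \<alpha> = g \<alpha>" using assms unfolding polyfun_def by blast
  show ?thesis
    by (rule exI[of _ "\<Sum>m\<in>Poly_Mapping.keys f. Polynomial.smult (Poly_Mapping.lookup f m)
        (\<Prod>i\<in>Poly_Mapping.keys m. [:\<alpha> i, \<delta> i:] ^ Poly_Mapping.lookup m i)"])
      (simp add: f[rule_format, symmetric] poly_eval_def poly_sum poly_prod)
qed

text \<open>Irreducibility of affine space: restrict both polynomials to the line through the two points.\<close>

lemma polyfun_nonzero_common: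
  fixes g h :: "(nat \<Rightarrow> 'k::field) \<Rightarrow> 'k"
  assumes inf: "infinite (UNIV :: 'k set)" and g: "polyfun n g" and h: "polyfun n h"
    and a: "\<alpha> \<in> affine_space n" "g \<alpha> \<noteq> 0" and b: "\<beta> \<in> affine_space n" "h \<beta> \<noteq> 0"
  shows "\<exists>\<gamma>\<in>affine_space n. g \<gamma> \<noteq> 0 \<and> h \<gamma> \<noteq> 0"
proof -
  let ?l = "\<lambda>t i. \<alpha> i + t * (\<beta> i - \<alpha> i)"
  obtain q where q: "\<And>t. poly q t = g (?l t)" using polyfun_line[OF g] by metis
  obtain r where r: "\<And>t. poly r t = h (?l t)" using polyfun_line[OF h] by metis
  have "poly q 0 \<noteq> 0" "poly r 1 \<noteq> 0" using q[of 0] r[of 1] a b by simp_all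
  then have "q \<noteq> 0" "r \<noteq> 0" by auto
  then have "finite {t. poly (q * r) t = 0}" by (intro poly_roots_finite) simp
  then obtain t where "poly (q * r) t \<noteq> 0"
    using inf by (metis (mono_tags, lifting) Collect_cong UNIV_I finite_subset mem_Collect_eq subsetI)
  then show ?thesis using q r a b by (intro bexI[of _ "?l t"]) (auto simp: affine_space_def)
qed

lemma polyfun_nonzero_common_finite:
  fixes g :: "'i \<Rightarrow> (nat \<Rightarrow> 'k::field) \<Rightarrow> 'k"
  assumes inf: "infinite (UNIV :: 'k set)" and I: "finite I" and g: "\<And>i. i \<in> I \<Longrightarrow> polyfun n (g i)"
    and a: "\<And>i. i \<in> I \<Longrightarrow> \<exists>\<alpha>\<in>affine_space n. g i \<alpha> \<noteq> 0"
  shows "\<exists>\<alpha>\<in>affine_space n. (\<Prod>i\<in>I. g i \<alpha>) \<noteq> 0"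
  using I g a
proof (induction I rule: finite_induct)
  case empty
  then show ?case by (auto simp: affine_space_def)
next
  case (insert i I)
  then obtain \<alpha> \<beta> where ab: "\<alpha> \<in> affine_space n" "(\<Prod>i\<in>I. g i \<alpha>) \<noteq> 0" "\<beta> \<in> affine_space n" "g i \<beta> \<noteq> 0"
    by (metis insertCI)
  have "polyfun n (\<lambda>\<alpha>. \<Prod>i\<in>I. g i \<alpha>)" by (intro polyfun_prod insert.prems) simp
  from polyfun_nonzero_common[OF inf this insert.prems(1)[of i] ab] show ?case using insert.hyps by auto
qed

lemma zariski_open_polyfun:
  assumes "polyfun n g"
  shows "zariski_open n {\<alpha> \<in> affine_space n. g \<alpha> \<noteq> 0}"
proof -
  obtain f where f: "\<forall>m\<in>Poly_Mapping.keys f. Poly_Mapping.keys m \<subseteq> {1..n}" "\<forall>\<alpha>. poly_eval f \<alpha> = g \<alpha>"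
    using assms unfolding polyfun_def by blast
  then show ?thesis unfolding zariski_open_def by (intro exI[of _ "{f}"]) auto
qed

lemma zariski_open_contains_polyfun:
  assumes "zariski_open n U" "U \<noteq> {}"
  obtains g where "polyfun n g" "\<exists>\<alpha>\<in>affine_space n. g \<alpha> \<noteq> 0" "{\<alpha> \<in> affine_space n. g \<alpha> \<noteq> 0} \<subseteq> U"
proof -
  obtain F where F: "\<forall>f\<in>F. \<forall>m\<in>Poly_Mapping.keys f. Poly_Mapping.keys m \<subseteq> {1..n}"
    "U = affine_space n - {\<alpha>. \<forall>f\<in>F. poly_eval f \<alpha> = 0}"
    using assms(1) unfolding zariski_open_def by blast
  then obtain \<alpha> f where "\<alpha> \<in> affine_space n" "f \<in> F" "poly_eval f \<alpha> \<noteq> 0" using assms(2) by auto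
  then show thesis using F by (intro that[of "poly_eval f"]) (auto simp: polyfun_def)
qed

lemma polyfun_det:
  assumes "\<And>i j. i < r \<Longrightarrow> j < r \<Longrightarrow> polyfun n (\<lambda>\<alpha>. f \<alpha> i j)"
  shows "polyfun n (\<lambda>\<alpha>. det (mat r r (\<lambda>(i, j). f \<alpha> i j)))"
proof -
  have eq: "det (mat r r (\<lambda>(i, j). f \<alpha> i j)) = (\<Sum>\<pi> | \<pi> permutes {0..<r}. signof \<pi> * (\<Prod>i = 0..<r. f \<alpha> i (\<pi> i)))" for \<alpha>
    by (subst det_def'[of _ r]) (auto intro!: sum.cong prod.cong simp: permutes_in_image)
  show ?thesis unfolding eq
  proof (intro polyfun_sum polyfun_mult polyfun_const polyfun_prod)
    fix \<pi> i assume "\<pi> \<in> {\<pi>. \<pi> permutes {0..<r}}" "i \<in> {0..<r}"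
    then show "polyfun n (\<lambda>\<alpha>. f \<alpha> i (\<pi> i))" using permutes_in_image[of \<pi> "{0..<r}" i] by (intro assms) auto
  qed
qed

text \<open>Stated for families: the condition on coefficients excludes repetitions as well, which
  is what the bounds by \<open>card I\<close> need.\<close>

lemma independent_family:
  fixes w :: "'i \<Rightarrow> ('a \<Rightarrow>\<^sub>0 'k::field)"
  assumes I: "finite I" and c: "\<And>c. (\<Sum>i\<in>I. fscale (c i) (w i)) = 0 \<Longrightarrow> \<forall>i\<in>I. c i = 0"
  shows "inj_on w I" "fspace.independent (w ` I)"
proof -
  show inj: "inj_on w I"
  proof (rule inj_onI, rule ccontr)
    fix i j assume ij: "i \<in> I" "j \<in> I" "w i = w j" "i \<noteq> j"
    let ?c = "\<lambda>k. if k = i then 1 else if k = j then - 1 else (0 :: 'k)"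
    have "(\<Sum>k\<in>I. fscale (?c k) (w k)) = fscale (?c i) (w i) + (fscale (?c j) (w j) + (\<Sum>k\<in>I - {i} - {j}. fscale (?c k) (w k)))"
      using ij I by (subst sum.remove[of _ i], simp, simp, subst sum.remove[of _ j]) auto
    also have "\<dots> = 0" using ij by (auto intro!: sum.neutral)
    finally have "?c i = 0" using c[of ?c] ij(1) by blast
    then show False by simp
  qed
  show "fspace.independent (w ` I)"
  proof (rule fspace.independent_if_scalars_zero)
    fix u x assume u: "(\<Sum>x\<in>w ` I. fscale (u x) x) = 0" and x: "x \<in> w ` I"
    have "(\<Sum>i\<in>I. fscale (u (w i)) (w i)) = 0" using u by (simp add: sum.reindex[OF inj])
    then show "u x = 0" using c[of "\<lambda>i. u (w i)"] x by auto
  qed (use I in simp)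
qed

lemma independent_family_card_le:
  fixes w :: "'i \<Rightarrow> ('a \<Rightarrow>\<^sub>0 'k::field)"
  assumes "finite I" "\<And>c. (\<Sum>i\<in>I. fscale (c i) (w i)) = 0 \<Longrightarrow> \<forall>i\<in>I. c i = 0"
    and W: "fin_dim W" "\<And>i. i \<in> I \<Longrightarrow> w i \<in> W"
  shows "card I \<le> fspace.dim W"
proof -
  have "card (w ` I) \<le> fspace.dim W"
    by (rule independent_card_le(2)[OF W(1) _ independent_family(2)[OF assms(1,2)]]) (use W(2) in auto)
  moreover have "inj_on w I" by (rule independent_family(1)[OF assms(1,2)])
  ultimately show ?thesis by (simp add: card_image)
qed

section \<open>Semicontinuity of the rank of the powers of a pencil\<close>

abbreviation flinear_form :: "(('a \<Rightarrow>\<^sub>0 'k::field) \<Rightarrow> 'k) \<Rightarrow> bool" where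
  "flinear_form \<equiv> Vector_Spaces.linear fscale (*)"

lemma flinear_form_simps:
  assumes "flinear_form \<xi>"
  shows "\<xi> (x + y) = \<xi> x + \<xi> y" "\<xi> (fscale c x) = c * \<xi> x" "\<xi> 0 = 0" "\<xi> (sum f A) = (\<Sum>a\<in>A. \<xi> (f a))"
proof -
  interpret Vector_Spaces.linear fscale "(*)" \<xi> by fact
  show "\<xi> (x + y) = \<xi> x + \<xi> y" "\<xi> (fscale c x) = c * \<xi> x" "\<xi> 0 = 0" "\<xi> (sum f A) = (\<Sum>a\<in>A. \<xi> (f a))"
    by (simp_all add: add scale zero sum)
qed

lemma dual_form:
  fixes D :: "('a \<Rightarrow>\<^sub>0 'k::field) set"
  assumes "fspace.independent D"
  shows "\<exists>\<xi>. flinear_form \<xi> \<and> (\<forall>x\<in>D. \<xi> x = h x)"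
proof -
  interpret k: vector_space "(*) :: 'k \<Rightarrow> 'k \<Rightarrow> 'k" by unfold_locales (auto simp: algebra_simps)
  interpret pair: vector_space_pair "fscale :: 'k \<Rightarrow> ('a \<Rightarrow>\<^sub>0 'k) \<Rightarrow> _" "(*) :: 'k \<Rightarrow> 'k \<Rightarrow> 'k" by unfold_locales
  show ?thesis by (rule pair.linear_independent_extend[OF assms])
qed

text \<open>With \<open>X i\<close> the action of \<open>g\<^sub>i - 1\<close> this is the action of
  \<open>u\<^sub>\<alpha> - 1\<close>, linear in the point \<alpha>.\<close>

definition pencil :: "nat \<Rightarrow> (nat \<Rightarrow> ('a \<Rightarrow>\<^sub>0 'k::field) \<Rightarrow> ('a \<Rightarrow>\<^sub>0 'k)) \<Rightarrow> (nat \<Rightarrow> 'k) \<Rightarrow> ('a \<Rightarrow>\<^sub>0 'k) \<Rightarrow> ('a \<Rightarrow>\<^sub>0 'k)" where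
  "pencil n X \<alpha> v = (\<Sum>i = 1..n. fscale (\<alpha> i) (X i v))"

lemma flinear_pencil: "(\<And>i. flinear (X i)) \<Longrightarrow> flinear (pencil n X \<alpha>)"
  unfolding pencil_def[abs_def] by (intro flinear_sum flinear_scale)

text \<open>The innermost factor is peeled off, so that the form stays fixed while the vector varies
  in the induction.\<close>

lemma polyfun_pencil_power:
  assumes X: "\<And>i. flinear (X i)" and \<xi>: "flinear_form \<xi>"
  shows "polyfun n (\<lambda>\<alpha>. \<xi> ((pencil n X \<alpha> ^^ j) v))"
proof (induction j arbitrary: v)
  case 0 show ?case by (simp add: polyfun_const)
next
  case (Suc j)
  have "\<xi> ((pencil n X \<alpha> ^^ Suc j) v) = (\<Sum>i = 1..n. \<alpha> i * \<xi> ((pencil n X \<alpha> ^^ j) (X i v)))" for \<alpha>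
  proof -
    have "flinear (pencil n X \<alpha> ^^ j)" by (intro flinear_funpow flinear_pencil X)
    then have "(pencil n X \<alpha> ^^ Suc j) v = (\<Sum>i = 1..n. fscale (\<alpha> i) ((pencil n X \<alpha> ^^ j) (X i v)))"
      by (simp only: funpow_Suc_right comp_def pencil_def[of n X \<alpha> v] flinear_simps)
    then show ?thesis by (simp only: flinear_form_simps[OF \<xi>])
  qed
  then show ?case by (simp only:) (intro polyfun_sum polyfun_mult polyfun_var Suc.IH)
qed

text \<open>The polynomial is a minor of size equal to the rank at \<alpha>: where it does not
  vanish, the same chosen vectors still have independent images.\<close>

lemma rank_semicontinuous:
  fixes X :: "nat \<Rightarrow> ('a \<Rightarrow>\<^sub>0 'k::field) \<Rightarrow> ('a \<Rightarrow>\<^sub>0 'k)"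
  assumes X: "\<And>i. flinear (X i)" and V: "fspace.subspace V" "fin_dim V"
  shows "\<exists>g. polyfun n g \<and> g \<alpha> \<noteq> 0 \<and> (\<forall>\<beta>. g \<beta> \<noteq> 0 \<longrightarrow>
    fspace.dim ((pencil n X \<alpha> ^^ j) ` V) \<le> fspace.dim ((pencil n X \<beta> ^^ j) ` V))"
proof -
  let ?N = "\<lambda>\<alpha>. pencil n X \<alpha> ^^ j"
  have lin: "flinear (?N \<alpha>)" for \<alpha> by (intro flinear_funpow flinear_pencil X)
  obtain D where D: "finite D" "fspace.independent D" "?N \<alpha> ` V = fspace.span D" "card D = fspace.dim (?N \<alpha> ` V)"
    by (rule fin_dim_basis[OF fin_dim_image[OF V(2) lin] subspace_image[OF lin V(1)]])
  obtain ds where ds: "distinct ds" "set ds = D" using finite_distinct_list[OF D(1)] by blast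
  define r where "r = length ds"
  have r: "r = card D" using ds by (simp add: r_def distinct_card[symmetric])
  have dD: "ds ! b \<in> D" if "b < r" for b using that ds r_def nth_mem by blast
  have "D \<subseteq> ?N \<alpha> ` V" unfolding D(3) by (rule fspace.span_superset)
  then have "\<forall>b<r. \<exists>x\<in>V. ?N \<alpha> x = ds ! b" using dD by (metis imageE subsetD)
  then obtain v where v: "\<And>b. b < r \<Longrightarrow> v b \<in> V" "\<And>b. b < r \<Longrightarrow> ?N \<alpha> (v b) = ds ! b" by metis
  have "\<forall>a. \<exists>\<xi>. flinear_form \<xi> \<and> (\<forall>x\<in>D. \<xi> x = (if x = ds ! a then 1 else 0))"
    by (intro allI dual_form[OF D(2)])
  then obtain \<xi> where \<xi>: "\<And>a. flinear_form (\<xi> a)" "\<And>a x. x \<in> D \<Longrightarrow> \<xi> a x = (if x = ds ! a then 1 else 0)" by metis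
  \<comment> \<open>The \<open>v b\<close> are preimages at \<alpha> of a basis of the image, and
    the forms are dual to that basis; at \<alpha> the matrix is therefore the identity.\<close>
  let ?A = "\<lambda>\<beta>. mat r r (\<lambda>(a, b). \<xi> a (?N \<beta> (v b)))"
  have "?A \<alpha> = 1\<^sub>m r"
    using \<xi>(2)[OF dD] v(2) ds(1) by (intro eq_matI) (auto simp: r_def nth_eq_iff_index_eq)
  then have "det (?A \<alpha>) \<noteq> 0" by simp
  moreover have "polyfun n (\<lambda>\<beta>. det (?A \<beta>))"
    by (intro polyfun_det polyfun_pencil_power X \<xi>(1))
  moreover have "card D \<le> fspace.dim (?N \<beta> ` V)" if "det (?A \<beta>) \<noteq> 0" for \<beta>
  proof -
    have "card {..<r} \<le> fspace.dim (?N \<beta> ` V)"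
    proof (rule independent_family_card_le[where w = "\<lambda>b. ?N \<beta> (v b)"])
      fix c assume c: "(\<Sum>b<r. fscale (c b) (?N \<beta> (v b))) = 0"
      have "?A \<beta> *\<^sub>v vec r c = 0\<^sub>v r"
      proof (rule eq_vecI)
        fix a assume a: "a < dim_vec (0\<^sub>v r :: 'k vec)"
        have "(?A \<beta> *\<^sub>v vec r c) $ a = \<xi> a (\<Sum>b<r. fscale (c b) (?N \<beta> (v b)))"
          using a by (simp add: flinear_form_simps[OF \<xi>(1)] scalar_prod_def atLeast0LessThan mult.commute)
        then show "(?A \<beta> *\<^sub>v vec r c) $ a = 0\<^sub>v r $ a" using c a by (simp add: flinear_form_simps[OF \<xi>(1)])
      qed simp
      moreover have "\<not> (\<exists>w. w \<in> carrier_vec r \<and> w \<noteq> 0\<^sub>v r \<and> ?A \<beta> *\<^sub>v w = 0\<^sub>v r)"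
        using that det_0_iff_vec_prod_zero[of "?A \<beta>" r] by simp
      ultimately have "vec r c = 0\<^sub>v r" using vec_carrier[of r c] by blast
      then show "\<forall>b\<in>{..<r}. c b = 0" by (metis index_vec index_zero_vec(1) lessThan_iff)
    qed (use v fin_dim_image[OF V(2) lin] in auto)
    then show ?thesis using r by simp
  qed
  ultimately show ?thesis using D(4) by auto
qed

definition generic_points :: "nat \<Rightarrow> ((nat \<Rightarrow> 'k::field) \<Rightarrow> 'k) \<Rightarrow> (nat \<Rightarrow> 'k) set" where
  "generic_points n g = {\<alpha> \<in> affine_space n. g \<alpha> \<noteq> 0}"

text \<open>For each \<open>j\<close> the rank is bounded and so attains its maximum at some point
  \<open>A j\<close>. The product over \<open>j \<le> p\<close> of the minors found at these points
  is a nonzero polynomial function, and off its zeros all ranks are maximal at once.\<close>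

lemma generic_rank:
  fixes X :: "nat \<Rightarrow> ('a \<Rightarrow>\<^sub>0 'k::field) \<Rightarrow> ('a \<Rightarrow>\<^sub>0 'k)"
  assumes inf: "infinite (UNIV :: 'k set)" and X: "\<And>i. flinear (X i)" and V: "fspace.subspace V" "fin_dim V"
  shows "\<exists>g r. polyfun n g \<and> generic_points n g \<noteq> {} \<and>
     (\<forall>\<alpha>\<in>generic_points n g. \<forall>j\<le>p. fspace.dim ((pencil n X \<alpha> ^^ j) ` V) = r j) \<and>
     (\<forall>\<alpha>\<in>affine_space n. \<forall>j\<le>p. fspace.dim ((pencil n X \<alpha> ^^ j) ` V) \<le> r j)"
proof -
  let ?r = "\<lambda>\<alpha> j. fspace.dim ((pencil n X \<alpha> ^^ j) ` V)"
  have lin: "flinear (pencil n X \<alpha> ^^ j)" for \<alpha> j by (intro flinear_funpow flinear_pencil X)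
  have bound: "?r \<alpha> j \<le> fspace.dim V" for \<alpha> j using dim_image_le[OF lin V] .
  have "\<exists>\<alpha>. \<alpha> \<in> affine_space n \<and> (\<forall>\<beta>. \<beta> \<in> affine_space n \<longrightarrow> ?r \<beta> j \<le> ?r \<alpha> j)" for j
    by (rule ex_has_greatest_nat[of _ "\<lambda>_. 0" _ "Suc (fspace.dim V)"])
       (use bound in \<open>auto simp: affine_space_def less_Suc_eq_le\<close>)
  then obtain A where A: "\<And>j. A j \<in> affine_space n" "\<And>j \<beta>. \<beta> \<in> affine_space n \<Longrightarrow> ?r \<beta> j \<le> ?r (A j) j" by metis
  have "\<forall>j. \<exists>g. polyfun n g \<and> g (A j) \<noteq> 0 \<and> (\<forall>\<beta>. g \<beta> \<noteq> 0 \<longrightarrow> ?r (A j) j \<le> ?r \<beta> j)"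
    by (intro allI rank_semicontinuous X V)
  then obtain g where g: "\<And>j. polyfun n (g j)" "\<And>j. g j (A j) \<noteq> 0"
    "\<And>j \<beta>. g j \<beta> \<noteq> 0 \<Longrightarrow> ?r (A j) j \<le> ?r \<beta> j" by metis
  let ?g = "\<lambda>\<alpha>. \<Prod>j\<in>{..p}. g j \<alpha>"
  have "polyfun n ?g" by (intro polyfun_prod g(1))
  moreover have "generic_points n ?g \<noteq> {}"
    using polyfun_nonzero_common_finite[OF inf, of "{..p}" n g] g(1,2) A(1) unfolding generic_points_def by blast
  moreover have "\<forall>\<alpha>\<in>generic_points n ?g. \<forall>j\<le>p. ?r \<alpha> j = ?r (A j) j"
    using A(2) g(3) by (auto simp: generic_points_def intro!: antisym)
  ultimately show ?thesis using A(2)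
    by (intro exI[of _ ?g] exI[of _ "\<lambda>j. ?r (A j) j"]) auto
qed

section \<open>Linear extension, the Frobenius identity and the operators of a pencil\<close>

definition flift :: "('a \<Rightarrow> ('b \<Rightarrow>\<^sub>0 'k::field)) \<Rightarrow> ('a \<Rightarrow>\<^sub>0 'k) \<Rightarrow> ('b \<Rightarrow>\<^sub>0 'k)" where
  "flift F v = (\<Sum>w\<in>Poly_Mapping.keys v. fscale (Poly_Mapping.lookup v w) (F w))"

abbreviation sing :: "'a \<Rightarrow> ('a \<Rightarrow>\<^sub>0 'k::field)" where "sing w \<equiv> Poly_Mapping.single w 1"

lemma flift_superset:
  "finite K \<Longrightarrow> Poly_Mapping.keys v \<subseteq> K \<Longrightarrow> flift F v = (\<Sum>w\<in>K. fscale (Poly_Mapping.lookup v w) (F w))"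
  unfolding flift_def by (intro sum.mono_neutral_left) (auto simp: in_keys_iff)

lemma flinear_flift: "flinear (flift (F :: 'a \<Rightarrow> ('b \<Rightarrow>\<^sub>0 'k::field)))"
proof (rule flinearI)
  fix x y :: "'a \<Rightarrow>\<^sub>0 'k"
  let ?K = "Poly_Mapping.keys x \<union> Poly_Mapping.keys y"
  have "finite ?K" "Poly_Mapping.keys (x + y) \<subseteq> ?K" using keys_add[of x y] by auto
  then show "flift F (x + y) = flift F x + flift F y"
    by (simp add: flift_superset[of ?K] lookup_add fspace.scale_left_distrib sum.distrib)
next
  fix c and x :: "'a \<Rightarrow>\<^sub>0 'k"
  have "Poly_Mapping.keys (fscale c x) \<subseteq> Poly_Mapping.keys x" by (auto simp: in_keys_iff)
  then show "flift F (fscale c x) = fscale c (flift F x)"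
    by (simp add: flift_superset[of "Poly_Mapping.keys x"] fspace.scale_sum_right)
qed

lemmas flift_simps = flinear_simps[OF flinear_flift]

lemma flift_single [simp]: "flift F (Poly_Mapping.single w c) = fscale c (F w)"
  by (subst flift_superset[of "{w}"]) auto

lemma fscale_single [simp]: "fscale c (Poly_Mapping.single x y) = Poly_Mapping.single x (c * y)"
  by (intro poly_mapping_eqI) (auto simp: lookup_single when_def)

lemma flift_sing_id [simp]: "flift sing v = v"
  by (intro poly_mapping_eqI) (simp add: flift_def lookup_sum lookup_single when_def in_keys_iff)

lemma flift_unique: "flinear f \<Longrightarrow> f v = flift (\<lambda>w. f (sing w)) v"
proof -
  assume f: "flinear f"
  have "f v = f (flift sing v)" by simp
  also have "\<dots> = flift (\<lambda>w. f (sing w)) v" unfolding flift_def by (simp only: flinear_simps[OF f])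
  finally show ?thesis .
qed

lemma flinear_eqI: "flinear f \<Longrightarrow> flinear g \<Longrightarrow> (\<And>w. f (sing w) = g (sing w)) \<Longrightarrow> f v = g v"
  using flift_unique[of f v] flift_unique[of g v] by simp

lemma flift_flift: "flift F (flift G v) = flift (\<lambda>w. flift F (G w)) v"
  unfolding flift_def[of G] flift_def[of "\<lambda>w. flift F (G w)"] by (simp only: flift_simps)

lemma lookup_flift_inj:
  assumes "inj_on f S" "Poly_Mapping.keys v \<subseteq> S" "w \<in> S"
  shows "Poly_Mapping.lookup (flift (\<lambda>w. sing (f w)) v) (f w) = Poly_Mapping.lookup v w"
proof -
  have "Poly_Mapping.lookup (flift (\<lambda>w. sing (f w)) v) (f w) =
      (\<Sum>u\<in>Poly_Mapping.keys v. if f u = f w then Poly_Mapping.lookup v u else 0)"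
    unfolding flift_def by (simp add: lookup_sum lookup_single when_def)
  also have "\<dots> = (\<Sum>u\<in>Poly_Mapping.keys v. if u = w then Poly_Mapping.lookup v u else 0)"
    using assms by (intro sum.cong refl) (auto dest: inj_onD)
  finally show ?thesis by (simp add: in_keys_iff)
qed

lemma flift_inj:
  assumes "inj_on f S" "Poly_Mapping.keys v \<subseteq> S" "flift (\<lambda>w. sing (f w)) v = 0"
  shows "v = 0"
proof (rule poly_mapping_eqI)
  fix w show "Poly_Mapping.lookup v w = Poly_Mapping.lookup 0 w"
    using lookup_flift_inj[OF assms(1,2), of w] assms(2,3) by (cases "w \<in> S") (auto simp: in_keys_iff)
qed

lemma keys_span: "x \<in> fspace.span B \<Longrightarrow> (\<And>b. b \<in> B \<Longrightarrow> Poly_Mapping.keys b \<subseteq> S) \<Longrightarrow> Poly_Mapping.keys x \<subseteq> S"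
proof (induction rule: fspace.span_induct_alt)
  case (step c y z)
  have "Poly_Mapping.keys (fscale c y + z) \<subseteq> Poly_Mapping.keys y \<union> Poly_Mapping.keys z"
    by (auto simp: in_keys_iff lookup_add)
  then show ?case using step by blast
qed simp

section \<open>Commuting operators in characteristic p\<close>

lemma commuting_funpow:
  assumes "\<And>x. f (g x) = g (f x)" shows "f ((g ^^ k) x) = (g ^^ k) (f x)"
  by (induction k) (simp_all add: assms)

lemma binomial_commuting:
  assumes X: "flinear X" and Y: "flinear Y" and XY: "\<And>x. X (Y x) = Y (X x)"
  shows "((\<lambda>x. X x + Y x) ^^ m) v = (\<Sum>k\<le>m. fscale (of_nat (m choose k)) ((X ^^ k) ((Y ^^ (m - k)) v)))"
proof (induction m)
  case 0 show ?case by simp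
next
  case (Suc m)
  let ?a = "\<lambda>i j. (X ^^ i) ((Y ^^ j) v)"
  let ?c = "\<lambda>n k x. fscale (of_nat (n choose k)) x"
  have Ya: "Y (?a i j) = ?a i (Suc j)" for i j using commuting_funpow[of Y X] XY by simp
  have "((\<lambda>x. X x + Y x) ^^ Suc m) v =
      X (\<Sum>k\<le>m. ?c m k (?a k (m - k))) + Y (\<Sum>k\<le>m. ?c m k (?a k (m - k)))"
    by (simp add: Suc)
  also have "\<dots> = (\<Sum>k\<le>m. ?c m k (?a (Suc k) (m - k))) + (\<Sum>k\<le>m. ?c m k (?a k (Suc (m - k))))"
    by (simp add: flinear_simps[OF X] flinear_simps[OF Y] Ya del: funpow.simps) simp
  also have "(\<Sum>k\<le>m. ?c m k (?a k (Suc (m - k)))) = (\<Sum>k\<le>Suc m. ?c m k (?a k (Suc m - k)))"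
    by (simp add: Suc_diff_le binomial_eq_0)
  also have "\<dots> = ?a 0 (Suc m) + (\<Sum>k\<le>m. ?c m (Suc k) (?a (Suc k) (m - k)))"
    by (subst sum.atMost_Suc_shift) simp
  also have "(\<Sum>k\<le>m. ?c m k (?a (Suc k) (m - k))) + (?a 0 (Suc m) + (\<Sum>k\<le>m. ?c m (Suc k) (?a (Suc k) (m - k))))
     = ?a 0 (Suc m) + (\<Sum>k\<le>m. ?c (Suc m) (Suc k) (?a (Suc k) (m - k)))"
    by (simp add: sum.distrib fspace.scale_left_distrib add.left_commute)
  also have "\<dots> = (\<Sum>k\<le>Suc m. ?c (Suc m) k (?a k (Suc m - k)))"
    by (subst sum.atMost_Suc_shift[of _ m]) simp
  finally show ?case .
qed

lemma frobenius_commuting: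
  fixes X Y :: "('a \<Rightarrow>\<^sub>0 'k::field) \<Rightarrow> ('a \<Rightarrow>\<^sub>0 'k)"
  assumes p: "prime p" "CHAR('k) = p" and X: "flinear X" and Y: "flinear Y" and XY: "\<And>x. X (Y x) = Y (X x)"
  shows "((\<lambda>x. X x + Y x) ^^ p) v = (X ^^ p) v + (Y ^^ p) v"
proof -
  have "of_nat (p choose k) = (0 :: 'k)" if "k \<in> {..p} - {0, p}" for k
    using dvd_choose_prime[of k p] that p by (simp add: of_nat_eq_0_iff_char_dvd)
  then have "(\<Sum>k\<le>p. fscale (of_nat (p choose k)) ((X ^^ k) ((Y ^^ (p - k)) v)))
      = (\<Sum>k\<in>{0,p}. fscale (of_nat (p choose k)) ((X ^^ k) ((Y ^^ (p - k)) v)))"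
    by (intro sum.mono_neutral_right) auto
  then show ?thesis using prime_gt_0_nat[OF p(1)] by (simp add: binomial_commuting[OF X Y XY])
qed

text \<open>The additivity of the \<open>p\<close>-th power applied to the decomposition
  \<open>X = (X - 1) + 1\<close>.\<close>

lemma frobenius_minus_id:
  fixes X :: "('a \<Rightarrow>\<^sub>0 'k::field) \<Rightarrow> ('a \<Rightarrow>\<^sub>0 'k)"
  assumes p: "prime p" "CHAR('k) = p" and X: "flinear X" "\<And>x. (X ^^ p) x = x"
  shows "((\<lambda>x. X x - x) ^^ p) v = 0"
proof -
  have "((\<lambda>x. (X x - x) + x) ^^ p) v = ((\<lambda>x. X x - x) ^^ p) v + ((\<lambda>x. x) ^^ p) v"
    by (rule frobenius_commuting[OF p flinear_diff[OF X(1) flinear_ident] flinear_ident]) simp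
  moreover have "((\<lambda>x. x) ^^ p) v = v" by (induction p) auto
  ultimately show ?thesis using X(2)[of v] by simp
qed

lemma funpow_fscale:
  fixes X :: "('a \<Rightarrow>\<^sub>0 'k::field) \<Rightarrow> ('a \<Rightarrow>\<^sub>0 'k)"
  shows "flinear X \<Longrightarrow> ((\<lambda>x. fscale c (X x)) ^^ k) v = fscale (c ^ k) ((X ^^ k) v)"
  by (induction k) (simp_all add: flinear_simps mult.commute)

lemma pencil_nilpotent:
  fixes X :: "nat \<Rightarrow> ('a \<Rightarrow>\<^sub>0 'k::field) \<Rightarrow> ('a \<Rightarrow>\<^sub>0 'k)"
  assumes p: "prime p" "CHAR('k) = p" and X: "\<And>i. flinear (X i)"
    and comm: "\<And>i j x. X i (X j x) = X j (X i x)" and nil: "\<And>i x. i \<in> {1..n} \<Longrightarrow> (X i ^^ p) x = 0"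
  shows "(pencil n X \<alpha> ^^ p) v = 0"
  using nil
proof (induction n)
  case 0
  have "pencil 0 X \<alpha> = (\<lambda>x. 0)" by (auto simp: pencil_def)
  then show ?case using prime_gt_0_nat[OF p(1)] by (cases p) auto
next
  case (Suc n)
  have eq: "pencil (Suc n) X \<alpha> = (\<lambda>v. pencil n X \<alpha> v + fscale (\<alpha> (Suc n)) (X (Suc n) v))"
    by (auto simp: pencil_def)
  have "(pencil (Suc n) X \<alpha> ^^ p) v = (pencil n X \<alpha> ^^ p) v + ((\<lambda>v. fscale (\<alpha> (Suc n)) (X (Suc n) v)) ^^ p) v"
    unfolding eq
    by (rule frobenius_commuting[OF p flinear_pencil[OF X] flinear_scale[OF X]])
       (simp add: pencil_def flinear_simps[OF X] comm[of _ "Suc n"] fspace.scale_sum_right mult.commute)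
  moreover have "(pencil n X \<alpha> ^^ p) v = 0" using Suc by simp
  moreover have "(X (Suc n) ^^ p) v = 0" using Suc.prems[of "Suc n"] by simp
  ultimately show ?case by (simp add: funpow_fscale[OF X])
qed

section \<open>The cycles \<open>g\<^sub>i\<close>\<close>

lemma g_cycle_set: "set [(i - 1) * p + 1..<i * p + 1] = {(i - 1) * p + 1..i * p}" by auto

lemma g_cycle_outside: "x \<notin> {(i - 1) * p + 1..i * p} \<Longrightarrow> g_cycle p i x = x"
  unfolding g_cycle_def by (rule id_outside_supp) auto

lemma g_cycle_0: "g_cycle p 0 = id"
  by (auto simp: fun_eq_iff g_cycle_outside)

lemma block_disjoint:
  fixes i j p :: nat
  assumes "i \<noteq> j"
  shows "{(i - 1) * p + 1..i * p} \<inter> {(j - 1) * p + 1..j * p} = {}"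
proof -
  have "{(i - 1) * p + 1..i * p} \<inter> {(j - 1) * p + 1..j * p} = {}" if "i < j" for i j :: nat
  proof -
    have le: "i * p \<le> (j - 1) * p" using that by (intro mult_le_mono1) auto
    show ?thesis
    proof (rule equals0I)
      fix x assume "x \<in> {(i - 1) * p + 1..i * p} \<inter> {(j - 1) * p + 1..j * p}"
      then have "x \<in> {(i - 1) * p + 1..i * p}" "x \<in> {(j - 1) * p + 1..j * p}" by blast+
      then have "x \<le> i * p" "(j - 1) * p + 1 \<le> x" by (simp_all only: atLeastAtMost_iff)
      then show False using le by linarith
    qed
  qed
  from this[of i j] this[of j i] assms show ?thesis by (metis Int_commute nat_neq_iff)
qed

lemma g_cycle_commute: "g_cycle p i \<circ> g_cycle p j = g_cycle p j \<circ> g_cycle p i"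
proof (cases "i = j")
  case False
  show ?thesis unfolding g_cycle_def
    by (intro cycles_commute) (simp_all only: g_cycle_set distinct_upt block_disjoint[OF False])
qed simp

lemma g_cycle_power: "(g_cycle p i ^^ p) = id"
proof (cases i)
  case (Suc j)
  then have l: "length [(i - 1) * p + 1..<i * p + 1] = p" by simp
  show ?thesis using cycle_is_id_root[of "[(i - 1) * p + 1..<i * p + 1]"] unfolding l g_cycle_def by simp
qed (simp add: g_cycle_0 id_def[symmetric])

lemma g_cycle_nth:
  assumes "1 \<le> i" "l < p"
  shows "(g_cycle p i ^^ l) ((i - 1) * p + 1) = (i - 1) * p + 1 + l"
proof -
  let ?cs = "[(i - 1) * p + 1..<i * p + 1]"
  have len: "length ?cs = p" using assms by (cases i) simp_all
  have "map (g_cycle p i ^^ l) ?cs ! 0 = rotate l ?cs ! 0"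
    unfolding g_cycle_def by (subst cyclic_rotation) simp_all
  also have "rotate l ?cs ! 0 = ?cs ! l" using assms len by (subst nth_rotate) auto
  finally show ?thesis using assms len by (simp del: upt_Suc)
qed

lemma g_cycle_permutes_block: "g_cycle p i permutes {(i - 1) * p + 1..i * p}"
  unfolding g_cycle_def using cycle_permutes[of "[(i - 1) * p + 1..<i * p + 1]"] by (simp only: g_cycle_set)

section \<open>Group algebra actions and freeness\<close>

definition gact :: "('g \<Rightarrow> ('a \<Rightarrow>\<^sub>0 'k::field) \<Rightarrow> ('a \<Rightarrow>\<^sub>0 'k)) \<Rightarrow> ('g \<Rightarrow>\<^sub>0 'k) \<Rightarrow> ('a \<Rightarrow>\<^sub>0 'k) \<Rightarrow> ('a \<Rightarrow>\<^sub>0 'k)" where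
  "gact A f x = flift (\<lambda>g. A g x) f"

lemma ga_act_gact: "rscale M = fscale \<Longrightarrow> ga_act M f x = gact (act M) f x"
  by (simp add: ga_act_def gact_def flift_def)

text \<open>All functions on \<open>nat\<close> act, not just the elements of a group; thus
  identities in the group algebra can be evaluated without membership conditions on the
  supports.\<close>

locale linear_action =
  fixes A :: "(nat \<Rightarrow> nat) \<Rightarrow> ('a \<Rightarrow>\<^sub>0 'k::field) \<Rightarrow> ('a \<Rightarrow>\<^sub>0 'k)"
  assumes A_lin: "flinear (A g)" and A_comp: "A (g \<circ> h) x = A g (A h x)" and A_id: "A id x = x"
begin

definition D :: "nat \<Rightarrow> nat \<Rightarrow> ('a \<Rightarrow>\<^sub>0 'k) \<Rightarrow> ('a \<Rightarrow>\<^sub>0 'k)" where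
  "D p i x = A (g_cycle p i) x - x"

lemma D_lin: "flinear (D p i)"
  unfolding D_def[abs_def] by (rule flinear_diff[OF A_lin flinear_ident])

lemma D_comm: "D p i (D p j x) = D p j (D p i x)"
proof -
  have "A (g_cycle p i) (A (g_cycle p j) x) = A (g_cycle p j) (A (g_cycle p i) x)"
    using g_cycle_commute[of p i j] by (metis A_comp)
  then show ?thesis unfolding D_def by (simp add: flinear_simps[OF A_lin])
qed

lemma A_pow: "(A g ^^ k) x = A (g ^^ k) x"
proof (induction k)
  case 0 show ?case using A_id by (simp add: id_def)
next
  case (Suc k) then show ?case using A_comp[of g "g ^^ k" x] by (simp add: comp_def)
qed

lemma gact_add: "gact A (f + h) x = gact A f x + gact A h x"
  and gact_diff: "gact A (f - h) x = gact A f x - gact A h x"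
  and gact_scale: "gact A (fscale c f) x = fscale c (gact A f x)"
  and gact_sum: "gact A (sum F I) x = (\<Sum>i\<in>I. gact A (F i) x)"
  and gact_zero: "gact A 0 x = 0"
  and gact_single: "gact A (Poly_Mapping.single g c) x = fscale c (A g x)"
  unfolding gact_def by (simp_all add: flift_simps)

lemma gact_u: "gact A (u_elem p n \<alpha>) x = x + pencil n (D p) \<alpha> x"
  unfolding u_elem_def pencil_def D_def
  by (simp add: gact_add gact_sum gact_scale gact_diff gact_single A_id del: fscale_single)

lemma gact_mult:
  assumes "mult G = (\<circ>)"
  shows "gact A (ga_mult G f h) x = gact A f (gact A h x)"
proof -
  have "gact A f (gact A h x) = (\<Sum>g\<in>Poly_Mapping.keys f. fscale (Poly_Mapping.lookup f g)
      (\<Sum>g'\<in>Poly_Mapping.keys h. fscale (Poly_Mapping.lookup h g') (A g (A g' x))))"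
    unfolding gact_def flift_def by (simp add: flinear_simps[OF A_lin])
  then show ?thesis unfolding ga_mult_def assms
    by (simp add: gact_sum gact_single fspace.scale_sum_right A_comp)
qed

lemma pencil_D_nilpotent: "prime p \<Longrightarrow> CHAR('k) = p \<Longrightarrow> (pencil n (D p) \<alpha> ^^ p) v = 0"
  by (rule pencil_nilpotent[OF _ _ D_lin D_comm], assumption+)
     (unfold D_def[abs_def], rule frobenius_minus_id, auto simp: A_lin A_pow g_cycle_power A_id)

end

text \<open>The natural permutation module; it serves as a witness that \<open>(u - 1)^(p-1)\<close>
  does not vanish in the group algebra.\<close>

definition perm_act :: "(nat \<Rightarrow> nat) \<Rightarrow> (nat \<Rightarrow>\<^sub>0 'k::field) \<Rightarrow> (nat \<Rightarrow>\<^sub>0 'k)" where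
  "perm_act g = flift (\<lambda>x. sing (g x))"

text \<open>Left multiplication in the group algebra becomes an instance of
  \<open>linear_action\<close>, so that powers of \<open>u - 1\<close> are powers of a pencil as
  well.\<close>

definition regular_act :: "(nat \<Rightarrow> nat) \<Rightarrow> ((nat \<Rightarrow> nat) \<Rightarrow>\<^sub>0 'k::field) \<Rightarrow> ((nat \<Rightarrow> nat) \<Rightarrow>\<^sub>0 'k)" where
  "regular_act g = flift (\<lambda>h. sing (g \<circ> h))"

interpretation perm: linear_action perm_act
  by (rule linear_action.intro) (simp_all add: perm_act_def flinear_flift flift_flift comp_def)

interpretation reg: linear_action regular_act
  by (rule linear_action.intro) (simp_all add: regular_act_def flinear_flift flift_flift comp_assoc)

lemma ga_mult_regular: "mult G = (\<circ>) \<Longrightarrow> ga_mult G f h = gact regular_act f h"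
  unfolding ga_mult_def gact_def regular_act_def flift_def
  by (simp add: fspace.scale_sum_right)

text \<open>The elements \<open>(u - 1)\<^sup>i\<close> of the group algebra.\<close>

definition u_power :: "nat \<Rightarrow> nat \<Rightarrow> (nat \<Rightarrow> 'k::field) \<Rightarrow> nat \<Rightarrow> ((nat \<Rightarrow> nat) \<Rightarrow>\<^sub>0 'k)" where
  "u_power p n \<alpha> i = (pencil n (reg.D p) \<alpha> ^^ i) (sing id)"

lemma ga_mult_u:
  assumes "mult G = (\<circ>)"
  shows "ga_mult G (u_elem p n \<alpha>) h = h + pencil n (reg.D p) \<alpha> h"
  unfolding ga_mult_regular[OF assms] by (rule reg.gact_u)

lemma (in linear_action) gact_pencil: "gact A (pencil n (reg.D p) \<alpha> h) x = pencil n (D p) \<alpha> (gact A h x)"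
proof -
  define G :: "(nat \<Rightarrow> nat) monoid" where "G = \<lparr>carrier = UNIV, mult = (\<circ>), one = id\<rparr>"
  have G: "mult G = (\<circ>)" by (simp add: G_def)
  have "gact A (h + pencil n (reg.D p) \<alpha> h) x = gact A h x + pencil n (D p) \<alpha> (gact A h x)"
    using gact_mult[OF G, of "u_elem p n \<alpha>" h x] unfolding ga_mult_u[OF G] gact_u .
  then show ?thesis by (simp add: gact_add)
qed

lemma (in linear_action) gact_u_power: "gact A (u_power p n \<alpha> i) x = (pencil n (D p) \<alpha> ^^ i) x"
  unfolding u_power_def by (induction i) (simp_all add: gact_single A_id[unfolded id_def] gact_pencil id_def)

lemma u_power_p:
  "prime p \<Longrightarrow> CHAR('k::field) = p \<Longrightarrow> u_power p n (\<alpha> :: nat \<Rightarrow> 'k) p = 0"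
  unfolding u_power_def by (rule reg.pencil_D_nilpotent)

text \<open>Evaluated on the first point of the \<open>i\<close>-th block in the natural permutation
  module: only the \<open>i\<close>-th summand acts there, and the \<open>l\<close>-th power has the
  leading term \<open>\<alpha> i ^ l\<close> times the \<open>l\<close>-th point of the block. For
  \<open>l = p - 1\<close> the block is not yet exhausted.\<close>

lemma u_power_nonzero:
  fixes \<alpha> :: "nat \<Rightarrow> 'k::field"
  assumes p: "prime p" and i: "i \<in> {1..n}" "\<alpha> i \<noteq> 0"
  shows "u_power p n \<alpha> (p - 1) \<noteq> 0"
proof
  let ?N = "pencil n (perm.D p) \<alpha>" and ?x = "\<lambda>l. (i - 1) * p + 1 + l"
  let ?S = "\<lambda>l. fspace.span (sing ` ?x ` {..<l}) :: (nat \<Rightarrow>\<^sub>0 'k) set"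
  have D: "perm.D p j (sing x) = sing (g_cycle p j x) - sing x" for j x
    by (simp add: perm.D_def perm_act_def)
  have Nx: "?N (sing x) = fscale (\<alpha> i) (sing (g_cycle p i x) - sing x)" if x: "x \<in> {(i - 1) * p + 1..i * p}" for x
  proof -
    have "perm.D p j (sing x) = (0 :: nat \<Rightarrow>\<^sub>0 'k)" if "j \<noteq> i" for j
    proof -
      have "x \<notin> {(j - 1) * p + 1..j * p}" using block_disjoint[OF that, of p] x by blast
      from g_cycle_outside[OF this] show ?thesis unfolding D by simp
    qed
    then show ?thesis unfolding pencil_def using i(1)
      by (subst sum.remove[of _ i]) (auto simp: D intro!: sum.neutral)
  qed
  have xb: "?x l \<in> {(i - 1) * p + 1..i * p}" if "l < p" for l
    using that i(1) by (cases i) auto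
  have gx: "g_cycle p i (?x l) = ?x (Suc l)" if "Suc l < p" for l
  proof -
    have "g_cycle p i ((g_cycle p i ^^ l) ((i - 1) * p + 1)) = (g_cycle p i ^^ Suc l) ((i - 1) * p + 1)" by simp
    then show ?thesis using g_cycle_nth[of i l p] g_cycle_nth[of i "Suc l" p] i(1) that by (simp del: funpow.simps)
  qed
  have linN: "flinear ?N" by (rule flinear_pencil[OF perm.D_lin])
  have Nxl: "?N (sing (?x l)) = fscale (\<alpha> i) (sing (?x (Suc l))) + fscale (- \<alpha> i) (sing (?x l))" if "Suc l < p" for l
    using Nx[OF xb[of l]] gx[OF that] that
    by (simp add: fspace.scale_right_diff_distrib del: fscale_single)
  have NS: "?N v \<in> ?S (Suc l)" if "v \<in> ?S l" "l < p" for v l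
  proof -
    have "?N v \<in> ?N ` ?S l" using that(1) by (rule imageI)
    also have "\<dots> = fspace.span (?N ` sing ` ?x ` {..<l})" by (rule fpair.linear_span_image[OF linN, symmetric])
    also have "\<dots> \<subseteq> ?S (Suc l)"
    proof (rule fspace.span_minimal[OF _ fspace.subspace_span], safe)
      fix k assume k: "k < l"
      have "?N (sing (?x k)) = fscale (\<alpha> i) (sing (?x (Suc k))) + fscale (- \<alpha> i) (sing (?x k))"
        by (rule Nxl) (use k that(2) in linarith)
      also have "\<dots> \<in> ?S (Suc l)"
        by (intro fspace.span_add fspace.span_scale fspace.span_base imageI) (use k in auto)
      finally show "?N (sing (?x k)) \<in> ?S (Suc l)" .
    qed
    finally show ?thesis .
  qed
  \<comment> \<open>\<open>?S l\<close> is spanned by the first \<open>l\<close> points of the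
    block, which absorb all lower terms.\<close>
  have pow: "(?N ^^ l) (sing (?x 0)) - fscale (\<alpha> i ^ l) (sing (?x l)) \<in> ?S l" if "l < p" for l
    using that
  proof (induction l)
    case 0 then show ?case using fspace.span_zero by simp
  next
    case (Suc l)
    let ?v = "(?N ^^ l) (sing (?x 0)) - fscale (\<alpha> i ^ l) (sing (?x l))"
    have "?N ?v \<in> ?S (Suc l)" using Suc by (intro NS) auto
    moreover have "fscale (\<alpha> i ^ l) (fscale (- \<alpha> i) (sing (?x l))) \<in> ?S (Suc l)"
      by (intro fspace.span_scale fspace.span_base) auto
    ultimately have "?N ?v + fscale (\<alpha> i ^ l) (fscale (- \<alpha> i) (sing (?x l))) \<in> ?S (Suc l)"
      by (rule fspace.span_add)
    also have "?N ?v + fscale (\<alpha> i ^ l) (fscale (- \<alpha> i) (sing (?x l))) =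
        (?N ^^ Suc l) (sing (?x 0)) - fscale (\<alpha> i ^ Suc l) (sing (?x (Suc l)))"
    proof -
      have "X - fscale a (fscale b y + fscale (- b) z) + fscale a (fscale (- b) z) = X - fscale (b * a) y"
        for X y z :: "nat \<Rightarrow>\<^sub>0 'k" and a b
        by (simp add: fspace.scale_right_distrib fspace.scale_right_diff_distrib mult.commute)
      moreover have "?N ?v = (?N ^^ Suc l) (sing (?x 0)) - fscale (\<alpha> i ^ l) (?N (sing (?x l)))"
        by (simp add: flinear_simps[OF linN] del: fscale_single)
      ultimately show ?thesis unfolding Nxl[OF Suc.prems] by (simp only: power_Suc)
    qed
    finally show ?case .
  qed
  have p1: "p - 1 < p" using prime_gt_0_nat[OF p] by simp
  assume "u_power p n \<alpha> (p - 1) = 0"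
  then have "(?N ^^ (p - 1)) (sing (?x 0)) = 0"
    using perm.gact_u_power[of p n \<alpha> "p - 1" "sing (?x 0)"] by (simp add: perm.gact_zero)
  then have "- fscale (\<alpha> i ^ (p - 1)) (sing (?x (p - 1))) \<in> ?S (p - 1)" using pow[OF p1] by simp
  then have "Poly_Mapping.keys (- fscale (\<alpha> i ^ (p - 1)) (sing (?x (p - 1)))) \<subseteq> ?x ` {..<p - 1}"
    by (rule keys_span) auto
  moreover have "?x (p - 1) \<in> Poly_Mapping.keys (- fscale (\<alpha> i ^ (p - 1)) (sing (?x (p - 1))))"
    using i(2) by (simp add: in_keys_iff)
  ultimately show False by auto
qed

text \<open>At the least index \<open>j\<close> not yet treated, multiplication by
  \<open>(u - 1)^(p-1-j)\<close> kills all higher terms because \<open>(u - 1)^p = 0\<close>; the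
  lower ones vanish by induction, and the remaining power \<open>(u - 1)^(p-1)\<close> is
  nonzero.\<close>

lemma u_power_independent:
  fixes \<alpha> :: "nat \<Rightarrow> 'k::field"
  assumes p: "prime p" "CHAR('k) = p" and i: "i \<in> {1..n}" "\<alpha> i \<noteq> 0"
    and s: "(\<Sum>j<p. fscale (c j) (u_power p n \<alpha> j)) = 0" and j: "j < p"
  shows "c j = 0"
  using j
proof (induction j rule: less_induct)
  case (less j)
  let ?N = "pencil n (reg.D p) \<alpha>"
  have lin: "flinear (?N ^^ k)" for k by (intro flinear_funpow flinear_pencil reg.D_lin)
  have z: "u_power p n \<alpha> k = 0" if "p \<le> k" for k
  proof -
    have "(?N ^^ k) (sing id) = (?N ^^ (k - p)) ((?N ^^ p) (sing id))"
      using that funpow_add[of "k - p" p ?N] by simp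
    then show ?thesis using u_power_p[OF p, of n \<alpha>] flinear_simps(4)[OF lin] by (simp add: u_power_def)
  qed
  have "0 = (?N ^^ (p - 1 - j)) (\<Sum>j<p. fscale (c j) (u_power p n \<alpha> j))"
    using flinear_simps(4)[OF lin] s by simp
  also have "\<dots> = (\<Sum>k<p. fscale (c k) (u_power p n \<alpha> (p - 1 - j + k)))"
    by (simp only: flinear_simps[OF lin] u_power_def funpow_add comp_def)
  also have "\<dots> = fscale (c j) (u_power p n \<alpha> (p - 1 - j + j)) + (\<Sum>k\<in>{..<p} - {j}. fscale (c k) (u_power p n \<alpha> (p - 1 - j + k)))"
    using less.prems by (subst sum.remove[of _ j]) auto
  also have "(\<Sum>k\<in>{..<p} - {j}. fscale (c k) (u_power p n \<alpha> (p - 1 - j + k))) = 0"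
  proof (rule sum.neutral, rule ballI)
    fix k assume "k \<in> {..<p} - {j}"
    then have k: "k < p" "k \<noteq> j" by auto
    show "fscale (c k) (u_power p n \<alpha> (p - 1 - j + k)) = 0"
    proof (cases "k < j")
      case True then show ?thesis using less.IH[of k] k by simp
    next
      case False then show ?thesis using z[of "p - 1 - j + k"] k less.prems by simp
    qed
  qed
  finally show ?case using u_power_nonzero[of p i n \<alpha>] p(1) i less.prems by simp
qed

text \<open>Both spans contain 1, and each is closed under multiplication by \<open>u\<close> and by
  \<open>u - 1\<close>. The right-hand side has a finite generating set, on which coefficients can
  be compared.\<close>

lemma ga_cyclic_u:
  fixes \<alpha> :: "nat \<Rightarrow> 'k::field"
  assumes p: "prime p" "CHAR('k) = p" and G: "mult G = (\<circ>)" "one G = id"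
  shows "ga_cyclic G (u_elem p n \<alpha>) = fspace.span (u_power p n \<alpha> ` {..<p})"
proof
  let ?u = "u_elem p n \<alpha>" and ?N = "pencil n (reg.D p) \<alpha>"
  let ?S = "fspace.span (u_power p n \<alpha> ` {..<p})"
  have lin: "flinear ?N" by (intro flinear_pencil reg.D_lin)
  have NS: "?N x \<in> ?S" if "x \<in> ?S" for x
  proof -
    have "?N x \<in> ?N ` ?S" using that by (rule imageI)
    also have "\<dots> = fspace.span (?N ` u_power p n \<alpha> ` {..<p})" by (rule fpair.linear_span_image[OF lin, symmetric])
    also have "\<dots> \<subseteq> ?S"
    proof (rule fspace.span_minimal[OF _ fspace.subspace_span], safe)
      fix k assume k: "k < p"
      have "?N (u_power p n \<alpha> k) = u_power p n \<alpha> (Suc k)" by (simp add: u_power_def)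
      also have "\<dots> \<in> ?S"
      proof (cases "Suc k = p")
        case True
        then have "u_power p n \<alpha> (Suc k) = 0" using u_power_p[OF p, of n \<alpha>] by simp
        then show ?thesis using fspace.span_zero by metis
      next
        case False
        then show ?thesis using k by (intro fspace.span_base imageI) auto
      qed
      finally show "?N (u_power p n \<alpha> k) \<in> ?S" .
    qed
    finally show ?thesis .
  qed
  have "ga_pow G ?u j \<in> ?S" for j
  proof (induction j)
    case 0
    have "sing id = u_power p n \<alpha> 0" by (simp add: u_power_def)
    then show ?case using prime_gt_0_nat[OF p(1)] by (auto simp: G intro!: fspace.span_base)
  next
    case (Suc j) then show ?case using NS by (simp add: ga_mult_u[OF G(1)] fspace.span_add)
  qed
  then show "ga_cyclic G ?u \<subseteq> ?S" unfolding ga_cyclic_def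
    by (intro fspace.span_minimal fspace.subspace_span) auto
  have lin1: "flinear (\<lambda>h. h + ?N h)" by (intro flinear_add flinear_ident lin)
  have NC: "?N x \<in> ga_cyclic G ?u" if x: "x \<in> ga_cyclic G ?u" for x
  proof -
    have "x + ?N x \<in> (\<lambda>h. h + ?N h) ` ga_cyclic G ?u" using x by (rule imageI)
    also have "\<dots> = fspace.span ((\<lambda>h. h + ?N h) ` range (ga_pow G ?u))"
      unfolding ga_cyclic_def by (rule fpair.linear_span_image[OF lin1, symmetric])
    also have "\<dots> \<subseteq> ga_cyclic G ?u" unfolding ga_cyclic_def
    proof (rule fspace.span_minimal[OF _ fspace.subspace_span], safe)
      fix k
      have "ga_pow G ?u k + ?N (ga_pow G ?u k) = ga_pow G ?u (Suc k)" by (simp add: ga_mult_u[OF G(1)])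
      then show "ga_pow G ?u k + ?N (ga_pow G ?u k) \<in> fspace.span (range (ga_pow G ?u))"
        by (metis fspace.span_base rangeI)
    qed
    finally have "x + ?N x - x \<in> ga_cyclic G ?u"
      using x unfolding ga_cyclic_def by (intro fspace.span_diff)
    then show ?thesis by simp
  qed
  have "u_power p n \<alpha> j \<in> ga_cyclic G ?u" for j
  proof (induction j)
    case 0
    have "sing id = ga_pow G ?u 0" by (simp add: G)
    then show ?case unfolding ga_cyclic_def u_power_def by (metis fspace.span_base funpow_0 rangeI)
  next
    case (Suc j) then show ?case using NC by (simp add: u_power_def)
  qed
  then show "?S \<subseteq> ga_cyclic G ?u" unfolding ga_cyclic_def
    by (intro fspace.span_minimal fspace.subspace_span) auto
qed

lemma span_image_finite:
  assumes "finite I" "x \<in> fspace.span (f ` I)"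
  shows "\<exists>c. x = (\<Sum>i\<in>I. fscale (c i) (f i))"
  using assms(2)
proof (induction rule: fspace.span_induct_alt)
  case base
  show ?case by (intro exI[of _ "\<lambda>_. 0"]) simp
next
  case (step a y z)
  then obtain c i where c: "z = (\<Sum>i\<in>I. fscale (c i) (f i))" and i: "i \<in> I" "y = f i" by blast
  have "(\<Sum>j\<in>I. fscale (if j = i then a else 0) (f j)) = fscale a y"
    using i assms(1) by (subst sum.remove[of _ i]) auto
  then have "fscale a y + z = (\<Sum>j\<in>I. fscale ((if j = i then a else 0) + c j) (f j))"
    unfolding c fspace.scale_left_distrib sum.distrib by simp
  then show ?case by (rule exI[of _ "\<lambda>j. (if j = i then a else 0) + c j"])
qed

section \<open>Freeness over the cyclic subalgebra in terms of kernel dimensions\<close>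

locale rep_pencil = linear_action A + nilpotent_on p "pencil n (D p) \<alpha>" V
  for A :: "(nat \<Rightarrow> nat) \<Rightarrow> ('a \<Rightarrow>\<^sub>0 'k::field) \<Rightarrow> ('a \<Rightarrow>\<^sub>0 'k)" and p n \<alpha> V +
  fixes M :: "(nat \<Rightarrow> nat, 'k, 'a \<Rightarrow>\<^sub>0 'k) kG_rep"
  assumes prime: "prime p" and char: "CHAR('k) = p"
    and M: "vecs M = V" "rscale M = fscale" "act M = A" "mult (grp M) = (\<circ>)" "one (grp M) = id"
begin

abbreviation "N \<equiv> pencil n (D p) \<alpha>"
abbreviation "cyc \<equiv> ga_cyclic (grp M) (u_elem p n \<alpha>)"

lemma lin_pow: "flinear (N ^^ j)" by (rule flinear_funpow[OF lin])

lemma ga_act_M: "ga_act M f x = gact A f x"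
  using ga_act_gact[of M f x] M by simp

lemma ga_act_u: "ga_act M (u_elem p n \<alpha>) x = x + N x"
  unfolding ga_act_M by (rule gact_u)

definition comb :: "(nat \<Rightarrow> 'k) \<Rightarrow> ((nat \<Rightarrow> nat) \<Rightarrow>\<^sub>0 'k)" where
  "comb c = (\<Sum>j<p. fscale (c j) (u_power p n \<alpha> j))"

lemma comb_act: "ga_act M (comb c) x = (\<Sum>j<p. fscale (c j) ((N ^^ j) x))"
  unfolding ga_act_M comb_def by (simp add: gact_sum gact_scale gact_u_power)

lemma comb_cyc: "comb c \<in> cyc"
  unfolding ga_cyclic_u[OF prime char M(4,5)] comb_def
  by (intro fspace.span_sum fspace.span_scale fspace.span_base imageI)

lemma cyc_comb: "x \<in> cyc \<Longrightarrow> \<exists>c. x = comb c"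
  unfolding ga_cyclic_u[OF prime char M(4,5)] comb_def by (rule span_image_finite) simp_all

lemma N_pow_in: "x \<in> V \<Longrightarrow> (N ^^ j) x \<in> V"
  using funpow_closed[of V N] closed by blast

text \<open>If \<open>B\<close> is a basis over the cyclic algebra, the vectors \<open>N^j b\<close>
  with \<open>b\<close> in \<open>B\<close> and \<open>j < p\<close> are independent, so
  \<open>dim V >= p * card B\<close>. An element of the kernel of \<open>N\<close> is a combination
  of the top vectors \<open>N^(p-1) b\<close> only, so the kernel has dimension at most
  \<open>card B\<close>.\<close>

lemma kdim_free_if:
  assumes free: "free_over_cyclic M (u_elem p n \<alpha>)" and i: "i \<in> {1..n}" "\<alpha> i \<noteq> 0"
  shows "p * kdim N V 1 \<le> fspace.dim V"
proof -
  from free[unfolded free_over_cyclic_def M] obtain B where B0: "finite B \<and> B \<subseteq> V \<and>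
    (\<forall>x\<in>V. \<exists>!r. (\<forall>b\<in>B. r b \<in> cyc) \<and> (\<forall>b. b \<notin> B \<longrightarrow> r b = 0) \<and> x = (\<Sum>b\<in>B. ga_act M (r b) b))" ..
  note B = B0[THEN conjunct1] B0[THEN conjunct2, THEN conjunct1] B0[THEN conjunct2, THEN conjunct2, rule_format]
  have indep: "c b j = 0"
    if s: "(\<Sum>b\<in>B. \<Sum>j<p. fscale (c b j) ((N ^^ j) b)) = 0" and bj: "b \<in> B" "j < p" for c b j
  proof -
    \<comment> \<open>A linear relation gives a second representation of 0 besides the zero
      coefficients; uniqueness makes each \<open>comb (c b)\<close> vanish, and a nonzero coordinate
      of \<alpha> makes the scalars vanish.\<close>
    let ?r = "\<lambda>b. if b \<in> B then comb (c b) else 0"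
    let ?P = "\<lambda>r. (\<forall>b\<in>B. r b \<in> cyc) \<and> (\<forall>b. b \<notin> B \<longrightarrow> r b = 0) \<and> 0 = (\<Sum>b\<in>B. ga_act M (r b) b)"
    have 1: "?P ?r" using s comb_cyc by (simp add: comb_act)
    have 2: "?P (\<lambda>_. 0)" by (simp add: ga_cyclic_def fspace.span_zero ga_act_M gact_zero)
    have "\<exists>!r. ?P r" by (rule B(3)[OF fspace.subspace_0[OF subV]])
    then obtain r0 where r0: "\<forall>r. ?P r \<longrightarrow> r = r0" by (rule ex1E)
    have "?r = (\<lambda>_. 0)" using r0[rule_format, OF 1] r0[rule_format, OF 2] by simp
    from fun_cong[OF this, of b] have "comb (c b) = 0" using bj by simp
    then show ?thesis using u_power_independent[of p i n \<alpha> "c b" j, OF prime char i] bj by (simp add: comb_def)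
  qed
  have "card (B \<times> {..<p}) \<le> fspace.dim V"
  proof (rule independent_family_card_le[where w = "\<lambda>(b, j). (N ^^ j) b"])
    fix c assume "(\<Sum>i\<in>B \<times> {..<p}. fscale (c i) (case i of (b, j) \<Rightarrow> (N ^^ j) b)) = 0"
    then have "(\<Sum>b\<in>B. \<Sum>j<p. fscale (c (b, j)) ((N ^^ j) b)) = 0"
      by (simp add: sum.cartesian_product case_prod_unfold)
    from indep[OF this] show "\<forall>i\<in>B \<times> {..<p}. c i = 0" by auto
  qed (use B N_pow_in finV in auto)
  then have dimV: "p * card B \<le> fspace.dim V" by (simp add: card_cartesian_product mult.commute)
  obtain q where q: "p = Suc q" using prime_gt_0_nat[OF prime] by (cases p) auto
  have "{x \<in> V. (N ^^ 1) x = 0} \<subseteq> fspace.span ((N ^^ q) ` B)"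
  proof
    fix x assume x: "x \<in> {x \<in> V. (N ^^ 1) x = 0}"
    then obtain r where r: "\<forall>b\<in>B. r b \<in> cyc" "x = (\<Sum>b\<in>B. ga_act M (r b) b)"
      using ex1_implies_ex[OF B(3)[of x]] by auto
    have "\<forall>b\<in>B. \<exists>c. r b = comb c" using r(1) cyc_comb by blast
    then obtain c where c: "\<And>b. b \<in> B \<Longrightarrow> r b = comb (c b)" by metis
    have xc: "x = (\<Sum>b\<in>B. \<Sum>j<p. fscale (c b j) ((N ^^ j) b))" unfolding r(2) using c by (simp add: comb_act)
    \<comment> \<open>\<open>N x\<close> has the coefficients of \<open>x\<close> shifted up by one;
      the coefficient at \<open>j = q\<close> drops out since \<open>N^p = 0\<close>. So
      \<open>N x = 0\<close> kills all coefficients below the top one.\<close>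
    have "(\<Sum>b\<in>B. \<Sum>j<p. fscale (case j of 0 \<Rightarrow> 0 | Suc j \<Rightarrow> c b j) ((N ^^ j) b)) =
        (\<Sum>b\<in>B. \<Sum>j<p. fscale (c b j) (N ((N ^^ j) b)))"
    proof (rule sum.cong[OF refl])
      fix b
      have "N ((N ^^ q) b) = 0" using nil[of b] by (simp add: q)
      then show "(\<Sum>j<p. fscale (case j of 0 \<Rightarrow> 0 | Suc j \<Rightarrow> c b j) ((N ^^ j) b)) =
          (\<Sum>j<p. fscale (c b j) (N ((N ^^ j) b)))"
        unfolding q by (subst sum.lessThan_Suc_shift, subst sum.lessThan_Suc) (simp add: q)
    qed
    also have "\<dots> = N x" unfolding xc by (simp add: flinear_simps[OF lin])
    finally have "(\<Sum>b\<in>B. \<Sum>j<p. fscale (case j of 0 \<Rightarrow> 0 | Suc j \<Rightarrow> c b j) ((N ^^ j) b)) = 0" using x by simp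
    from indep[OF this, of _ "Suc _"] have c0: "c b j = 0" if "b \<in> B" "j < q" for b j using that q by auto
    have "x = (\<Sum>b\<in>B. fscale (c b q) ((N ^^ q) b))"
      unfolding xc q sum.lessThan_Suc using c0 by (intro sum.cong refl) simp
    moreover have "(\<Sum>b\<in>B. fscale (c b q) ((N ^^ q) b)) \<in> fspace.span ((N ^^ q) ` B)"
      by (intro fspace.span_sum fspace.span_scale fspace.span_base imageI)
    ultimately show "x \<in> fspace.span ((N ^^ q) ` B)" by simp
  qed
  then have "kdim N V 1 \<le> card ((N ^^ q) ` B)" unfolding kdim_def by (rule fspace.dim_le_card) (use B(1) in simp)
  also have "\<dots> \<le> card B" by (rule card_image_le[OF B(1)])
  finally have "p * kdim N V 1 \<le> p * card B" by (rule mult_le_mono2)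
  then show ?thesis using dimV by (rule order_trans)
qed

text \<open>Preimages under \<open>N^(p-1)\<close> of a basis of its image serve as basis. Freeness
  of the kernel dimensions gives \<open>dim V = p * dim (N^(p-1) V)\<close>, so the vectors
  \<open>N^j b\<close> are exactly as many as the dimension and it suffices that they are
  independent.\<close>

lemma free_if_kdim:
  assumes free: "p * kdim N V 1 \<le> fspace.dim V"
  shows "free_over_cyclic M (u_elem p n \<alpha>)"
proof -
  obtain q where q: "p = Suc q" using prime_gt_0_nat[OF prime] by (cases p) auto
  let ?W = "(N ^^ q) ` V"
  have "fspace.dim V = kdim N V q + fspace.dim ?W"
    unfolding kdim_def by (rule rank_nullity[OF lin_pow subV finV])
  then have dW: "fspace.dim V = p * fspace.dim ?W"
    using kdim_free[OF free, of q] kdim_free[OF free, of p] kdim_p q by simp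
  obtain C where C: "finite C" "fspace.independent C" "?W = fspace.span C" "card C = fspace.dim ?W"
    by (rule fin_dim_basis[OF fin_dim_image[OF finV lin_pow] subspace_image[OF lin_pow subV]])
  have "C \<subseteq> ?W" unfolding C(3) by (rule fspace.span_superset)
  then have "\<forall>c\<in>C. \<exists>x\<in>V. (N ^^ q) x = c" by (metis imageE subsetD)
  then obtain f where f: "\<And>c. c \<in> C \<Longrightarrow> f c \<in> V" "\<And>c. c \<in> C \<Longrightarrow> (N ^^ q) (f c) = c" by metis
  define B where "B = f ` C"
  have f_inj: "inj_on f C" by (rule inj_on_inverseI[of _ "N ^^ q"]) (rule f(2))
  have B: "finite B" "B \<subseteq> V" "card B = fspace.dim ?W"
    using C f(1) card_image[OF f_inj] by (auto simp: B_def)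
  have indep: "c b j = 0"
    if s: "(\<Sum>b\<in>B. \<Sum>j<p. fscale (c b j) ((N ^^ j) b)) = 0" and b: "b \<in> B" and j: "j < p" for c b j
    using j b
  proof (induction j arbitrary: b rule: less_induct)
    case (less j)
    have z: "(N ^^ k) x = 0" if "p \<le> k" for k x
    proof -
      have "(N ^^ k) x = (N ^^ (k - p)) ((N ^^ p) x)" using that funpow_add[of "k - p" p N] by simp
      then show ?thesis using nil flinear_simps(4)[OF lin_pow] by simp
    qed
    have "0 = (N ^^ (q - j)) (\<Sum>b\<in>B. \<Sum>j<p. fscale (c b j) ((N ^^ j) b))"
      using s flinear_simps(4)[OF lin_pow] by simp
    also have "\<dots> = (\<Sum>b\<in>B. \<Sum>k<p. fscale (c b k) ((N ^^ (q - j + k)) b))"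
      by (simp only: flinear_simps[OF lin_pow] funpow_add comp_def)
    also have "\<dots> = (\<Sum>b\<in>B. fscale (c b j) ((N ^^ q) b))"
    proof (intro sum.cong refl)
      fix b assume b: "b \<in> B"
      have "(\<Sum>k\<in>{..<p} - {j}. fscale (c b k) ((N ^^ (q - j + k)) b)) = 0"
      proof (rule sum.neutral, rule ballI)
        fix k assume "k \<in> {..<p} - {j}"
        then have k: "k < p" "k \<noteq> j" by auto
        show "fscale (c b k) ((N ^^ (q - j + k)) b) = 0"
        proof (cases "k < j")
          case True then show ?thesis using less.IH[of k b] k b by simp
        next
          case False then show ?thesis using z[of "q - j + k"] k less.prems q by simp
        qed
      qed
      then show "(\<Sum>k<p. fscale (c b k) ((N ^^ (q - j + k)) b)) = fscale (c b j) ((N ^^ q) b)"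
        using less.prems(1) q by (subst sum.remove[of _ j]) auto
    qed
    also have "\<dots> = (\<Sum>d\<in>C. fscale (c (f d) j) d)"
      unfolding B_def using f(2) by (subst sum.reindex[OF f_inj]) simp
    finally have "(\<Sum>d\<in>C. fscale (c (f d) j) d) = 0" by simp
    then have "c (f d) j = 0" if "d \<in> C" for d
      using fspace.independentD[OF C(2) C(1) subset_refl, of "\<lambda>d. c (f d) j"] that by blast
    then show ?case using less.prems(2) unfolding B_def by blast
  qed
  let ?w = "\<lambda>(b, j). (N ^^ j) b"
  have indep': "\<forall>i\<in>B \<times> {..<p}. c i = 0"
    if "(\<Sum>i\<in>B \<times> {..<p}. fscale (c i) (?w i)) = 0" for c
  proof -
    have "(\<Sum>b\<in>B. \<Sum>j<p. fscale (c (b, j)) ((N ^^ j) b)) = 0"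
      using that by (simp add: sum.cartesian_product case_prod_unfold)
    from indep[OF this] show ?thesis by auto
  qed
  have fin: "finite (B \<times> {..<p})" using B(1) by simp
  have "fspace.span (?w ` (B \<times> {..<p})) = V"
  proof (rule dim_eq_subspace[OF finV fspace.subspace_span])
    show "fspace.span (?w ` (B \<times> {..<p})) \<subseteq> V"
      by (rule fspace.span_minimal[OF _ subV]) (use B(2) N_pow_in in auto)
    show "fspace.dim V \<le> fspace.dim (fspace.span (?w ` (B \<times> {..<p})))"
    proof -
      have "fspace.independent (?w ` (B \<times> {..<p}))" by (rule independent_family(2)[OF fin indep'])
      moreover have "inj_on ?w (B \<times> {..<p})" by (rule independent_family(1)[OF fin indep'])
      ultimately show ?thesis using dW B(3)
        by (simp add: fspace.dim_eq_card_independent card_image card_cartesian_product mult.commute)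
    qed
  qed
  then have spanV: "fspace.span (?w ` (B \<times> {..<p})) = V" .
  have ex: "\<exists>c. x = (\<Sum>b\<in>B. \<Sum>j<p. fscale (c b j) ((N ^^ j) b))" if "x \<in> V" for x
  proof -
    have "x \<in> fspace.span (?w ` (B \<times> {..<p}))" using that unfolding spanV .
    then obtain c where "x = (\<Sum>i\<in>B \<times> {..<p}. fscale (c i) (?w i))" using span_image_finite[OF fin] by blast
    then show ?thesis by (intro exI[of _ "\<lambda>b j. c (b, j)"]) (simp add: sum.cartesian_product case_prod_unfold)
  qed
  show ?thesis unfolding free_over_cyclic_def M
  proof (intro exI[of _ B] conjI ballI B)
    fix x assume "x \<in> V"
    then obtain c where c: "x = (\<Sum>b\<in>B. \<Sum>j<p. fscale (c b j) ((N ^^ j) b))" using ex by blast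
    show "\<exists>!r. (\<forall>b\<in>B. r b \<in> cyc) \<and> (\<forall>b. b \<notin> B \<longrightarrow> r b = 0) \<and> x = (\<Sum>b\<in>B. ga_act M (r b) b)"
    proof (rule ex1I[of _ "\<lambda>b. if b \<in> B then comb (c b) else 0"])
      fix r assume r: "(\<forall>b\<in>B. r b \<in> cyc) \<and> (\<forall>b. b \<notin> B \<longrightarrow> r b = 0) \<and> x = (\<Sum>b\<in>B. ga_act M (r b) b)"
      then have "\<forall>b\<in>B. \<exists>c. r b = comb c" using cyc_comb by blast
      then obtain c' where c': "\<And>b. b \<in> B \<Longrightarrow> r b = comb (c' b)" by metis
      have "x = (\<Sum>b\<in>B. \<Sum>j<p. fscale (c' b j) ((N ^^ j) b))" using r c' by (simp add: comb_act)
      then have "(\<Sum>b\<in>B. \<Sum>j<p. fscale (c' b j - c b j) ((N ^^ j) b)) = 0"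
        using c by (simp add: fspace.scale_left_diff_distrib sum_subtractf)
      from indep[OF this] have "comb (c' b) = comb (c b)" if "b \<in> B" for b
        unfolding comb_def using that by (intro sum.cong refl) simp
      then have "r b = (if b \<in> B then comb (c b) else 0)" for b
        using c'[of b] r by (cases "b \<in> B") simp_all
      then show "r = (\<lambda>b. if b \<in> B then comb (c b) else 0)" by (rule ext)
    next
      show "(\<forall>b\<in>B. (if b \<in> B then comb (c b) else 0) \<in> cyc) \<and> (\<forall>b. b \<notin> B \<longrightarrow> (if b \<in> B then comb (c b) else 0) = 0)
        \<and> x = (\<Sum>b\<in>B. ga_act M (if b \<in> B then comb (c b) else 0) b)"
        using comb_cyc c by (simp add: comb_act)
    qed
  qed
qed

end

section \<open>A word model of Specht modules\<close>

text \<open>A tableau with cells \<open>D\<close> and entries \<open>X\<close> is stored as the pair of functions \<open>w\<close>, \<open>c\<close> that map an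
  entry to its row and its column; the word \<open>w\<close> alone is the tabloid. Words vanish outside \<open>X\<close>. The cell
  set \<open>D\<close> is arbitrary: adding an isolated cell to a Young diagram gives an induced Specht module.\<close>

definition colstab :: "nat set \<Rightarrow> (nat \<Rightarrow> nat) \<Rightarrow> (nat \<Rightarrow> nat) set" where
  "colstab X c = {\<pi>. \<pi> permutes X \<and> (\<forall>x\<in>X. c (\<pi> x) = c x)}"

text \<open>Words are functions of the entries, so permutations act from the right. The column
  stabilizer is closed under inversion and signs are unchanged by it, so this is the usual
  polytabloid.\<close>

definition ptb :: "nat set \<Rightarrow> (nat \<Rightarrow> nat) \<Rightarrow> (nat \<Rightarrow> nat) \<Rightarrow> ((nat \<Rightarrow> nat) \<Rightarrow>\<^sub>0 'k::field)" where
  "ptb X w c = (\<Sum>\<pi>\<in>colstab X c. Poly_Mapping.single (w \<circ> \<pi>) (of_int (sign \<pi>)))"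

definition filling :: "nat set \<Rightarrow> (nat \<times> nat) set \<Rightarrow> (nat \<Rightarrow> nat) \<Rightarrow> (nat \<Rightarrow> nat) \<Rightarrow> bool" where
  "filling X D w c \<longleftrightarrow> bij_betw (\<lambda>x. (w x, c x)) X D \<and> (\<forall>x. x \<notin> X \<longrightarrow> w x = 0)"

definition Sp :: "nat set \<Rightarrow> (nat \<times> nat) set \<Rightarrow> ((nat \<Rightarrow> nat) \<Rightarrow>\<^sub>0 'k::field) set" where
  "Sp X D = fspace.span {ptb X w c |w c. filling X D w c}"

text \<open>A right action: a group element \<open>g\<close> acts from the left by
  \<open>relabel\<close> of its inverse.\<close>

definition relabel :: "(nat \<Rightarrow> nat) \<Rightarrow> ((nat \<Rightarrow> nat) \<Rightarrow>\<^sub>0 'k::field) \<Rightarrow> ((nat \<Rightarrow> nat) \<Rightarrow>\<^sub>0 'k)" where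
  "relabel \<tau> = flift (\<lambda>w. sing (w \<circ> \<tau>))"

text \<open>Composition on the other side of the word commutes with every \<open>relabel\<close>,
  hence is a module homomorphism.\<close>

definition rowmap :: "(nat \<Rightarrow> nat) \<Rightarrow> ((nat \<Rightarrow> nat) \<Rightarrow>\<^sub>0 'k::field) \<Rightarrow> ((nat \<Rightarrow> nat) \<Rightarrow>\<^sub>0 'k)" where
  "rowmap \<rho> = flift (\<lambda>w. sing (\<rho> \<circ> w))"

lemma fillingD:
  assumes "filling X D w c"
  shows "x \<in> X \<Longrightarrow> (w x, c x) \<in> D" "x \<notin> X \<Longrightarrow> w x = 0"
    "x \<in> X \<Longrightarrow> y \<in> X \<Longrightarrow> w x = w y \<Longrightarrow> c x = c y \<Longrightarrow> x = y"
    "(i, j) \<in> D \<Longrightarrow> \<exists>x\<in>X. w x = i \<and> c x = j"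
proof -
  show "x \<in> X \<Longrightarrow> (w x, c x) \<in> D" "x \<notin> X \<Longrightarrow> w x = 0"
    using assms unfolding filling_def bij_betw_def by blast+
  show "x \<in> X \<Longrightarrow> y \<in> X \<Longrightarrow> w x = w y \<Longrightarrow> c x = c y \<Longrightarrow> x = y"
    using assms unfolding filling_def bij_betw_def inj_on_def by blast
  assume "(i, j) \<in> D"
  then have "(i, j) \<in> (\<lambda>x. (w x, c x)) ` X" using assms unfolding filling_def bij_betw_def by simp
  then show "\<exists>x\<in>X. w x = i \<and> c x = j" by auto
qed

lemma fillingI:
  assumes "\<And>x. x \<in> X \<Longrightarrow> (w x, c x) \<in> D" "\<And>x. x \<notin> X \<Longrightarrow> w x = 0"
    "\<And>x y. x \<in> X \<Longrightarrow> y \<in> X \<Longrightarrow> w x = w y \<Longrightarrow> c x = c y \<Longrightarrow> x = y"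
    "\<And>i j. (i, j) \<in> D \<Longrightarrow> \<exists>x\<in>X. w x = i \<and> c x = j"
  shows "filling X D w c"
  unfolding filling_def bij_betw_def inj_on_def using assms by (auto simp: image_iff) metis

lemma finite_colstab: "finite X \<Longrightarrow> finite (colstab X c)"
  unfolding colstab_def by (rule finite_subset[OF _ finite_permutations[of X]]) auto

lemma colstab_cong: "(\<And>x. x \<in> X \<Longrightarrow> c x = c' x) \<Longrightarrow> colstab X c = colstab X c'"
  unfolding colstab_def by (auto simp: permutes_in_image)

lemma ptb_cong: "(\<And>x. x \<in> X \<Longrightarrow> c x = c' x) \<Longrightarrow> ptb X w c = ptb X w c'"
  unfolding ptb_def using colstab_cong[of X c c'] by simp

lemma ptb_in_Sp: "filling X D w c \<Longrightarrow> ptb X w c \<in> Sp X D"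
  unfolding Sp_def by (rule fspace.span_base) blast

lemma subspace_Sp: "fspace.subspace (Sp X D)"
  unfolding Sp_def by (rule fspace.subspace_span)

lemma linear_image_Sp_le:
  assumes "flinear f" "fspace.subspace V" "\<And>w c. filling X D w c \<Longrightarrow> f (ptb X w c) \<in> V" "v \<in> Sp X D"
  shows "f v \<in> V"
proof -
  have "f v \<in> f ` Sp X D" using assms(4) by (rule imageI)
  also have "\<dots> = fspace.span (f ` {ptb X w c |w c. filling X D w c})"
    unfolding Sp_def by (rule fpair.linear_span_image[OF assms(1), symmetric])
  also have "\<dots> \<subseteq> V" by (rule fspace.span_minimal[OF _ assms(2)]) (use assms(3) in auto)
  finally show ?thesis .
qed

lemma linear_eq_on_Sp:
  assumes "flinear f" "flinear g" "\<And>w c. filling X D w c \<Longrightarrow> f (ptb X w c) = g (ptb X w c)" "v \<in> Sp X D"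
  shows "f v = g v"
proof (rule fpair.linear_eq_on[OF assms(1,2)])
  show "v \<in> fspace.span {ptb X w c |w c. filling X D w c}" using assms(4) unfolding Sp_def .
qed (use assms(3) in blast)

lemma Sp_le_image:
  assumes "flinear f" "fspace.subspace V" "\<And>w c. filling X D w c \<Longrightarrow> \<exists>v\<in>V. f v = ptb X w c"
  shows "Sp X D \<subseteq> f ` V"
  unfolding Sp_def by (rule fspace.span_minimal[OF _ subspace_image[OF assms(1,2)]]) (use assms(3) in force)

definition words :: "nat set \<Rightarrow> nat set \<Rightarrow> (nat \<Rightarrow> nat) set" where
  "words X R = {w. \<forall>x. (x \<in> X \<longrightarrow> w x \<in> R) \<and> (x \<notin> X \<longrightarrow> w x = 0)}"

lemma filling_word:
  assumes "filling X D w c" "\<pi> permutes X"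
  shows "w \<circ> \<pi> \<in> words X (fst ` D)"
proof -
  have "w (\<pi> x) \<in> fst ` D" if "x \<in> X" for x
    using fillingD(1)[OF assms(1), of "\<pi> x"] permutes_in_image[OF assms(2)] that by force
  moreover have "w (\<pi> x) = 0" if "x \<notin> X" for x
    using fillingD(2)[OF assms(1), of "\<pi> x"] permutes_in_image[OF assms(2)] that by force
  ultimately show ?thesis unfolding words_def by simp
qed

lemma ptb_in_span_words: "filling X D w c \<Longrightarrow> ptb X w c \<in> fspace.span (sing ` words X (fst ` D))"
  unfolding ptb_def
proof (rule fspace.span_sum)
  fix \<pi> assume "filling X D w c" "\<pi> \<in> colstab X c"
  then have "w \<circ> \<pi> \<in> words X (fst ` D)" using filling_word by (auto simp: colstab_def)
  then have "fscale (of_int (sign \<pi>)) (sing (w \<circ> \<pi>)) \<in> fspace.span (sing ` words X (fst ` D))"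
    by (intro fspace.span_scale fspace.span_base imageI)
  then show "Poly_Mapping.single (w \<circ> \<pi>) (of_int (sign \<pi>)) \<in> fspace.span (sing ` words X (fst ` D))" by simp
qed

lemma Sp_words: "Sp X D \<subseteq> fspace.span (sing ` words X (fst ` D))"
  unfolding Sp_def by (rule fspace.span_minimal[OF _ fspace.subspace_span]) (use ptb_in_span_words in auto)

lemma fin_dim_Sp:
  assumes "finite X" "finite D" shows "fin_dim (Sp X D)"
proof -
  have "finite (words X (fst ` D))"
    unfolding words_def by (rule finite_set_of_finite_funs) (use assms in auto)
  then show ?thesis using fin_dim_subset[OF fin_dim_span Sp_words] by blast
qed

text \<open>The involution matches the terms of sign 1 with those of sign -1. Splitting by sign
  avoids a division by 2, so characteristic 2 is included.\<close>

lemma sum_sign_cancel: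
  assumes "\<And>g. g \<in> G \<Longrightarrow> h g \<in> G" "\<And>g. g \<in> G \<Longrightarrow> h (h g) = g"
    "\<And>g. g \<in> G \<Longrightarrow> sign (h g) = - sign g" "\<And>g. g \<in> G \<Longrightarrow> F (h g) = F g" and fin: "finite G"
  shows "(\<Sum>g\<in>G. Poly_Mapping.single (F g) (of_int (sign g) :: 'k::field)) = 0"
proof -
  let ?s = "\<lambda>g. Poly_Mapping.single (F g) (of_int (sign g) :: 'k)"
  let ?P = "{g \<in> G. sign g = 1}" and ?M = "{g \<in> G. sign g = -1}"
  have PM: "G = ?P \<union> ?M" "?P \<inter> ?M = {}" by (auto simp: sign_def)
  have "sum ?s ?M = (\<Sum>g\<in>?P. - ?s g)"
    by (rule sum.reindex_bij_witness[of _ h h]) (use assms(1-4) in \<open>auto simp: single_uminus\<close>)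
  then have "sum ?s ?P + sum ?s ?M = 0" by (simp add: sum_negf)
  moreover have "sum ?s G = sum ?s ?P + sum ?s ?M"
    by (subst PM(1), rule sum.union_disjoint) (use PM(2) fin in auto)
  ultimately show ?thesis by simp
qed

lemma sign_compose_permutes:
  "finite X \<Longrightarrow> p permutes X \<Longrightarrow> q permutes X \<Longrightarrow> sign (p \<circ> q) = sign p * sign q"
  by (metis permutation_permutes sign_compose)

lemma ptb_zero:
  assumes X: "finite X" and xy: "x \<in> X" "y \<in> X" "x \<noteq> y" "w x = w y" "c x = c y"
  shows "ptb X w c = 0"
proof -
  let ?t = "transpose x y"
  have t: "?t permutes X" using xy by (intro permutes_swap_id)
  have wt: "w (?t z) = w z" and ct: "c (?t z) = c z" for z using xy by (auto simp: transpose_def)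
  show ?thesis unfolding ptb_def
  proof (rule sum_sign_cancel[where h = "\<lambda>\<pi>. ?t \<circ> \<pi>"])
    fix \<pi> assume \<pi>: "\<pi> \<in> colstab X c"
    then show "?t \<circ> \<pi> \<in> colstab X c" using t ct by (auto simp: colstab_def permutes_compose)
    show "?t \<circ> (?t \<circ> \<pi>) = \<pi>" by (auto simp: fun_eq_iff)
    show "sign (?t \<circ> \<pi>) = - sign \<pi>"
      using sign_compose_permutes[OF X t, of \<pi>] \<pi> xy by (simp add: colstab_def sign_swap_id)
    show "w \<circ> (?t \<circ> \<pi>) = w \<circ> \<pi>" using wt by (auto simp: fun_eq_iff)
  qed (rule finite_colstab[OF X])
qed

lemma flinear_relabel: "flinear (relabel \<tau>)" unfolding relabel_def by (rule flinear_flift)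
lemma flinear_rowmap: "flinear (rowmap \<rho>)" unfolding rowmap_def by (rule flinear_flift)

lemma relabel_single: "relabel \<tau> (Poly_Mapping.single w a) = Poly_Mapping.single (w \<circ> \<tau>) a"
  by (simp add: relabel_def)

lemma rowmap_single: "rowmap \<rho> (Poly_Mapping.single w a) = Poly_Mapping.single (\<rho> \<circ> w) a"
  by (simp add: rowmap_def)

lemma relabel_comp: "relabel \<sigma> (relabel \<tau> v) = relabel (\<tau> \<circ> \<sigma>) v"
  by (simp add: relabel_def flift_flift comp_assoc)

lemma relabel_id: "relabel id v = v"
  by (simp add: relabel_def)

lemma relabel_rowmap: "relabel \<tau> (rowmap \<rho> v) = rowmap \<rho> (relabel \<tau> v)"
  by (simp add: relabel_def rowmap_def flift_flift comp_assoc)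

lemma rowmap_ptb: "rowmap \<rho> (ptb X w c) = ptb X (\<rho> \<circ> w) c"
  unfolding ptb_def by (simp add: flinear_simps[OF flinear_rowmap] rowmap_single comp_assoc)

text \<open>The permutation lives on a larger finite set \<open>Z\<close>, so that it can carry
  \<open>Y\<close> onto a different set \<open>X\<close>. Conjugation by it identifies the two
  column stabilizers and preserves signs.\<close>

lemma relabel_ptb:
  assumes Z: "finite Z" "\<tau> permutes Z" and XY: "\<tau> ` Y = X" and X: "finite X"
  shows "relabel \<tau> (ptb X w c) = ptb Y (w \<circ> \<tau>) (c \<circ> \<tau>)"
proof -
  have inv: "inv_into UNIV \<tau> permutes Z" using Z(2) by (rule permutes_inv)
  have io: "inv_into UNIV \<tau> (\<tau> x) = x" "\<tau> (inv_into UNIV \<tau> x) = x" for x using permutes_inverses[OF Z(2)] by auto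
  have invX: "inv_into UNIV \<tau> ` X = Y" unfolding XY[symmetric] by (simp add: image_image io)
  have memX: "x \<in> X \<longleftrightarrow> inv_into UNIV \<tau> x \<in> Y" for x using XY invX io by (metis image_eqI)
  have conj: "\<sigma> \<circ> \<pi> \<circ> \<sigma>' permutes B"
    if "\<pi> permutes A" "\<And>x. \<sigma> (\<sigma>' x) = x" "\<And>x. \<sigma>' (\<sigma> x) = x" "\<And>x. x \<in> B \<longleftrightarrow> \<sigma>' x \<in> A" for \<sigma> \<sigma>' \<pi> :: "nat \<Rightarrow> nat" and A B
  proof -
    have "bij (\<sigma> \<circ> \<pi> \<circ> \<sigma>')"
      by (rule o_bij[of "\<sigma> \<circ> inv_into UNIV \<pi> \<circ> \<sigma>'"]) (use that permutes_inverses[OF that(1)] in \<open>auto simp: fun_eq_iff\<close>)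
    moreover have "(\<sigma> \<circ> \<pi> \<circ> \<sigma>') x = x" if "x \<notin> B" for x
      using that \<open>\<pi> permutes A\<close>[THEN permutes_not_in, of "\<sigma>' x"] \<open>\<And>x. x \<in> B \<longleftrightarrow> \<sigma>' x \<in> A\<close> \<open>\<And>x. \<sigma> (\<sigma>' x) = x\<close> by simp
    ultimately show ?thesis unfolding permutes_def by (simp add: bij_iff)
  qed
  have sgn: "sign (inv_into UNIV \<tau> \<circ> \<pi> \<circ> \<tau>) = sign \<pi>" if "\<pi> permutes X" for \<pi>
  proof -
    have p: "permutation \<tau>" "permutation (inv_into UNIV \<tau>)" "permutation \<pi>"
      using Z inv that X permutation_permutes by blast+
    then have "sign (inv_into UNIV \<tau> \<circ> \<pi> \<circ> \<tau>) = sign \<tau> * sign \<pi> * sign \<tau>"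
      by (simp add: sign_compose permutation_compose sign_inverse)
    then show ?thesis by (cases "evenperm \<tau>") (simp_all add: sign_def)
  qed
  have "relabel \<tau> (ptb X w c) = (\<Sum>\<pi>\<in>colstab X c. Poly_Mapping.single (w \<circ> \<pi> \<circ> \<tau>) (of_int (sign \<pi>)))"
    unfolding ptb_def by (simp add: flinear_simps[OF flinear_relabel] relabel_single)
  also have "\<dots> = ptb Y (w \<circ> \<tau>) (c \<circ> \<tau>)" unfolding ptb_def
  proof (rule sum.reindex_bij_witness[where j = "\<lambda>\<pi>. inv_into UNIV \<tau> \<circ> \<pi> \<circ> \<tau>" and i = "\<lambda>\<pi>. \<tau> \<circ> \<pi> \<circ> inv_into UNIV \<tau>"])
    fix \<pi> assume \<pi>: "\<pi> \<in> colstab X c"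
    then have pX: "\<pi> permutes X" by (simp add: colstab_def)
    show "\<tau> \<circ> (inv_into UNIV \<tau> \<circ> \<pi> \<circ> \<tau>) \<circ> inv_into UNIV \<tau> = \<pi>" by (auto simp: fun_eq_iff io)
    have "inv_into UNIV \<tau> \<circ> \<pi> \<circ> \<tau> permutes Y" by (rule conj[OF pX]) (use io memX in auto)
    moreover have "c (\<pi> (\<tau> x)) = c (\<tau> x)" if "x \<in> Y" for x using \<pi> that XY by (auto simp: colstab_def)
    ultimately show "inv_into UNIV \<tau> \<circ> \<pi> \<circ> \<tau> \<in> colstab Y (c \<circ> \<tau>)" by (simp add: colstab_def io)
    show "Poly_Mapping.single (w \<circ> \<tau> \<circ> (inv_into UNIV \<tau> \<circ> \<pi> \<circ> \<tau>)) (of_int (sign (inv_into UNIV \<tau> \<circ> \<pi> \<circ> \<tau>))) =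
        Poly_Mapping.single (w \<circ> \<pi> \<circ> \<tau>) (of_int (sign \<pi>))"
      unfolding sgn[OF pX] by (rule arg_cong2[of _ _ _ _ Poly_Mapping.single]) (auto simp: fun_eq_iff io)
  next
    fix \<pi> assume \<pi>: "\<pi> \<in> colstab Y (c \<circ> \<tau>)"
    then have pY: "\<pi> permutes Y" by (simp add: colstab_def)
    show "inv_into UNIV \<tau> \<circ> (\<tau> \<circ> \<pi> \<circ> inv_into UNIV \<tau>) \<circ> \<tau> = \<pi>" by (auto simp: fun_eq_iff io)
    have "\<tau> \<circ> \<pi> \<circ> inv_into UNIV \<tau> permutes X" by (rule conj[OF pY]) (use io memX in auto)
    moreover have "c (\<tau> (\<pi> (inv_into UNIV \<tau> x))) = c x" if "x \<in> X" for x
      using \<pi> that memX[of x] io by (auto simp: colstab_def)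
    ultimately show "\<tau> \<circ> \<pi> \<circ> inv_into UNIV \<tau> \<in> colstab X c" by (simp add: colstab_def)
  qed
  finally show ?thesis .
qed

lemma filling_relabel:
  assumes "filling X D w c" "bij \<tau>" "\<tau> ` Y = X"
  shows "filling Y D (w \<circ> \<tau>) (c \<circ> \<tau>)"
proof (rule fillingI)
  have m: "x \<in> Y \<longleftrightarrow> \<tau> x \<in> X" for x using assms(2,3) by (metis bij_is_inj inj_image_mem_iff)
  show "((w \<circ> \<tau>) x, (c \<circ> \<tau>) x) \<in> D" if "x \<in> Y" for x using that m fillingD(1)[OF assms(1)] by simp
  show "(w \<circ> \<tau>) x = 0" if "x \<notin> Y" for x using that m fillingD(2)[OF assms(1)] by simp
  show "x = y" if "x \<in> Y" "y \<in> Y" "(w \<circ> \<tau>) x = (w \<circ> \<tau>) y" "(c \<circ> \<tau>) x = (c \<circ> \<tau>) y" for x y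
    using fillingD(3)[OF assms(1), of "\<tau> x" "\<tau> y"] that m bij_is_inj[OF assms(2)] by (auto dest: injD)
  show "\<exists>x\<in>Y. (w \<circ> \<tau>) x = i \<and> (c \<circ> \<tau>) x = j" if "(i, j) \<in> D" for i j
    using fillingD(4)[OF assms(1) that] assms(3) by auto
qed

lemma relabel_Sp:
  assumes "finite X" "\<tau> permutes X" "v \<in> Sp X D"
  shows "relabel \<tau> v \<in> Sp X D"
proof (rule linear_image_Sp_le[OF flinear_relabel subspace_Sp _ assms(3)])
  fix w c assume f: "filling X D w c"
  have "relabel \<tau> (ptb X w c) = ptb X (w \<circ> \<tau>) (c \<circ> \<tau>)"
    by (rule relabel_ptb) (use assms permutes_image in auto)
  then show "relabel \<tau> (ptb X w c) \<in> Sp X D"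
    using ptb_in_Sp[OF filling_relabel[OF f permutes_bij permutes_image]] assms(2) by metis
qed

lemma dim_Sp_relabel:
  assumes Z: "finite Z" "\<tau> permutes Z" and XY: "\<tau> ` Y = X" and fin: "finite X" "finite D"
  shows "fspace.dim (Sp Y D :: ((nat \<Rightarrow> nat) \<Rightarrow>\<^sub>0 'k::field) set) \<le> fspace.dim (Sp X D :: (_ \<Rightarrow>\<^sub>0 'k) set)"
proof -
  have io: "inv_into UNIV \<tau> (\<tau> x) = x" "\<tau> (inv_into UNIV \<tau> x) = x" for x using permutes_inverses[OF Z(2)] by auto
  have invX: "inv_into UNIV \<tau> ` X = Y" unfolding XY[symmetric] by (simp add: image_image io)
  have "(Sp Y D :: (_ \<Rightarrow>\<^sub>0 'k) set) \<subseteq> relabel \<tau> ` Sp X D"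
  proof (rule Sp_le_image[OF flinear_relabel subspace_Sp])
    fix w c assume f: "filling Y D w c"
    have g: "filling X D (w \<circ> inv_into UNIV \<tau>) (c \<circ> inv_into UNIV \<tau>)"
      by (rule filling_relabel[OF f _ invX]) (use Z permutes_inv permutes_bij in blast)
    have "relabel \<tau> (ptb X (w \<circ> inv_into UNIV \<tau>) (c \<circ> inv_into UNIV \<tau>)) = (ptb Y (w \<circ> inv_into UNIV \<tau> \<circ> \<tau>) (c \<circ> inv_into UNIV \<tau> \<circ> \<tau>) :: _ \<Rightarrow>\<^sub>0 'k)"
      by (rule relabel_ptb[OF Z XY fin(1)])
    moreover have "w \<circ> inv_into UNIV \<tau> \<circ> \<tau> = w" "c \<circ> inv_into UNIV \<tau> \<circ> \<tau> = c" by (auto simp: fun_eq_iff io)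
    ultimately show "\<exists>v\<in>Sp X D. relabel \<tau> v = (ptb Y w c :: _ \<Rightarrow>\<^sub>0 'k)" using ptb_in_Sp[OF g] by auto
  qed
  then have "fspace.dim (Sp Y D :: (_ \<Rightarrow>\<^sub>0 'k) set) \<le> fspace.dim (relabel \<tau> ` (Sp X D :: (_ \<Rightarrow>\<^sub>0 'k) set))"
    by (rule dim_mono[OF fin_dim_image[OF fin_dim_Sp[OF fin] flinear_relabel]])
  also have "\<dots> \<le> fspace.dim (Sp X D :: (_ \<Rightarrow>\<^sub>0 'k) set)"
    by (rule dim_image_le[OF flinear_relabel subspace_Sp fin_dim_Sp[OF fin]])
  finally show ?thesis .
qed

section \<open>Restriction and induction of word-model Specht modules\<close>

text \<open>Partitions as functions from row indices, starting at 0, to row lengths.\<close>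

definition par :: "(nat \<Rightarrow> nat) \<Rightarrow> bool" where
  "par f \<longleftrightarrow> antimono f \<and> finite {i. f i \<noteq> 0}"

definition dg :: "(nat \<Rightarrow> nat) \<Rightarrow> (nat \<times> nat) set" where
  "dg f = {(i, j). j < f i}"

definition addable :: "(nat \<Rightarrow> nat) \<Rightarrow> nat set" where
  "addable f = {r. r = 0 \<or> f r < f (r - 1)}"

definition removable :: "(nat \<Rightarrow> nat) \<Rightarrow> nat set" where
  "removable f = {r. f (Suc r) < f r}"

definition inc_row :: "(nat \<Rightarrow> nat) \<Rightarrow> nat \<Rightarrow> (nat \<Rightarrow> nat)" where
  "inc_row f r = f(r := Suc (f r))"

definition dec_row :: "(nat \<Rightarrow> nat) \<Rightarrow> nat \<Rightarrow> (nat \<Rightarrow> nat)" where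
  "dec_row f r = f(r := f r - 1)"

lemma parD: "par f \<Longrightarrow> i \<le> j \<Longrightarrow> f j \<le> f i"
  by (simp add: par_def antimonoD)

lemma finite_dg: "par f \<Longrightarrow> finite (dg f)"
proof -
  assume f: "par f"
  have "dg f \<subseteq> (SIGMA i:{i. f i \<noteq> 0}. {..<f i})" by (auto simp: dg_def)
  then show ?thesis by (rule finite_subset) (use f in \<open>auto simp: par_def\<close>)
qed

lemma dg_inc: "dg (inc_row f r) = insert (r, f r) (dg f)"
  by (auto simp: dg_def inc_row_def split: if_splits)

lemma dg_dec: "dg (dec_row f r) = dg f - {(r, f r - 1)}"
  by (auto simp: dg_def dec_row_def split: if_splits)

lemma removable_subset: "removable f \<subseteq> {i. f i \<noteq> 0}"
  by (auto simp: removable_def)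

lemma addable_eq: "addable f = insert 0 (Suc ` removable f)"
proof (rule Set.set_eqI)
  fix r show "r \<in> addable f \<longleftrightarrow> r \<in> insert 0 (Suc ` removable f)"
    by (cases r) (auto simp: addable_def removable_def)
qed

lemma finite_removable: "par f \<Longrightarrow> finite (removable f)"
  by (rule finite_subset[OF removable_subset]) (simp add: par_def)

lemma finite_addable: "par f \<Longrightarrow> finite (addable f)"
  by (simp add: addable_eq finite_removable)

lemma antimono_natI: "(\<And>i. f (Suc i) \<le> f i) \<Longrightarrow> antimono (f :: nat \<Rightarrow> nat)"
  by (rule antimonoI) (rule lift_Suc_antimono_le)

lemma par_inc: "par f \<Longrightarrow> r \<in> addable f \<Longrightarrow> par (inc_row f r)"
proof -
  assume f: "par f" and r: "r \<in> addable f"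
  have "antimono (inc_row f r)"
    by (rule antimono_natI) (use r parD[OF f] in \<open>auto simp: inc_row_def addable_def le_Suc_eq\<close>)
  moreover have "{i. inc_row f r i \<noteq> 0} \<subseteq> insert r {i. f i \<noteq> 0}" by (auto simp: inc_row_def)
  ultimately show ?thesis using f unfolding par_def by (meson finite_insert finite_subset)
qed

lemma par_dec: "par f \<Longrightarrow> r \<in> removable f \<Longrightarrow> par (dec_row f r)"
proof -
  assume f: "par f" and r: "r \<in> removable f"
  have "antimono (dec_row f r)"
  proof (rule antimono_natI)
    fix i show "dec_row f r (Suc i) \<le> dec_row f r i"
      using r parD[OF f, of i "Suc i"] by (auto simp: dec_row_def removable_def)
  qed
  moreover have "{i. dec_row f r i \<noteq> 0} \<subseteq> {i. f i \<noteq> 0}" by (auto simp: dec_row_def)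
  ultimately show ?thesis using f unfolding par_def by (meson finite_subset)
qed

text \<open>The map of the classical branching rule: the tabloids with the entry \<open>z\<close> in
  row \<open>r\<close> survive, with \<open>z\<close> deleted.\<close>

definition restr :: "nat \<Rightarrow> nat \<Rightarrow> ((nat \<Rightarrow> nat) \<Rightarrow>\<^sub>0 'k::field) \<Rightarrow> ((nat \<Rightarrow> nat) \<Rightarrow>\<^sub>0 'k)" where
  "restr z r = flift (\<lambda>w. if w z = r then sing (w(z := 0)) else 0)"

lemma flinear_restr: "flinear (restr z r)" unfolding restr_def by (rule flinear_flift)

lemma restr_ptb: "restr z s (ptb X w c) = (\<Sum>\<pi>\<in>colstab X c. if w (\<pi> z) = s then Poly_Mapping.single ((w \<circ> \<pi>)(z := 0)) (of_int (sign \<pi>)) else 0)"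
  unfolding ptb_def by (simp add: flinear_simps[OF flinear_restr], intro sum.cong refl) (simp add: restr_def)

lemma colstab_fix: "z \<in> X \<Longrightarrow> colstab (X - {z}) c = {\<pi> \<in> colstab X c. \<pi> z = z}"
proof
  assume z: "z \<in> X"
  show "colstab (X - {z}) c \<subseteq> {\<pi> \<in> colstab X c. \<pi> z = z}"
  proof
    fix \<pi> assume "\<pi> \<in> colstab (X - {z}) c"
    then have \<pi>: "\<pi> permutes X - {z}" "\<And>x. x \<in> X - {z} \<Longrightarrow> c (\<pi> x) = c x" by (auto simp: colstab_def)
    have "\<pi> permutes X" by (rule permutes_subset[OF \<pi>(1)]) auto
    moreover have z: "\<pi> z = z" using permutes_not_in[OF \<pi>(1), of z] by simp
    moreover have "c (\<pi> x) = c x" if "x \<in> X" for x using \<pi>(2)[of x] z that by (cases "x = z") auto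
    ultimately show "\<pi> \<in> {\<pi> \<in> colstab X c. \<pi> z = z}" by (simp add: colstab_def)
  qed
  show "{\<pi> \<in> colstab X c. \<pi> z = z} \<subseteq> colstab (X - {z}) c"
    by (auto simp: colstab_def permutes_def)
qed

text \<open>The column that contains a removable node of row \<open>r\<close> at its end has no cell
  below row \<open>r\<close>. A column permutation can therefore move \<open>z\<close> only upwards,
  and keeps it in row \<open>r\<close> exactly when it fixes \<open>z\<close>.\<close>

lemma restr_eq:
  assumes w: "filling X (dg f) w c" and f: "par f" and z: "z \<in> X" and r: "r \<in> removable f" "w z = r" "c z = f r - 1"
    and X: "finite X" and s: "r \<le> s"
  shows "restr z s (ptb X w c) = (if s = r then ptb (X - {z}) (w(z := 0)) c else 0)"
proof -
  have row: "w (\<pi> z) \<le> r" "w (\<pi> z) = r \<longleftrightarrow> \<pi> z = z" if \<pi>: "\<pi> \<in> colstab X c" for \<pi>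
  proof -
    have pX: "\<pi> z \<in> X" "c (\<pi> z) = c z" using \<pi> z by (auto simp: colstab_def permutes_in_image)
    have "c z < f (w (\<pi> z))" using fillingD(1)[OF w pX(1)] pX(2) by (simp add: dg_def)
    then have "f r - 1 < f (w (\<pi> z))" using r(3) by simp
    then show "w (\<pi> z) \<le> r"
      using parD[OF f, of "Suc r" "w (\<pi> z)"] r(1) by (cases "r < w (\<pi> z)") (auto simp: removable_def)
    show "w (\<pi> z) = r \<longleftrightarrow> \<pi> z = z" using fillingD(3)[OF w pX(1) z] pX(2) r(2) by auto
  qed
  show ?thesis
  proof (cases "s = r")
    case False
    then have "restr z s (ptb X w c) = 0" unfolding restr_ptb using row(1) s
      by (intro sum.neutral ballI) (metis antisym)
    then show ?thesis using False by simp
  next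
    case True
    have "restr z s (ptb X w c) = (\<Sum>\<pi>\<in>colstab X c. if \<pi> z = z then Poly_Mapping.single ((w \<circ> \<pi>)(z := 0)) (of_int (sign \<pi>)) else 0)"
      unfolding restr_ptb using row(2) True by (intro sum.cong refl) auto
    also have "\<dots> = (\<Sum>\<pi>\<in>{\<pi> \<in> colstab X c. \<pi> z = z}. Poly_Mapping.single ((w \<circ> \<pi>)(z := 0)) (of_int (sign \<pi>)))"
      by (rule sum.inter_filter[symmetric, OF finite_colstab[OF X]])
    also have "\<dots> = ptb (X - {z}) (w(z := 0)) c" unfolding ptb_def colstab_fix[OF z]
    proof (rule sum.cong[OF refl])
      fix \<pi> assume \<pi>: "\<pi> \<in> {\<pi> \<in> colstab X c. \<pi> z = z}"
      then have "inj \<pi>" by (auto simp: colstab_def permutes_inj)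
      then have "\<pi> x = z \<longleftrightarrow> x = z" for x using \<pi> by (metis (mono_tags, lifting) injD mem_Collect_eq)
      then have "(w \<circ> \<pi>)(z := 0) = w(z := 0) \<circ> \<pi>" by (auto simp: fun_eq_iff)
      then show "Poly_Mapping.single ((w \<circ> \<pi>)(z := 0)) (of_int (sign \<pi>)) = Poly_Mapping.single (w(z := 0) \<circ> \<pi>) (of_int (sign \<pi>))"
        by simp
    qed
    finally show ?thesis using True by simp
  qed
qed

text \<open>Every polytabloid of a smaller diagram is the image of one with \<open>z\<close> in the
  removed node, and that preimage is annihilated by the restrictions to all lower rows. So each
  Specht module of a smaller diagram embeds into one step of the filtration.\<close>

lemma dim_restriction:
  fixes f :: "nat \<Rightarrow> nat"
  assumes f: "par f" and X: "finite X" and z: "z \<in> X"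
  shows "(\<Sum>r\<in>removable f. fspace.dim (Sp (X - {z}) (dg (dec_row f r)) :: (_ \<Rightarrow>\<^sub>0 'k::field) set))
    \<le> fspace.dim (Sp X (dg f) :: (_ \<Rightarrow>\<^sub>0 'k) set)"
proof -
  let ?V = "Sp X (dg f) :: (_ \<Rightarrow>\<^sub>0 'k) set"
  note finV = fin_dim_Sp[OF X finite_dg[OF f]]
  obtain R where R: "\<And>r. r \<in> removable f \<Longrightarrow> r < R"
    using finite_removable[OF f] finite_nat_set_iff_bounded by auto
  \<comment> \<open>The filtration takes the rows from the bottom upwards, that is, in decreasing
    order of the index.\<close>
  let ?h = "\<lambda>r. R - r"
  have inj: "inj_on ?h (removable f)"
  proof (rule inj_onI)
    fix x y assume xy: "x \<in> removable f" "y \<in> removable f" "R - x = R - y"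
    then show "x = y" using R[OF xy(1)] R[OF xy(2)] by arith
  qed
  let ?K = "\<lambda>r. {v \<in> ?V. \<forall>s\<in>removable f. ?h s < ?h r \<longrightarrow> restr z s v = 0}"
  have subK: "fspace.subspace (?K r)" for r
    using subspace_Sp[of X "dg f"] unfolding fspace.subspace_def by (auto simp: flinear_simps[OF flinear_restr])
  have ge: "fspace.dim (Sp (X - {z}) (dg (dec_row f r)) :: (_ \<Rightarrow>\<^sub>0 'k) set) \<le> fspace.dim (restr z r ` ?K r)"
    if r: "r \<in> removable f" for r
  proof (rule dim_mono)
    show "fin_dim (restr z r ` ?K r)" by (rule fin_dim_image[OF fin_dim_Collect[OF finV] flinear_restr])
    show "(Sp (X - {z}) (dg (dec_row f r)) :: (_ \<Rightarrow>\<^sub>0 'k) set) \<subseteq> restr z r ` ?K r"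
    proof (rule Sp_le_image[OF flinear_restr subK])
      fix w' c' assume w': "filling (X - {z}) (dg (dec_row f r)) w' c'"
      let ?w = "w'(z := r)" and ?c = "c'(z := f r - 1)"
      have rc: "(r, f r - 1) \<in> dg f" using r by (auto simp: dg_def removable_def)
      have w: "filling X (dg f) ?w ?c"
      proof (rule fillingI)
        show "(?w x, ?c x) \<in> dg f" if "x \<in> X" for x
          using fillingD(1)[OF w', of x] rc that by (auto simp: dg_dec)
        show "?w x = 0" if "x \<notin> X" for x using fillingD(2)[OF w', of x] that z by auto
        show "x = y" if "x \<in> X" "y \<in> X" "?w x = ?w y" "?c x = ?c y" for x y
          using fillingD(3)[OF w', of x y] fillingD(1)[OF w', of x] fillingD(1)[OF w', of y] that
          by (auto simp: dg_dec split: if_splits)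
        show "\<exists>x\<in>X. ?w x = i \<and> ?c x = j" if "(i, j) \<in> dg f" for i j
        proof (cases "(i, j) = (r, f r - 1)")
          case True then show ?thesis using z by (intro bexI[of _ z]) auto
        next
          case False
          then show ?thesis using fillingD(4)[OF w', of i j] that by (auto simp: dg_dec)
        qed
      qed
      have eq: "restr z s (ptb X ?w ?c) = (if s = r then ptb (X - {z}) (?w(z := 0)) ?c else 0 :: _ \<Rightarrow>\<^sub>0 'k)" if "r \<le> s" for s
        by (rule restr_eq[OF w f z r _ _ X that]) auto
      have "?w(z := 0) = w'" using fillingD(2)[OF w', of z] by auto
      then have "restr z r (ptb X ?w ?c) = (ptb (X - {z}) w' ?c :: _ \<Rightarrow>\<^sub>0 'k)" using eq[of r] by simp
      also have "\<dots> = ptb (X - {z}) w' c'" by (rule ptb_cong) auto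
      finally have 1: "restr z r (ptb X ?w ?c) = (ptb (X - {z}) w' c' :: _ \<Rightarrow>\<^sub>0 'k)" .
      have "(ptb X ?w ?c :: _ \<Rightarrow>\<^sub>0 'k) \<in> ?K r"
        using ptb_in_Sp[OF w] eq R r by (auto simp: less_imp_le)
      then show "\<exists>v\<in>?K r. restr z r v = ptb (X - {z}) w' c'" using 1 by blast
    qed
  qed
  have "fspace.dim ?V = (\<Sum>r\<in>removable f. fspace.dim (restr z r ` ?K r)) + fspace.dim {v \<in> ?V. \<forall>r\<in>removable f. restr z r v = 0}"
    by (rule dim_filtration[OF subspace_Sp finV flinear_restr finite_removable[OF f] inj])
  moreover have "(\<Sum>r\<in>removable f. fspace.dim (Sp (X - {z}) (dg (dec_row f r)) :: (_ \<Rightarrow>\<^sub>0 'k) set))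
      \<le> (\<Sum>r\<in>removable f. fspace.dim (restr z r ` ?K r))"
    by (rule sum_mono) (rule ge)
  ultimately show ?thesis by linarith
qed

section \<open>The induced module and its row maps\<close>

definition repl :: "nat \<Rightarrow> nat \<Rightarrow> nat \<Rightarrow> nat" where
  "repl E r i = (if i = E then r else i)"

text \<open>The isolated cell \<open>(E, F)\<close> turns the Specht module of \<open>f\<close> into the induced one.\<close>

locale induced =
  fixes f :: "nat \<Rightarrow> nat" and E F :: nat and X :: "nat set"
  assumes f: "par f" and E0: "f E = 0" "E \<noteq> 0" and EA: "E \<notin> addable f" and F: "f 0 \<le> F" and X: "finite X"
begin

text \<open>The new cell is alone in its row and its column, and \<open>E\<close> differs from 0,
  the value of words outside \<open>X\<close>; so the letter \<open>E\<close> occurs exactly once in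
  every word and marks the entry of the added node.\<close>

definition "DM = insert (E, F) (dg f)"

lemma finDM: "finite DM" by (simp add: DM_def finite_dg[OF f])

lemma dgF: "(i, j) \<in> dg f \<Longrightarrow> j < F \<and> i \<noteq> E"
  using parD[OF f, of 0 i] F E0 by (auto simp: dg_def)

lemma fin_dim_M: "fin_dim (Sp X DM)" by (rule fin_dim_Sp[OF X finDM])

lemma extra_letter:
  assumes "filling X DM w c"
  obtains x where "x \<in> X" "w x = E" "c x = F" "\<forall>y. w y = E \<longleftrightarrow> y = x" "\<forall>y\<in>X. c y = F \<longleftrightarrow> y = x"
proof -
  obtain x where x: "x \<in> X" "w x = E" "c x = F" using fillingD(4)[OF assms, of E F] by (auto simp: DM_def)
  have 1: "(w y, c y) = (E, F) \<or> (c y < F \<and> w y \<noteq> E)" if "y \<in> X" for y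
    using fillingD(1)[OF assms that] dgF unfolding DM_def by blast
  have "y = x" if y: "y \<in> X" "w y = E" for y using fillingD(3)[OF assms y(1) x(1)] 1[OF y(1)] y x by auto
  moreover have "w y \<noteq> E" if "y \<notin> X" for y using fillingD(2)[OF assms that] E0 by simp
  moreover have "y = x" if y: "y \<in> X" "c y = F" for y using fillingD(3)[OF assms y(1) x(1)] 1[OF y(1)] y x by auto
  ultimately show thesis using x by (intro that[of x]) blast+
qed

text \<open>The coset sum: the column through \<open>x\<^sub>0\<close> is antisymmetrised in two steps, first over the stabiliser of
  \<open>x\<^sub>0\<close> and then over the transpositions \<open>(x\<^sub>0 y)\<close>.\<close>

lemma lifted_ptb_in_M:
  assumes r: "r \<in> addable f" and w: "filling X (dg (inc_row f r)) w c" and x0: "x0 \<in> X" "w x0 = r" "c x0 = f r"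
  shows "(ptb X (w(x0 := E)) c :: _ \<Rightarrow>\<^sub>0 'k::field) \<in> Sp X DM"
proof -
  let ?w = "w(x0 := E)" and ?c = "c(x0 := F)"
  let ?Y = "{y \<in> X. c y = c x0}"
  have rE: "r \<noteq> E" using r EA by blast
  have cell: "(w x, c x) \<in> dg f" if "x \<in> X" "x \<noteq> x0" for x
    using fillingD(1)[OF w that(1)] fillingD(3)[OF w that(1) x0(1)] x0 that(2) unfolding dg_inc by auto
  have fil: "filling X DM ?w ?c"
  proof (rule fillingI)
    show "(?w x, ?c x) \<in> DM" if "x \<in> X" for x using cell[of x] that by (auto simp: DM_def)
    show "?w x = 0" if "x \<notin> X" for x using fillingD(2)[OF w that] x0 that by auto
    show "x = y" if xy: "x \<in> X" "y \<in> X" "?w x = ?w y" "?c x = ?c y" for x y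
      using fillingD(3)[OF w xy(1,2)] cell[of x] cell[of y] xy dgF by (auto split: if_splits)
    show "\<exists>x\<in>X. ?w x = i \<and> ?c x = j" if "(i, j) \<in> DM" for i j
    proof (cases "(i, j) = (E, F)")
      case True then show ?thesis using x0 by (intro bexI[of _ x0]) auto
    next
      case False
      then have ij: "(i, j) \<in> dg f" using that unfolding DM_def by blast
      then obtain x where x: "x \<in> X" "w x = i" "c x = j" using fillingD(4)[OF w, of i j] by (auto simp: dg_inc)
      then have "x \<noteq> x0" using ij x0 by (auto simp: dg_def)
      then show ?thesis using x by (intro bexI[of _ x]) auto
    qed
  qed
  have cF: "c x \<noteq> F" if "x \<in> X" "x \<noteq> x0" for x using cell[OF that] dgF by blast
  have cs: "colstab X ?c = {\<pi> \<in> colstab X c. \<pi> x0 = x0}"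
  proof (intro Set.set_eqI iffI)
    fix \<pi> assume \<pi>: "\<pi> \<in> colstab X ?c"
    then have p: "\<pi> permutes X" by (simp add: colstab_def)
    have "?c (\<pi> x0) = F" using \<pi> x0(1) by (auto simp: colstab_def)
    then have 1: "\<pi> x0 = x0" using cF[of "\<pi> x0"] permutes_in_image[OF p] x0(1) by (auto split: if_splits)
    have "c (\<pi> x) = c x" if "x \<in> X" for x
    proof (cases "x = x0")
      case False
      then have "\<pi> x \<noteq> x0" using 1 inj_eq[OF permutes_inj[OF p], of x x0] by simp
      moreover have "?c (\<pi> x) = ?c x" using \<pi> that by (simp add: colstab_def)
      ultimately show ?thesis using False by simp
    qed (simp add: 1)
    then show "\<pi> \<in> {\<pi> \<in> colstab X c. \<pi> x0 = x0}" using p 1 by (simp add: colstab_def)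
  next
    fix \<pi> assume \<pi>: "\<pi> \<in> {\<pi> \<in> colstab X c. \<pi> x0 = x0}"
    then have p: "\<pi> permutes X" "\<pi> x0 = x0" by (auto simp: colstab_def)
    have "\<pi> x = x0 \<longleftrightarrow> x = x0" for x using p(2) inj_eq[OF permutes_inj[OF p(1)], of x x0] by simp
    then show "\<pi> \<in> colstab X ?c" using \<pi> by (auto simp: colstab_def)
  qed
  have part: "(\<Sum>\<pi>\<in>{\<pi> \<in> colstab X c. inv_into UNIV \<pi> x0 = y}. Poly_Mapping.single (?w \<circ> \<pi>) (of_int (sign \<pi>) :: 'k))
      = fscale (of_int (sign (transpose x0 y))) (relabel (transpose x0 y) (ptb X ?w ?c))" if y: "y \<in> ?Y" for y
  proof -
    let ?t = "transpose x0 y"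
    have t: "?t permutes X" using x0 y by (intro permutes_swap_id) auto
    have ct: "c (?t x) = c x" for x using y by (auto simp: transpose_def)
    have "(\<Sum>\<pi>\<in>{\<pi> \<in> colstab X c. inv_into UNIV \<pi> x0 = y}. Poly_Mapping.single (?w \<circ> \<pi>) (of_int (sign \<pi>) :: 'k))
      = (\<Sum>\<pi>\<in>colstab X ?c. Poly_Mapping.single (?w \<circ> \<pi> \<circ> ?t) (of_int (sign ?t * sign \<pi>)))"
      unfolding cs
    proof (rule sum.reindex_bij_witness[where i = "\<lambda>\<pi>. \<pi> \<circ> ?t" and j = "\<lambda>\<pi>. \<pi> \<circ> ?t"])
      fix \<pi> assume \<pi>: "\<pi> \<in> {\<pi> \<in> colstab X c. inv_into UNIV \<pi> x0 = y}"
      then have p: "\<pi> permutes X" by (auto simp: colstab_def)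
      have "\<pi> y = x0" using \<pi> permutes_inverses[OF p] by auto
      then show "\<pi> \<circ> ?t \<in> {\<pi> \<in> colstab X c. \<pi> x0 = x0}"
        using \<pi> p t ct permutes_in_image[OF t] by (auto simp: colstab_def permutes_compose)
      show "\<pi> \<circ> ?t \<circ> ?t = \<pi>" by (auto simp: fun_eq_iff)
      show "Poly_Mapping.single (?w \<circ> (\<pi> \<circ> ?t) \<circ> ?t) (of_int (sign ?t * sign (\<pi> \<circ> ?t))) = Poly_Mapping.single (?w \<circ> \<pi>) (of_int (sign \<pi>) :: 'k)"
      proof -
        have "?w \<circ> (\<pi> \<circ> ?t) \<circ> ?t = ?w \<circ> \<pi>" by (auto simp: fun_eq_iff)
        moreover have "sign ?t * sign (\<pi> \<circ> ?t) = sign \<pi>"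
          using sign_compose_permutes[OF X p t] by (simp add: sign_swap_id)
        ultimately show ?thesis by simp
      qed
    next
      fix \<pi> assume \<pi>: "\<pi> \<in> {\<pi> \<in> colstab X c. \<pi> x0 = x0}"
      then have p: "\<pi> permutes X" by (auto simp: colstab_def)
      have pt: "\<pi> \<circ> ?t permutes X" using p t by (rule permutes_compose[rotated])
      have "(\<pi> \<circ> ?t) y = x0" using \<pi> by simp
      then have "inv_into UNIV (\<pi> \<circ> ?t) x0 = y" using permutes_inverses(2)[OF pt, of y] by metis
      then show "\<pi> \<circ> ?t \<in> {\<pi> \<in> colstab X c. inv_into UNIV \<pi> x0 = y}"
        using pt \<pi> ct permutes_in_image[OF t] by (auto simp: colstab_def)
      show "\<pi> \<circ> ?t \<circ> ?t = \<pi>" by (auto simp: fun_eq_iff)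
    qed
    also have "\<dots> = fscale (of_int (sign ?t)) (relabel ?t (ptb X ?w ?c))"
      unfolding ptb_def by (simp add: flinear_simps[OF flinear_relabel] relabel_single fspace.scale_sum_right)
    finally show ?thesis .
  qed
  have "ptb X ?w c = (\<Sum>y\<in>?Y. \<Sum>\<pi>\<in>{\<pi> \<in> colstab X c. inv_into UNIV \<pi> x0 = y}. Poly_Mapping.single (?w \<circ> \<pi>) (of_int (sign \<pi>) :: 'k))"
    unfolding ptb_def
  proof (rule sum.group[symmetric, OF finite_colstab[OF X]])
    show "finite ?Y" using X by simp
    show "(\<lambda>\<pi>. inv_into UNIV \<pi> x0) ` colstab X c \<subseteq> ?Y"
    proof
      fix y assume "y \<in> (\<lambda>\<pi>. inv_into UNIV \<pi> x0) ` colstab X c"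
      then obtain \<pi> where \<pi>: "\<pi> \<in> colstab X c" "y = inv_into UNIV \<pi> x0" by blast
      then have p: "\<pi> permutes X" by (simp add: colstab_def)
      have "\<pi> y = x0" using permutes_inverses[OF p] \<pi>(2) by simp
      then show "y \<in> ?Y" using \<pi>(1) x0(1) permutes_in_image[OF p, of y] by (auto simp: colstab_def)
    qed
  qed
  also have "\<dots> = (\<Sum>y\<in>?Y. fscale (of_int (sign (transpose x0 y))) (relabel (transpose x0 y) (ptb X ?w ?c)))"
    by (rule sum.cong[OF refl part])
  also have "\<dots> \<in> Sp X DM"
  proof (intro fspace.subspace_sum[OF subspace_Sp] fspace.subspace_scale[OF subspace_Sp] relabel_Sp[OF X _ ptb_in_Sp[OF fil]])
    fix y assume "y \<in> ?Y"
    then show "transpose x0 y permutes X" using x0 by (intro permutes_swap_id) auto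
  qed
  finally show ?thesis .
qed

text \<open>The step of the filtration on which the row map into row \<open>r\<close> is considered.
  Without the vanishing on smaller rows its image can exceed the Specht module.\<close>

definition "K r = {v \<in> Sp X DM. \<forall>i\<in>addable f. i < r \<longrightarrow> rowmap (repl E i) v = 0}"

lemma subspace_K: "fspace.subspace (K r)"
  using subspace_Sp[of X DM] unfolding K_def fspace.subspace_def by (auto simp: flinear_simps[OF flinear_rowmap])

lemma fin_dim_K: "fin_dim (K r)" unfolding K_def by (rule fin_dim_Collect[OF fin_dim_M])

text \<open>A preimage is obtained by writing \<open>E\<close> for the letter of the new node,
  keeping its column. Moving \<open>E\<close> into an addable row \<open>i < r\<close> instead
  produces two equal letters in one column, because row \<open>i\<close> is longer than row
  \<open>r\<close> and so already meets the column \<open>f r\<close>.\<close>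

lemma Sp_inc_subset:
  assumes r: "r \<in> addable f"
  shows "Sp X (dg (inc_row f r)) \<subseteq> rowmap (repl E r) ` K r"
proof (rule Sp_le_image[OF flinear_rowmap subspace_K])
  fix w c assume w: "filling X (dg (inc_row f r)) w c"
  obtain x0 where x0: "x0 \<in> X" "w x0 = r" "c x0 = f r" using fillingD(4)[OF w, of r "f r"] by (auto simp: dg_inc)
  let ?v = "ptb X (w(x0 := E)) c"
  have rE: "r \<noteq> E" using r EA by blast
  have wE: "w x \<noteq> E" for x
  proof (cases "x \<in> X")
    case True
    from fillingD(1)[OF w this, unfolded dg_inc] show ?thesis using rE E0 by (auto simp: dg_def)
  next
    case False
    from fillingD(2)[OF w this] show ?thesis using E0 by simp
  qed
  have "repl E r \<circ> w(x0 := E) = w" using wE x0 by (auto simp: fun_eq_iff repl_def)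
  then have 1: "rowmap (repl E r) ?v = ptb X w c" by (simp add: rowmap_ptb)
  have "rowmap (repl E i) ?v = 0" if i: "i \<in> addable f" "i < r" for i
  proof -
    have "f r < f (r - 1)" using r i by (auto simp: addable_def)
    moreover have "i \<le> r - 1" using i(2) by simp
    ultimately have "f r < f i" using parD[OF f, of i "r - 1"] by simp
    then obtain y where y: "y \<in> X" "w y = i" "c y = f r"
      using fillingD(4)[OF w[unfolded dg_inc], of i "f r"] by (auto simp: dg_def)
    then have "y \<noteq> x0" using x0 i by auto
    then show ?thesis unfolding rowmap_ptb
      by (intro ptb_zero[of X x0 y]) (use X x0 y wE in \<open>auto simp: repl_def\<close>)
  qed
  then have "?v \<in> K r" unfolding K_def using lifted_ptb_in_M[OF r w x0] by blast
  then show "\<exists>v\<in>K r. rowmap (repl E r) v = ptb X w c" using 1 by blast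
qed

text \<open>The common kernel of the row maps remains as an error term. It is removed only later, by
  comparing dimensions.\<close>

lemma dim_induced_filtration:
  "fspace.dim (Sp X DM :: (_ \<Rightarrow>\<^sub>0 'k::field) set) =
    (\<Sum>r\<in>addable f. fspace.dim (rowmap (repl E r) ` K r :: (_ \<Rightarrow>\<^sub>0 'k) set)) +
    fspace.dim {v \<in> Sp X DM :: (_ \<Rightarrow>\<^sub>0 'k) set. \<forall>r\<in>addable f. rowmap (repl E r) v = 0}"
  unfolding K_def
  by (rule dim_filtration[where h = "\<lambda>i. i", OF subspace_Sp fin_dim_M flinear_rowmap finite_addable[OF f]]) simp

lemma dim_inc_le:
  assumes r: "r \<in> addable f"
  shows "fspace.dim (Sp X (dg (inc_row f r)) :: (_ \<Rightarrow>\<^sub>0 'k::field) set) \<le> fspace.dim (rowmap (repl E r) ` K r :: (_ \<Rightarrow>\<^sub>0 'k) set)"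
  by (rule dim_mono[OF fin_dim_image[OF fin_dim_K flinear_rowmap] Sp_inc_subset[OF r]])

section \<open>The grading of the induced module by the entry of the isolated cell\<close>

definition component :: "nat \<Rightarrow> ((nat \<Rightarrow> nat) \<Rightarrow>\<^sub>0 'k::field) \<Rightarrow> ((nat \<Rightarrow> nat) \<Rightarrow>\<^sub>0 'k)" where
  "component x = flift (\<lambda>w. if w x = E then sing w else 0)"

lemma flinear_component: "flinear (component x)" unfolding component_def by (rule flinear_flift)

lemma component_ptb:
  assumes "filling X DM w c"
  shows "component x (ptb X w c) = (if w x = E then ptb X w c else 0)"
proof -
  obtain y where y': "y \<in> X" "w y = E" "c y = F" "\<forall>z. w z = E \<longleftrightarrow> z = y" "\<forall>z\<in>X. c z = F \<longleftrightarrow> z = y"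
    by (rule extra_letter[OF assms])
  note y = y'(1-3) y'(4)[rule_format] y'(5)[rule_format]
  have "w (\<pi> x) = E \<longleftrightarrow> w x = E" if \<pi>: "\<pi> \<in> colstab X c" for \<pi>
  proof -
    have p: "\<pi> permutes X" using \<pi> by (simp add: colstab_def)
    have "c (\<pi> y) = F" using \<pi> y by (auto simp: colstab_def)
    then have "\<pi> y = y" using y(5)[of "\<pi> y"] permutes_in_image[OF p] y(1) by simp
    then show ?thesis using y(4) permutes_inj[OF p] by (metis injD)
  qed
  then have *: "component x (Poly_Mapping.single (w \<circ> \<pi>) a) = (if w x = E then Poly_Mapping.single (w \<circ> \<pi>) a else 0)"
    if "\<pi> \<in> colstab X c" for \<pi> a using that by (simp add: component_def)
  have "component x (ptb X w c) = (\<Sum>\<pi>\<in>colstab X c. component x (Poly_Mapping.single (w \<circ> \<pi>) (of_int (sign \<pi>))))"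
    unfolding ptb_def by (rule flinear_simps(3)[OF flinear_component])
  also have "\<dots> = (if w x = E then ptb X w c else 0)" by (simp add: * ptb_def)
  finally show ?thesis .
qed

lemma sum_component:
  assumes "v \<in> Sp X DM"
  shows "v = (\<Sum>x\<in>X. component x v)"
proof (rule linear_eq_on_Sp[OF flinear_ident _ _ assms])
  show "flinear (\<lambda>v. \<Sum>x\<in>X. component x v)" by (intro flinear_sum flinear_component)
  fix w c assume w: "filling X DM w c"
  obtain y where y': "y \<in> X" "w y = E" "c y = F" "\<forall>z. w z = E \<longleftrightarrow> z = y" "\<forall>z\<in>X. c z = F \<longleftrightarrow> z = y"
    by (rule extra_letter[OF w])
  note y = y'(1-3) y'(4)[rule_format] y'(5)[rule_format]
  show "ptb X w c = (\<Sum>x\<in>X. component x (ptb X w c))"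
    unfolding component_ptb[OF w] using y(1) X by (simp add: y(4))
qed

definition insert_letter :: "nat \<Rightarrow> ((nat \<Rightarrow> nat) \<Rightarrow>\<^sub>0 'k::field) \<Rightarrow> ((nat \<Rightarrow> nat) \<Rightarrow>\<^sub>0 'k)" where
  "insert_letter x = flift (\<lambda>w. sing (w(x := E)))"

text \<open>The isolated cell is alone in its column, so the column stabilizer fixes its entry
  \<open>x\<close> and equals that of the tableau with \<open>x\<close> deleted.\<close>

lemma component_subset:
  assumes x: "x \<in> X"
  shows "component x ` Sp X DM \<subseteq> insert_letter x ` (Sp (X - {x}) (dg f) :: (_ \<Rightarrow>\<^sub>0 'k::field) set)"
proof
  fix u :: "(nat \<Rightarrow> nat) \<Rightarrow>\<^sub>0 'k" assume "u \<in> component x ` Sp X DM"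
  then obtain v where v: "u = component x v" "v \<in> Sp X DM" by blast
  have lin: "flinear (insert_letter x)" unfolding insert_letter_def by (rule flinear_flift)
  have "component x v \<in> insert_letter x ` Sp (X - {x}) (dg f)"
  proof (rule linear_image_Sp_le[OF flinear_component subspace_image[OF lin subspace_Sp] _ v(2)])
    fix w c assume w: "filling X DM w c"
    show "component x (ptb X w c) \<in> insert_letter x ` (Sp (X - {x}) (dg f) :: (_ \<Rightarrow>\<^sub>0 'k) set)"
    proof (cases "w x = E")
      case False
      then have "component x (ptb X w c) = (0 :: _ \<Rightarrow>\<^sub>0 'k)" by (simp add: component_ptb[OF w])
      moreover have "fspace.subspace (insert_letter x ` (Sp (X - {x}) (dg f) :: (_ \<Rightarrow>\<^sub>0 'k) set))"
        by (rule subspace_image[OF lin subspace_Sp])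
      ultimately show ?thesis using fspace.subspace_0[of "insert_letter x ` (Sp (X - {x}) (dg f) :: (_ \<Rightarrow>\<^sub>0 'k) set)"] by simp
    next
      case True
      obtain y where y': "y \<in> X" "w y = E" "c y = F" "\<forall>z. w z = E \<longleftrightarrow> z = y" "\<forall>z\<in>X. c z = F \<longleftrightarrow> z = y"
        by (rule extra_letter[OF w])
      note y = y'(1-3) y'(4)[rule_format] y'(5)[rule_format]
      have xy: "x = y" using True y(4) by simp
      let ?w = "w(x := 0)"
      have fil: "filling (X - {x}) (dg f) ?w c"
      proof (rule fillingI)
        show "(?w z, c z) \<in> dg f" if "z \<in> X - {x}" for z
          using fillingD(1)[OF w, of z] y(4)[of z] that xy by (auto simp: DM_def)
        show "?w z = 0" if "z \<notin> X - {x}" for z using fillingD(2)[OF w, of z] that by auto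
        show "z = z'" if "z \<in> X - {x}" "z' \<in> X - {x}" "?w z = ?w z'" "c z = c z'" for z z'
          using fillingD(3)[OF w, of z z'] that by auto
        show "\<exists>z\<in>X - {x}. ?w z = i \<and> c z = j" if "(i, j) \<in> dg f" for i j
        proof -
          have "(i, j) \<in> DM" using that by (simp add: DM_def)
          from fillingD(4)[OF w this] obtain z where z: "z \<in> X" "w z = i" "c z = j" by blast
          then have "z \<noteq> x" using dgF[OF that] True by auto
          then show ?thesis using z by (intro bexI[of _ z]) auto
        qed
      qed
      have pix: "\<pi> x = x" "\<And>z. \<pi> z = x \<longleftrightarrow> z = x" if \<pi>: "\<pi> \<in> colstab X c" for \<pi>
      proof -
        have p: "\<pi> permutes X" using \<pi> by (simp add: colstab_def)
        have "c (\<pi> y) = F" using \<pi> y by (auto simp: colstab_def)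
        then show "\<pi> x = x" using y(5)[of "\<pi> y"] permutes_in_image[OF p] y(1) xy by simp
        then show "\<And>z. \<pi> z = x \<longleftrightarrow> z = x" using permutes_inj[OF p] by (metis injD)
      qed
      then have "colstab X c = colstab (X - {x}) c" unfolding colstab_fix[OF x] by blast
      moreover have "(?w \<circ> \<pi>)(x := E) = w \<circ> \<pi>" if "\<pi> \<in> colstab X c" for \<pi>
      proof (rule ext)
        fix z show "((?w \<circ> \<pi>)(x := E)) z = (w \<circ> \<pi>) z"
          using pix(1)[OF that] pix(2)[OF that, of z] True by (cases "z = x") simp_all
      qed
      ultimately have "insert_letter x (ptb (X - {x}) ?w c) = ptb X w c"
        unfolding ptb_def flinear_simps[OF lin] by (intro sum.cong) (simp_all add: insert_letter_def)
      then show ?thesis unfolding component_ptb[OF w] using True ptb_in_Sp[OF fil] by (metis imageI)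
    qed
  qed
  then show "u \<in> insert_letter x ` Sp (X - {x}) (dg f)" using v by simp
qed

lemma dim_component_le:
  assumes x: "x \<in> X"
  shows "fspace.dim (component x ` Sp X DM :: (_ \<Rightarrow>\<^sub>0 'k::field) set) \<le> fspace.dim (Sp (X - {x}) (dg f) :: (_ \<Rightarrow>\<^sub>0 'k) set)"
proof -
  have lin: "flinear (insert_letter x)" unfolding insert_letter_def by (rule flinear_flift)
  have fd: "fin_dim (Sp (X - {x}) (dg f))" by (rule fin_dim_Sp) (use X finite_dg[OF f] in auto)
  have "fspace.dim (component x ` Sp X DM :: (_ \<Rightarrow>\<^sub>0 'k) set) \<le> fspace.dim (insert_letter x ` Sp (X - {x}) (dg f) :: (_ \<Rightarrow>\<^sub>0 'k) set)"
    by (rule dim_mono[OF fin_dim_image[OF fd lin] component_subset[OF x]])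
  also have "\<dots> \<le> fspace.dim (Sp (X - {x}) (dg f) :: (_ \<Rightarrow>\<^sub>0 'k) set)"
    by (rule dim_image_le[OF lin subspace_Sp fd])
  finally show ?thesis .
qed

text \<open>Formulated for a subspace and a set of entries that detects it, since two cases are
  needed: the whole module with all entries, and the kernel of a pencil with one entry per
  block.\<close>

lemma dim_le_components:
  assumes V: "fspace.subspace V" "V \<subseteq> Sp X DM" and I: "I \<subseteq> X" and ker: "\<And>v. v \<in> V \<Longrightarrow> \<forall>x\<in>I. component x v = 0 \<Longrightarrow> v = 0"
  shows "fspace.dim (V :: (_ \<Rightarrow>\<^sub>0 'k::field) set) \<le> (\<Sum>x\<in>I. fspace.dim (Sp (X - {x}) (dg f) :: (_ \<Rightarrow>\<^sub>0 'k) set))"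
proof -
  have finV: "fin_dim V" by (rule fin_dim_subset[OF fin_dim_M V(2)])
  have finI: "finite I" using I X finite_subset by blast
  have z: "{v \<in> V. \<forall>x\<in>I. component x v = 0} = {0}"
    using ker fspace.subspace_0[OF V(1)] flinear_simps(4)[OF flinear_component] by auto
  have "fspace.dim V = (\<Sum>x\<in>I. fspace.dim (component x ` {v \<in> V. \<forall>j\<in>I. j < x \<longrightarrow> component j v = 0}))
      + fspace.dim {v \<in> V. \<forall>x\<in>I. component x v = 0}"
    by (rule dim_filtration[where h = "\<lambda>i. i", OF V(1) finV flinear_component finI]) simp
  then have "fspace.dim V = (\<Sum>x\<in>I. fspace.dim (component x ` {v \<in> V. \<forall>j\<in>I. j < x \<longrightarrow> component j v = 0}))"
    unfolding z dim_zero_space by simp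
  also have "\<dots> \<le> (\<Sum>x\<in>I. fspace.dim (Sp (X - {x}) (dg f) :: (_ \<Rightarrow>\<^sub>0 'k) set))"
  proof (rule sum_mono)
    fix x assume x: "x \<in> I"
    have "component x ` {v \<in> V. \<forall>j\<in>I. j < x \<longrightarrow> component j v = 0} \<subseteq> component x ` Sp X DM" using V(2) by blast
    then have "fspace.dim (component x ` {v \<in> V. \<forall>j\<in>I. j < x \<longrightarrow> component j v = 0})
        \<le> fspace.dim (component x ` Sp X DM :: (_ \<Rightarrow>\<^sub>0 'k) set)"
      by (rule dim_mono[OF fin_dim_image[OF fin_dim_M flinear_component]])
    also have "\<dots> \<le> fspace.dim (Sp (X - {x}) (dg f) :: (_ \<Rightarrow>\<^sub>0 'k) set)" by (rule dim_component_le) (use x I in blast)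
    finally show "fspace.dim (component x ` {v \<in> V. \<forall>j\<in>I. j < x \<longrightarrow> component j v = 0})
        \<le> fspace.dim (Sp (X - {x}) (dg f) :: (_ \<Rightarrow>\<^sub>0 'k) set)" .
  qed
  finally show ?thesis .
qed

lemma dim_M_le: "fspace.dim (Sp X DM :: (_ \<Rightarrow>\<^sub>0 'k::field) set) \<le> (\<Sum>x\<in>X. fspace.dim (Sp (X - {x}) (dg f) :: (_ \<Rightarrow>\<^sub>0 'k) set))"
proof (rule dim_le_components[OF subspace_Sp subset_refl subset_refl])
  fix v assume "v \<in> Sp X DM" "\<forall>x\<in>X. component x v = 0"
  then show "v = 0" using sum_component[of v] by simp
qed

end

section \<open>Dimensions: the branching inequalities are equalities\<close>

lemma card_dg_inc: "par f \<Longrightarrow> card (dg (inc_row f r)) = Suc (card (dg f))"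
  unfolding dg_inc by (rule card_insert_disjoint[OF finite_dg]) (auto simp: dg_def)

lemma dec_inc: "dec_row (inc_row f r) r = f"
  by (auto simp: dec_row_def inc_row_def)

lemma inc_dec: "f r \<noteq> 0 \<Longrightarrow> inc_row (dec_row f r) r = f"
  by (auto simp: dec_row_def inc_row_def)

lemma dec_inc_swap: "r \<noteq> s \<Longrightarrow> dec_row (inc_row f r) s = inc_row (dec_row f s) r"
  by (auto simp: dec_row_def inc_row_def)

lemma removable_inc: "par f \<Longrightarrow> r \<in> removable (inc_row f r)"
  using parD[of f r "Suc r"] by (auto simp: removable_def inc_row_def)

lemma addable_dec: "par f \<Longrightarrow> s \<in> removable f \<Longrightarrow> s \<in> addable (dec_row f s)"
  using parD[of f "s - 1" s] by (cases s) (auto simp: removable_def addable_def dec_row_def)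

lemma card_dg_dec: "par f \<Longrightarrow> s \<in> removable f \<Longrightarrow> card (dg f) = Suc (card (dg (dec_row f s)))"
  using card_dg_inc[OF par_dec, of f s s] inc_dec[of f s] by (auto simp: removable_def)

lemma add_rem_swap:
  "r \<noteq> s \<Longrightarrow> (r \<in> addable f \<and> s \<in> removable (inc_row f r)) \<longleftrightarrow> (s \<in> removable f \<and> r \<in> addable (dec_row f s))"
  by (cases r) (auto simp: addable_def removable_def inc_row_def dec_row_def)

lemma card_addable: "par f \<Longrightarrow> card (addable f) = Suc (card (removable f))"
  unfolding addable_eq by (subst card_insert_disjoint) (auto simp: finite_removable card_image)

text \<open>Adding in row \<open>r\<close> and removing in row \<open>s\<close> commute for
  \<open>r \<noteq> s\<close>, so these terms agree on both sides. The terms with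
  \<open>r = s\<close> all equal \<open>d f\<close>; their numbers are those of the addable and of
  the removable nodes, which differ by one.\<close>

lemma branching_identity:
  fixes d :: "(nat \<Rightarrow> nat) \<Rightarrow> nat"
  assumes f: "par f"
  shows "(\<Sum>r\<in>addable f. \<Sum>s\<in>removable (inc_row f r). d (dec_row (inc_row f r) s)) =
     d f + (\<Sum>s\<in>removable f. \<Sum>r\<in>addable (dec_row f s). d (inc_row (dec_row f s) r))"
proof -
  let ?A = "SIGMA r:addable f. removable (inc_row f r) - {r}" and ?B = "SIGMA s:removable f. addable (dec_row f s) - {s}"
  have fin: "finite (removable (inc_row f r))" if "r \<in> addable f" for r
    using finite_removable par_inc f that by blast
  have fin': "finite (addable (dec_row f r))" if "r \<in> removable f" for r
    using finite_addable par_dec f that by blast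
  have mem: "(r, s) \<in> ?A \<longleftrightarrow> (s, r) \<in> ?B" for r s using add_rem_swap[of r s f] by (cases "r = s") auto
  have "(\<Sum>r\<in>addable f. \<Sum>s\<in>removable (inc_row f r). d (dec_row (inc_row f r) s)) =
      (\<Sum>r\<in>addable f. d f + (\<Sum>s\<in>removable (inc_row f r) - {r}. d (dec_row (inc_row f r) s)))"
    by (rule sum.cong[OF refl], subst sum.remove[OF fin removable_inc[OF f]]) (simp_all add: dec_inc)
  also have "\<dots> = card (addable f) * d f + (\<Sum>(r, s)\<in>?A. d (dec_row (inc_row f r) s))"
    using finite_addable[OF f] fin by (simp add: sum.distrib sum.Sigma)
  also have "(\<Sum>(r, s)\<in>?A. d (dec_row (inc_row f r) s)) = (\<Sum>(s, r)\<in>?B. d (inc_row (dec_row f s) r))"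
  proof (rule sum.reindex_bij_witness[where i = "\<lambda>(s, r). (r, s)" and j = "\<lambda>(r, s). (s, r)"])
    fix x assume "x \<in> ?A"
    then obtain r s where x: "x = (r, s)" "(r, s) \<in> ?A" by (cases x) auto
    show "(case x of (r, s) \<Rightarrow> (s, r)) \<in> ?B" unfolding x(1) prod.case using x(2) mem by blast
    have "r \<noteq> s" using x(2) by auto
    then show "(case case x of (r, s) \<Rightarrow> (s, r) of (s, r) \<Rightarrow> d (inc_row (dec_row f s) r)) = (case x of (r, s) \<Rightarrow> d (dec_row (inc_row f r) s))"
      by (simp add: x(1) dec_inc_swap)
  next
    fix x assume "x \<in> ?B"
    then obtain r s where x: "x = (s, r)" "(s, r) \<in> ?B" by (cases x) auto
    show "(case x of (s, r) \<Rightarrow> (r, s)) \<in> ?A" unfolding x(1) prod.case using x(2) mem by blast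
  qed auto
  also have "card (addable f) * d f + (\<Sum>(s, r)\<in>?B. d (inc_row (dec_row f s) r)) =
      d f + (\<Sum>s\<in>removable f. d f + (\<Sum>r\<in>addable (dec_row f s) - {s}. d (inc_row (dec_row f s) r)))"
    using finite_removable[OF f] fin' by (simp add: sum.distrib sum.Sigma card_addable[OF f])
  also have "\<dots> = d f + (\<Sum>s\<in>removable f. \<Sum>r\<in>addable (dec_row f s). d (inc_row (dec_row f s) r))"
  proof -
    have "d f + (\<Sum>r\<in>addable (dec_row f s) - {s}. d (inc_row (dec_row f s) r)) = (\<Sum>r\<in>addable (dec_row f s). d (inc_row (dec_row f s) r))"
      if s: "s \<in> removable f" for s
      using s inc_dec[of f s] by (subst sum.remove[OF fin'[OF s] addable_dec[OF f s]]) (simp add: removable_def)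
    then show ?thesis by simp
  qed
  finally show ?thesis .
qed

lemma removable_nonempty:
  assumes g: "par g" and i: "g i \<noteq> 0"
  shows "\<exists>s. s \<in> removable g"
proof -
  let ?S = "{i. g i \<noteq> 0}"
  have "finite ?S" using g by (simp add: par_def)
  then have "Max ?S \<in> ?S" using Max_in[of ?S] i by blast
  moreover have "Suc (Max ?S) \<notin> ?S" using Max_ge[OF \<open>finite ?S\<close>, of "Suc (Max ?S)"] by linarith
  ultimately have "Max ?S \<in> removable g" by (simp add: removable_def)
  then show ?thesis ..
qed

text \<open>The relation \<open>DU - UD = 1\<close> of Young's lattice forces equality in both branching inequalities.\<close>

lemma branching_equality:
  fixes d :: "(nat \<Rightarrow> nat) \<Rightarrow> nat"
  assumes A: "\<And>f. par f \<Longrightarrow> (\<Sum>r\<in>removable f. d (dec_row f r)) \<le> d f"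
    and B: "\<And>f. par f \<Longrightarrow> (\<Sum>r\<in>addable f. d (inc_row f r)) \<le> Suc (card (dg f)) * d f"
    and f: "par f"
  shows "(\<Sum>r\<in>addable f. d (inc_row f r)) = Suc (card (dg f)) * d f"
proof -
  \<comment> \<open>The hypothesis on \<open>d f\<close> carries the factor \<open>n\<close> in
    order to include the empty partition, which has no removable node. The sum of the lower bounds
    \<open>?L r\<close> equals the upper bound \<open>Suc n * d f\<close>, so equality holds in
    between and, term by term, also in \<open>A\<close>.\<close>
  have core: "(\<Sum>r\<in>addable f. d (inc_row f r)) = Suc n * d f \<and>
      (\<forall>r\<in>addable f. d (inc_row f r) = (\<Sum>s\<in>removable (inc_row f r). d (dec_row (inc_row f r) s)))"
    if f: "par f" "card (dg f) = n" "n * d f = n * (\<Sum>s\<in>removable f. d (dec_row f s))"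
      and IH: "\<And>s. s \<in> removable f \<Longrightarrow> (\<Sum>r\<in>addable (dec_row f s). d (inc_row (dec_row f s) r)) = n * d (dec_row f s)"
    for f n
  proof -
    let ?L = "\<lambda>r. \<Sum>s\<in>removable (inc_row f r). d (dec_row (inc_row f r) s)"
    have "(\<Sum>r\<in>addable f. ?L r) = d f + n * d f"
      unfolding branching_identity[OF f(1)] f(3) by (simp add: IH sum_distrib_left)
    moreover have le: "?L r \<le> d (inc_row f r)" if "r \<in> addable f" for r
      using A[OF par_inc[OF f(1) that]] .
    moreover have "(\<Sum>r\<in>addable f. ?L r) \<le> (\<Sum>r\<in>addable f. d (inc_row f r))" by (rule sum_mono[OF le])
    ultimately have eq: "(\<Sum>r\<in>addable f. ?L r) = (\<Sum>r\<in>addable f. d (inc_row f r))"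
      "(\<Sum>r\<in>addable f. d (inc_row f r)) = Suc n * d f" using B[OF f(1)] f(2) by simp_all
    have "?L r = d (inc_row f r)" if "r \<in> addable f" for r
      by (rule sum_mono_inv[OF eq(1) le that finite_addable[OF f(1)]])
    then show ?thesis using eq(2) by simp
  qed
  have "\<forall>f. par f \<and> card (dg f) = n \<longrightarrow> (\<Sum>r\<in>addable f. d (inc_row f r)) = Suc n * d f \<and>
      (\<forall>r\<in>addable f. d (inc_row f r) = (\<Sum>s\<in>removable (inc_row f r). d (dec_row (inc_row f r) s)))" for n
  proof (induction n)
    case 0
    show ?case
    proof (intro allI impI, rule core)
      fix f s assume f: "par f \<and> card (dg f) = 0" and "s \<in> removable f"
      then show "(\<Sum>r\<in>addable (dec_row f s). d (inc_row (dec_row f s) r)) = 0 * d (dec_row f s)"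
        using card_dg_dec[of f s] by simp
    qed simp_all
  next
    case (Suc n)
    show ?case
    proof (intro allI impI, rule core)
      fix g assume g: "par g \<and> card (dg g) = Suc n"
      have dec: "par (dec_row g s) \<and> card (dg (dec_row g s)) = n" if "s \<in> removable g" for s
        using par_dec[of g s] card_dg_dec[of g s] g that by auto
      have "dg g \<noteq> {}" using g by auto
      then obtain i where i: "g i \<noteq> 0" unfolding dg_def by fastforce
      obtain s where s: "s \<in> removable g" using removable_nonempty[of g i] i g by blast
      have "inc_row (dec_row g s) s = g" using inc_dec[of g s] s by (simp add: removable_def)
      moreover have "s \<in> addable (dec_row g s)" using addable_dec s g by blast
      ultimately have "d g = (\<Sum>s\<in>removable g. d (dec_row g s))" using Suc.IH dec[OF s] by metis
      then show "Suc n * d g = Suc n * (\<Sum>s\<in>removable g. d (dec_row g s))" by simp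
      fix s assume "s \<in> removable g"
      then show "(\<Sum>r\<in>addable (dec_row g s). d (inc_row (dec_row g s) r)) = Suc n * d (dec_row g s)"
        using Suc.IH dec by blast
    qed auto
  qed
  then show ?thesis using f by blast
qed

section \<open>Application to the dimensions of Specht modules\<close>

definition specht_dim :: "'k::field itself \<Rightarrow> (nat \<Rightarrow> nat) \<Rightarrow> nat" where
  "specht_dim _ f = fspace.dim (Sp {1..card (dg f)} (dg f) :: (_ \<Rightarrow>\<^sub>0 'k) set)"

lemma dim_Sp_remove_letter:
  assumes x: "x \<in> {1..Suc m}" and D: "finite D"
  shows "fspace.dim (Sp ({1..Suc m} - {x}) D :: (_ \<Rightarrow>\<^sub>0 'k::field) set) \<le> fspace.dim (Sp {1..m} D :: (_ \<Rightarrow>\<^sub>0 'k) set)"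
proof (rule dim_Sp_relabel[of "{1..Suc m}" "transpose x (Suc m)"])
  show "transpose x (Suc m) permutes {1..Suc m}" using x by (intro permutes_swap_id) auto
  show "transpose x (Suc m) ` ({1..Suc m} - {x}) = {1..m}"
  proof -
    have "transpose x (Suc m) ` ({1..Suc m} - {x}) = transpose x (Suc m) ` {1..Suc m} - {transpose x (Suc m) x}"
      using image_set_diff[OF permutes_inj[OF permutes_swap_id[of x "{1..Suc m}" "Suc m"]], of "{1..Suc m}" "{x}"] x
      by simp
    also have "transpose x (Suc m) ` {1..Suc m} = {1..Suc m}"
      using permutes_image[OF permutes_swap_id[of x "{1..Suc m}" "Suc m"]] x by simp
    finally show ?thesis by auto
  qed
qed (use D in auto)

lemma exists_extra_cell:
  assumes f: "par f" shows "\<exists>E F. induced f E F {1..m}"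
proof -
  have "finite (insert 0 ({i. f i \<noteq> 0} \<union> addable f))" using f finite_addable[OF f] by (simp add: par_def)
  then obtain E where E: "E \<notin> insert 0 ({i. f i \<noteq> 0} \<union> addable f)" using ex_new_if_finite infinite_UNIV_nat by metis
  have "induced f E (f 0) {1..m}" using f E by unfold_locales auto
  then show ?thesis by blast
qed

lemma (in induced) dim_M_le_specht_dim:
  assumes m: "X = {1..Suc (card (dg f))}"
  shows "fspace.dim (Sp X DM :: (_ \<Rightarrow>\<^sub>0 'k::field) set) \<le> Suc (card (dg f)) * specht_dim TYPE('k) f"
proof -
  have "fspace.dim (Sp X DM :: (_ \<Rightarrow>\<^sub>0 'k) set) \<le> (\<Sum>x\<in>X. fspace.dim (Sp (X - {x}) (dg f) :: (_ \<Rightarrow>\<^sub>0 'k) set))"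
    by (rule dim_M_le)
  also have "\<dots> \<le> (\<Sum>x\<in>X. specht_dim TYPE('k) f)"
    unfolding specht_dim_def m by (intro sum_mono dim_Sp_remove_letter finite_dg f)
  also have "\<dots> = Suc (card (dg f)) * specht_dim TYPE('k) f" by (simp add: m)
  finally show ?thesis .
qed

lemma (in induced) sum_inc_le:
  assumes m: "X = {1..Suc (card (dg f))}"
  shows "(\<Sum>r\<in>addable f. specht_dim TYPE('k::field) (inc_row f r)) \<le> (\<Sum>r\<in>addable f. fspace.dim (rowmap (repl E r) ` K r :: (_ \<Rightarrow>\<^sub>0 'k) set))"
proof (rule sum_mono)
  fix r assume r: "r \<in> addable f"
  show "specht_dim TYPE('k) (inc_row f r) \<le> fspace.dim (rowmap (repl E r) ` K r :: (_ \<Rightarrow>\<^sub>0 'k) set)"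
    using dim_inc_le[OF r, where ?'k = 'k] by (simp add: specht_dim_def m card_dg_inc[OF f])
qed

lemma specht_dim_branching:
  assumes f: "par f"
  shows "(\<Sum>r\<in>addable f. specht_dim TYPE('k::field) (inc_row f r)) = Suc (card (dg f)) * specht_dim TYPE('k) f"
proof (rule branching_equality[OF _ _ f])
  fix f assume f: "par f"
  show "(\<Sum>r\<in>removable f. specht_dim TYPE('k) (dec_row f r)) \<le> specht_dim TYPE('k) f"
  proof (cases "removable f = {}")
    case False
    then obtain s where s: "s \<in> removable f" by blast
    let ?m = "card (dg f)"
    have m: "?m \<in> {1..?m}" using card_dg_dec[OF f s] by simp
    have "(\<Sum>r\<in>removable f. specht_dim TYPE('k) (dec_row f r)) =
        (\<Sum>r\<in>removable f. fspace.dim (Sp ({1..?m} - {?m}) (dg (dec_row f r)) :: (_ \<Rightarrow>\<^sub>0 'k) set))"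
    proof (rule sum.cong[OF refl])
      fix r assume r: "r \<in> removable f"
      have "{1..?m} - {?m} = {1..card (dg (dec_row f r))}" using card_dg_dec[OF f r] by auto
      then show "specht_dim TYPE('k) (dec_row f r) = fspace.dim (Sp ({1..?m} - {?m}) (dg (dec_row f r)) :: (_ \<Rightarrow>\<^sub>0 'k) set)"
        by (simp add: specht_dim_def)
    qed
    also have "\<dots> \<le> specht_dim TYPE('k) f" unfolding specht_dim_def by (rule dim_restriction[OF f _ m]) simp
    finally show ?thesis .
  qed simp
next
  fix f assume f: "par f"
  obtain E F where "induced f E F {1..Suc (card (dg f))}" using exists_extra_cell[OF f] by blast
  then interpret induced f E F "{1..Suc (card (dg f))}" .
  have "(\<Sum>r\<in>addable f. specht_dim TYPE('k) (inc_row f r)) \<le> fspace.dim (Sp {1..Suc (card (dg f))} DM :: (_ \<Rightarrow>\<^sub>0 'k) set)"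
    using sum_inc_le[OF refl, where ?'k = 'k] dim_induced_filtration[where ?'k = 'k] by linarith
  also have "\<dots> \<le> Suc (card (dg f)) * specht_dim TYPE('k) f" by (rule dim_M_le_specht_dim[OF refl])
  finally show "(\<Sum>r\<in>addable f. specht_dim TYPE('k) (inc_row f r)) \<le> Suc (card (dg f)) * specht_dim TYPE('k) f" .
qed

context induced
begin

context
  assumes m: "X = {1..Suc (card (dg f))}"
begin

text \<open>The branching equality closes the chain between the sum of the Specht dimensions, the
  filtration and the bound from the grading. Hence the error term has dimension 0 and no image of a
  row map on its filtration step is larger than the Specht module inside it.\<close>

lemma induced_equalities:
  shows dim_M: "fspace.dim (Sp X DM :: (_ \<Rightarrow>\<^sub>0 'k::field) set) = Suc (card (dg f)) * specht_dim TYPE('k) f"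
    and rowmap_K: "r \<in> addable f \<Longrightarrow> rowmap (repl E r) ` K r = (Sp X (dg (inc_row f r)) :: (_ \<Rightarrow>\<^sub>0 'k) set)"
    and rowmap_inj: "v \<in> Sp X DM \<Longrightarrow> (\<And>r. r \<in> addable f \<Longrightarrow> rowmap (repl E r) v = (0 :: _ \<Rightarrow>\<^sub>0 'k)) \<Longrightarrow> v = 0"
proof -
  let ?ker = "{v \<in> Sp X DM :: (_ \<Rightarrow>\<^sub>0 'k) set. \<forall>r\<in>addable f. rowmap (repl E r) v = 0}"
  let ?g = "\<lambda>r. fspace.dim (rowmap (repl E r) ` K r :: (_ \<Rightarrow>\<^sub>0 'k) set)"
  note filt = dim_induced_filtration[where ?'k = 'k] and le = sum_inc_le[OF m, where ?'k = 'k]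
    and dm = dim_M_le_specht_dim[OF m, where ?'k = 'k] and br = specht_dim_branching[OF f, where ?'k = 'k]
  show "fspace.dim (Sp X DM :: (_ \<Rightarrow>\<^sub>0 'k) set) = Suc (card (dg f)) * specht_dim TYPE('k) f"
    using filt le dm br by linarith
  have "fspace.dim ?ker = 0" using filt le dm br by linarith
  then have "?ker \<subseteq> {0}" by (rule dim_eq_0D[OF fin_dim_Collect[OF fin_dim_M]])
  then show "v \<in> Sp X DM \<Longrightarrow> (\<And>r. r \<in> addable f \<Longrightarrow> rowmap (repl E r) v = (0 :: _ \<Rightarrow>\<^sub>0 'k)) \<Longrightarrow> v = 0" by blast
  have eq: "(\<Sum>r\<in>addable f. specht_dim TYPE('k) (inc_row f r)) = (\<Sum>r\<in>addable f. ?g r)"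
    using filt le dm br by linarith
  have le1: "specht_dim TYPE('k) (inc_row f r) \<le> ?g r" if "r \<in> addable f" for r
    using dim_inc_le[OF that, where ?'k = 'k] by (simp add: specht_dim_def m card_dg_inc[OF f])
  show "rowmap (repl E r) ` K r = (Sp X (dg (inc_row f r)) :: (_ \<Rightarrow>\<^sub>0 'k) set)" if r: "r \<in> addable f"
  proof -
    have "specht_dim TYPE('k) (inc_row f r) = ?g r"
      by (rule sum_mono_inv[OF eq le1 r finite_addable[OF f]])
    then have "?g r \<le> fspace.dim (Sp X (dg (inc_row f r)) :: (_ \<Rightarrow>\<^sub>0 'k) set)"
      by (simp add: specht_dim_def m card_dg_inc[OF f])
    then show ?thesis
      by (rule dim_eq_subspace[OF fin_dim_image[OF fin_dim_K flinear_rowmap] subspace_Sp Sp_inc_subset[OF r], symmetric])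
  qed
qed

end

end

section \<open>The sum of all transpositions\<close>

definition class_sum :: "nat set \<Rightarrow> ((nat \<Rightarrow> nat) \<Rightarrow>\<^sub>0 'k::field) \<Rightarrow> ((nat \<Rightarrow> nat) \<Rightarrow>\<^sub>0 'k)" where
  "class_sum X v = (\<Sum>(x, y)\<in>{(x, y). x \<in> X \<and> y \<in> X \<and> x < y}. relabel (transpose x y) v)"

lemma flinear_class_sum: "flinear (class_sum X)"
  unfolding class_sum_def[abs_def] by (rule flinear_sum) (auto simp: case_prod_beta flinear_relabel)

text \<open>Each unordered pair is counted once, whichever orientation \<open>R\<close> selects.
  This is used for an order pulled back along a permutation and for the order of the entries of a
  tableau by columns.\<close>

lemma class_sum_order:
  assumes R: "\<And>x y. x \<in> X \<Longrightarrow> y \<in> X \<Longrightarrow> x \<noteq> y \<Longrightarrow> R x y \<longleftrightarrow> \<not> R y x" "\<And>x. \<not> R x x"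
  shows "class_sum X v = (\<Sum>(x, y)\<in>{(x, y). x \<in> X \<and> y \<in> X \<and> R x y}. relabel (transpose x y) v)"
  unfolding class_sum_def
proof (rule sum.reindex_bij_witness[where i = "\<lambda>(x, y). if x < y then (x, y) else (y, x)" and j = "\<lambda>(x, y). if R x y then (x, y) else (y, x)"])
  fix a assume "a \<in> {(x, y). x \<in> X \<and> y \<in> X \<and> x < y}"
  then obtain x y where a: "a = (x, y)" "x \<in> X" "y \<in> X" "x < y" by auto
  then show "(case case a of (x, y) \<Rightarrow> if R x y then (x, y) else (y, x) of (x, y) \<Rightarrow> if x < y then (x, y) else (y, x)) = a"
    "(case a of (x, y) \<Rightarrow> if R x y then (x, y) else (y, x)) \<in> {(x, y). x \<in> X \<and> y \<in> X \<and> R x y}"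
    using R(1)[of x y] by auto
  show "(case case a of (x, y) \<Rightarrow> if R x y then (x, y) else (y, x) of (x, y) \<Rightarrow> relabel (transpose x y) v) = (case a of (x, y) \<Rightarrow> relabel (transpose x y) v)"
    by (simp add: a(1) transpose_commute)
next
  fix a assume "a \<in> {(x, y). x \<in> X \<and> y \<in> X \<and> R x y}"
  then obtain x y where a: "a = (x, y)" "x \<in> X" "y \<in> X" "R x y" by auto
  then have "x \<noteq> y" using R(2) by blast
  then show "(case case a of (x, y) \<Rightarrow> if x < y then (x, y) else (y, x) of (x, y) \<Rightarrow> if R x y then (x, y) else (y, x)) = a"
    "(case a of (x, y) \<Rightarrow> if x < y then (x, y) else (y, x)) \<in> {(x, y). x \<in> X \<and> y \<in> X \<and> x < y}"
    using a R(1)[of x y] by auto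
qed

lemma class_sum_rowmap: "class_sum X (rowmap \<rho> v) = rowmap \<rho> (class_sum X v)"
  unfolding class_sum_def flinear_simps[OF flinear_rowmap] by (simp add: relabel_rowmap case_prod_beta)

lemma class_sum_Sp: "finite X \<Longrightarrow> v \<in> Sp X D \<Longrightarrow> class_sum X v \<in> Sp X D"
  unfolding class_sum_def
  by (rule fspace.subspace_sum[OF subspace_Sp]) (auto intro!: relabel_Sp permutes_swap_id)

lemma class_sum_relabel:
  assumes \<sigma>: "\<sigma> permutes X" and X: "finite X"
  shows "class_sum X (relabel \<sigma> v) = relabel \<sigma> (class_sum X v)"
proof -
  let ?P = "{(x, y). x \<in> X \<and> y \<in> X \<and> x < y}"
  let ?i = "inv_into UNIV \<sigma>"
  let ?Q = "{(x, y). x \<in> X \<and> y \<in> X \<and> ?i x < ?i y}"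
  have io: "?i (\<sigma> x) = x" "\<sigma> (?i x) = x" for x using permutes_inverses[OF \<sigma>] by auto
  have mem: "\<sigma> x \<in> X \<longleftrightarrow> x \<in> X" "?i x \<in> X \<longleftrightarrow> x \<in> X" for x
    using permutes_in_image[OF \<sigma>] permutes_in_image[OF permutes_inv[OF \<sigma>]] by auto
  have tr: "\<sigma> \<circ> transpose x y = transpose (\<sigma> x) (\<sigma> y) \<circ> \<sigma>" for x y
    using inj_eq[OF permutes_inj[OF \<sigma>]] by (auto simp: fun_eq_iff transpose_def)
  have "class_sum X (relabel \<sigma> v) = (\<Sum>(x, y)\<in>?P. relabel (transpose (\<sigma> x) (\<sigma> y) \<circ> \<sigma>) v)"
    unfolding class_sum_def relabel_comp tr ..
  also have "\<dots> = (\<Sum>(x, y)\<in>?Q. relabel (transpose x y \<circ> \<sigma>) v)"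
    by (rule sum.reindex_bij_witness[where i = "\<lambda>(x, y). (?i x, ?i y)" and j = "\<lambda>(x, y). (\<sigma> x, \<sigma> y)"])
       (auto simp: io mem)
  also have "\<dots> = relabel \<sigma> (\<Sum>(x, y)\<in>?Q. relabel (transpose x y) v)"
    unfolding flinear_simps[OF flinear_relabel] by (simp add: case_prod_beta relabel_comp)
  also have "(\<Sum>(x, y)\<in>?Q. relabel (transpose x y) v) = class_sum X v"
  proof (rule class_sum_order[symmetric])
    fix x y :: nat assume "x \<noteq> y"
    then have "?i x \<noteq> ?i y" using io by metis
    then show "(?i x < ?i y) = (\<not> ?i y < ?i x)" by auto
  qed simp
  finally show ?thesis .
qed

text \<open>A Garnir relation for the entries of column \<open>j\<close> together with one entry
  \<open>y\<close> to the right of it. The signed sum over \<open>G\<close> vanishes by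
  cancellation; sorted by the element that lands in the column of \<open>y\<close>, it consists of
  the polytabloid itself (for \<open>y\<close>) and the negatives of its images under the
  transpositions \<open>(x y)\<close>.\<close>

lemma garnir_relation:
  assumes f: "par f" and X: "finite X" and w: "filling X (dg f) w c" and y: "y \<in> X" "j < c y"
  shows "(\<Sum>x\<in>{x \<in> X. c x = j}. relabel (transpose x y) (ptb X w c)) = (ptb X w c :: _ \<Rightarrow>\<^sub>0 'k::field)"
proof -
  define Y0 where "Y0 = {x \<in> X. c x = j}"
  define Y where "Y = insert y Y0"
  have yY: "y \<notin> Y0" using y by (simp add: Y0_def)
  have YX: "Y \<subseteq> X" using y by (auto simp: Y_def Y0_def)
  have finY: "finite Y0" using X by (simp add: Y0_def)
  \<comment> \<open>This is the union of the cosets of the column stabilizer by the transpositions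
    \<open>(x y)\<close>, for \<open>x\<close> in \<open>Y\<close>: exactly one element of
    \<open>Y\<close>, later called \<open>ex g\<close>, is sent to the column of
    \<open>y\<close>.\<close>
  define G where "G = {g. g permutes X \<and> (\<forall>z\<in>X - Y. c (g z) = c z) \<and> (\<exists>x\<in>Y. c (g x) = c y \<and> (\<forall>z\<in>Y - {x}. c (g z) = j))}"
  have finG: "finite G" unfolding G_def by (rule finite_subset[OF _ finite_permutations[OF X]]) auto
  define ex where "ex g = (THE x. x \<in> Y \<and> c (g x) = c y)" for g
  have ex: "ex g = x" if g: "g \<in> G" and x: "x \<in> Y" "c (g x) = c y" for g x
  proof -
    obtain x' where x': "x' \<in> Y" "c (g x') = c y" "\<forall>z\<in>Y - {x'}. c (g z) = j" using g unfolding G_def by blast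
    then have "z = x'" if "z \<in> Y" "c (g z) = c y" for z using that y(2) by (metis DiffI less_irrefl singletonD)
    then show ?thesis unfolding ex_def using x by (intro the_equality) metis+
  qed
  have exG: "ex g \<in> Y" "c (g (ex g)) = c y" "\<And>z. z \<in> Y \<Longrightarrow> z \<noteq> ex g \<Longrightarrow> c (g z) = j" "g permutes X" "\<And>z. z \<in> X - Y \<Longrightarrow> c (g z) = c z"
    if g: "g \<in> G" for g
  proof -
    obtain x' where x': "x' \<in> Y" "c (g x') = c y" "\<forall>z\<in>Y - {x'}. c (g z) = j" using g unfolding G_def by blast
    have "ex g = x'" by (rule ex[OF g x'(1,2)])
    then show "ex g \<in> Y" "c (g (ex g)) = c y" "\<And>z. z \<in> Y \<Longrightarrow> z \<noteq> ex g \<Longrightarrow> c (g z) = j" using x' by auto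
    show "g permutes X" "\<And>z. z \<in> X - Y \<Longrightarrow> c (g z) = c z" using g unfolding G_def by blast+
  qed
  let ?t = "\<lambda>x. transpose x y"
  have t: "?t x permutes X" if "x \<in> Y" for x using that YX y by (intro permutes_swap_id) auto
  have fib: "(\<Sum>g\<in>{g \<in> G. ex g = x}. Poly_Mapping.single (w \<circ> g) (of_int (sign g) :: 'k)) =
      fscale (of_int (sign (?t x))) (relabel (?t x) (ptb X w c))" if x: "x \<in> Y" for x
  proof -
    have "(\<Sum>g\<in>{g \<in> G. ex g = x}. Poly_Mapping.single (w \<circ> g) (of_int (sign g) :: 'k)) =
        (\<Sum>\<pi>\<in>colstab X c. Poly_Mapping.single (w \<circ> \<pi> \<circ> ?t x) (of_int (sign (?t x) * sign \<pi>)))"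
    proof (rule sum.reindex_bij_witness[where i = "\<lambda>\<pi>. \<pi> \<circ> ?t x" and j = "\<lambda>g. g \<circ> ?t x"])
      fix g assume "g \<in> {g \<in> G. ex g = x}"
      then have g: "g \<in> G" "ex g = x" by auto
      note e = exG[OF g(1), unfolded g(2)]
      show "g \<circ> ?t x \<circ> ?t x = g" by (auto simp: fun_eq_iff)
      have "c (g (?t x u)) = c u" if u: "u \<in> X" for u
      proof -
        consider "u = y" | "u = x" "u \<noteq> y" | "u \<noteq> x" "u \<noteq> y" by blast
        then show ?thesis
        proof cases
          case 1 then show ?thesis using e(2) by simp
        next
          case 2
          then have "c x = j" using x by (auto simp: Y_def Y0_def)
          then show ?thesis using e(3)[of y] 2 by (simp add: Y_def)
        next
          case 3
          then have "?t x u = u" by (simp add: transpose_def)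
          then show ?thesis using e(3)[of u] e(5)[of u] 3 u by (cases "u \<in> Y") (auto simp: Y_def Y0_def)
        qed
      qed
      then show "g \<circ> ?t x \<in> colstab X c" using e(4) t[OF x] by (auto simp: colstab_def permutes_compose)
      have "w \<circ> (g \<circ> ?t x) \<circ> ?t x = w \<circ> g" by (auto simp: fun_eq_iff)
      moreover have "sign (?t x) * sign (g \<circ> ?t x) = sign g"
        using sign_compose_permutes[OF X e(4) t[OF x]] by (simp add: sign_swap_id)
      ultimately show "Poly_Mapping.single (w \<circ> (g \<circ> ?t x) \<circ> ?t x) (of_int (sign (?t x) * sign (g \<circ> ?t x))) = Poly_Mapping.single (w \<circ> g) (of_int (sign g) :: 'k)"
        by simp
    next
      fix \<pi> assume "\<pi> \<in> colstab X c"
      then have \<pi>: "\<pi> permutes X" "\<And>u. u \<in> X \<Longrightarrow> c (\<pi> u) = c u" by (auto simp: colstab_def)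
      show "\<pi> \<circ> ?t x \<circ> ?t x = \<pi>" by (auto simp: fun_eq_iff)
      have G: "\<pi> \<circ> ?t x \<in> G" unfolding G_def
      proof (intro CollectI conjI)
        show "\<pi> \<circ> ?t x permutes X" using \<pi>(1) t[OF x] by (intro permutes_compose)
        show "\<forall>z\<in>X - Y. c ((\<pi> \<circ> ?t x) z) = c z"
        proof
          fix z assume z: "z \<in> X - Y"
          then have "?t x z = z" using x by (auto simp: transpose_def Y_def)
          then show "c ((\<pi> \<circ> ?t x) z) = c z" using \<pi>(2) z by simp
        qed
        show "\<exists>u\<in>Y. c ((\<pi> \<circ> ?t x) u) = c y \<and> (\<forall>z\<in>Y - {u}. c ((\<pi> \<circ> ?t x) z) = j)"
        proof (intro bexI[of _ x] conjI ballI)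
          show "c ((\<pi> \<circ> ?t x) x) = c y" using \<pi>(2) y by simp
          fix z assume z: "z \<in> Y - {x}"
          have "?t x z \<in> X" using permutes_in_image[OF t[OF x]] z YX by blast
          then have "c ((\<pi> \<circ> ?t x) z) = c (?t x z)" using \<pi>(2) by simp
          also have "\<dots> = j" using z x by (auto simp: transpose_def Y_def Y0_def)
          finally show "c ((\<pi> \<circ> ?t x) z) = j" .
        qed (rule x)
      qed
      moreover have "c ((\<pi> \<circ> ?t x) x) = c y" using \<pi>(2) y by simp
      ultimately show "\<pi> \<circ> ?t x \<in> {g \<in> G. ex g = x}" using ex x by blast
    qed
    also have "\<dots> = fscale (of_int (sign (?t x))) (relabel (?t x) (ptb X w c))"
      unfolding ptb_def by (simp add: flinear_simps[OF flinear_relabel] relabel_single fspace.scale_sum_right)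
    finally show ?thesis .
  qed
  \<comment> \<open>Since \<open>j < c y\<close>, the row of \<open>g (ex g)\<close> also has a cell
    in column \<open>j\<close>, and only elements of \<open>Y\<close> can be sent there. Exchanging
    the two preimages is the sign-reversing involution.\<close>
  have part: "\<exists>z. z \<in> Y \<and> z \<noteq> ex g \<and> w (g z) = w (g (ex g))" if g: "g \<in> G" for g
  proof -
    note e = exG[OF g]
    have gx: "g (ex g) \<in> X" using e(1,4) YX permutes_in_image[OF e(4)] by blast
    then have "(w (g (ex g)), c y) \<in> dg f" using fillingD(1)[OF w gx] e(2) by simp
    then have "(w (g (ex g)), j) \<in> dg f" using y(2) by (auto simp: dg_def)
    then obtain u where u: "u \<in> X" "w u = w (g (ex g))" "c u = j" using fillingD(4)[OF w] by blast
    define z where "z = inv_into UNIV g u"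
    have gz: "g z = u" unfolding z_def using permutes_inverses[OF e(4)] by simp
    then have zX: "z \<in> X" using u(1) permutes_in_image[OF e(4), of z] by simp
    have "z \<in> Y"
    proof (rule ccontr)
      assume "z \<notin> Y"
      then have "c z = j" using e(5)[of z] zX gz u(3) by simp
      then show False using \<open>z \<notin> Y\<close> zX by (simp add: Y_def Y0_def)
    qed
    moreover have "z \<noteq> ex g" using e(2) gz u(3) y(2) by auto
    ultimately show ?thesis using gz u(2) by auto
  qed
  define pt where "pt g = (SOME z. z \<in> Y \<and> z \<noteq> ex g \<and> w (g z) = w (g (ex g)))" for g
  have pt: "pt g \<in> Y" "pt g \<noteq> ex g" "w (g (pt g)) = w (g (ex g))" if "g \<in> G" for g
    using someI_ex[OF part[OF that]] unfolding pt_def by blast+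
  have ptu: "pt g = z" if g: "g \<in> G" and z: "z \<in> Y" "z \<noteq> ex g" "w (g z) = w (g (ex g))" for g z
  proof -
    note e = exG[OF g]
    have "g (pt g) = g z"
    proof (rule fillingD(3)[OF w])
      show "g (pt g) \<in> X" "g z \<in> X" using pt(1)[OF g] z(1) YX permutes_in_image[OF e(4)] by auto
      show "w (g (pt g)) = w (g z)" using pt(3)[OF g] z(3) by simp
      show "c (g (pt g)) = c (g z)" using e(3) pt[OF g] z by simp
    qed
    then show ?thesis using inj_eq[OF permutes_inj[OF e(4)]] by simp
  qed
  let ?h = "\<lambda>g. g \<circ> transpose (ex g) (pt g)"
  have hG: "?h g \<in> G" "ex (?h g) = pt g" "pt (?h g) = ex g" if g: "g \<in> G" for g
  proof -
    note e = exG[OF g] and q = pt[OF g]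
    let ?s = "transpose (ex g) (pt g)"
    have s: "?s permutes X" using e(1) q(1) YX by (intro permutes_swap_id) auto
    show hg: "?h g \<in> G" unfolding G_def
    proof (intro CollectI conjI)
      show "?h g permutes X" using s e(4) by (rule permutes_compose)
      show "\<forall>z\<in>X - Y. c (?h g z) = c z"
      proof
        fix z assume z: "z \<in> X - Y"
        then have "?s z = z" using e(1) q(1) by (auto simp: transpose_def)
        then show "c (?h g z) = c z" using e(5)[OF z] by simp
      qed
      show "\<exists>x\<in>Y. c (?h g x) = c y \<and> (\<forall>z\<in>Y - {x}. c (?h g z) = j)"
      proof (intro bexI[of _ "pt g"] conjI ballI)
        show "c (?h g (pt g)) = c y" using e(2) by simp
        fix z assume z: "z \<in> Y - {pt g}"
        show "c (?h g z) = j"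
        proof (cases "z = ex g")
          case True then show ?thesis using e(3)[OF q(1,2)] by simp
        next
          case False
          then have "?s z = z" using z by (auto simp: transpose_def)
          then show ?thesis using e(3)[of z] z False by simp
        qed
      qed (rule q(1))
    qed
    show exh: "ex (?h g) = pt g" by (rule ex[OF hg q(1)]) (use e(2) in simp)
    show "pt (?h g) = ex g" by (rule ptu[OF hg e(1)]) (use exh q in simp_all)
  qed
  have zero: "(\<Sum>g\<in>G. Poly_Mapping.single (w \<circ> g) (of_int (sign g) :: 'k)) = 0"
  proof (rule sum_sign_cancel[where h = ?h, OF _ _ _ _ finG])
    fix g assume g: "g \<in> G"
    show "?h g \<in> G" by (rule hG(1)[OF g])
    show "?h g \<circ> transpose (ex (?h g)) (pt (?h g)) = g" unfolding hG(2,3)[OF g]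
      by (auto simp: fun_eq_iff transpose_commute[of "pt g"])
    have s: "transpose (ex g) (pt g) permutes X" using exG(1)[OF g] pt(1)[OF g] YX by (intro permutes_swap_id) auto
    show "sign (?h g) = - sign g"
      using sign_compose_permutes[OF X exG(4)[OF g] s] pt(2)[OF g] by (simp add: sign_swap_id)
    show "w \<circ> ?h g = w \<circ> g" using pt(3)[OF g] by (auto simp: fun_eq_iff transpose_def)
  qed
  have "(\<Sum>x\<in>Y. fscale (of_int (sign (?t x))) (relabel (?t x) (ptb X w c :: _ \<Rightarrow>\<^sub>0 'k))) = 
      (\<Sum>x\<in>Y. \<Sum>g\<in>{g \<in> G. ex g = x}. Poly_Mapping.single (w \<circ> g) (of_int (sign g) :: 'k))"
    by (rule sum.cong[OF refl fib[symmetric]])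
  also have "\<dots> = (\<Sum>g\<in>G. Poly_Mapping.single (w \<circ> g) (of_int (sign g) :: 'k))"
    by (rule sum.group[OF finG]) (use finY exG(1) in \<open>auto simp: Y_def\<close>)
  finally have "(\<Sum>x\<in>Y. fscale (of_int (sign (?t x))) (relabel (?t x) (ptb X w c :: _ \<Rightarrow>\<^sub>0 'k))) = 0" using zero by simp
  moreover have "(\<Sum>x\<in>Y. fscale (of_int (sign (?t x))) (relabel (?t x) (ptb X w c :: _ \<Rightarrow>\<^sub>0 'k))) =
      ptb X w c + (\<Sum>x\<in>Y0. - relabel (?t x) (ptb X w c))"
    unfolding Y_def sum.insert[OF finY yY]
  proof (rule arg_cong2[of _ _ _ _ "(+)"])
    show "fscale (of_int (sign (?t y))) (relabel (?t y) (ptb X w c :: _ \<Rightarrow>\<^sub>0 'k)) = ptb X w c" by (simp add: relabel_id[unfolded id_def] relabel_id)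
    show "(\<Sum>x\<in>Y0. fscale (of_int (sign (?t x))) (relabel (?t x) (ptb X w c :: _ \<Rightarrow>\<^sub>0 'k))) = (\<Sum>x\<in>Y0. - relabel (?t x) (ptb X w c))"
      using yY by (intro sum.cong refl) (auto simp: sign_swap_id)
  qed
  ultimately show ?thesis unfolding Y0_def[symmetric] by (simp add: sum_negf)
qed

lemma relabel_same_column:
  assumes X: "finite X" and xy: "x \<in> X" "y \<in> X" "x \<noteq> y" "c x = c y"
  shows "relabel (transpose x y) (ptb X w c) = - ptb X w c"
proof -
  let ?t = "transpose x y"
  have t: "?t permutes X" using xy by (intro permutes_swap_id)
  have ct: "c (?t z) = c z" for z using xy by (auto simp: transpose_def)
  have "relabel ?t (ptb X w c) = ptb X (w \<circ> ?t) (c \<circ> ?t)"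
    by (rule relabel_ptb[OF X t permutes_image[OF t] X])
  also have "\<dots> = ptb X (w \<circ> ?t) c" by (rule ptb_cong) (simp add: ct)
  also have "\<dots> = (\<Sum>\<pi>\<in>colstab X c. - Poly_Mapping.single (w \<circ> \<pi>) (of_int (sign \<pi>)))" unfolding ptb_def
  proof (rule sum.reindex_bij_witness[where i = "\<lambda>\<pi>. ?t \<circ> \<pi>" and j = "\<lambda>\<pi>. ?t \<circ> \<pi>"])
    fix \<pi> assume \<pi>: "\<pi> \<in> colstab X c"
    then show "?t \<circ> \<pi> \<in> colstab X c" using t ct by (auto simp: colstab_def permutes_compose)
    have "sign (?t \<circ> \<pi>) = - sign \<pi>"
      using sign_compose_permutes[OF X t, of \<pi>] \<pi> xy by (simp add: colstab_def sign_swap_id)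
    then show "- Poly_Mapping.single (w \<circ> (?t \<circ> \<pi>)) (of_int (sign (?t \<circ> \<pi>))) = Poly_Mapping.single (w \<circ> ?t \<circ> \<pi>) (of_int (sign \<pi>))"
      by (simp add: comp_assoc single_uminus)
  next
    fix \<pi> assume \<pi>: "\<pi> \<in> colstab X c"
    then show "?t \<circ> \<pi> \<in> colstab X c" using t ct by (auto simp: colstab_def permutes_compose)
  qed (auto simp: fun_eq_iff)
  also have "\<dots> = - ptb X w c" unfolding ptb_def by (simp add: sum_negf)
  finally show ?thesis .
qed

definition content_sum :: "(nat \<Rightarrow> nat) \<Rightarrow> int" where
  "content_sum f = (\<Sum>(i, j)\<in>dg f. int j - int i)"

text \<open>The pairs are ordered by columns from left to right and within a column from top to
  bottom. For a fixed larger entry \<open>y\<close>, each column to its left contributes 1 by the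
  Garnir relation and each entry above it contributes -1, together the content of its cell.\<close>

lemma class_sum_ptb:
  assumes f: "par f" and X: "finite X" and w: "filling X (dg f) w c"
  shows "class_sum X (ptb X w c) = fscale (of_int (content_sum f)) (ptb X w c :: _ \<Rightarrow>\<^sub>0 'k::field)"
proof -
  let ?e = "ptb X w c :: _ \<Rightarrow>\<^sub>0 'k" and ?T = "\<lambda>x y. relabel (transpose x y) (ptb X w c) :: _ \<Rightarrow>\<^sub>0 'k"
  define R where "R x y \<longleftrightarrow> c x < c y \<or> (c x = c y \<and> w x < w y)" for x y
  have "class_sum X ?e = (\<Sum>(x, y)\<in>{(x, y). x \<in> X \<and> y \<in> X \<and> R x y}. ?T x y)"
  proof (rule class_sum_order)
    fix x y assume "x \<in> X" "y \<in> X" "x \<noteq> y"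
    then have "w x \<noteq> w y \<or> c x \<noteq> c y" using fillingD(3)[OF w] by blast
    then show "R x y = (\<not> R y x)" unfolding R_def by linarith
  qed (simp add: R_def)
  also have "\<dots> = (\<Sum>(y, x)\<in>(SIGMA y:X. {x \<in> X. R x y}). ?T x y)"
    by (rule sum.reindex_bij_witness[where i = "\<lambda>(y, x). (x, y)" and j = "\<lambda>(x, y). (y, x)"]) auto
  also have "\<dots> = (\<Sum>y\<in>X. \<Sum>x\<in>{x \<in> X. R x y}. ?T x y)" using X by (simp add: sum.Sigma)
  also have "\<dots> = (\<Sum>y\<in>X. fscale (of_int (int (c y) - int (w y))) ?e)"
  proof (rule sum.cong[OF refl])
    fix y assume y: "y \<in> X"
    let ?A = "{x \<in> X. c x < c y}" and ?B = "{x \<in> X. c x = c y \<and> w x < w y}"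
    have "(\<Sum>x\<in>{x \<in> X. R x y}. ?T x y) = (\<Sum>x\<in>?A \<union> ?B. ?T x y)"
      by (rule sum.cong) (auto simp: R_def)
    also have "\<dots> = (\<Sum>x\<in>?A. ?T x y) + (\<Sum>x\<in>?B. ?T x y)"
      by (rule sum.union_disjoint) (use X in auto)
    also have "(\<Sum>x\<in>?A. ?T x y) = (\<Sum>j<c y. \<Sum>x\<in>{x \<in> ?A. c x = j}. ?T x y)"
      by (rule sum.group[symmetric]) (use X in auto)
    also have "\<dots> = (\<Sum>j<c y. ?e)"
    proof (rule sum.cong[OF refl])
      fix j assume j: "j \<in> {..<c y}"
      then have "{x \<in> ?A. c x = j} = {x \<in> X. c x = j}" by auto
      then show "(\<Sum>x\<in>{x \<in> ?A. c x = j}. ?T x y) = ?e" using garnir_relation[OF f X w y] j by simp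
    qed
    also have "(\<Sum>x\<in>?B. ?T x y) = (\<Sum>x\<in>?B. - ?e)"
      by (rule sum.cong[OF refl]) (use relabel_same_column[OF X _ y] in auto)
    also have "(\<Sum>j<c y. ?e) + (\<Sum>x\<in>?B. - ?e) = fscale (of_int (int (c y) - int (card ?B))) ?e"
    proof -
      have cnt: "(\<Sum>a\<in>I. v) = fscale (of_nat (card I)) v" for I :: "nat set" and v :: "(nat \<Rightarrow> nat) \<Rightarrow>\<^sub>0 'k"
        by (induction I rule: infinite_finite_induct) (simp_all add: fspace.scale_left_distrib)
      show ?thesis unfolding cnt by (simp add: fspace.scale_left_diff_distrib)
    qed
    also have "card ?B = w y"
    proof -
      have "bij_betw w ?B {..<w y}" unfolding bij_betw_def
      proof
        show "inj_on w ?B" by (rule inj_onI) (use fillingD(3)[OF w] in auto)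
        show "w ` ?B = {..<w y}"
        proof
          show "{..<w y} \<subseteq> w ` ?B"
          proof
            fix i assume i: "i \<in> {..<w y}"
            have "(w y, c y) \<in> dg f" by (rule fillingD(1)[OF w y])
            then have "(i, c y) \<in> dg f" using parD[OF f, of i "w y"] i by (auto simp: dg_def)
            then obtain x where "x \<in> X" "w x = i" "c x = c y" using fillingD(4)[OF w] by blast
            then show "i \<in> w ` ?B" using i by auto
          qed
        qed auto
      qed
      then show ?thesis using bij_betw_same_card by fastforce
    qed
    finally show "(\<Sum>x\<in>{x \<in> X. R x y}. ?T x y) = fscale (of_int (int (c y) - int (w y))) ?e" .
  qed
  also have "\<dots> = fscale (of_int (\<Sum>y\<in>X. int (c y) - int (w y))) ?e"
    by (simp add: fspace.scale_sum_left)
  also have "(\<Sum>y\<in>X. int (c y) - int (w y)) = content_sum f"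
    unfolding content_sum_def using w unfolding filling_def
    by (subst sum.reindex_bij_betw[symmetric, of "\<lambda>x. (w x, c x)" X]) auto
  finally show ?thesis .
qed

lemma class_sum_Sp_scalar:
  assumes f: "par f" and X: "finite X" and v: "v \<in> Sp X (dg f)"
  shows "class_sum X v = fscale (of_int (content_sum f)) v"
  by (rule linear_eq_on_Sp[OF flinear_class_sum flinear_scale[OF flinear_ident] class_sum_ptb[OF f X] v])

lemma content_sum_inc: "par f \<Longrightarrow> content_sum (inc_row f r) = content_sum f + (int (f r) - int r)"
  unfolding content_sum_def dg_inc by (subst sum.insert[OF finite_dg]) (auto simp: dg_def)

section \<open>The induced module is generically free\<close>

definition word_D :: "nat \<Rightarrow> nat \<Rightarrow> ((nat \<Rightarrow> nat) \<Rightarrow>\<^sub>0 'k::field) \<Rightarrow> ((nat \<Rightarrow> nat) \<Rightarrow>\<^sub>0 'k)" where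
  "word_D p i v = relabel (inv_into UNIV (g_cycle p i)) v - v"

lemma g_cycle_bij: "bij (g_cycle p i)"
  using g_cycle_permutes_block permutes_bij by blast

lemma inv_g_cycle: "inv_into UNIV (g_cycle p i) (g_cycle p i x) = x" "g_cycle p i (inv_into UNIV (g_cycle p i) x) = x"
  using permutes_inverses[OF g_cycle_permutes_block[of p i]] by auto

lemma flinear_word_D: "flinear (word_D p i)"
  unfolding word_D_def[abs_def] by (rule flinear_diff[OF flinear_relabel flinear_ident])

lemma relabel_pow: "(relabel \<tau> ^^ k) v = relabel (\<tau> ^^ k) v"
proof (induction k)
  case 0 show ?case by (simp add: relabel_id[unfolded id_def] id_def)
next
  case (Suc k)
  have "(relabel \<tau> ^^ Suc k) v = relabel \<tau> (relabel (\<tau> ^^ k) v)" using Suc by simp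
  then show ?case by (simp only: relabel_comp funpow_Suc_right)
qed

lemma inv_g_cycle_pow: "(inv_into UNIV (g_cycle p i) ^^ k) ((g_cycle p i ^^ (k + l)) x) = (g_cycle p i ^^ l) x"
proof (induction k)
  case (Suc k)
  let ?i = "inv_into UNIV (g_cycle p i)"
  have "(?i ^^ Suc k) y = (?i ^^ k) (?i y)" for y by (simp add: funpow_swap1)
  moreover have "(g_cycle p i ^^ (Suc k + l)) x = g_cycle p i ((g_cycle p i ^^ (k + l)) x)" by simp
  ultimately show ?case using Suc by (simp only: inv_g_cycle)
qed simp

lemma word_pencil_nilpotent:
  assumes "prime p" "CHAR('k::field) = p"
  shows "nilpotent p (pencil n (word_D p) \<alpha> :: (_ \<Rightarrow>\<^sub>0 'k) \<Rightarrow> _)"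
proof (rule nilpotent.intro)
  show "flinear (pencil n (word_D p) \<alpha> :: (_ \<Rightarrow>\<^sub>0 'k) \<Rightarrow> _)" by (rule flinear_pencil[OF flinear_word_D])
  fix v :: "(nat \<Rightarrow> nat) \<Rightarrow>\<^sub>0 'k"
  show "(pencil n (word_D p) \<alpha> ^^ p) v = 0"
  proof (rule pencil_nilpotent[OF assms flinear_word_D])
    fix i j and x :: "(nat \<Rightarrow> nat) \<Rightarrow>\<^sub>0 'k"
    let ?i = "inv_into UNIV (g_cycle p i)" and ?j = "inv_into UNIV (g_cycle p j)"
    have "?i \<circ> ?j = ?j \<circ> ?i"
      using g_cycle_commute[of p i j] o_inv_distrib[OF g_cycle_bij g_cycle_bij] by metis
    then show "word_D p i (word_D p j x) = word_D p j (word_D p i x)"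
      unfolding word_D_def by (simp add: flinear_simps[OF flinear_relabel] relabel_comp)
    show "(word_D p i ^^ p) x = 0" unfolding word_D_def[abs_def]
    proof (rule frobenius_minus_id[OF assms flinear_relabel])
      fix x :: "(nat \<Rightarrow> nat) \<Rightarrow>\<^sub>0 'k"
      have "?i ^^ p = id" using inv_g_cycle_pow[where k = p and l = 0 and p = p and i = i] g_cycle_power[of p i]
        by (auto simp: fun_eq_iff)
      then show "(relabel ?i ^^ p) x = x" unfolding relabel_pow by (simp add: relabel_id)
    qed
  qed
qed

lemma word_pencil_Sp:
  assumes "v \<in> Sp {1..n * p} D"
  shows "pencil n (word_D p) \<alpha> v \<in> Sp {1..n * p} D"
  unfolding pencil_def word_D_def
  by (intro fspace.subspace_sum[OF subspace_Sp] fspace.subspace_scale[OF subspace_Sp] fspace.subspace_diff[OF subspace_Sp]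
      relabel_Sp assms permutes_inv g_cycle_permutes) simp_all

lemma rowmap_pencil: "rowmap \<rho> (pencil n (word_D p) \<alpha> v) = pencil n (word_D p) \<alpha> (rowmap \<rho> v)"
  unfolding pencil_def word_D_def by (simp add: flinear_simps[OF flinear_rowmap] relabel_rowmap)

lemma class_sum_pencil:
  "class_sum {1..n * p} (pencil n (word_D p) \<alpha> v) = pencil n (word_D p) \<alpha> (class_sum {1..n * p} v)"
  unfolding pencil_def word_D_def
  by (simp only: flinear_simps[OF flinear_class_sum], intro sum.cong refl,
      subst class_sum_relabel[OF permutes_inv[OF g_cycle_permutes]]) simp_all

lemma in_block:
  assumes "x \<in> {1..n * p}" "0 < p"
  obtains i l where "i \<in> {1..n}" "l < p" "x = (g_cycle p i ^^ l) ((i - 1) * p + 1)"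
proof -
  let ?i = "(x - 1) div p + 1" and ?l = "(x - 1) mod p"
  have "(x - 1) div p < n" using assms by (simp add: div_less_iff_less_mult) linarith
  then have "?i \<in> {1..n}" by simp
  moreover have "?l < p" using assms by simp
  moreover have "x = (?i - 1) * p + 1 + ?l" using assms(1) div_mult_mod_eq[of "x - 1" p] by simp
  ultimately show thesis using that[of ?i ?l] g_cycle_nth[of ?i ?l p] by simp
qed

context induced
begin

lemma component_relabel:
  assumes "bij g"
  shows "component x (relabel (inv_into UNIV g) v) = relabel (inv_into UNIV g) (component (inv_into UNIV g x) v)"
  by (rule flinear_eqI[OF flinear_comp[OF flinear_component flinear_relabel] flinear_comp[OF flinear_relabel flinear_component]])
     (simp add: relabel_single component_def flinear_simps[OF flinear_relabel])

lemma relabel_eq_0: "bij g \<Longrightarrow> relabel (inv_into UNIV g) v = 0 \<Longrightarrow> v = 0"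
proof -
  assume g: "bij g" and v: "relabel (inv_into UNIV g) v = 0"
  have "relabel g (relabel (inv_into UNIV g) v) = v"
    unfolding relabel_comp using g by (simp add: relabel_id bij_is_inj)
  then show "v = 0" using v by (simp add: flinear_simps[OF flinear_relabel])
qed

text \<open>Only \<open>g\<^sub>i\<close> moves an entry \<open>x\<close> of the \<open>i\<close>-th
  block. If the component of \<open>v\<close> at \<open>x\<close> vanishes, the component at
  \<open>x\<close> of the equation \<open>N v = 0\<close> reduces to the component of
  \<open>v\<close> at the preimage of \<open>x\<close> under \<open>g\<^sub>i\<close>, with the
  factor \<open>\<alpha> i\<close>. So vanishing spreads around the whole cycle.\<close>

lemma kernel_component:
  assumes Xn: "X = {1..n * p}" and p: "0 < p" and \<alpha>: "\<And>i. i \<in> {1..n} \<Longrightarrow> \<alpha> i \<noteq> 0"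
    and v: "v \<in> Sp X DM" "pencil n (word_D p) \<alpha> v = 0"
    and c: "\<And>i. i \<in> {1..n} \<Longrightarrow> component ((i - 1) * p + 1) v = 0"
  shows "v = 0"
proof -
  let ?g = "\<lambda>i. inv_into UNIV (g_cycle p i)"
  have step: "component (?g i x) v = 0" if i: "i \<in> {1..n}" and x: "x \<in> {(i - 1) * p + 1..i * p}" and cx: "component x v = 0" for i x
  proof -
    have "0 = component x (pencil n (word_D p) \<alpha> v)" using v(2) by (simp add: flinear_simps[OF flinear_component])
    also have "\<dots> = (\<Sum>j = 1..n. fscale (\<alpha> j) (relabel (?g j) (component (?g j x) v)))"
      unfolding pencil_def word_D_def
      by (simp add: flinear_simps[OF flinear_component] component_relabel[OF g_cycle_bij] cx)
    also have "\<dots> = fscale (\<alpha> i) (relabel (?g i) (component (?g i x) v)) + (\<Sum>j\<in>{1..n} - {i}. fscale (\<alpha> j) (relabel (?g j) (component (?g j x) v)))"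
      using i by (subst sum.remove[of _ i]) auto
    also have "(\<Sum>j\<in>{1..n} - {i}. fscale (\<alpha> j) (relabel (?g j) (component (?g j x) v))) = 0"
    proof (rule sum.neutral, rule ballI)
      fix j assume j: "j \<in> {1..n} - {i}"
      then have "x \<notin> {(j - 1) * p + 1..j * p}" using block_disjoint[of j i p] x by blast
      then have "g_cycle p j x = x" by (rule g_cycle_outside)
      then have "?g j x = x" using inv_g_cycle(1)[of p j x] by simp
      then show "fscale (\<alpha> j) (relabel (?g j) (component (?g j x) v)) = 0" by (simp add: cx flinear_simps[OF flinear_relabel])
    qed
    finally have "relabel (?g i) (component (?g i x) v) = 0" using \<alpha>[OF i] by simp
    then show ?thesis by (rule relabel_eq_0[OF g_cycle_bij])
  qed
  have all: "component ((?g i ^^ l) ((i - 1) * p + 1)) v = 0" if i: "i \<in> {1..n}" for i l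
  proof (induction l)
    case 0 then show ?case using c[OF i] by simp
  next
    case (Suc l)
    have perm: "?g i ^^ l permutes {(i - 1) * p + 1..i * p}"
      by (rule permutes_funpow[OF permutes_inv[OF g_cycle_permutes_block]])
    have "(i - 1) * p + 1 \<in> {(i - 1) * p + 1..i * p}" using i p by (cases i) auto
    then have "(?g i ^^ l) ((i - 1) * p + 1) \<in> {(i - 1) * p + 1..i * p}" using permutes_in_image[OF perm] by blast
    from step[OF i this Suc] show ?case by simp
  qed
  have "component x v = 0" if x: "x \<in> X" for x
  proof -
    obtain i l where il: "i \<in> {1..n}" "l < p" "x = (g_cycle p i ^^ l) ((i - 1) * p + 1)"
      using in_block[OF x[unfolded Xn] p] by blast
    have "(?g i ^^ (p - l)) ((g_cycle p i ^^ (p - l + l)) ((i - 1) * p + 1)) = x" unfolding il(3) by (rule inv_g_cycle_pow)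
    then have "x = (?g i ^^ (p - l)) ((i - 1) * p + 1)" using il(2) by (simp add: g_cycle_power)
    then show ?thesis using all[OF il(1)] by simp
  qed
  then show "v = 0" using sum_component[OF v(1)] by simp
qed

text \<open>The kernel embeds into \<open>n\<close> graded pieces, one for each block, whereas the
  whole module has the dimension of \<open>n * p\<close> pieces.\<close>

lemma induced_free:
  fixes \<alpha> :: "nat \<Rightarrow> 'k::field"
  assumes Xn: "X = {1..n * p}" "Suc (card (dg f)) = n * p" and p: "0 < p" and \<alpha>: "\<And>i. i \<in> {1..n} \<Longrightarrow> \<alpha> i \<noteq> 0"
  shows "p * kdim (pencil n (word_D p) \<alpha>) (Sp X DM) 1 \<le> fspace.dim (Sp X DM :: (_ \<Rightarrow>\<^sub>0 'k) set)"
proof -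
  have m: "X = {1..Suc (card (dg f))}" using Xn by simp
  let ?N = "pencil n (word_D p) \<alpha>"
  let ?V = "{v \<in> Sp X DM :: (_ \<Rightarrow>\<^sub>0 'k) set. (?N ^^ 1) v = 0}"
  let ?x = "\<lambda>i. (i - 1) * p + 1"
  have I: "?x ` {1..n} \<subseteq> X"
  proof
    fix x assume "x \<in> ?x ` {1..n}"
    then obtain i where i: "i \<in> {1..n}" "x = (i - 1) * p + 1" by blast
    have "i * p \<le> n * p" by (rule mult_le_mono1) (use i in simp)
    then have "(i - 1) * p + p \<le> n * p" using i(1) by (cases i) (auto simp: add.commute)
    then show "x \<in> X" using i p unfolding Xn by simp
  qed
  have "fspace.dim ?V \<le> (\<Sum>x\<in>?x ` {1..n}. fspace.dim (Sp (X - {x}) (dg f) :: (_ \<Rightarrow>\<^sub>0 'k) set))"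
  proof (rule dim_le_components[OF subspace_ker[OF flinear_funpow[OF flinear_pencil[OF flinear_word_D]] subspace_Sp] _ I])
    fix v assume v: "v \<in> ?V" "\<forall>x\<in>?x ` {1..n}. component x v = 0"
    have c: "component (?x i) v = 0" if "i \<in> {1..n}" for i using v(2) that by blast
    have "v \<in> Sp X DM" "?N v = 0" using v(1) by simp_all
    from kernel_component[OF Xn(1) p \<alpha> this c] show "v = 0" by simp
  qed auto
  also have "\<dots> \<le> (\<Sum>x\<in>?x ` {1..n}. specht_dim TYPE('k) f)"
    unfolding specht_dim_def m
  proof (rule sum_mono)
    fix x assume "x \<in> ?x ` {1..n}"
    then have "x \<in> {1..Suc (card (dg f))}" using I unfolding m by blast
    then show "fspace.dim (Sp ({1..Suc (card (dg f))} - {x}) (dg f) :: (_ \<Rightarrow>\<^sub>0 'k) set) \<le> fspace.dim (Sp {1..card (dg f)} (dg f) :: (_ \<Rightarrow>\<^sub>0 'k) set)"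
      by (rule dim_Sp_remove_letter[OF _ finite_dg[OF f]])
  qed
  also have "\<dots> \<le> n * specht_dim TYPE('k) f" using card_image_le[of "{1..n}" ?x] by simp
  finally have "p * kdim ?N (Sp X DM) 1 \<le> p * (n * specht_dim TYPE('k) f)" unfolding kdim_def by (rule mult_le_mono2)
  also have "\<dots> = fspace.dim (Sp X DM :: (_ \<Rightarrow>\<^sub>0 'k) set)" using dim_M[OF m, where ?'k = 'k] Xn(2) by (simp add: mult_ac)
  finally show ?thesis .
qed

section \<open>The block component of the induced module\<close>

text \<open>\<open>T\<close> acts on the filtration factor of row \<open>r\<close> by
  \<open>cc r - cc r1\<close>, which is zero for \<open>r1\<close> and \<open>r2\<close> only. The
  filtration meets \<open>r1\<close> first, so the factor of \<open>r1\<close> becomes the quotient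
  of \<open>P\<close> and that of \<open>r2\<close> the submodule.\<close>

lemma complementary_words:
  fixes \<alpha> :: "nat \<Rightarrow> 'k::field"
  assumes p: "prime p" "CHAR('k) = p" and Xn: "X = {1..n * p}" "Suc (card (dg f)) = n * p"
    and \<alpha>: "\<And>i. i \<in> {1..n} \<Longrightarrow> \<alpha> i \<noteq> 0"
    and r: "r1 \<in> addable f" "r2 \<in> addable f" "r1 < r2"
    and res: "(of_int (int (f r1) - int r1) :: 'k) = of_int (int (f r2) - int r2)"
      "\<And>r. r \<in> addable f \<Longrightarrow> r \<noteq> r1 \<Longrightarrow> r \<noteq> r2 \<Longrightarrow> (of_int (int (f r) - int r) :: 'k) \<noteq> of_int (int (f r1) - int r1)"
  defines "S \<equiv> \<lambda>r. Sp X (dg (inc_row f r)) :: (_ \<Rightarrow>\<^sub>0 'k) set" and "N \<equiv> pencil n (word_D p) \<alpha>"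
  shows "\<exists>d. p * d = fspace.dim (S r1) + fspace.dim (S r2) \<and>
    (\<forall>j\<le>p. kdim N (S r1) j + fspace.dim (S r2) = j * d + kdim N (S r2) (p - j))"
proof -
  have m: "X = {1..Suc (card (dg f))}" using Xn by simp
  have p0: "0 < p" using p(1) prime_gt_0_nat by blast
  let ?M = "Sp X DM :: (_ \<Rightarrow>\<^sub>0 'k) set"
  define \<psi> where "\<psi> r = (rowmap (repl E r) :: (_ \<Rightarrow>\<^sub>0 'k) \<Rightarrow> _)" for r
  define cc where "cc r = (of_int (content_sum (inc_row f r)) :: 'k)" for r
  define T where "T v = class_sum X v - fscale (cc r1) v" for v :: "(nat \<Rightarrow> nat) \<Rightarrow>\<^sub>0 'k"
  have lin\<psi>: "flinear (\<psi> r)" for r unfolding \<psi>_def by (rule flinear_rowmap)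
  have linT: "flinear T" unfolding T_def[abs_def]
    by (rule flinear_diff[OF flinear_class_sum flinear_scale[OF flinear_ident]])
  have cc: "cc r1 = cc r2" "\<And>r. r \<in> addable f \<Longrightarrow> r \<noteq> r1 \<Longrightarrow> r \<noteq> r2 \<Longrightarrow> cc r \<noteq> cc r1"
    using res unfolding cc_def content_sum_inc[OF f] by simp_all
  have T\<psi>: "\<psi> r (T v) = T (\<psi> r v)" for r v
    unfolding T_def \<psi>_def by (simp add: flinear_simps[OF flinear_rowmap] class_sum_rowmap)
  have \<psi>K: "\<psi> r ` K r = S r" if "r \<in> addable f" for r
    unfolding \<psi>_def S_def by (rule rowmap_K[OF m that])
  have TS: "T y = fscale (cc r - cc r1) y" if "r \<in> addable f" "y \<in> S r" for r y
    using class_sum_Sp_scalar[OF par_inc[OF f that(1)] X] that(2)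
    by (simp add: T_def S_def cc_def fspace.scale_left_diff_distrib)
  have TM: "T v \<in> ?M" if "v \<in> ?M" for v unfolding T_def
    by (intro fspace.subspace_diff[OF subspace_Sp] fspace.subspace_scale[OF subspace_Sp] class_sum_Sp X that)
  have TK: "T v \<in> K r" if "v \<in> K r" for v r
    using that TM T\<psi> flinear_simps(4)[OF linT] unfolding K_def by (auto simp flip: \<psi>_def)
  have TKn: "T (T (T (T v))) \<in> K r" if "v \<in> K r" for v r using TK that by blast
  \<comment> \<open>On the factors of the other rows \<open>T\<close> is a nonzero scalar, so a
    vector killed by a power of \<open>T\<close> has image 0 there. The fourth power is needed
    because the stability of the kernel of \<open>T^2\<close> compares it with that of
    \<open>T^4\<close>.\<close>
  have in_K: "u \<in> K b" if u: "u \<in> ?M" "T (T (T (T u))) = 0" "\<And>i. i \<in> {r1, r2} \<Longrightarrow> i < b \<Longrightarrow> \<psi> i u = 0" for u b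
  proof -
    have "i \<in> addable f \<Longrightarrow> i < b \<Longrightarrow> \<psi> i u = 0" for i
    proof (induction i rule: less_induct)
      case (less i)
      show ?case
      proof (cases "i \<in> {r1, r2}")
        case True then show ?thesis using u(3) less.prems by blast
      next
        case False
        have "u \<in> K i" unfolding K_def using u(1) less by (auto simp flip: \<psi>_def)
        then have y: "\<psi> i u \<in> S i" using \<psi>K[OF less.prems(1)] by blast
        have "0 = T (T (T (T (\<psi> i u))))" using u(2) T\<psi>[symmetric] flinear_simps(4)[OF lin\<psi>] by simp
        also have "\<dots> = fscale ((cc i - cc r1) ^ 4) (\<psi> i u)"
          using TS[OF less.prems(1) y] by (simp add: flinear_simps[OF linT] power4_eq_xxxx mult.assoc)
        finally show ?thesis using cc(2)[OF less.prems(1)] False by simp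
      qed
    qed
    then show ?thesis unfolding K_def using u(1) by (auto simp flip: \<psi>_def)
  qed
  have all0: "u = 0" if u: "u \<in> ?M" "T (T (T (T u))) = 0" "\<psi> r1 u = 0" "\<psi> r2 u = 0" for u
  proof (rule rowmap_inj[OF m u(1)])
    fix r assume "r \<in> addable f"
    moreover have "u \<in> K (Suc r)" by (rule in_K[OF u(1,2)]) (use u(3,4) in auto)
    ultimately show "rowmap (repl E r) u = 0" unfolding K_def by simp
  qed
  have kill: "\<psi> r (T v) = 0" if "r \<in> {r1, r2}" "v \<in> K r" for r v
  proof -
    have ra: "r \<in> addable f" using that(1) r by blast
    have "\<psi> r v \<in> S r" using \<psi>K[OF ra] that(2) by blast
    then have "T (\<psi> r v) = 0" using TS[OF ra] that(1) cc(1) by auto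
    then show ?thesis by (simp add: T\<psi>)
  qed
  have T0: "T 0 = 0" by (rule flinear_simps(4)[OF linT])
  \<comment> \<open>The first application of \<open>T\<close> clears the factor of
    \<open>r1\<close>, which puts \<open>T v\<close> into \<open>K r2\<close>; the second clears the
    factor of \<open>r2\<close>, and all other factors are zero already.\<close>
  have st: "T (T v) = 0" if v: "v \<in> ?M" "T (T (T (T v))) = 0" for v
  proof -
    have "v \<in> K r1" by (rule in_K[OF v]) (use r in auto)
    then have 1: "\<psi> r1 (T v) = 0" using kill by blast
    have Tv: "T v \<in> ?M" "T (T (T (T (T v)))) = 0" using TM[OF v(1)] v(2) T0 by simp_all
    have "T v \<in> K r2" by (rule in_K[OF Tv]) (use 1 r in auto)
    then have "\<psi> r2 (T (T v)) = 0" using kill by blast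
    moreover have "\<psi> r1 (T (T v)) = 0" using 1 T0 by (simp add: T\<psi>)
    ultimately show ?thesis using all0[of "T (T v)"] TM Tv(1) v(2) T0 by simp
  qed
  let ?T2 = "\<lambda>v. T (T v)"
  have linT2: "flinear ?T2" by (rule flinear_comp[OF linT linT])
  \<comment> \<open>Each of the two factors with the common residue is killed by one application of \<open>T\<close>, so the
    generalized eigenspace is the kernel of \<open>T\<^sup>2\<close>.\<close>
  define P where "P = {v \<in> ?M. ?T2 v = 0}"
  have NM: "nilpotent_on p N ?M"
    by (rule nilpotent_onI) (use word_pencil_nilpotent[OF p] subspace_Sp fin_dim_M word_pencil_Sp Xn in \<open>auto simp: N_def\<close>)
  interpret M: nilpotent_on p N ?M by (rule NM)
  have TN: "T (N v) = N (T v)" for v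
    unfolding T_def N_def Xn(1) class_sum_pencil by (simp add: flinear_simps[OF flinear_pencil[OF flinear_word_D]])
  have freeP: "p * kdim N P 1 \<le> fspace.dim P" unfolding P_def
  proof (rule kdim_summand[OF NM _ linT2])
    show "p * kdim N ?M 1 \<le> fspace.dim ?M" unfolding N_def by (rule induced_free[OF Xn p0 \<alpha>])
  qed (use TM TN st in auto)
  have subP: "fspace.subspace P" and finP: "fin_dim P" unfolding P_def
    by (rule subspace_ker[OF linT2 subspace_Sp], rule fin_dim_Collect[OF fin_dim_M])
  have NP: "nilpotent_on p N P"
    by (rule nilpotent_onI[OF M.nilpotent_axioms subP finP])
       (use M.closed TN flinear_simps(4)[OF M.lin] in \<open>auto simp: P_def\<close>)
  interpret P: nilpotent_on p N P by (rule NP)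
  have P4: "v \<in> ?M" "T (T (T (T v))) = 0" if "v \<in> P" for v using that T0 by (auto simp: P_def)
  have KM: "v \<in> ?M" if "v \<in> K b" for v b using that by (simp add: K_def)
  \<comment> \<open>The Fitting decomposition inside one step of the filtration. For
    \<open>b\<close> equal to \<open>r1\<close> or \<open>r2\<close> the row map kills
    \<open>?T2 z\<close>, so every preimage can be replaced by one in \<open>P\<close>.\<close>
  have fit: "\<exists>a z. v = a + ?T2 z \<and> a \<in> K b \<and> ?T2 a = 0 \<and> z \<in> K b" if v: "v \<in> K b" for v b
  proof -
    have 1: "?T2 x \<in> K b" if "x \<in> K b" for x by (intro TK that)
    have 2: "?T2 x = 0" if "x \<in> K b" "?T2 (?T2 x) = 0" for x by (rule st[OF KM[OF that(1)] that(2)])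
    obtain a z where "v = a + ?T2 z" "a \<in> K b" "?T2 a = 0" "z \<in> K b"
      by (rule fitting[OF subspace_K fin_dim_K linT2 1 2 v])
    then show ?thesis by blast
  qed
  have im1: "\<psi> r1 ` P = S r1"
  proof (intro subset_antisym subsetI)
    fix y assume "y \<in> \<psi> r1 ` P"
    then obtain v where v: "y = \<psi> r1 v" "v \<in> P" by blast
    have "v \<in> K r1" by (rule in_K[OF P4[OF v(2)]]) (use r in auto)
    then show "y \<in> S r1" using \<psi>K[OF r(1)] v(1) by blast
  next
    fix y assume "y \<in> S r1"
    then obtain v where v: "y = \<psi> r1 v" "v \<in> K r1" using \<psi>K[OF r(1)] by blast
    obtain a z where az: "v = a + ?T2 z" "a \<in> K r1" "?T2 a = 0" "z \<in> K r1"
      using fit[OF v(2)] by blast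
    have "\<psi> r1 (?T2 z) = 0" using kill[of r1 z] az(4) T0 by (simp add: T\<psi>)
    then have "y = \<psi> r1 a" unfolding v(1) az(1) by (simp add: flinear_simps[OF lin\<psi>])
    moreover have "a \<in> P" using az(2,3) by (simp add: P_def K_def)
    ultimately show "y \<in> \<psi> r1 ` P" by blast
  qed
  let ?A = "{v \<in> P. \<psi> r1 v = 0}"
  have im2: "\<psi> r2 ` ?A = S r2"
  proof (intro subset_antisym subsetI)
    fix y assume "y \<in> \<psi> r2 ` ?A"
    then obtain v where v: "y = \<psi> r2 v" "v \<in> P" "\<psi> r1 v = 0" by blast
    have "v \<in> K r2" by (rule in_K[OF P4[OF v(2)]]) (use r v(3) in auto)
    then show "y \<in> S r2" using \<psi>K[OF r(2)] v(1) by blast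
  next
    fix y assume "y \<in> S r2"
    then obtain v where v: "y = \<psi> r2 v" "v \<in> K r2" using \<psi>K[OF r(2)] by blast
    obtain a z where az: "v = a + ?T2 z" "a \<in> K r2" "?T2 a = 0" "z \<in> K r2"
      using fit[OF v(2)] by blast
    have "\<psi> r2 (?T2 z) = 0" using kill[of r2 z] az(4) T0 by (simp add: T\<psi>)
    then have "y = \<psi> r2 a" unfolding v(1) az(1) by (simp add: flinear_simps[OF lin\<psi>])
    moreover have "a \<in> ?A" using az(2,3) r by (simp add: P_def K_def \<psi>_def)
    ultimately show "y \<in> \<psi> r2 ` ?A" by blast
  qed
  have subA: "fspace.subspace ?A" and finA: "fin_dim ?A"
    by (rule subspace_ker[OF lin\<psi> subP], rule fin_dim_Collect[OF finP])
  have injA: "x = 0" if "x \<in> ?A" "\<psi> r2 x = 0" for x using all0[of x] that P4 by blast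
  have \<psi>N: "\<psi> r (N v) = N (\<psi> r v)" for r v unfolding \<psi>_def N_def by (rule rowmap_pencil)
  have NA: "N x \<in> ?A" if "x \<in> ?A" for x
    using that P.closed \<psi>N flinear_simps(4)[OF M.lin] by auto
  have k2: "kdim N (S r2) j = kdim N ?A j" for j unfolding im2[symmetric]
    by (rule kdim_image[OF lin\<psi> subA finA injA M.lin NA \<psi>N])
  have d2: "fspace.dim (S r2) = fspace.dim ?A" unfolding im2[symmetric]
    by (rule dim_image_inj[OF lin\<psi> subA finA injA])
  have dP: "fspace.dim P = fspace.dim ?A + fspace.dim (S r1)" unfolding im1[symmetric]
    by (rule rank_nullity[OF lin\<psi> subP finP])
  have pd: "p * kdim N P 1 = fspace.dim P" using freeP P.dim_le_mult by linarith
  have "kdim N (S r1) j + fspace.dim (S r2) = j * kdim N P 1 + kdim N (S r2) (p - j)" if "j \<le> p" for j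
    unfolding k2 d2 im1[symmetric] by (rule kdim_exact[OF NP freeP lin\<psi> \<psi>N that])
  then show ?thesis using pd dP d2 by (intro exI[of _ "kdim N P 1"]) auto
qed

end

section \<open>From the word model to Specht modules\<close>

definition part_fun :: "nat list \<Rightarrow> nat \<Rightarrow> nat" where
  "part_fun \<mu> i = (if i < length \<mu> then \<mu> ! i else 0)"

lemma dg_part_fun: "dg (part_fun \<mu>) = diagram \<mu>"
  by (auto simp: dg_def part_fun_def diagram_def split: if_splits)

lemma card_diagram: "card (diagram \<mu>) = sum_list \<mu>"
proof -
  have "diagram \<mu> = (SIGMA i:{..<length \<mu>}. {..<\<mu> ! i})" by (auto simp: diagram_def)
  then show ?thesis by (simp add: sum_list_sum_nth atLeast0LessThan)
qed

lemma par_part_fun: "is_partition \<mu> \<Longrightarrow> par (part_fun \<mu>)"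
proof -
  assume \<mu>: "is_partition \<mu>"
  have "antimono (part_fun \<mu>)"
    by (rule antimonoI) (use \<mu> in \<open>auto simp: part_fun_def is_partition_def sorted_wrt_iff_nth_less le_less\<close>)
  moreover have "{i. part_fun \<mu> i \<noteq> 0} \<subseteq> {..<length \<mu>}" by (auto simp: part_fun_def)
  ultimately show ?thesis unfolding par_def using finite_subset by blast
qed

definition word_tabloid :: "nat \<Rightarrow> nat set \<Rightarrow> (nat \<Rightarrow> nat) \<Rightarrow> nat set list" where
  "word_tabloid L X w = map (\<lambda>i. {x \<in> X. w x = i}) [0..<L]"

lemma inj_on_word_tabloid:
  assumes "R \<subseteq> {..<L}"
  shows "inj_on (word_tabloid L X) (words X R)"
proof (rule inj_onI, rule ext)
  fix w w' x assume w: "w \<in> words X R" "w' \<in> words X R" "word_tabloid L X w = word_tabloid L X w'"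
  show "w x = w' x"
  proof (cases "x \<in> X")
    case True
    then have "w x < L" using w(1) assms by (auto simp: words_def)
    then have "{y \<in> X. w y = w x} = {y \<in> X. w' y = w x}"
      using arg_cong[OF w(3), of "\<lambda>T. T ! w x"] by (simp add: word_tabloid_def)
    moreover have "x \<in> {y \<in> X. w y = w x}" using True by simp
    ultimately have "x \<in> {y \<in> X. w' y = w x}" by simp
    then show ?thesis by simp
  qed (use w in \<open>auto simp: words_def\<close>)
qed

interpretation tab: linear_action tabloid_act
  by (rule linear_action.intro)
     (auto intro!: flinearI simp: tabloid_act_add tabloid_act_scale tabloid_act_comp tabloid_act_id)

context
  fixes \<mu> :: "nat list" and X :: "nat set"
  defines "X \<equiv> {1..sum_list \<mu>}"
begin

definition to_tabloid :: "((nat \<Rightarrow> nat) \<Rightarrow>\<^sub>0 'k::field) \<Rightarrow> (nat set list \<Rightarrow>\<^sub>0 'k)" where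
  "to_tabloid = flift (\<lambda>w. sing (word_tabloid (length \<mu>) {1..sum_list \<mu>} w))"

lemma flinear_to_tabloid: "flinear to_tabloid" unfolding to_tabloid_def by (rule flinear_flift)

lemma to_tabloid_single: "to_tabloid (Poly_Mapping.single w a) = Poly_Mapping.single (word_tabloid (length \<mu>) X w) a"
  by (simp add: to_tabloid_def X_def)

lemma to_tabloid_relabel:
  assumes g: "g permutes X"
  shows "to_tabloid (relabel (inv_into UNIV g) v) = tabloid_act g (to_tabloid v)"
proof (rule flinear_eqI[OF flinear_comp[OF flinear_to_tabloid flinear_relabel] flinear_comp[OF tab.A_lin flinear_to_tabloid]])
  fix w :: "nat \<Rightarrow> nat"
  have "{x \<in> X. (w \<circ> inv_into UNIV g) x = i} = g ` {x \<in> X. w x = i}" for i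
  proof (intro Set.set_eqI iffI)
    fix x assume x: "x \<in> {x \<in> X. (w \<circ> inv_into UNIV g) x = i}"
    then have "inv_into UNIV g x \<in> {x \<in> X. w x = i}" using permutes_in_image[OF permutes_inv[OF g]] by simp
    then show "x \<in> g ` {x \<in> X. w x = i}" using permutes_inverses(1)[OF g, of x] by (metis imageI)
  next
    fix x assume "x \<in> g ` {x \<in> X. w x = i}"
    then show "x \<in> {x \<in> X. (w \<circ> inv_into UNIV g) x = i}"
      using permutes_in_image[OF g] permutes_inverses(2)[OF g] by auto
  qed
  then have "word_tabloid (length \<mu>) X (w \<circ> inv_into UNIV g) = map ((`) g) (word_tabloid (length \<mu>) X w)"
    unfolding word_tabloid_def by simp
  then show "to_tabloid (relabel (inv_into UNIV g) (sing w)) = tabloid_act g (to_tabloid (sing w))"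
    by (simp add: relabel_single to_tabloid_single tabloid_act_single)
qed

text \<open>A permutation acts on tabloids from the left and on words from the right, so the two
  sums over the column stabilizer correspond under inversion.\<close>

lemma to_tabloid_ptb:
  assumes w: "filling X (diagram \<mu>) w c" and t: "\<And>x. x \<in> X \<Longrightarrow> t (w x, c x) = x"
  shows "to_tabloid (ptb X w c) = (polytabloid \<mu> t :: _ \<Rightarrow>\<^sub>0 'k::field)"
proof -
  have X: "finite X" by (simp add: X_def)
  have tX: "t (i, j) \<in> X \<and> w (t (i, j)) = i \<and> c (t (i, j)) = j" if "(i, j) \<in> diagram \<mu>" for i j
    using fillingD(4)[OF w that] t by auto
  have col: "{t (i, j) |i. (i, j) \<in> diagram \<mu>} = {x \<in> X. c x = j}" for j
  proof (intro Set.set_eqI iffI)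
    fix x assume "x \<in> {x \<in> X. c x = j}"
    then have "x = t (w x, j)" "(w x, j) \<in> diagram \<mu>" using t[of x] fillingD(1)[OF w, of x] by auto
    then show "x \<in> {t (i, j) |i. (i, j) \<in> diagram \<mu>}" by blast
  qed (use tX in auto)
  have row: "{t (i, j) |j. (i, j) \<in> diagram \<mu>} = {x \<in> X. w x = i}" for i
  proof (intro Set.set_eqI iffI)
    fix x assume "x \<in> {x \<in> X. w x = i}"
    then have "x = t (i, c x)" "(i, c x) \<in> diagram \<mu>" using t[of x] fillingD(1)[OF w, of x] by auto
    then show "x \<in> {t (i, j) |j. (i, j) \<in> diagram \<mu>}" by blast
  qed (use tX in auto)
  have tabl: "tabloid \<mu> (\<pi> \<circ> t) = word_tabloid (length \<mu>) X (w \<circ> inv_into UNIV \<pi>)" if \<pi>: "\<pi> permutes X" for \<pi>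
  proof -
    have "{(\<pi> \<circ> t) (i, j) |j. (i, j) \<in> diagram \<mu>} = {x \<in> X. (w \<circ> inv_into UNIV \<pi>) x = i}" for i
    proof -
      have "{(\<pi> \<circ> t) (i, j) |j. (i, j) \<in> diagram \<mu>} = \<pi> ` {t (i, j) |j. (i, j) \<in> diagram \<mu>}" by auto
      also have "\<dots> = \<pi> ` {x \<in> X. w x = i}" unfolding row ..
      also have "\<dots> = {x \<in> X. (w \<circ> inv_into UNIV \<pi>) x = i}"
      proof (intro Set.set_eqI iffI)
        fix x assume x: "x \<in> {x \<in> X. (w \<circ> inv_into UNIV \<pi>) x = i}"
        then have "inv_into UNIV \<pi> x \<in> {x \<in> X. w x = i}" using permutes_in_image[OF permutes_inv[OF \<pi>]] by simp
        then show "x \<in> \<pi> ` {x \<in> X. w x = i}" using permutes_inverses(1)[OF \<pi>, of x] by (metis imageI)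
      next
        fix x assume "x \<in> \<pi> ` {x \<in> X. w x = i}"
        then show "x \<in> {x \<in> X. (w \<circ> inv_into UNIV \<pi>) x = i}"
          using permutes_in_image[OF \<pi>] permutes_inverses(2)[OF \<pi>] by auto
      qed
      finally show ?thesis .
    qed
    then show ?thesis unfolding tabloid_def word_tabloid_def by (simp cong: map_cong)
  qed
  have stab: "column_stabilizer \<mu> t = colstab X c"
  proof (intro Set.set_eqI iffI)
    fix \<pi> assume \<pi>: "\<pi> \<in> column_stabilizer \<mu> t"
    then have "\<pi> permutes X" "\<And>j. \<pi> ` {x \<in> X. c x = j} = {x \<in> X. c x = j}"
      unfolding column_stabilizer_def col X_def by auto
    then show "\<pi> \<in> colstab X c" unfolding colstab_def by blast
  next
    fix \<pi> assume "\<pi> \<in> colstab X c"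
    then have \<pi>: "\<pi> permutes X" "\<And>x. x \<in> X \<Longrightarrow> c (\<pi> x) = c x" by (auto simp: colstab_def)
    have "\<pi> ` {x \<in> X. c x = j} = {x \<in> X. c x = j}" for j
    proof (rule endo_inj_surj)
      show "\<pi> ` {x \<in> X. c x = j} \<subseteq> {x \<in> X. c x = j}" using \<pi>(2) permutes_in_image[OF \<pi>(1)] by auto
    qed (use X permutes_inj_on[OF \<pi>(1)] in auto)
    then show "\<pi> \<in> column_stabilizer \<mu> t" unfolding column_stabilizer_def col using \<pi>(1) by (simp add: X_def)
  qed
  have invc: "inv_into UNIV \<pi> \<in> colstab X c" if "\<pi> \<in> colstab X c" for \<pi>
  proof -
    have \<pi>: "\<pi> permutes X" "\<And>x. x \<in> X \<Longrightarrow> c (\<pi> x) = c x" using that by (auto simp: colstab_def)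
    have "c (inv_into UNIV \<pi> x) = c x" if "x \<in> X" for x
      using \<pi>(2)[of "inv_into UNIV \<pi> x"] permutes_in_image[OF permutes_inv[OF \<pi>(1)], of x] that permutes_inverses(1)[OF \<pi>(1), of x] by simp
    then show ?thesis using permutes_inv[OF \<pi>(1)] by (simp add: colstab_def)
  qed
  have "to_tabloid (ptb X w c) = (\<Sum>\<pi>\<in>colstab X c. Poly_Mapping.single (word_tabloid (length \<mu>) X (w \<circ> \<pi>)) (of_int (sign \<pi>) :: 'k))"
    unfolding ptb_def by (simp add: flinear_simps[OF flinear_to_tabloid] to_tabloid_single)
  also have "\<dots> = polytabloid \<mu> t" unfolding polytabloid_def stab
  proof (rule sum.reindex_bij_witness[where i = "inv_into UNIV" and j = "inv_into UNIV"])
    fix \<pi> assume \<pi>: "\<pi> \<in> colstab X c"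
    then have p: "\<pi> permutes X" by (simp add: colstab_def)
    show "inv_into UNIV (inv_into UNIV \<pi>) = \<pi>" by (rule permutes_inv_inv[OF p])
    show "inv_into UNIV \<pi> \<in> colstab X c" by (rule invc[OF \<pi>])
    have "sign (inv_into UNIV \<pi>) = sign \<pi>"
      by (rule sign_inverse) (use p X permutation_permutes in blast)
    then show "Poly_Mapping.single (tabloid \<mu> (inv_into UNIV \<pi> \<circ> t)) (of_int (sign (inv_into UNIV \<pi>))) =
        Poly_Mapping.single (word_tabloid (length \<mu>) X (w \<circ> \<pi>)) (of_int (sign \<pi>) :: 'k)"
      by (simp add: tabl[OF permutes_inv[OF p]] permutes_inv_inv[OF p])
  next
    fix \<pi> assume \<pi>: "\<pi> \<in> colstab X c"
    then have p: "\<pi> permutes X" by (simp add: colstab_def)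
    show "inv_into UNIV (inv_into UNIV \<pi>) = \<pi>" by (rule permutes_inv_inv[OF p])
    show "inv_into UNIV \<pi> \<in> colstab X c" by (rule invc[OF \<pi>])
  qed
  finally show ?thesis .
qed

lemma vecs_specht: "vecs (specht \<mu> :: (_, 'k::field, _) kG_rep) = to_tabloid ` Sp X (diagram \<mu>)"
proof -
  have "to_tabloid ` {ptb X w c |w c. filling X (diagram \<mu>) w c} = ({polytabloid \<mu> t |t. is_tableau \<mu> t} :: (nat set list \<Rightarrow>\<^sub>0 'k) set)"
  proof (intro Set.set_eqI iffI)
    fix v :: "nat set list \<Rightarrow>\<^sub>0 'k" assume "v \<in> to_tabloid ` {ptb X w c |w c. filling X (diagram \<mu>) w c}"
    then obtain w c where w: "v = to_tabloid (ptb X w c)" "filling X (diagram \<mu>) w c" by blast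
    let ?t = "inv_into X (\<lambda>x. (w x, c x))"
    have b: "bij_betw (\<lambda>x. (w x, c x)) X (diagram \<mu>)" using w(2) by (simp add: filling_def)
    have "is_tableau \<mu> ?t" unfolding is_tableau_def X_def[symmetric] by (rule bij_betw_inv_into[OF b])
    moreover have "?t (w x, c x) = x" if "x \<in> X" for x using bij_betw_inv_into_left[OF b that] by simp
    then have "v = polytabloid \<mu> ?t" unfolding w(1) by (rule to_tabloid_ptb[OF w(2)])
    ultimately show "v \<in> {polytabloid \<mu> t |t. is_tableau \<mu> t}" by blast
  next
    fix v :: "nat set list \<Rightarrow>\<^sub>0 'k" assume "v \<in> {polytabloid \<mu> t |t. is_tableau \<mu> t}"
    then obtain t where t: "v = polytabloid \<mu> t" "bij_betw t (diagram \<mu>) X" unfolding is_tableau_def X_def by blast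
    let ?s = "inv_into (diagram \<mu>) t"
    let ?w = "\<lambda>x. if x \<in> X then fst (?s x) else 0" and ?c = "\<lambda>x. snd (?s x)"
    have "bij_betw (\<lambda>x. (?w x, ?c x)) X (diagram \<mu>)"
      using bij_betw_inv_into[OF t(2)] by (rule bij_betw_cong[THEN iffD1, rotated]) simp
    then have f: "filling X (diagram \<mu>) ?w ?c" by (simp add: filling_def)
    have "t (?w x, ?c x) = x" if "x \<in> X" for x using bij_betw_inv_into_right[OF t(2) that] that by simp
    then have "to_tabloid (ptb X ?w ?c) = v" unfolding t(1) by (rule to_tabloid_ptb[OF f])
    then show "v \<in> to_tabloid ` {ptb X w c |w c. filling X (diagram \<mu>) w c}" using f by blast
  qed
  then show ?thesis unfolding specht_def Sp_def by (simp add: fpair.linear_span_image[OF flinear_to_tabloid, symmetric])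
qed

lemma to_tabloid_inj:
  assumes "v \<in> Sp X (diagram \<mu>)" "to_tabloid v = 0" shows "v = 0"
proof -
  have "fst ` diagram \<mu> \<subseteq> {..<length \<mu>}" by (auto simp: diagram_def)
  then have inj: "inj_on (word_tabloid (length \<mu>) X) (words X (fst ` diagram \<mu>))" by (rule inj_on_word_tabloid)
  have "v \<in> fspace.span (sing ` words X (fst ` diagram \<mu>))" using assms(1) Sp_words by blast
  then have "Poly_Mapping.keys v \<subseteq> words X (fst ` diagram \<mu>)" by (rule keys_span) auto
  from flift_inj[OF inj this] show ?thesis using assms(2) by (simp add: to_tabloid_def X_def)
qed

end

lemma to_tabloid_pencil:
  assumes "sum_list \<mu> = n * p"
  shows "to_tabloid \<mu> (pencil n (word_D p) \<alpha> v) = pencil n (tab.D p) \<alpha> (to_tabloid \<mu> v)"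
proof -
  have "to_tabloid \<mu> (relabel (inv_into UNIV (g_cycle p i)) v) = tabloid_act (g_cycle p i) (to_tabloid \<mu> v)" if "i \<in> {1..n}" for i
    by (rule to_tabloid_relabel) (use g_cycle_permutes[OF that] assms in simp)
  then show ?thesis unfolding pencil_def word_D_def tab.D_def
    by (simp add: flinear_simps[OF flinear_to_tabloid])
qed

lemma fin_dim_diagram: "fin_dim (Sp {1..sum_list \<mu>} (diagram \<mu>))"
  by (rule fin_dim_Sp) (simp_all add: finite_diagram)

lemma kdim_specht:
  assumes "sum_list \<mu> = n * p"
  shows "kdim (pencil n (tab.D p) \<alpha>) (vecs (specht \<mu> :: (_, 'k::field, _) kG_rep)) j =
      kdim (pencil n (word_D p) \<alpha>) (Sp {1..n * p} (diagram \<mu>) :: (_ \<Rightarrow>\<^sub>0 'k) set) j"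
proof -
  let ?V = "Sp {1..sum_list \<mu>} (diagram \<mu>) :: (_ \<Rightarrow>\<^sub>0 'k) set"
  have "kdim (pencil n (tab.D p) \<alpha>) (to_tabloid \<mu> ` ?V) j = kdim (pencil n (word_D p) \<alpha>) ?V j"
  proof (rule kdim_image[OF flinear_to_tabloid subspace_Sp fin_dim_diagram _ flinear_pencil[OF flinear_word_D]])
    show "v = 0" if "v \<in> ?V" "to_tabloid \<mu> v = 0" for v by (rule to_tabloid_inj[OF that])
    show "pencil n (word_D p) \<alpha> v \<in> ?V" if "v \<in> ?V" for v using word_pencil_Sp that unfolding assms .
  qed (rule to_tabloid_pencil[OF assms])
  then show ?thesis unfolding vecs_specht assms .
qed

lemma dim_specht:
  assumes "sum_list \<mu> = n * p"
  shows "fspace.dim (vecs (specht \<mu> :: (_, 'k::field, _) kG_rep)) = fspace.dim (Sp {1..n * p} (diagram \<mu>) :: (_ \<Rightarrow>\<^sub>0 'k) set)"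
  unfolding vecs_specht assms[symmetric]
  by (rule dim_image_inj[OF flinear_to_tabloid subspace_Sp fin_dim_diagram to_tabloid_inj])

lemma rep_pencil_specht:
  assumes p: "prime p" "CHAR('k::field) = p" and \<mu>: "sum_list \<mu> = n * p"
  shows "rep_pencil tabloid_act p n \<alpha> (vecs (specht \<mu>)) ((specht \<mu> :: (_, 'k, _) kG_rep) \<down> E_subgroup p n)"
proof -
  let ?V = "vecs (specht \<mu> :: (_, 'k, _) kG_rep)" and ?N = "pencil n (tab.D p) \<alpha>"
  have "nilpotent p (?N :: (_ \<Rightarrow>\<^sub>0 'k) \<Rightarrow> _)"
    by (rule nilpotent.intro[OF flinear_pencil[OF tab.D_lin] tab.pencil_D_nilpotent[OF p]])
  then have "nilpotent_on p ?N ?V"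
  proof (rule nilpotent_onI)
    show "fspace.subspace ?V" unfolding vecs_specht by (rule subspace_image[OF flinear_to_tabloid subspace_Sp])
    show "fin_dim ?V" unfolding vecs_specht by (rule fin_dim_image[OF fin_dim_diagram flinear_to_tabloid])
    fix x assume "x \<in> ?V"
    then obtain v where v: "x = to_tabloid \<mu> v" "v \<in> Sp {1..sum_list \<mu>} (diagram \<mu>)" unfolding vecs_specht by blast
    have "pencil n (word_D p) \<alpha> v \<in> Sp {1..sum_list \<mu>} (diagram \<mu>)" using word_pencil_Sp v(2) unfolding \<mu> by blast
    then show "?N x \<in> ?V" unfolding v(1) vecs_specht to_tabloid_pencil[OF \<mu>, symmetric] by (rule imageI)
  qed
  then show ?thesis
    by (intro rep_pencil.intro tab.linear_action_axioms rep_pencil_axioms.intro p)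
       (simp_all add: restrict_rep_def specht_def sym_group_def)
qed

section \<open>Generic Jordan types\<close>

text \<open>Where the ranks of all powers are maximal, all kernel dimensions and therefore the
  Jordan type are constant. The description in \<open>generic_jordan_type\<close> is unique because
  any nonempty open set meets this one. The minimality of the kernel is recorded for the comparison
  with an arbitrary point.\<close>

lemma generic_jordan_type:
  fixes A :: "(nat \<Rightarrow> nat) \<Rightarrow> ('a \<Rightarrow>\<^sub>0 'k::field) \<Rightarrow> ('a \<Rightarrow>\<^sub>0 'k)"
  assumes inf: "infinite (UNIV :: 'k set)" and rep: "\<And>\<alpha>. rep_pencil A p n \<alpha> V M"
  defines "N \<equiv> pencil n (linear_action.D A p)"
  shows "\<exists>g. polyfun n g \<and> (\<exists>\<alpha>\<in>affine_space n. g \<alpha> \<noteq> 0) \<and> (\<forall>\<alpha>\<in>affine_space n. g \<alpha> \<noteq> 0 \<longrightarrow>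
     has_jordan_type M (u_elem p n \<alpha>) (generic_jordan_type p n M) \<and>
     (\<forall>\<beta>\<in>affine_space n. kdim (N \<alpha>) V 1 \<le> kdim (N \<beta>) V 1))"
proof -
  interpret R: rep_pencil A p n "\<lambda>_. 0" V M by (rule rep)
  have nilp: "nilpotent_on p (N \<alpha>) V" for \<alpha>
    using rep[of \<alpha>] unfolding N_def rep_pencil_def by blast
  have u: "ga_act M (u_elem p n \<alpha>) x = x + N \<alpha> x" for \<alpha> x
    using rep_pencil.ga_act_u[OF rep] unfolding N_def .
  obtain g r where g: "polyfun n g" "generic_points n g \<noteq> {}"
     "\<forall>\<alpha>\<in>generic_points n g. \<forall>j\<le>p. fspace.dim ((N \<alpha> ^^ j) ` V) = r j"
     "\<forall>\<alpha>\<in>affine_space n. \<forall>j\<le>p. fspace.dim ((N \<alpha> ^^ j) ` V) \<le> r j"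
    using generic_rank[OF inf _ R.subV R.finV, where X = "R.D p" and n = n and p = p] R.D_lin unfolding N_def by blast
  have linN: "flinear (N \<alpha> ^^ j)" for \<alpha> j unfolding N_def by (intro flinear_funpow flinear_pencil R.D_lin)
  have rn: "kdim (N \<alpha>) V j + fspace.dim ((N \<alpha> ^^ j) ` V) = fspace.dim V" for \<alpha> j
    unfolding kdim_def using rank_nullity[OF linN R.subV R.finV] by metis
  have big: "kdim (N \<alpha>) V j = fspace.dim V" if "p \<le> j" for \<alpha> j
  proof -
    have "(N \<alpha> ^^ j) x = 0" for x
    proof -
      have "(N \<alpha> ^^ j) x = (N \<alpha> ^^ (j - p)) ((N \<alpha> ^^ p) x)" using that funpow_add[of "j - p" p "N \<alpha>"] by simp
      then show ?thesis
        using nilpotent.nil[of p "N \<alpha>" x] nilp[of \<alpha>] flinear_simps(4)[OF linN] unfolding nilpotent_on_def by simp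
    qed
    then show ?thesis unfolding kdim_def by simp
  qed
  have same: "kdim (N \<alpha>) V j = kdim (N \<beta>) V j" if "\<alpha> \<in> generic_points n g" "\<beta> \<in> generic_points n g" for \<alpha> \<beta> j
  proof (cases "j \<le> p")
    case True
    then have "fspace.dim ((N \<alpha> ^^ j) ` V) = fspace.dim ((N \<beta> ^^ j) ` V)" using g(3) that by simp
    then show ?thesis using rn[of \<alpha> j] rn[of \<beta> j] by linarith
  next
    case False
    then show ?thesis using big[of j \<alpha>] big[of j \<beta>] by simp
  qed
  note sums = has_jordan_type_sum[OF nilp R.M(1,2) u]
  obtain \<alpha>0 where a0: "\<alpha>0 \<in> generic_points n g" using g(2) by blast
  obtain J where J: "has_jordan_type M (u_elem p n \<alpha>0) J" using has_jordan_type_ex[OF nilp R.M(1,2) u] by blast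
  have JJ: "has_jordan_type M (u_elem p n \<alpha>) J" if "\<alpha> \<in> generic_points n g" for \<alpha>
  proof -
    obtain J' where J': "has_jordan_type M (u_elem p n \<alpha>) J'" using has_jordan_type_ex[OF nilp R.M(1,2) u] by blast
    have "J' = J" by (rule jordan_type_unique) (simp_all add: sums[OF J] sums[OF J'] same[OF that a0])
    then show ?thesis using J' by simp
  qed
  have "generic_jordan_type p n M = J" unfolding generic_jordan_type_def
  proof (rule the_equality)
    show "\<exists>U. zariski_open n U \<and> U \<noteq> {} \<and> (\<forall>\<alpha>\<in>U. has_jordan_type M (u_elem p n \<alpha>) J)"
      using zariski_open_polyfun[OF g(1)] g(2) JJ unfolding generic_points_def by blast
    fix J' assume "\<exists>U. zariski_open n U \<and> U \<noteq> {} \<and> (\<forall>\<alpha>\<in>U. has_jordan_type M (u_elem p n \<alpha>) J')"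
    then obtain U where U: "zariski_open n U" "U \<noteq> {}" "\<forall>\<alpha>\<in>U. has_jordan_type M (u_elem p n \<alpha>) J'" by blast
    obtain h where h: "polyfun n h" "\<exists>\<alpha>\<in>affine_space n. h \<alpha> \<noteq> 0" "{\<alpha> \<in> affine_space n. h \<alpha> \<noteq> 0} \<subseteq> U"
      by (rule zariski_open_contains_polyfun[OF U(1,2)])
    obtain \<gamma> where \<gamma>: "\<gamma> \<in> affine_space n" "g \<gamma> \<noteq> 0" "h \<gamma> \<noteq> 0"
      using polyfun_nonzero_common[OF inf g(1) h(1)] a0 h(2) unfolding generic_points_def by blast
    have J1: "has_jordan_type M (u_elem p n \<gamma>) J'" using U(3) h(3) \<gamma> by blast
    have J2: "has_jordan_type M (u_elem p n \<gamma>) J" using JJ \<gamma> by (simp add: generic_points_def)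
    show "J' = J" by (rule jordan_type_unique) (simp_all add: sums[OF J1] sums[OF J2])
  qed
  moreover have "kdim (N \<alpha>) V 1 \<le> kdim (N \<beta>) V 1" if "\<alpha> \<in> generic_points n g" "\<beta> \<in> affine_space n" for \<alpha> \<beta>
  proof -
    have "1 \<le> p" using R.prime prime_ge_1_nat by blast
    then have "fspace.dim ((N \<beta> ^^ 1) ` V) \<le> fspace.dim ((N \<alpha> ^^ 1) ` V)" using g(3,4) that by metis
    then show ?thesis using rn[of \<alpha> 1] rn[of \<beta> 1] by linarith
  qed
  ultimately show ?thesis using JJ g(1,2) unfolding generic_points_def by (intro exI[of _ g]) auto
qed

section \<open>Empty cores\<close>

text \<open>The content of the cell just beyond the end of row \<open>l\<close>, that is, of the
  node that \<open>inc_row f l\<close> would add.\<close>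

definition row_content :: "(nat \<Rightarrow> nat) \<Rightarrow> nat \<Rightarrow> int" where
  "row_content f l = int (f l) - int l"

text \<open>For at most \<open>p\<close> parts, the \<open>p\<close>-core is empty if and only if the first \<open>p\<close> contents of row ends
  (beta numbers up to a shift) are distinct modulo \<open>p\<close>.\<close>

definition contents_mod :: "nat \<Rightarrow> (nat \<Rightarrow> nat) \<Rightarrow> int set" where
  "contents_mod p f = (\<lambda>l. row_content f l mod int p) ` {..<p}"

lemma contents_mod_inj:
  assumes "contents_mod p f = {0..<int p}" "l < p" "m < p" "row_content f l mod int p = row_content f m mod int p"
  shows "l = m"
proof -
  have "card ((\<lambda>l. row_content f l mod int p) ` {..<p}) = card {..<p}"
    using assms(1) by (simp add: contents_mod_def)
  then have "inj_on (\<lambda>l. row_content f l mod int p) {..<p}" by (simp add: eq_card_imp_inj_on)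
  from inj_onD[OF this assms(4)] show ?thesis using assms(2,3) by simp
qed

lemma contents_mod_zero: assumes "0 < p" shows "contents_mod p (\<lambda>_. 0) = {0..<int p}"
proof (rule card_subset_eq)
  show "contents_mod p (\<lambda>_. 0) \<subseteq> {0..<int p}" using assms by (auto simp: contents_mod_def)
  have "inj_on (\<lambda>l. row_content (\<lambda>_. 0) l mod int p) {..<p}"
  proof (rule inj_onI)
    fix l m assume lm: "l \<in> {..<p}" "m \<in> {..<p}" "row_content (\<lambda>_. 0) l mod int p = row_content (\<lambda>_. 0) m mod int p"
    then have "(- int l) mod int p = (- int m) mod int p" by (simp add: row_content_def)
    then have "int l mod int p = int m mod int p" by (metis minus_minus mod_minus_cong)
    then show "l = m" using lm by simp
  qed
  then show "card (contents_mod p (\<lambda>_. 0)) = card {0..<int p}"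
    unfolding contents_mod_def by (simp add: card_image)
qed simp

section \<open>Rim hooks and the contents of row ends\<close>

lemma connected_cells_cut:
  assumes D: "connected_cells D" and c: "c \<in> D" "fst c \<le> l" and d: "d \<in> D" "l < fst d"
  shows "\<exists>j. (l, j) \<in> D \<and> (Suc l, j) \<in> D"
proof -
  have "(c, d) \<in> {(x, y). x \<in> D \<and> y \<in> D \<and> adjacent x y}\<^sup>*"
    using D c(1) d(1) by (simp add: connected_cells_def)
  then have "l < fst d \<longrightarrow> (\<exists>j. (l, j) \<in> D \<and> (Suc l, j) \<in> D)"
  proof (induction rule: rtrancl_induct)
    case base
    then show ?case using c by simp
  next
    case (step y z)
    show ?case
    proof (cases "l < fst y")
      case False
      show ?thesis
      proof
        assume z: "l < fst z"
        have yz: "y \<in> D" "z \<in> D" "adjacent y z" using step(2) by auto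
        then have "fst y = l" "fst z = Suc l" "snd z = snd y" using False z unfolding adjacent_def by auto
        then show "\<exists>j. (l, j) \<in> D \<and> (Suc l, j) \<in> D" using yz by (metis prod.collapse)
      qed
    qed (use step.IH in blast)
  qed
  then show ?thesis using d by blast
qed

lemma sum_list_part_fun: "length \<mu> \<le> p \<Longrightarrow> sum_list \<mu> = (\<Sum>l<p. part_fun \<mu> l)"
proof -
  assume p: "length \<mu> \<le> p"
  have "(\<Sum>l<p. part_fun \<mu> l) = (\<Sum>l<length \<mu>. part_fun \<mu> l)"
    by (rule sum.mono_neutral_right) (use p in \<open>auto simp: part_fun_def\<close>)
  then show ?thesis by (simp add: sum_list_sum_nth atLeast0LessThan part_fun_def)
qed

lemma part_fun_pos: "is_partition \<mu> \<Longrightarrow> part_fun \<mu> l \<noteq> 0 \<longleftrightarrow> l < length \<mu>"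
  by (auto simp: part_fun_def is_partition_def)

lemma diagram_subset_iff: "diagram \<nu> \<subseteq> diagram \<mu> \<longleftrightarrow> (\<forall>l. part_fun \<nu> l \<le> part_fun \<mu> l)"
proof
  assume s: "diagram \<nu> \<subseteq> diagram \<mu>"
  show "\<forall>l. part_fun \<nu> l \<le> part_fun \<mu> l"
  proof
    fix l show "part_fun \<nu> l \<le> part_fun \<mu> l"
    proof (rule ccontr)
      assume "\<not> ?thesis"
      then have "(l, part_fun \<mu> l) \<in> diagram \<nu>" unfolding dg_part_fun[symmetric] dg_def by simp
      then have "(l, part_fun \<mu> l) \<in> diagram \<mu>" using s by blast
      then show False unfolding dg_part_fun[symmetric] dg_def by simp
    qed
  qed
next
  assume "\<forall>l. part_fun \<nu> l \<le> part_fun \<mu> l"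
  then show "diagram \<nu> \<subseteq> diagram \<mu>" unfolding dg_part_fun[symmetric] dg_def by (auto intro: less_le_trans)
qed

text \<open>Connectedness forces consecutive rows of the hook to share a column, and the absence of
  a square allows only one. So row \<open>l + 1\<close> of the larger diagram ends exactly one cell
  after row \<open>l\<close> of the smaller one.\<close>

lemma rim_hook_rows:
  assumes rem: "removes_rim_hook p \<mu> \<nu>" and p: "0 < p" and L: "length \<mu> \<le> p"
  obtains i q where "i \<le> q" "q < p" "\<And>l. i \<le> l \<Longrightarrow> l < q \<Longrightarrow> part_fun \<mu> (Suc l) = Suc (part_fun \<nu> l)"
    "\<And>l. l < i \<or> q < l \<Longrightarrow> part_fun \<nu> l = part_fun \<mu> l"
proof -
  define f g where "f = part_fun \<mu>" and "g = part_fun \<nu>"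
  define D where "D = diagram \<mu> - diagram \<nu>"
  have D: "card D = p" "connected_cells D" "\<nexists>i j. {(i, j), (Suc i, j), (i, Suc j), (Suc i, Suc j)} \<subseteq> D"
    and part: "is_partition \<mu>" "is_partition \<nu>" and sub: "diagram \<nu> \<subseteq> diagram \<mu>"
    using rem unfolding removes_rim_hook_def D_def by (auto simp: Let_def)
  have memD: "(i, j) \<in> D \<longleftrightarrow> g i \<le> j \<and> j < f i" for i j
    unfolding D_def f_def g_def dg_part_fun[symmetric] dg_def by auto
  have gf: "g l \<le> f l" for l using sub unfolding diagram_subset_iff f_def g_def by blast
  have anti: "f (Suc l) \<le> f l" "g (Suc l) \<le> g l" for l
    unfolding f_def g_def using parD[OF par_part_fun[OF part(1)], of l "Suc l"] parD[OF par_part_fun[OF part(2)], of l "Suc l"] by simp_all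
  define I where "I = {l. g l < f l}"
  have I: "I \<subseteq> {..<length \<mu>}" by (auto simp: I_def f_def part_fun_def split: if_splits)
  then have fin: "finite I" using finite_subset by blast
  have "D \<noteq> {}" using D(1) p by auto
  then obtain i0 j0 where "(i0, j0) \<in> D" by auto
  then have "i0 \<in> I" by (simp add: I_def memD)
  then have ne: "I \<noteq> {}" by blast
  define i q where "i = Min I" and "q = Max I"
  have iq: "i \<in> I" "q \<in> I" using fin ne by (simp_all add: i_def q_def)
  show thesis
  proof (rule that)
    show "i \<le> q" using fin iq(1) by (simp add: q_def)
    show "q < p" using iq(2) I L by (meson less_le_trans lessThan_iff subsetD)
    show "part_fun \<nu> l = part_fun \<mu> l" if "l < i \<or> q < l" for l
    proof -
      have "l \<notin> I" using that Min_le[OF fin, of l] Max_ge[OF fin, of l] unfolding i_def q_def by (meson leD)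
      then show ?thesis using gf[of l] by (simp add: I_def f_def g_def)
    qed
    show "part_fun \<mu> (Suc l) = Suc (part_fun \<nu> l)" if l: "i \<le> l" "l < q" for l
    proof -
      have "(i, g i) \<in> D" "(q, g q) \<in> D" using iq by (auto simp: memD I_def)
      from connected_cells_cut[OF D(2) this(1) _ this(2), of l]
      obtain j where j: "(l, j) \<in> D" "(Suc l, j) \<in> D" using l by auto
      have "\<not> g l + 2 \<le> f (Suc l)"
      proof
        assume "g l + 2 \<le> f (Suc l)"
        then have "{(l, g l), (Suc l, g l), (l, Suc (g l)), (Suc l, Suc (g l))} \<subseteq> D"
          using anti[of l] by (auto simp: memD)
        then show False using D(3) by blast
      qed
      then show ?thesis using j unfolding memD f_def g_def by simp
    qed
  qed
qed

lemma sum_cycle_rows: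
  fixes F G :: "nat \<Rightarrow> int"
  assumes iq: "i \<le> q" "q < p" and eq: "\<And>l. i \<le> l \<Longrightarrow> l < q \<Longrightarrow> F (Suc l) = G l" "\<And>l. l < i \<or> q < l \<Longrightarrow> G l = F l"
  shows "(\<Sum>l<p. F l) - (\<Sum>l<p. G l) = F i - G q"
proof -
  have "(\<Sum>l<p. F l - G l) = (\<Sum>l\<in>{i..q}. F l - G l)"
    by (rule sum.mono_neutral_right) (use iq eq(2) in auto)
  also have "\<dots> = (\<Sum>l\<in>{i..q}. F l) - (\<Sum>l\<in>{i..q}. G l)" by (rule sum_subtractf)
  also have "(\<Sum>l\<in>{i..q}. F l) = F i + (\<Sum>l\<in>{i..<q}. F (Suc l))"
    using iq(1) by (simp add: sum.atLeast_Suc_atMost sum.shift_bounds_Suc_ivl[symmetric] atLeastLessThanSuc_atLeastAtMost)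
  also have "(\<Sum>l\<in>{i..<q}. F (Suc l)) = (\<Sum>l\<in>{i..<q}. G l)" by (rule sum.cong) (use eq(1) in auto)
  also have "(\<Sum>l\<in>{i..q}. G l) = (\<Sum>l\<in>{i..<q}. G l) + G q"
    using iq(1) by (simp add: atLeastLessThanSuc_atLeastAtMost[symmetric])
  finally show ?thesis by (simp add: sum_subtractf)
qed

lemma contents_mod_cycle_rows:
  assumes iq: "i \<le> q" "q < p" and eq: "\<And>l. i \<le> l \<Longrightarrow> l < q \<Longrightarrow> row_content f (Suc l) = row_content g l"
    "\<And>l. l < i \<or> q < l \<Longrightarrow> row_content g l = row_content f l" and last: "row_content g q mod int p = row_content f i mod int p"
  shows "contents_mod p g = contents_mod p f"
proof -
  define \<sigma> where "\<sigma> l = (if i \<le> l \<and> l < q then Suc l else if l = q then i else l)" for l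
  have "\<sigma> ` {..<p} = {..<p}"
  proof (rule endo_inj_surj)
    show "\<sigma> ` {..<p} \<subseteq> {..<p}" using iq by (auto simp: \<sigma>_def)
    show "inj_on \<sigma> {..<p}" using iq by (auto simp: \<sigma>_def inj_on_def split: if_splits)
  qed simp
  moreover have "row_content g l mod int p = row_content f (\<sigma> l) mod int p" for l
    using eq(1)[of l] eq(2)[of l] last by (auto simp: \<sigma>_def)
  then have "contents_mod p g = (\<lambda>l. row_content f l mod int p) ` (\<sigma> ` {..<p})"
    unfolding contents_mod_def image_image by simp
  ultimately show ?thesis unfolding contents_mod_def by simp
qed

lemma removes_rim_hook_length:
  assumes "removes_rim_hook p \<mu> \<nu>" shows "length \<nu> \<le> length \<mu>"
proof (rule ccontr)
  have part: "is_partition \<mu>" "is_partition \<nu>" and "diagram \<nu> \<subseteq> diagram \<mu>"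
    using assms unfolding removes_rim_hook_def by auto
  then have le: "part_fun \<nu> (length \<mu>) \<le> part_fun \<mu> (length \<mu>)" by (simp add: diagram_subset_iff)
  assume "\<not> length \<nu> \<le> length \<mu>"
  then have "part_fun \<nu> (length \<mu>) \<noteq> 0" unfolding part_fun_pos[OF part(2)] by simp
  then show False using le by (simp add: part_fun_def)
qed

lemma removes_rim_hook_sum:
  assumes "removes_rim_hook p \<mu> \<nu>" shows "sum_list \<mu> = sum_list \<nu> + p"
proof -
  have "diagram \<nu> \<subseteq> diagram \<mu>" "card (diagram \<mu> - diagram \<nu>) = p"
    using assms unfolding removes_rim_hook_def by (auto simp: Let_def)
  then show ?thesis using card_Diff_subset[of "diagram \<nu>" "diagram \<mu>"] card_mono[of "diagram \<mu>" "diagram \<nu>"]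
    by (simp add: finite_diagram card_diagram)
qed

text \<open>In terms of contents the removal is a cyclic shift of the rows \<open>i\<close> to
  \<open>q\<close>: all values are only moved, except that the first becomes the last after being
  lowered by the number of removed cells, which is \<open>p\<close>.\<close>

lemma removes_rim_hook_contents:
  assumes rem: "removes_rim_hook p \<mu> \<nu>" and p: "0 < p" and L: "length \<mu> \<le> p"
  shows "contents_mod p (part_fun \<nu>) = contents_mod p (part_fun \<mu>)"
proof -
  obtain i q where iq: "i \<le> q" "q < p" "\<And>l. i \<le> l \<Longrightarrow> l < q \<Longrightarrow> part_fun \<mu> (Suc l) = Suc (part_fun \<nu> l)"
    "\<And>l. l < i \<or> q < l \<Longrightarrow> part_fun \<nu> l = part_fun \<mu> l" by (rule rim_hook_rows[OF assms]) blast
  let ?F = "row_content (part_fun \<mu>)" and ?G = "row_content (part_fun \<nu>)"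
  have eq: "?F (Suc l) = ?G l" if "i \<le> l" "l < q" for l using iq(3)[OF that] by (simp add: row_content_def)
  have eq': "?G l = ?F l" if "l < i \<or> q < l" for l using iq(4)[OF that] by (simp add: row_content_def)
  have "(\<Sum>l<p. int (part_fun \<mu> l)) = (\<Sum>l<p. int (part_fun \<nu> l)) + int p"
    using removes_rim_hook_sum[OF rem] sum_list_part_fun[OF L] sum_list_part_fun[of \<nu> p] removes_rim_hook_length[OF rem] L
    by (simp flip: of_nat_sum)
  then have "?F i - ?G q = int p"
    using sum_cycle_rows[where F = ?F and G = ?G, OF iq(1,2) eq eq'] by (simp add: row_content_def sum_subtractf)
  then have "?F i = ?G q + int p" by simp
  then have "?G q mod int p = ?F i mod int p" by simp
  from contents_mod_cycle_rows[OF iq(1,2) eq eq' this] show ?thesis .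
qed

section \<open>Existence of a removable rim hook\<close>

lemma part_fun_filter:
  "sorted_wrt (\<ge>) \<mu> \<Longrightarrow> part_fun (filter (\<lambda>x. 0 < x) \<mu>) = part_fun \<mu>"
proof (induction \<mu>)
  case (Cons x \<mu>)
  show ?case
  proof (cases "0 < x")
    case True
    have step: "part_fun (y # ys) = case_nat y (part_fun ys)" for y ys
      by (auto simp: fun_eq_iff part_fun_def split: nat.splits)
    then show ?thesis using Cons True by simp
  next
    case False
    then have z: "\<forall>y\<in>set (x # \<mu>). y = 0" using Cons.prems by auto
    then have "filter (\<lambda>x. 0 < x) (x # \<mu>) = []" by (simp add: filter_empty_conv)
    moreover have "part_fun (x # \<mu>) l = 0" for l
      unfolding part_fun_def using z[rule_format, OF nth_mem, of l] by presburger
    ultimately show ?thesis by (simp add: part_fun_def fun_eq_iff)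
  qed
qed simp

lemma sorted_list_of_par: "par f \<Longrightarrow> sorted_wrt (\<ge>) (map f [0..<L])"
  using parD[of f] by (auto simp: sorted_wrt_iff_nth_less)

definition list_of_par :: "nat \<Rightarrow> (nat \<Rightarrow> nat) \<Rightarrow> nat list" where
  "list_of_par L f = filter (\<lambda>x. 0 < x) (map f [0..<L])"

lemma is_partition_filter: "sorted_wrt (\<ge>) \<mu> \<Longrightarrow> is_partition (filter (\<lambda>x. 0 < x) \<mu>)"
  by (simp add: is_partition_def sorted_wrt_filter)

lemma list_of_par:
  assumes f: "par f" and L: "\<And>l. L \<le> l \<Longrightarrow> f l = 0"
  shows "is_partition (list_of_par L f)" "part_fun (list_of_par L f) = f" "length (list_of_par L f) \<le> L"
proof -
  show "is_partition (list_of_par L f)" unfolding list_of_par_def by (rule is_partition_filter[OF sorted_list_of_par[OF f]])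
  have "part_fun (map f [0..<L]) = f" using L by (auto simp: part_fun_def fun_eq_iff)
  then show "part_fun (list_of_par L f) = f" unfolding list_of_par_def part_fun_filter[OF sorted_list_of_par[OF f]] .
  show "length (list_of_par L f) \<le> L" unfolding list_of_par_def using length_filter_le[of _ "map f [0..<L]"] by simp
qed

text \<open>The content of row 0 is lowered by \<open>p\<close> and the contents are sorted again.
  Distinct residues prevent a collision, and the cells lost in this way form a rim hook that starts
  in the first row.\<close>

lemma ex_rim_hook:
  assumes part: "is_partition \<mu>" and L: "length \<mu> \<le> p" and p: "0 < p" and ne: "\<mu> \<noteq> []"
    and full: "contents_mod p (part_fun \<mu>) = {0..<int p}"
  shows "\<exists>\<nu>. removes_rim_hook p \<mu> \<nu>"
proof -
  define f where "f = part_fun \<mu>"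
  have f: "par f" unfolding f_def by (rule par_part_fun[OF part])
  have f0: "f l = 0" if "p \<le> l" for l using that L by (simp add: f_def part_fun_def)
  have "0 < f 0" using part_fun_pos[OF part, of 0] ne by (simp add: f_def)
  \<comment> \<open>The condition says that the content of row \<open>l\<close> exceeds that of row
    0 lowered by \<open>p\<close>; so \<open>q\<close> is the position of the lowered value after
    sorting.\<close>
  define q where "q = (GREATEST l. l < p \<and> f 0 + l < f l + p)"
  have "0 < p \<and> f 0 + 0 < f 0 + p" using p by simp
  from GreatestI_nat[of "\<lambda>l. l < p \<and> f 0 + l < f l + p" 0 p, OF this]
  have q: "q < p" "f 0 + q < f q + p" unfolding q_def by auto
  have q': "f (Suc q) + p \<le> f 0 + q"
  proof (cases "Suc q < p")
    case True
    have "\<not> (Suc q < p \<and> f 0 + Suc q < f (Suc q) + p)"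
    proof
      assume "Suc q < p \<and> f 0 + Suc q < f (Suc q) + p"
      from Greatest_le_nat[of "\<lambda>l. l < p \<and> f 0 + l < f l + p", OF this, of p] show False by (simp add: q_def)
    qed
    moreover have "f 0 + Suc q \<noteq> f (Suc q) + p"
    proof
      assume "f 0 + Suc q = f (Suc q) + p"
      then have "row_content f 0 = row_content f (Suc q) + int p" by (simp add: row_content_def)
      then have "row_content f 0 mod int p = row_content f (Suc q) mod int p" by simp
      from contents_mod_inj[OF full[folded f_def] p True this] show False by simp
    qed
    ultimately show ?thesis using True by linarith
  next
    case False
    then show ?thesis using f0[of "Suc q"] q(1) \<open>0 < f 0\<close> by simp
  qed
  define g where "g l = (if l < q then f (Suc l) - 1 else if l = q then f 0 + q - p else f l)" for l
  have pos: "0 < f l" if "l \<le> q" for l using q(2) q' parD[OF f that] by linarith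
  have gf: "g l < f l" if "l \<le> q" for l
    using that q(2) q' parD[OF f, of l "Suc l"] pos[of l] pos[of "Suc l"] by (auto simp: g_def)
  have gf': "g l \<le> f l" for l using gf[of l] by (cases "l \<le> q") (auto simp: g_def)
  have "par g" unfolding par_def
  proof
    show "antimono g"
    proof (rule antimono_natI)
      fix l
      consider "Suc l < q" | "Suc l = q" | "l = q" | "q < l" by linarith
      then show "g (Suc l) \<le> g l"
        using parD[OF f, of "Suc l" "Suc (Suc l)"] parD[OF f, of l "Suc l"] q(2) q' by cases (auto simp: g_def)
    qed
    have "{i. g i \<noteq> 0} \<subseteq> {i. f i \<noteq> 0}" using gf' by (metis (mono_tags, lifting) Collect_mono le_zero_eq)
    then show "finite {i. g i \<noteq> 0}" using f finite_subset unfolding par_def by blast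
  qed
  have g0: "g l = 0" if "p \<le> l" for l using f0[OF that] gf'[of l] by simp
  define \<nu> where "\<nu> = list_of_par p g"
  have \<nu>: "is_partition \<nu>" "part_fun \<nu> = g" "length \<nu> \<le> p"
    unfolding \<nu>_def by (rule list_of_par[OF \<open>par g\<close> g0]; assumption)+
  define D where "D = diagram \<mu> - diagram \<nu>"
  have memD: "(i, j) \<in> D \<longleftrightarrow> g i \<le> j \<and> j < f i" for i j
    unfolding D_def f_def dg_part_fun[symmetric] dg_def \<nu>(2) by auto
  have rows: "l \<le> q" if "(l, j) \<in> D" for l j using that by (rule_tac ccontr) (auto simp: memD g_def)
  have sub: "diagram \<nu> \<subseteq> diagram \<mu>" unfolding diagram_subset_iff \<nu>(2) using gf' by (simp add: f_def)
  have "int (sum_list \<mu>) - int (sum_list \<nu>) = int p"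
  proof -
    have "row_content f (Suc l) = row_content g l" if "0 \<le> l" "l < q" for l
      using that pos[of "Suc l"] by (simp add: g_def row_content_def)
    moreover have "row_content g l = row_content f l" if "l < 0 \<or> q < l" for l using that by (simp add: g_def row_content_def)
    ultimately have "(\<Sum>l<p. row_content f l) - (\<Sum>l<p. row_content g l) = row_content f 0 - row_content g q"
      by (rule sum_cycle_rows[where i = 0 and q = q, OF le0 q(1)])
    also have "\<dots> = int p" using q' by (simp add: row_content_def g_def of_nat_diff)
    finally show ?thesis unfolding sum_list_part_fun[OF L] sum_list_part_fun[OF \<nu>(3)] \<nu>(2) f_def[symmetric]
      by (simp add: row_content_def sum_subtractf)
  qed
  then have card: "card D = p" unfolding D_def card_Diff_subset[OF finite_diagram sub] card_diagram by linarith
  have no_square: "\<nexists>i j. {(i, j), (Suc i, j), (i, Suc j), (Suc i, Suc j)} \<subseteq> D"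
  proof
    assume "\<exists>i j. {(i, j), (Suc i, j), (i, Suc j), (Suc i, Suc j)} \<subseteq> D"
    then obtain i j where ij: "(i, j) \<in> D" "(Suc i, Suc j) \<in> D" by auto
    have "i < q" using rows[OF ij(2)] by simp
    then show False using ij by (auto simp: memD g_def)
  qed
  let ?R = "{(x, y). x \<in> D \<and> y \<in> D \<and> adjacent x y}"
  \<comment> \<open>Every cell is joined to the lower left end of the hook: leftwards within its row
    as far as possible, then down by one row. The cell below belongs to \<open>D\<close> because row
    \<open>l + 1\<close> ends in the column \<open>g l\<close>.\<close>
  have path: "((l, j), (q, g q)) \<in> ?R\<^sup>*" if "(l, j) \<in> D" for l j
    using that
  proof (induction "j + (q - l)" arbitrary: l j rule: less_induct)
    case less
    have l: "l \<le> q" by (rule rows[OF less.prems])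
    consider "g l < j" | "j = g l" "l < q" | "j = g l" "l = q" using less.prems l by (fastforce simp: memD)
    then show ?case
    proof cases
      case 1
      then have "(l, j - 1) \<in> D" using less.prems by (auto simp: memD)
      moreover from this have "((l, j), (l, j - 1)) \<in> ?R" using less.prems 1 by (simp add: adjacent_def)
      moreover have "j - 1 + (q - l) < j + (q - l)" using 1 by simp
      ultimately show ?thesis using less.hyps[of "j - 1" l] by (meson converse_rtrancl_into_rtrancl)
    next
      case 2
      have "(Suc l, j) \<in> D" using 2 pos[of "Suc l"] gf[of "Suc l"] by (auto simp: memD g_def)
      moreover from this have "((l, j), (Suc l, j)) \<in> ?R" using less.prems by (simp add: adjacent_def)
      moreover have "j + (q - Suc l) < j + (q - l)" using 2 by simp
      ultimately show ?thesis using less.hyps[of j "Suc l"] by (meson converse_rtrancl_into_rtrancl)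
    qed simp
  qed
  have "sym ?R" by (auto simp: sym_def adjacent_def)
  then have "sym (?R\<^sup>*)" by (rule sym_rtrancl)
  have "connected_cells D" unfolding connected_cells_def
  proof (intro ballI)
    fix c d assume "c \<in> D" "d \<in> D"
    then have "(c, (q, g q)) \<in> ?R\<^sup>*" "(d, (q, g q)) \<in> ?R\<^sup>*"
      using path[of "fst c" "snd c"] path[of "fst d" "snd d"] by simp_all
    from rtrancl_trans[OF this(1) symD[OF \<open>sym (?R\<^sup>*)\<close> this(2)]] show "(c, d) \<in> ?R\<^sup>*" .
  qed
  then have "removes_rim_hook p \<mu> \<nu>"
    unfolding removes_rim_hook_def Let_def D_def[symmetric] using part \<nu>(1) sub card no_square by blast
  then show ?thesis by blast
qed

text \<open>The set of residues does not change when a hook is removed, and it is full for the empty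
  partition. Conversely, a full set lets hooks be removed until nothing is left.\<close>

lemma empty_core_iff:
  assumes part: "is_partition \<mu>" and L: "length \<mu> \<le> p" and p: "0 < p"
  shows "has_empty_core p \<mu> \<longleftrightarrow> contents_mod p (part_fun \<mu>) = {0..<int p}"
proof
  have nil: "part_fun [] = (\<lambda>_. 0)" by (simp add: part_fun_def fun_eq_iff)
  assume "has_empty_core p \<mu>"
  then have "(removes_rim_hook p)\<^sup>*\<^sup>* \<mu> []" by (simp add: has_empty_core_def is_p_core_of_def)
  then have "length \<mu> \<le> p \<longrightarrow> contents_mod p (part_fun \<mu>) = contents_mod p (part_fun [])"
  proof (induction rule: converse_rtranclp_induct)
    case (step y z)
    show ?case
    proof
      assume y: "length y \<le> p"
      then have "contents_mod p (part_fun z) = contents_mod p (part_fun [])"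
        using step.IH removes_rim_hook_length[OF step(1)] by simp
      then show "contents_mod p (part_fun y) = contents_mod p (part_fun [])"
        using removes_rim_hook_contents[OF step(1) p y] by simp
    qed
  qed simp
  then show "contents_mod p (part_fun \<mu>) = {0..<int p}" using L contents_mod_zero[OF p] by (simp add: nil)
next
  assume "contents_mod p (part_fun \<mu>) = {0..<int p}"
  then have "(removes_rim_hook p)\<^sup>*\<^sup>* \<mu> []" using part L
  proof (induction "sum_list \<mu>" arbitrary: \<mu> rule: less_induct)
    case less
    show ?case
    proof (cases "\<mu> = []")
      case False
      obtain \<nu> where \<nu>: "removes_rim_hook p \<mu> \<nu>" using ex_rim_hook[OF less.prems(2,3) p False less.prems(1)] by blast
      have "is_partition \<nu>" using \<nu> by (simp add: removes_rim_hook_def)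
      moreover have "sum_list \<nu> < sum_list \<mu>" using removes_rim_hook_sum[OF \<nu>] p by simp
      moreover have "length \<nu> \<le> p" using removes_rim_hook_length[OF \<nu>] less.prems(3) by simp
      moreover have "contents_mod p (part_fun \<nu>) = {0..<int p}"
        using removes_rim_hook_contents[OF \<nu> p less.prems(3)] less.prems(1) by simp
      ultimately have "(removes_rim_hook p)\<^sup>*\<^sup>* \<nu> []" using less.hyps by blast
      with \<nu> show ?thesis by (rule converse_rtranclp_into_rtranclp)
    qed simp
  qed
  moreover have "\<not> removes_rim_hook p [] \<nu>" for \<nu> using removes_rim_hook_sum[of p "[]" \<nu>] p by auto
  ultimately show "has_empty_core p \<mu>" unfolding has_empty_core_def is_p_core_of_def by blast
qed

section \<open>The map \<open>\<phi>\<close>\<close>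

definition core_free :: "nat \<Rightarrow> nat \<Rightarrow> nat list \<Rightarrow> bool" where
  "core_free p m \<mu> \<longleftrightarrow> is_partition_of \<mu> m \<and> length \<mu> \<le> p \<and> contents_mod p (part_fun \<mu>) = {0..<int p}"

lemma core_free_iff: "0 < p \<Longrightarrow> is_partition_of \<mu> m \<Longrightarrow> length \<mu> \<le> p \<Longrightarrow> core_free p m \<mu> \<longleftrightarrow> has_empty_core p \<mu>"
  by (simp add: core_free_def is_partition_of_def empty_core_iff)

lemma part_eq_part_fun: "1 \<le> i \<Longrightarrow> i \<le> length \<mu> \<Longrightarrow> part \<mu> i = part_fun \<mu> (i - 1)"
  by (simp add: part_def part_fun_def)

text \<open>Conditions (i) and (ii) in terms of row indices starting at 0.\<close>

definition phi_rows :: "nat \<Rightarrow> (nat \<Rightarrow> nat) \<Rightarrow> nat \<Rightarrow> nat \<Rightarrow> bool" where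
  "phi_rows p f A B \<longleftrightarrow> A < B \<and> \<not> p dvd f B \<and> (\<forall>l>B. p dvd f l) \<and>
     row_content f A mod int p = (row_content f B - 1) mod int p"

lemma phi_indices_iff:
  "phi_indices p \<mu> a b \<longleftrightarrow> 1 \<le> a \<and> 1 \<le> b \<and> phi_rows p (part_fun \<mu>) (a - 1) (b - 1)"
proof (cases "1 \<le> a \<and> a < b \<and> b \<le> length \<mu>")
  case True
  have e1: "(\<forall>i\<in>{b + 1..length \<mu>}. [part \<mu> i = 0] (mod p)) \<longleftrightarrow> (\<forall>l>b - 1. p dvd part_fun \<mu> l)"
  proof
    assume d: "\<forall>i\<in>{b + 1..length \<mu>}. [part \<mu> i = 0] (mod p)"
    show "\<forall>l>b - 1. p dvd part_fun \<mu> l"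
    proof (intro allI impI)
      fix l assume l: "b - 1 < l"
      show "p dvd part_fun \<mu> l"
      proof (cases "l < length \<mu>")
        case True
        then have "[part \<mu> (Suc l) = 0] (mod p)" using d l by simp
        then show ?thesis using True by (simp add: part_def part_fun_def cong_0_iff)
      qed (simp add: part_fun_def)
    qed
  next
    assume d: "\<forall>l>b - 1. p dvd part_fun \<mu> l"
    show "\<forall>i\<in>{b + 1..length \<mu>}. [part \<mu> i = 0] (mod p)"
    proof
      fix i assume i: "i \<in> {b + 1..length \<mu>}"
      have "b - 1 < i - 1" by (rule diff_less_mono) (use i True in auto)
      then have "p dvd part_fun \<mu> (i - 1)" using d by blast
      then show "[part \<mu> i = 0] (mod p)" using part_eq_part_fun[of i \<mu>] i by (simp add: cong_0_iff)
    qed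
  qed
  have e2: "part \<mu> a = part_fun \<mu> (a - 1)" "part \<mu> b = part_fun \<mu> (b - 1)"
    by (rule part_eq_part_fun; use True in simp)+
  have e3: "row_content f (a - 1) mod int p = (row_content f (b - 1) - 1) mod int p \<longleftrightarrow>
      [int (f (a - 1)) - int a = int (f (b - 1)) - 1 - int b] (mod int p)" for f
  proof -
    have "row_content f (a - 1) = int (f (a - 1)) - int a + 1" "row_content f (b - 1) - 1 = int (f (b - 1)) - 1 - int b + 1"
      using True by (simp_all add: row_content_def of_nat_diff)
    then show ?thesis by (metis cong_def cong_add_rcancel)
  qed
  have "a - 1 < b - 1" using True by auto
  then show ?thesis unfolding phi_indices_def phi_rows_def e1 e2 e3 unfolding cong_0_iff using True by auto
next
  case False
  have b: "b \<le> length \<mu>" if "\<not> p dvd part_fun \<mu> (b - 1)"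
    using that by (cases "b \<le> length \<mu>") (auto simp: part_fun_def split: if_splits)
  then show ?thesis using False unfolding phi_indices_def phi_rows_def using b by (metis diff_less_mono less_diff_iff)
qed

lemma phi_rows_unique:
  assumes "contents_mod p f = {0..<int p}" "\<forall>l\<ge>p. f l = 0" "phi_rows p f A B" "phi_rows p f A' B'"
  shows "A = A' \<and> B = B'"
proof -
  have B: "B = B'" using assms(3,4) unfolding phi_rows_def by (metis linorder_neqE_nat)
  have "B < p" using assms(2) assms(3) unfolding phi_rows_def by (metis dvd_0_right not_less)
  then have "A = A'"
    by (intro contents_mod_inj[OF assms(1)]) (use assms(3,4) B in \<open>auto simp: phi_rows_def\<close>)
  then show ?thesis using B by simp
qed

lemma content_dvd: "p dvd f l \<Longrightarrow> row_content f l mod int p = (- int l) mod int p"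
  unfolding row_content_def by (metis diff_0 int_dvd_int_iff mod_0_imp_dvd dvd_imp_mod_0 mod_diff_left_eq)

lemma phi_rows_exist:
  assumes p: "1 < p" and full: "contents_mod p f = {0..<int p}" and f: "\<forall>l\<ge>p. f l = 0" and nd: "\<not> p dvd f l0"
  shows "\<exists>A B. phi_rows p f A B"
proof -
  define B where "B = (GREATEST l. \<not> p dvd f l)"
  have b: "\<not> p dvd f l \<Longrightarrow> l \<le> p" for l using f by (metis dvd_0_right nat_le_linear)
  have B: "\<not> p dvd f B" unfolding B_def by (rule GreatestI_nat[of _ l0 p]) (use nd b in auto)
  have last: "p dvd f l" if "B < l" for l
  proof (rule ccontr)
    assume "\<not> p dvd f l"
    from Greatest_le_nat[of "\<lambda>l. \<not> p dvd f l", OF this, of p] b that show False unfolding B_def by auto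
  qed
  have Bp: "B < p" using f B by (metis dvd_0_right not_less)
  have "(row_content f B - 1) mod int p \<in> contents_mod p f" unfolding full using p by simp
  then obtain A where A: "A < p" "row_content f A mod int p = (row_content f B - 1) mod int p"
    unfolding contents_mod_def by auto
  \<comment> \<open>Rows below \<open>B\<close> have length divisible by \<open>p\<close>, so
    \<open>A > B\<close> would give row \<open>B\<close> the residue of \<open>-(A - 1)\<close>. If
    \<open>A - 1 = B\<close>, then \<open>p\<close> divides \<open>f B\<close>; otherwise row
    \<open>A - 1\<close> has the same residue as row \<open>B\<close>.\<close>
  have "A < B"
  proof (rule ccontr)
    assume "\<not> A < B"
    moreover have "A \<noteq> B"
    proof
      assume "A = B"
      then have "int p dvd row_content f B - (row_content f B - 1)" using A(2) by (simp only: mod_eq_dvd_iff)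
      then show False using p by simp
    qed
    ultimately have AB: "B < A" by simp
    have "row_content f A mod int p = (- int A) mod int p" by (rule content_dvd[where f = f, OF last[OF AB]])
    then have "(row_content f B - 1) mod int p = (- int A) mod int p" using A(2) by simp
    then have "(row_content f B - 1 + 1) mod int p = (- int A + 1) mod int p" by (metis mod_add_cong)
    then have cB: "row_content f B mod int p = (- int (A - 1)) mod int p" using AB by (simp add: of_nat_diff)
    show False
    proof (cases "A - 1 = B")
      case True
      then have "int p dvd row_content f B - (- int B)" using cB by (simp only: mod_eq_dvd_iff)
      then show False using B by (simp add: row_content_def)
    next
      case False
      then have "B < A - 1" using AB by simp
      from content_dvd[where f = f, OF last[OF this]] have "row_content f B mod int p = row_content f (A - 1) mod int p" using cB by simp
      from contents_mod_inj[OF full Bp _ this] show False using A(1) False by simp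
    qed
  qed
  then have "phi_rows p f A B" using B last A(2) by (simp add: phi_rows_def)
  then show ?thesis by blast
qed

text \<open>Removing the last node of row \<open>B\<close> lowers its residue to that of row
  \<open>A\<close>, while the other rows keep their pairwise distinct residues. So only row
  \<open>p\<close>, outside the range in which residues are known to be distinct, needs a separate
  argument for the third addable node.\<close>

lemma phi_rows_common:
  assumes p: "1 < p" and f: "par f" "\<forall>l\<ge>p. f l = 0" and full: "contents_mod p f = {0..<int p}"
    and AB: "phi_rows p f A B"
  defines "g \<equiv> dec_row f B"
  shows "B < p" "par g" "A \<in> addable g" "B \<in> addable g" "inc_row g B = f"
    "row_content g A mod int p = row_content g B mod int p"
    "\<And>r. r \<in> addable g \<Longrightarrow> r \<noteq> A \<Longrightarrow> r \<noteq> B \<Longrightarrow> row_content g r mod int p \<noteq> row_content g A mod int p"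
    "contents_mod p (inc_row g A) = {0..<int p}"
proof -
  have AB': "A < B" "\<not> p dvd f B" "\<And>l. B < l \<Longrightarrow> p dvd f l" "row_content f A mod int p = (row_content f B - 1) mod int p"
    using AB by (auto simp: phi_rows_def)
  have fB: "0 < f B" using AB'(2) by (metis dvd_0_right neq0_conv)
  show Bp: "B < p" using f(2) fB by (metis not_less neq0_conv)
  have "f (Suc B) \<noteq> f B" using AB'(2) AB'(3)[of "Suc B"] by auto
  then have rem: "B \<in> removable f" using parD[OF f(1), of B "Suc B"] by (simp add: removable_def)
  show "par g" unfolding g_def by (rule par_dec[OF f(1) rem])
  have g: "g B = f B - 1" "\<And>l. l \<noteq> B \<Longrightarrow> g l = f l" by (auto simp: g_def dec_row_def)
  have cB: "row_content g B = row_content f B - 1" using fB g(1) by (simp add: row_content_def)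
  have cl: "row_content g l = row_content f l" if "l \<noteq> B" for l using g(2)[OF that] by (simp add: row_content_def)
  show "inc_row g B = f" using fB by (auto simp: g_def inc_row_def dec_row_def)
  show cAB: "row_content g A mod int p = row_content g B mod int p" using AB'(1,4) cB cl by simp
  show "B \<in> addable g" using parD[OF f(1), of "B - 1" B] g fB AB'(1) by (auto simp: addable_def)
  show "A \<in> addable g"
  proof (cases "A = 0")
    case False
    \<comment> \<open>If the rows \<open>A - 1\<close> and \<open>A\<close> had equal length, the
      content of row \<open>A - 1\<close> would be larger by one and congruent to that of row
      \<open>B\<close>.\<close>
    have "f A \<noteq> f (A - 1)"
    proof
      assume "f A = f (A - 1)"
      then have "row_content f (A - 1) = row_content f A + 1" using False by (simp add: row_content_def of_nat_diff)
      then have "row_content f (A - 1) mod int p = (row_content f A + 1) mod int p" by simp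
      also have "\<dots> = (row_content f B - 1 + 1) mod int p" using AB'(4) by (metis mod_add_cong)
      finally have "A - 1 = B" using contents_mod_inj[OF full, of "A - 1" B] AB'(1) Bp by simp
      then show False using AB'(1) by simp
    qed
    then have "g A < g (A - 1)" using parD[OF f(1), of "A - 1" A] g AB'(1) by simp
    then show ?thesis by (simp add: addable_def)
  qed (simp add: addable_def)
  show "row_content g r mod int p \<noteq> row_content g A mod int p" if r: "r \<in> addable g" "r \<noteq> A" "r \<noteq> B" for r
  proof
    assume c: "row_content g r mod int p = row_content g A mod int p"
    then have c': "row_content f r mod int p = row_content f A mod int p" using r AB'(1) cl by simp
    have "r < p \<Longrightarrow> r = A" by (rule contents_mod_inj[OF full _ _ c']) (use AB'(1) Bp in auto)
    then have "p \<le> r" using r(2) by linarith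
    moreover have "g r < g (r - 1)" using r(1) \<open>p \<le> r\<close> p by (simp add: addable_def)
    then have "0 < f (r - 1)" using g by (metis diff_le_self gr0I less_nat_zero_code not_less_eq nat_less_le zero_diff)
    then have "r - 1 < p" using f(2) by (metis not_less neq0_conv)
    \<comment> \<open>The empty row \<open>p\<close> has content congruent to 0, so a coincidence
      means that row \<open>B\<close> has content congruent to 1. If \<open>B = p - 1\<close>, then
      \<open>p\<close> divides \<open>f B\<close>; otherwise row \<open>p - 1\<close>, of length
      divisible by \<open>p\<close>, has content congruent to 1 as well.\<close>
    ultimately have rp: "r = p" by linarith
    then have "row_content f r mod int p = 0" using f(2) by (simp add: row_content_def)
    then have "(row_content f B - 1) mod int p = 0" using c' AB'(4) by simp
    then have d: "int p dvd row_content f B - 1" by (simp add: mod_eq_0_iff_dvd)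
    show False
    proof (cases "B = p - 1")
      case True
      then have "row_content f B - 1 = int (f B) - int p" using p by (simp add: row_content_def of_nat_diff)
      then have "int p dvd int (f B)" using d by (simp add: dvd_diff_left_iff)
      then show False using AB'(2) by simp
    next
      case False
      then have "B < p - 1" using Bp by simp
      from content_dvd[where f = f, OF AB'(3)[OF this]] have "row_content f (p - 1) mod int p = (- int (p - 1)) mod int p" .
      also have "\<dots> = row_content f B mod int p"
      proof -
        have "int p dvd (row_content f B - 1) - (- int p)" using d by simp
        then have "int p dvd row_content f B - (- int (p - 1))" using p by (simp add: of_nat_diff algebra_simps)
        then show ?thesis by (simp only: mod_eq_dvd_iff[symmetric])
      qed
      finally show False using contents_mod_inj[OF full, of "p - 1" B] p Bp False by simp
    qed
  qed
  \<comment> \<open>Passing from \<open>f\<close> to \<open>h\<close> exchanges the residues of the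
    rows \<open>A\<close> and \<open>B\<close>, so the set of residues stays full.\<close>
  define h where "h = inc_row g A"
  have hA: "row_content h A = row_content f A + 1" and hB: "row_content h B = row_content f B - 1"
    and hl: "\<And>l. l \<noteq> A \<Longrightarrow> l \<noteq> B \<Longrightarrow> row_content h l = row_content f l"
    using AB'(1) cB cl by (auto simp: h_def inc_row_def row_content_def)
  have h: "row_content h l mod int p = row_content f (transpose A B l) mod int p" for l
  proof -
    consider "l = A" | "l = B" | "l \<noteq> A" "l \<noteq> B" by blast
    then show ?thesis
    proof cases
      case 1
      have "(row_content f A + 1) mod int p = (row_content f B - 1 + 1) mod int p" using AB'(4) by (metis mod_add_cong)
      then show ?thesis using 1 hA by simp
    next
      case 2
      then show ?thesis using hB AB'(4) by simp
    next
      case 3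
      then show ?thesis using hl by simp
    qed
  qed
  have "contents_mod p h = (\<lambda>l. row_content f l mod int p) ` transpose A B ` {..<p}"
    unfolding contents_mod_def image_image h ..
  also have "transpose A B ` {..<p} = {..<p}" by (rule permutes_image, rule permutes_swap_id) (use AB'(1) Bp in auto)
  finally show "contents_mod p (inc_row g A) = {0..<int p}" using full by (simp add: contents_mod_def h_def)
qed

lemma core_freeD:
  assumes "core_free p m \<mu>"
  shows "is_partition \<mu>" "sum_list \<mu> = m" "par (part_fun \<mu>)" "length \<mu> \<le> p" "\<forall>l\<ge>p. part_fun \<mu> l = 0"
    "contents_mod p (part_fun \<mu>) = {0..<int p}"
  using assms par_part_fun by (auto simp: core_free_def is_partition_of_def part_fun_def)

lemma dvd_part_fun_iff: "(\<forall>x\<in>set \<mu>. p dvd x) \<longleftrightarrow> (\<forall>l. p dvd part_fun \<mu> l)"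
  by (simp add: all_set_conv_all_nth part_fun_def)

lemma part_fun_update: "i < length \<mu> \<Longrightarrow> part_fun (\<mu>[i := x]) = (part_fun \<mu>)(i := x)"
  by (auto simp: part_fun_def fun_eq_iff)

lemma phi_part_fun:
  assumes p: "1 < p" and \<mu>: "core_free p m \<mu>" and AB: "phi_rows p (part_fun \<mu>) A B"
  shows "part_fun (phi p \<mu>) = inc_row (dec_row (part_fun \<mu>) B) A" "core_free p m (phi p \<mu>)"
proof -
  note \<mu> = core_freeD[OF \<mu>]
  note c = phi_rows_common[OF p \<mu>(3,5,6) AB]
  let ?f = "part_fun \<mu>" and ?g = "dec_row (part_fun \<mu>) B"
  have AB': "A < B" "\<not> p dvd ?f B" using AB by (auto simp: phi_rows_def)
  have BL: "B < length \<mu>" using AB'(2) by (auto simp: part_fun_def split: if_splits)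
  have nd: "\<not> (\<forall>x\<in>set \<mu>. p dvd x)" unfolding dvd_part_fun_iff using AB'(2) by blast
  have "(THE ab. phi_indices p \<mu> (fst ab) (snd ab)) = (Suc A, Suc B)"
  proof (rule the_equality)
    show "phi_indices p \<mu> (fst (Suc A, Suc B)) (snd (Suc A, Suc B))" unfolding phi_indices_iff using AB by simp
    fix ab assume ab: "phi_indices p \<mu> (fst ab) (snd ab)"
    then have ab1: "1 \<le> fst ab" "1 \<le> snd ab" "phi_rows p ?f (fst ab - 1) (snd ab - 1)" unfolding phi_indices_iff by auto
    have "fst ab - 1 = A \<and> snd ab - 1 = B" by (rule phi_rows_unique[OF \<mu>(6,5) ab1(3) AB])
    then have "fst ab = Suc A" "snd ab = Suc B" using ab1(1,2) by linarith+
    then show "ab = (Suc A, Suc B)" by (simp add: prod_eq_iff)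
  qed
  then have phi: "phi p \<mu> = filter (\<lambda>x. 0 < x) (\<mu>[B := part \<mu> (Suc B) - 1, A := part \<mu> (Suc A) + 1])"
    unfolding phi_def Let_def if_not_P[OF nd] by simp
  let ?l = "\<mu>[B := part \<mu> (Suc B) - 1, A := part \<mu> (Suc A) + 1]"
  have l: "part_fun ?l = inc_row ?g A" using BL AB'(1)
    by (simp add: part_fun_update inc_row_def dec_row_def part_eq_part_fun fun_eq_iff)
  have par: "par (inc_row ?g A)" by (rule par_inc[OF c(2,3)])
  have "sorted_wrt (\<ge>) ?l"
  proof -
    have "map (part_fun ?l) [0..<length ?l] = ?l" by (rule nth_equalityI) (simp_all add: part_fun_def)
    then show ?thesis using sorted_list_of_par[OF par, of "length ?l"] by (simp only: l)
  qed
  note s = this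
  show pf: "part_fun (phi p \<mu>) = inc_row ?g A" unfolding phi part_fun_filter[OF s] l ..
  have part: "is_partition (phi p \<mu>)" unfolding phi by (rule is_partition_filter[OF s])
  have len: "length (phi p \<mu>) \<le> p" unfolding phi using length_filter_le[of _ ?l] \<mu>(4) by (metis le_trans length_list_update)
  have "card (dg (inc_row ?g A)) = card (dg (inc_row ?g B))"
    using card_dg_inc[OF c(2)] by simp
  moreover have "card (dg ?f) = m" using \<mu>(2) by (simp add: dg_part_fun card_diagram)
  ultimately have "card (dg (inc_row ?g A)) = m" by (simp only: c(5))
  then have "sum_list (phi p \<mu>) = m" by (simp only: card_diagram[symmetric] dg_part_fun[symmetric] pf)
  then show "core_free p m (phi p \<mu>)" using part len c(8) pf by (simp add: core_free_def is_partition_of_def)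
qed

section \<open>Termination of the iteration\<close>

definition sum_of_squares :: "nat \<Rightarrow> nat list \<Rightarrow> nat" where
  "sum_of_squares p \<mu> = (\<Sum>l<p. part_fun \<mu> l * part_fun \<mu> l)"

lemma sum_of_squares_le: "core_free p m \<mu> \<Longrightarrow> sum_of_squares p \<mu> \<le> m * m"
proof -
  assume "core_free p m \<mu>"
  note \<mu> = core_freeD[OF this]
  have S: "(\<Sum>l<p. part_fun \<mu> l) = m" using sum_list_part_fun[OF \<mu>(4)] \<mu>(2) by simp
  have "sum_of_squares p \<mu> \<le> (\<Sum>l<p. part_fun \<mu> l * m)" unfolding sum_of_squares_def
  proof (rule sum_mono)
    fix l assume "l \<in> {..<p}"
    then have "part_fun \<mu> l \<le> m" unfolding S[symmetric] by (intro member_le_sum) auto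
    then show "part_fun \<mu> l * part_fun \<mu> l \<le> part_fun \<mu> l * m" by simp
  qed
  then show ?thesis by (simp add: sum_distrib_right[symmetric] S)
qed

lemma sum_of_squares_phi:
  assumes p: "1 < p" and \<mu>: "core_free p m \<mu>" and AB: "phi_rows p (part_fun \<mu>) A B"
  shows "sum_of_squares p \<mu> < sum_of_squares p (phi p \<mu>)"
proof -
  let ?f = "part_fun \<mu>" and ?h = "part_fun (phi p \<mu>)"
  note m = core_freeD[OF \<mu>]
  have AB': "A < B" "\<not> p dvd ?f B" using AB by (auto simp: phi_rows_def)
  have Bp: "B < p" by (rule phi_rows_common(1)[OF p m(3,5,6) AB])
  have fB: "0 < ?f B" using AB'(2) by (metis dvd_0_right neq0_conv)
  have le: "?f B \<le> ?f A" by (rule parD[OF m(3)]) (use AB'(1) in simp)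
  have h: "?h A = Suc (?f A)" "?h B = ?f B - 1" "\<And>l. l \<noteq> A \<Longrightarrow> l \<noteq> B \<Longrightarrow> ?h l = ?f l"
    unfolding phi_part_fun(1)[OF p \<mu> AB] using AB'(1) by (auto simp: inc_row_def dec_row_def)
  have split: "(\<Sum>l<p. F l) = F A + F B + (\<Sum>l\<in>{..<p} - {A, B}. F l)" for F :: "nat \<Rightarrow> nat"
  proof -
    have "(\<Sum>l<p. F l) = (\<Sum>l\<in>{A, B}. F l) + (\<Sum>l\<in>{..<p} - {A, B}. F l)"
      using sum.subset_diff[of "{A, B}" "{..<p}" F] AB'(1) Bp by (simp add: add.commute)
    then show ?thesis using AB'(1) by simp
  qed
  have rest: "(\<Sum>l\<in>{..<p} - {A, B}. ?h l * ?h l) = (\<Sum>l\<in>{..<p} - {A, B}. ?f l * ?f l)"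
    by (rule sum.cong) (use h(3) in auto)
  obtain b where b: "?f B = Suc b" using fB gr0_implies_Suc by blast
  have "?f A * ?f A + ?f B * ?f B < ?h A * ?h A + ?h B * ?h B"
    using le unfolding h(1,2) b by simp
  then show ?thesis unfolding sum_of_squares_def split rest by simp
qed

lemma funpow_phi_const: "\<forall>x\<in>set \<nu>. p dvd x \<Longrightarrow> (phi p ^^ t) \<nu> = \<nu>"
  by (induction t) (simp_all add: phi_def)

lemma ex_phi_rows:
  assumes p: "1 < p" and \<mu>: "core_free p m \<mu>" and nd: "\<not> (\<forall>x\<in>set \<mu>. p dvd x)"
  shows "\<exists>A B. phi_rows p (part_fun \<mu>) A B"
proof -
  obtain l where "\<not> p dvd part_fun \<mu> l" using nd unfolding dvd_part_fun_iff by blast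
  then show ?thesis using phi_rows_exist[where f = "part_fun \<mu>", OF p core_freeD(6)[OF \<mu>] core_freeD(5)[OF \<mu>]] by blast
qed

lemma phi_eventually_dvd:
  assumes p: "1 < p" and \<mu>: "core_free p m \<mu>"
  shows "\<exists>t. \<forall>x\<in>set ((phi p ^^ t) \<mu>). p dvd x"
  using \<mu>
proof (induction "m * m - sum_of_squares p \<mu>" arbitrary: \<mu> rule: less_induct)
  case less
  show ?case
  proof (cases "\<forall>x\<in>set \<mu>. p dvd x")
    case True
    then show ?thesis by (intro exI[of _ 0]) simp
  next
    case False
    then obtain A B where AB: "phi_rows p (part_fun \<mu>) A B" using ex_phi_rows[OF p less.prems] by blast
    have cf: "core_free p m (phi p \<mu>)" by (rule phi_part_fun(2)[OF p less.prems AB])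
    have "m * m - sum_of_squares p (phi p \<mu>) < m * m - sum_of_squares p \<mu>" using sum_of_squares_le[OF cf] sum_of_squares_phi[OF p less.prems AB] by simp
    from less.hyps[OF this cf] obtain t where "\<forall>x\<in>set ((phi p ^^ t) (phi p \<mu>)). p dvd x" by blast
    then show ?thesis by (intro exI[of _ "Suc t"]) (simp add: funpow_swap1)
  qed
qed

lemma Phi_eq_funpow:
  assumes "1 < p" and "core_free p m \<mu>"
  shows "\<exists>t. Phi p \<mu> = (phi p ^^ t) \<mu>"
proof -
  obtain t where t: "\<forall>x\<in>set ((phi p ^^ t) \<mu>). p dvd x" using phi_eventually_dvd[OF assms] by blast
  have const: "(phi p ^^ s) \<mu> = (phi p ^^ t) \<mu>" if "t \<le> s" for s
  proof -
    have "(phi p ^^ s) \<mu> = (phi p ^^ (s - t)) ((phi p ^^ t) \<mu>)" using that by (simp flip: funpow_add comp_apply[of "phi p ^^ (s - t)"])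
    then show ?thesis using funpow_phi_const[OF t] by simp
  qed
  have "Phi p \<mu> = (phi p ^^ t) \<mu>" unfolding Phi_def
  proof (rule the_equality)
    show "\<forall>\<^sub>F s in sequentially. (phi p ^^ s) \<mu> = (phi p ^^ t) \<mu>" using const eventually_sequentially by blast
    fix \<nu> assume "\<forall>\<^sub>F s in sequentially. (phi p ^^ s) \<mu> = \<nu>"
    then obtain N where "\<And>s. N \<le> s \<Longrightarrow> (phi p ^^ s) \<mu> = \<nu>" unfolding eventually_sequentially by blast
    then show "\<nu> = (phi p ^^ t) \<mu>" using const[of "max N t"] by (metis max.cobounded1 max.cobounded2)
  qed
  then show ?thesis by blast
qed

lemma core_free_phi:
  assumes p: "1 < p" and \<mu>: "core_free p m \<mu>" shows "core_free p m (phi p \<mu>)"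
proof (cases "\<forall>x\<in>set \<mu>. p dvd x")
  case True
  then show ?thesis using \<mu> by (simp add: phi_def)
next
  case False
  then show ?thesis using ex_phi_rows[OF p \<mu>] phi_part_fun(2)[OF p \<mu>] by blast
qed

lemma Phi_invariant:
  assumes p: "1 < p" and \<mu>: "core_free p m \<mu>"
    and Q: "\<And>\<nu> A B. core_free p m \<nu> \<Longrightarrow> phi_rows p (part_fun \<nu>) A B \<Longrightarrow> Q (phi p \<nu>) \<longleftrightarrow> Q \<nu>"
  shows "Q (Phi p \<mu>) \<longleftrightarrow> Q \<mu>"
proof -
  have Q': "Q (phi p \<nu>) \<longleftrightarrow> Q \<nu>" if \<nu>: "core_free p m \<nu>" for \<nu>
  proof (cases "\<forall>x\<in>set \<nu>. p dvd x")
    case True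
    then show ?thesis by (simp add: phi_def)
  next
    case False
    then show ?thesis using ex_phi_rows[OF p \<nu>] Q[OF \<nu>] by blast
  qed
  have "core_free p m ((phi p ^^ t) \<mu>) \<and> (Q ((phi p ^^ t) \<mu>) \<longleftrightarrow> Q \<mu>)" for t
    by (induction t) (use \<mu> core_free_phi[OF p] Q' in auto)
  then show ?thesis using Phi_eq_funpow[OF p \<mu>] by metis
qed

section \<open>Specht modules of \<open>\<mu>\<close> and \<open>\<phi>(\<mu>)\<close>\<close>

lemma phi_kdim:
  fixes \<alpha> :: "nat \<Rightarrow> 'k::field"
  assumes p: "prime p" "CHAR('k) = p" and \<mu>: "core_free p (n * p) \<mu>" and AB: "phi_rows p (part_fun \<mu>) A B"
    and \<alpha>: "\<And>i. i \<in> {1..n} \<Longrightarrow> \<alpha> i \<noteq> 0"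
  defines "K \<equiv> \<lambda>\<nu>. kdim (pencil n (tab.D p) \<alpha>) (vecs (specht \<nu> :: (_, 'k, _) kG_rep))"
    and "D \<equiv> \<lambda>\<nu>. fspace.dim (vecs (specht \<nu> :: (_, 'k, _) kG_rep))"
  shows "\<exists>d. p * d = D (phi p \<mu>) + D \<mu> \<and> (\<forall>j\<le>p. K (phi p \<mu>) j + D \<mu> = j * d + K \<mu> (p - j))"
proof -
  have p1: "1 < p" by (rule prime_gt_1_nat[OF p(1)])
  note m = core_freeD[OF \<mu>]
  note c = phi_rows_common[OF p1 m(3,5,6) AB]
  note ph = phi_part_fun[OF p1 \<mu> AB]
  let ?g = "dec_row (part_fun \<mu>) B"
  have AB': "A < B" using AB by (simp add: phi_rows_def)
  have d\<phi>: "dg (inc_row ?g A) = diagram (phi p \<mu>)" unfolding ph(1)[symmetric] by (rule dg_part_fun)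
  have d\<mu>: "dg (inc_row ?g B) = diagram \<mu>" unfolding c(5) by (rule dg_part_fun)
  have card: "Suc (card (dg ?g)) = n * p"
    using card_dg_inc[OF c(2), of B] m(2) by (simp only: d\<mu> card_diagram)
  have eq: "(of_int x :: 'k) = of_int y \<longleftrightarrow> x mod int p = y mod int p" for x y
    by (simp add: of_int_eq_iff_cong_CHAR p(2) cong_def)
  have r1: "(of_int (int (?g A) - int A) :: 'k) = of_int (int (?g B) - int B)"
    unfolding eq using c(6) by (simp only: row_content_def)
  have r2: "(of_int (int (?g r) - int r) :: 'k) \<noteq> of_int (int (?g A) - int A)" if "r \<in> addable ?g" "r \<noteq> A" "r \<noteq> B" for r
    unfolding eq using c(7)[OF that] unfolding row_content_def .
  have s: "sum_list \<mu> = n * p" "sum_list (phi p \<mu>) = n * p" using m(2) core_freeD(2)[OF ph(2)] by simp_all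
  obtain E F where "induced ?g E F {1..n * p}" using exists_extra_cell[OF c(2)] by blast
  note cw = induced.complementary_words[OF this p refl card _ c(3,4) AB' r1, where \<alpha> = \<alpha>, unfolded d\<phi> d\<mu>]
  show ?thesis unfolding K_def D_def kdim_specht[OF s(1)] kdim_specht[OF s(2)] dim_specht[OF s(1)] dim_specht[OF s(2)]
    by (rule cw) (erule \<alpha> r2; assumption)+
qed

section \<open>Free restrictions and full rank varieties\<close>

lemma infinite_alg_closed_field: "infinite (UNIV :: 'k::alg_closed_field set)"
proof
  assume fin: "finite (UNIV :: 'k set)"
  \<comment> \<open>\<open>P\<close> vanishes at every element of a finite field, so the nonconstant
    polynomial \<open>1 + P\<close> would have no root.\<close>
  define P where "P = (\<Prod>a\<in>(UNIV :: 'k set). [:- a, 1:])"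
  have "degree P = card (UNIV :: 'k set)" unfolding P_def by (subst degree_prod_eq_sum_degree) auto
  then have deg: "0 < degree P" using fin by (simp add: card_gt_0_iff)
  then have "0 < degree (1 + P)" by (subst degree_add_eq_right) auto
  then obtain x where x: "poly (1 + P) x = 0" using alg_closed_imp_poly_has_root by blast
  have "poly P x = 0" unfolding P_def poly_prod using fin by (intro prod_zero bexI[of _ x]) auto
  then show False using x by simp
qed

text \<open>An element of the group algebra acts on the trivial module by its augmentation
  \<open>a\<close>. The element \<open>u - 1\<close> is nonzero of augmentation 0, so it is a
  nontrivial coefficient in a representation of 0; an empty basis does not generate the module
  either.\<close>

lemma trivial_not_free:
  fixes \<alpha> :: "nat \<Rightarrow> 'k::field"
  assumes p: "prime p" "CHAR('k) = p" and i: "i \<in> {1..n}" "\<alpha> i \<noteq> 0"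
  shows "\<not> free_over_cyclic (trivial_rep (sym_group (n * p)) \<down> E_subgroup p n :: (_, 'k, _) kG_rep) (u_elem p n \<alpha>)"
proof
  let ?M = "trivial_rep (sym_group (n * p)) \<down> E_subgroup p n :: (_, 'k, _) kG_rep"
  define a where "a v = flift (\<lambda>_. sing ()) v" for v :: "(nat \<Rightarrow> nat) \<Rightarrow>\<^sub>0 'k"
  have lin_a: "flinear a" unfolding a_def[abs_def] by (rule flinear_flift)
  have act: "ga_act ?M v x = Poly_Mapping.lookup (a v) () * x" for v x
    by (simp add: ga_act_def trivial_rep_def restrict_rep_def a_def flift_def lookup_sum sum_distrib_right)
  let ?u = "u_power p n \<alpha> 1"
  have u: "?u = (\<Sum>i=1..n. fscale (\<alpha> i) (sing (g_cycle p i) - sing id))"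
    by (simp add: u_power_def pencil_def reg.D_def regular_act_def)
  have au: "a ?u = 0" unfolding u by (simp add: flinear_simps[OF lin_a]) (simp add: a_def)
  have p2: "2 \<le> p" by (rule prime_ge_2_nat[OF p(1)])
  \<comment> \<open>\<open>u - 1\<close> is nonzero because its power with exponent
    \<open>p - 1\<close> is.\<close>
  have "u_power p n \<alpha> (p - 1) = (pencil n (reg.D p) \<alpha> ^^ (p - 2)) ?u"
  proof -
    have "p - 1 = p - 2 + 1" using p2 by simp
    then show ?thesis unfolding u_power_def by (simp only: funpow_add comp_apply)
  qed
  moreover have "(pencil n (reg.D p) \<alpha> ^^ (p - 2)) 0 = 0"
    by (rule flinear_simps(4)[OF flinear_funpow[OF flinear_pencil[OF reg.D_lin]]])
  ultimately have u0: "?u \<noteq> 0"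
    using u_power_nonzero[where p = p and n = n and \<alpha> = \<alpha>, OF p(1) i] by auto
  have cyc: "ga_cyclic (grp ?M) (u_elem p n \<alpha>) = fspace.span (u_power p n \<alpha> ` {..<p})"
    by (rule ga_cyclic_u[OF p]) (simp_all add: trivial_rep_def restrict_rep_def sym_group_def)
  have uc: "?u \<in> ga_cyclic (grp ?M) (u_elem p n \<alpha>)" unfolding cyc by (rule fspace.span_base) (use p2 in auto)
  have zc: "0 \<in> ga_cyclic (grp ?M) (u_elem p n \<alpha>)" unfolding cyc by (rule fspace.span_zero)
  assume "free_over_cyclic ?M (u_elem p n \<alpha>)"
  then obtain Bs where "finite Bs" and Bs: "\<forall>x\<in>vecs ?M. \<exists>!r. (\<forall>b\<in>Bs. r b \<in> ga_cyclic (grp ?M) (u_elem p n \<alpha>)) \<and>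
      (\<forall>b. b \<notin> Bs \<longrightarrow> r b = 0) \<and> x = (\<Sum>b\<in>Bs. ga_act ?M (r b) b)"
    unfolding free_over_cyclic_def by - (elim exE conjE, rule that)
  have V: "x \<in> vecs ?M" for x by (simp add: trivial_rep_def restrict_rep_def)
  show False
  proof (cases "Bs = {}")
    case True
    then show False using bspec[OF Bs V[of 1]] by auto
  next
    case False
    then obtain b where b: "b \<in> Bs" by blast
    let ?P = "\<lambda>r. (\<forall>b\<in>Bs. r b \<in> ga_cyclic (grp ?M) (u_elem p n \<alpha>)) \<and> (\<forall>b. b \<notin> Bs \<longrightarrow> r b = 0) \<and>
           0 = (\<Sum>b\<in>Bs. ga_act ?M (r b) b)"
    have P0: "?P (\<lambda>_. 0)" using zc by (simp add: act flinear_simps[OF lin_a])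
    have P1: "?P (\<lambda>x. if x = b then ?u else 0)"
    proof -
      have "a (if x = b then ?u else 0) = 0" for x using au flinear_simps[OF lin_a] by (cases "x = b") simp_all
      then have "0 = (\<Sum>x\<in>Bs. ga_act ?M (if x = b then ?u else 0) x)" unfolding act by simp
      moreover have "\<forall>x\<in>Bs. (if x = b then ?u else 0) \<in> ga_cyclic (grp ?M) (u_elem p n \<alpha>)" using zc uc by simp
      moreover have "\<forall>x. x \<notin> Bs \<longrightarrow> (if x = b then ?u else 0) = 0" using b by auto
      ultimately show ?thesis by (intro conjI)
    qed
    have U: "\<forall>r s. ?P r \<and> ?P s \<longrightarrow> r = s" by (rule alt_ex1E[OF bspec[OF Bs V[of 0]]])
    have "(\<lambda>_. 0) = (\<lambda>x. if x = b then ?u else 0)"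
      by (rule mp[OF spec[OF spec[OF U, of "\<lambda>_. 0"], of "\<lambda>x. if x = b then ?u else 0"] conjI[OF P0 P1]])
    from fun_cong[OF this, of b] show False using u0 by simp
  qed
qed

lemma affine_space_nonzero: "\<alpha> \<in> affine_space n \<Longrightarrow> \<alpha> \<noteq> (\<lambda>_. 0) \<Longrightarrow> \<exists>i\<in>{1..n}. \<alpha> i \<noteq> 0"
  unfolding affine_space_def by (metis (mono_tags, lifting) ext mem_Collect_eq)

lemma rank_variety_trivial:
  assumes p: "prime p" "CHAR('k::field) = p"
  shows "rank_variety p n (trivial_rep (sym_group (n * p)) \<down> E_subgroup p n :: (_, 'k, _) kG_rep) = affine_space n"
proof -
  have "\<not> free_over_cyclic (trivial_rep (sym_group (n * p)) \<down> E_subgroup p n :: (_, 'k, _) kG_rep) (u_elem p n \<alpha>)"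
    if "\<alpha> \<in> affine_space n" "\<alpha> \<noteq> (\<lambda>_. 0)" for \<alpha> :: "nat \<Rightarrow> 'k"
    using affine_space_nonzero[OF that] trivial_not_free[OF p] by blast
  moreover have "(\<lambda>_. 0 :: 'k) \<in> affine_space n" by (simp add: affine_space_def)
  ultimately show ?thesis unfolding rank_variety_def by blast
qed

lemma rank_variety_full_iff:
  "rank_variety p n M = affine_space n \<longleftrightarrow> \<not> (\<exists>\<alpha>\<in>affine_space n. \<alpha> \<noteq> (\<lambda>_. 0) \<and> free_over_cyclic M (u_elem p n \<alpha>))"
proof -
  have "(\<lambda>_. 0) \<in> affine_space n" by (simp add: affine_space_def)
  then show ?thesis unfolding rank_variety_def by blast
qed

text \<open>The kernel at the generic point is the smallest one, so the inequality that expresses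
  freeness passes from any nonzero point to it.\<close>

lemma free_iff_generic:
  assumes rep: "\<And>\<alpha>. rep_pencil A p n \<alpha> V M" and n: "1 \<le> n"
    and \<gamma>: "\<gamma> \<in> affine_space n" "\<And>i. i \<in> {1..n} \<Longrightarrow> \<gamma> i \<noteq> 0"
    and min: "\<And>\<beta>. \<beta> \<in> affine_space n \<Longrightarrow> kdim (pencil n (linear_action.D A p) \<gamma>) V 1 \<le> kdim (pencil n (linear_action.D A p) \<beta>) V 1"
  shows "(\<exists>\<alpha>\<in>affine_space n. \<alpha> \<noteq> (\<lambda>_. 0) \<and> free_over_cyclic M (u_elem p n \<alpha>)) \<longleftrightarrow>
    p * kdim (pencil n (linear_action.D A p) \<gamma>) V 1 \<le> fspace.dim V"
proof
  assume "\<exists>\<alpha>\<in>affine_space n. \<alpha> \<noteq> (\<lambda>_. 0) \<and> free_over_cyclic M (u_elem p n \<alpha>)"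
  then obtain \<alpha> where \<alpha>: "\<alpha> \<in> affine_space n" "\<alpha> \<noteq> (\<lambda>_. 0)" "free_over_cyclic M (u_elem p n \<alpha>)" by blast
  obtain i where i: "i \<in> {1..n}" "\<alpha> i \<noteq> 0" using affine_space_nonzero[OF \<alpha>(1,2)] by blast
  have "p * kdim (pencil n (linear_action.D A p) \<alpha>) V 1 \<le> fspace.dim V"
    by (rule rep_pencil.kdim_free_if[OF rep \<alpha>(3) i])
  then show "p * kdim (pencil n (linear_action.D A p) \<gamma>) V 1 \<le> fspace.dim V"
    using mult_le_mono2[OF min[OF \<alpha>(1)], of p] by linarith
next
  assume "p * kdim (pencil n (linear_action.D A p) \<gamma>) V 1 \<le> fspace.dim V"
  then have "free_over_cyclic M (u_elem p n \<gamma>)" by (rule rep_pencil.free_if_kdim[OF rep])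
  moreover have "\<gamma> \<noteq> (\<lambda>_. 0)" using \<gamma>(2)[of 1] n by auto
  ultimately show "\<exists>\<alpha>\<in>affine_space n. \<alpha> \<noteq> (\<lambda>_. 0) \<and> free_over_cyclic M (u_elem p n \<alpha>)" using \<gamma>(1) by blast
qed

text \<open>All comparisons are made at one point \<gamma> that is generic for both modules and has
  only nonzero coordinates; the latter is what the freeness of the induced module requires.\<close>

lemma phi_pair:
  fixes n :: nat
  assumes p: "prime p" "CHAR('k::alg_closed_field) = p" and \<mu>: "core_free p (n * p) \<mu>"
    and AB: "phi_rows p (part_fun \<mu>) A B"
  defines "M \<equiv> \<lambda>\<nu>. (specht \<nu> :: (_, 'k, _) kG_rep) \<down> E_subgroup p n"
  shows "complementary_stable_jordan_type p n (M \<mu>) (M (phi p \<mu>))"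
    and "rank_variety p n (M (phi p \<mu>)) = affine_space n \<longleftrightarrow> rank_variety p n (M \<mu>) = affine_space n"
proof -
  have p1: "1 < p" by (rule prime_gt_1_nat[OF p(1)])
  note m = core_freeD[OF \<mu>]
  have s: "sum_list \<mu> = n * p" "sum_list (phi p \<mu>) = n * p"
    using m(2) core_freeD(2)[OF phi_part_fun(2)[OF p1 \<mu> AB]] by simp_all
  have inf: "infinite (UNIV :: 'k set)" by (rule infinite_alg_closed_field)
  let ?V = "\<lambda>\<nu>. vecs (specht \<nu> :: (_, 'k, _) kG_rep)"
  define N where "N \<alpha> = pencil n (tab.D p) \<alpha>" for \<alpha> :: "nat \<Rightarrow> 'k"
  have rp: "rep_pencil tabloid_act p n \<alpha> (?V \<nu>) (M \<nu>)" if "sum_list \<nu> = n * p" for \<nu> \<alpha>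
    unfolding M_def by (rule rep_pencil_specht[OF p that])
  define J where "J \<nu> = generic_jordan_type p n (M \<nu>)" for \<nu>
  obtain g1 where g1: "polyfun n g1" "\<exists>\<alpha>\<in>affine_space n. g1 \<alpha> \<noteq> 0"
    "\<And>\<alpha>. \<alpha> \<in> affine_space n \<Longrightarrow> g1 \<alpha> \<noteq> 0 \<Longrightarrow> has_jordan_type (M \<mu>) (u_elem p n \<alpha>) (J \<mu>) \<and>
       (\<forall>\<beta>\<in>affine_space n. kdim (N \<alpha>) (?V \<mu>) 1 \<le> kdim (N \<beta>) (?V \<mu>) 1)"
    using generic_jordan_type[OF inf rp[OF s(1)]] unfolding N_def[symmetric] J_def[symmetric] by blast
  obtain g2 where g2: "polyfun n g2" "\<exists>\<alpha>\<in>affine_space n. g2 \<alpha> \<noteq> 0"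
    "\<And>\<alpha>. \<alpha> \<in> affine_space n \<Longrightarrow> g2 \<alpha> \<noteq> 0 \<Longrightarrow> has_jordan_type (M (phi p \<mu>)) (u_elem p n \<alpha>) (J (phi p \<mu>)) \<and>
       (\<forall>\<beta>\<in>affine_space n. kdim (N \<alpha>) (?V (phi p \<mu>)) 1 \<le> kdim (N \<beta>) (?V (phi p \<mu>)) 1)"
    using generic_jordan_type[OF inf rp[OF s(2)]] unfolding N_def[symmetric] J_def[symmetric] by blast
  obtain \<gamma>1 where \<gamma>1: "\<gamma>1 \<in> affine_space n" "g1 \<gamma>1 * g2 \<gamma>1 \<noteq> 0"
    using polyfun_nonzero_common[OF inf g1(1) g2(1)] g1(2) g2(2) by force
  have prod: "polyfun n (\<lambda>\<alpha>. \<Prod>i=1..n. \<alpha> i :: 'k)" by (intro polyfun_prod polyfun_var)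
  have one: "(\<lambda>i. if i \<in> {1..n} then 1 else 0 :: 'k) \<in> affine_space n" by (simp add: affine_space_def)
  obtain \<gamma> where \<gamma>: "\<gamma> \<in> affine_space n" "g1 \<gamma> * g2 \<gamma> \<noteq> 0" "(\<Prod>i=1..n. \<gamma> i) \<noteq> 0"
    using polyfun_nonzero_common[OF inf polyfun_mult[OF g1(1) g2(1)] prod \<gamma>1 one] by auto
  then have g: "g1 \<gamma> \<noteq> 0" "g2 \<gamma> \<noteq> 0" and nz: "\<And>i. i \<in> {1..n} \<Longrightarrow> \<gamma> i \<noteq> 0" by auto
  define D where "D \<nu> = fspace.dim (?V \<nu>)" for \<nu>
  define K where "K \<nu> j = kdim (N \<gamma>) (?V \<nu>) j" for \<nu> j
  have "\<exists>d. p * d = D (phi p \<mu>) + D \<mu> \<and> (\<forall>j\<le>p. K (phi p \<mu>) j + D \<mu> = j * d + K \<mu> (p - j))"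
    unfolding K_def D_def N_def by (rule phi_kdim[OF p \<mu> AB]) (rule nz)
  then obtain d where d: "p * d = D (phi p \<mu>) + D \<mu>" "\<And>j. j \<le> p \<Longrightarrow> K (phi p \<mu>) j + D \<mu> = j * d + K \<mu> (p - j)"
    by blast
  have sums: "(\<Sum>x\<in>#J \<nu>. min k x) = K \<nu> k"
    if "sum_list \<nu> = n * p" "has_jordan_type (M \<nu>) (u_elem p n \<gamma>) (J \<nu>)" for \<nu> k
  proof -
    interpret R: rep_pencil tabloid_act p n \<gamma> "?V \<nu>" "M \<nu>" by (rule rp[OF that(1)])
    show ?thesis unfolding K_def N_def
      by (rule has_jordan_type_sum(1)[OF R.nilpotent_on_axioms R.M(1,2) R.ga_act_u that(2)])
  qed
  have S1: "(\<Sum>x\<in>#J \<mu>. min k x) = K \<mu> k" for k using sums[OF s(1)] g1(3)[OF \<gamma>(1) g(1)] by blast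
  have S2: "(\<Sum>x\<in>#J (phi p \<mu>). min k x) = K (phi p \<mu>) k" for k using sums[OF s(2)] g2(3)[OF \<gamma>(1) g(2)] by blast
  show "complementary_stable_jordan_type p n (M \<mu>) (M (phi p \<mu>))"
    unfolding complementary_stable_jordan_type_def J_def[symmetric]
  proof
    fix i assume i: "i \<in> {1..p - 1}"
    \<comment> \<open>The relation between the kernel dimensions is used at \<open>j - 1\<close>,
      \<open>j\<close> and \<open>j + 1\<close>. In the second difference the linear term with
      \<open>d\<close> and the constant \<open>D \<mu>\<close> cancel, and the block counts at
      \<open>j\<close> and at \<open>i\<close> remain.\<close>
    define j where "j = p - i"
    have ij: "1 \<le> j" "j + 1 \<le> p" "p - (j + 1) = i - 1" "p - j = i" "p - (j - 1) = i + 1" "1 \<le> i"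
      using i p1 by (auto simp: j_def)
    obtain l where l: "j = Suc l" using ij(1) by (cases j) auto
    show "count (J \<mu>) i = count (J (phi p \<mu>)) (p - i)"
      using count_blocks[OF ij(6), of "J \<mu>"] count_blocks[OF ij(1), of "J (phi p \<mu>)"]
        d(2)[of "j + 1"] d(2)[of j] d(2)[of "j - 1"] ij
      unfolding S1 S2 j_def[symmetric] by (simp add: l)
  qed
  have le: "K \<nu> k \<le> k * K \<nu> 1" if "sum_list \<nu> = n * p" for \<nu> k
  proof -
    interpret R: rep_pencil tabloid_act p n \<gamma> "?V \<nu>" "M \<nu>" by (rule rp[OF that])
    show ?thesis unfolding K_def N_def by (rule R.kdim_le_mult)
  qed
  \<comment> \<open>A nonempty partition forces \<open>n \<ge> 1\<close>, so that a point with all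
    coordinates nonzero is not the origin.\<close>
  have "B < length \<mu>" using AB by (auto simp: phi_rows_def part_fun_def split: if_splits)
  then have "0 < sum_list \<mu>" using part_fun_pos[OF m(1), of B] elem_le_sum_list[of B \<mu>] by (simp add: part_fun_def)
  then have n: "1 \<le> n" using s(1) by (cases n) auto
  have free: "(\<exists>\<alpha>\<in>affine_space n. \<alpha> \<noteq> (\<lambda>_. 0) \<and> free_over_cyclic (M \<nu>) (u_elem p n \<alpha>)) \<longleftrightarrow> p * K \<nu> 1 \<le> D \<nu>"
    if "\<nu> \<in> {\<mu>, phi p \<mu>}" for \<nu>
    unfolding K_def D_def N_def
  proof (rule free_iff_generic[OF _ n \<gamma>(1) nz])
    show "rep_pencil tabloid_act p n \<alpha> (?V \<nu>) (M \<nu>)" for \<alpha> by (rule rp) (use that s in auto)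
    show "kdim (pencil n (tab.D p) \<gamma>) (?V \<nu>) 1 \<le> kdim (pencil n (tab.D p) \<beta>) (?V \<nu>) 1" if "\<beta> \<in> affine_space n" for \<beta>
      using g1(3)[OF \<gamma>(1) g(1)] g2(3)[OF \<gamma>(1) g(2)] \<open>\<nu> \<in> {\<mu>, phi p \<mu>}\<close> that unfolding N_def by blast
  qed
  obtain q where q: "p = Suc q" using p1 by (cases p) auto
  \<comment> \<open>The relation is used at \<open>j = 1\<close> in one direction and at
    \<open>j = p - 1\<close> in the other, each time with the bound of the kernel of the
    \<open>q\<close>-th power by \<open>q\<close> times that of the first.\<close>
  have "p * K (phi p \<mu>) 1 \<le> D (phi p \<mu>) \<longleftrightarrow> p * K \<mu> 1 \<le> D \<mu>"
  proof
    assume a: "p * K \<mu> 1 \<le> D \<mu>"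
    have "K (phi p \<mu>) 1 + D \<mu> \<le> d + q * K \<mu> 1" using d(2)[of 1] le[OF s(1), of q] p1 by (simp add: q)
    from mult_le_mono2[OF this, of p] have "p * K (phi p \<mu>) 1 + p * D \<mu> \<le> p * d + q * (p * K \<mu> 1)"
      by (simp add: algebra_simps)
    also have "\<dots> \<le> D (phi p \<mu>) + D \<mu> + q * D \<mu>" using mult_le_mono2[OF a, of q] d(1) by linarith
    finally show "p * K (phi p \<mu>) 1 \<le> D (phi p \<mu>)" by (simp add: q)
  next
    assume a: "p * K (phi p \<mu>) 1 \<le> D (phi p \<mu>)"
    have "K \<mu> 1 + q * d \<le> q * K (phi p \<mu>) 1 + D \<mu>" using d(2)[of q] le[OF s(2), of q] by (simp add: q)
    from mult_le_mono2[OF this, of p] have "p * K \<mu> 1 + q * (p * d) \<le> q * (p * K (phi p \<mu>) 1) + p * D \<mu>"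
      by (simp add: algebra_simps)
    also have "\<dots> \<le> q * D (phi p \<mu>) + p * D \<mu>" using mult_le_mono2[OF a, of q] by linarith
    finally have "p * K \<mu> 1 + q * (D (phi p \<mu>) + D \<mu>) \<le> q * D (phi p \<mu>) + p * D \<mu>" unfolding d(1) .
    then show "p * K \<mu> 1 \<le> D \<mu>" by (simp add: q algebra_simps)
  qed
  then show "rank_variety p n (M (phi p \<mu>)) = affine_space n \<longleftrightarrow> rank_variety p n (M \<mu>) = affine_space n"
    unfolding rank_variety_full_iff using free by simp
qed

theorem lemma5p8:
  fixes p n a b :: nat
    and \<mu> :: "nat list"
  assumes "prime p" and "CHAR('k::alg_closed_field) = p"
    and "is_partition_of \<mu> (n * p)" and "1 \<le> length \<mu>" and "length \<mu> \<le> p"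
    and "has_empty_core p \<mu>"
    and "1 \<le> a" and "a < b" and "b \<le> length \<mu>"
    and "\<forall>i\<in>{b + 1..length \<mu>}. [part \<mu> i = 0] (mod p)" and "\<not> [part \<mu> b = 0] (mod p)"
    and "[int (part \<mu> a) - int a = int (part \<mu> b) - 1 - int b] (mod int p)"
  shows "has_empty_core p (phi p \<mu>) \<and>
    complementary_stable_jordan_type p n
      ((specht \<mu> :: (_, 'k, _) kG_rep) \<down> E_subgroup p n)
      ((specht (phi p \<mu>) :: (_, 'k, _) kG_rep) \<down> E_subgroup p n) \<and>
    (rank_variety p n ((specht \<mu> :: (_, 'k, _) kG_rep) \<down> E_subgroup p n) =
       rank_variety p n (trivial_rep (sym_group (n * p)) \<down> E_subgroup p n) \<longleftrightarrow>
     rank_variety p n ((specht (Phi p \<mu>) :: (_, 'k, _) kG_rep) \<down> E_subgroup p n) =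
       rank_variety p n (trivial_rep (sym_group (n * p)) \<down> E_subgroup p n))"
proof -
  have p1: "1 < p" by (rule prime_gt_1_nat[OF assms(1)])
  have \<mu>: "core_free p (n * p) \<mu>" using core_free_iff[of p \<mu> "n * p"] assms(3,5,6) p1 by simp
  have "phi_indices p \<mu> a b" unfolding phi_indices_def using assms(7-12) by blast
  then have AB: "phi_rows p (part_fun \<mu>) (a - 1) (b - 1)" unfolding phi_indices_iff by blast
  have \<phi>: "core_free p (n * p) (phi p \<mu>)" by (rule phi_part_fun(2)[OF p1 \<mu> AB])
  have "has_empty_core p (phi p \<mu>)"
    using core_free_iff[of p "phi p \<mu>" "n * p"] \<phi> p1 by (simp add: core_free_def)
  moreover have "rank_variety p n ((specht (Phi p \<mu>) :: (_, 'k, _) kG_rep) \<down> E_subgroup p n) = affine_space n \<longleftrightarrow>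
      rank_variety p n ((specht \<mu> :: (_, 'k, _) kG_rep) \<down> E_subgroup p n) = affine_space n"
    by (rule Phi_invariant[OF p1 \<mu>]) (rule phi_pair(2)[OF assms(1,2)])
  ultimately show ?thesis
    using phi_pair(1)[OF assms(1,2) \<mu> AB] unfolding rank_variety_trivial[OF assms(1,2)] by blast
qed

end
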